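(* Let $G$ be a graph. Then the following are equivalent: (1) $G$ is a $(P_7,C_4,C_5)$-free graph that does not admit a clique-cutset; (2) either $G$ is a complete graph, or $G$ contains exactly one nontrivial anticomponent, and this anticomponent is either a 7-bracelet, a thickened emerald, a lantern, a 6-wreath, or a 6-crown.
   Context: All graphs are finite, simple and nonnull. $P_n$ is the path on $n$ vertices and $C_n$ the cycle on $n$ vertices. A graph is $\mathcal{H}$-free if no induced subgraph of it is isomorphic to a member of $\mathcal{H}$. A clique is a (possibly empty) set of pairwise adjacent vertices. A clique-cutset of $G$ is a (possibly empty) clique $C\subsetneq V(G)$ such that $G\setminus C$ is disconnected. An anticomponent of $G$ is an induced subgraph $H$ of $G$ such that $\overline{H}$ is a connected component of the complement $\overline{G}$; it is nontrivial if it has at least two vertices. $N_G[v]$ is the closed neighborhood of $v$. For disjoint vertex sets $X,Y$, $X$ is complete (resp. anticomplete) to $Y$ if every vertex of $X$ is adjacent (resp. nonadjacent) to every vertex of $Y$. 7-bracelet: Let $B$ be a graph, $\{A_i\}_{i\in\mathbb{Z}_7}$ a partition of $V(B)$, and $i^*\in\mathbb{Z}_7$. $B$ is a 7-bracelet with good pair $(\{A_i\}_{i\in\mathbb{Z}_7},i^* )$ if: (I) for all $i$, $A_i$ is a nonempty clique, complete to $A_{i-1}\cup A_{i+1}$ and anticomplete to $A_{i-3}\cup A_{i+3}$; (II) for all $i$, $A_i$ can be partitioned into three (possibly empty) sets $A_i^*,A_i^+,A_i^-$ such that: (a) $A_i^*$ is anticomplete to $A_{i-2}\cup A_{i+2}$;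 (b) $A_i^+$ is anticomplete to $A_{i-2}$, and every vertex of $A_i^+$ has a neighbor in $A_{i+2}$; (c) $A_i^-$ is anticomplete to $A_{i+2}$, and every vertex of $A_i^-$ has a neighbor in $A_{i-2}$; (d) if $A_i^+\neq\emptyset$, then $A_i^+$ can be ordered as $a_1,\dots,a_{|A_i^+|}$ with $N_B[a_{|A_i^+|}]\subseteq\dots\subseteq N_B[a_1]$; (e) if $A_i^-\neq\emptyset$, then $A_i^-$ can be ordered as $a_1,\dots,a_{|A_i^-|}$ with $N_B[a_{|A_i^-|}]\subseteq\dots\subseteq N_B[a_1]$; (f) either $A_i^*\neq\emptyset$, or $A_i^+$ is not complete to $A_{i+2}$, or $A_i^-$ is not complete to $A_{i-2}$; (III) $A_{i^*-3}=A_{i^*-3}^*$ and $A_{i^*+3}=A_{i^*+3}^*$; (IV) $A_{i^*-2}=A_{i^*-2}^*\cup A_{i^*-2}^+$ and $A_{i^*+2}=A_{i^*+2}^*\cup A_{i^*+2}^-$; (V) $A_{i^*-1}=A_{i^*-1}^*\cup A_{i^*-1}^+$ and $A_{i^*+1}=A_{i^*+1}^*\cup A_{i^*+1}^-$. A 7-bracelet is a graph that is a 7-bracelet with some good pair. Thickened emerald: a graph $B$ for which there are a partition of $V(B)$ into nonempty cliques $C,A_0,\dots,A_6$ (indices in $\mathbb{Z}_7$) and $i^*\in\mathbb{Z}_7$ such that: for all $i\in\mathbb{Z}_7$, $A_i$ is complete to $A_{i-1}\cup A_{i+1}$ and anticomplete to $A_{i-3}\cup A_{i+3}$; for all $i\in\{i^*-3,i^*-1,i^*+1,i^*+3\}$,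 $A_i$ is anticomplete to $A_{i-2}\cup A_{i+2}$; and there are nonempty, pairwise disjoint cliques $A_{i^*}^-,A_{i^*}^+,A_{i^*+2}^*,A_{i^*+2}^-,A_{i^*-2}^*,A_{i^*-2}^+$ with $A_{i^*}=A_{i^*}^-\cup A_{i^*}^+$, $A_{i^*+2}=A_{i^*+2}^*\cup A_{i^*+2}^-$, $A_{i^*-2}=A_{i^*-2}^*\cup A_{i^*-2}^+$, such that $A_{i^*}^-$ is complete to $A_{i^*-2}^+$ and anticomplete to $A_{i^*-2}^*\cup A_{i^*+2}$; $A_{i^*}^+$ is complete to $A_{i^*+2}^-$ and anticomplete to $A_{i^*+2}^*\cup A_{i^*-2}$; and $C$ is complete to $A_{i^*+2}^*\cup A_{i^*+3}\cup A_{i^*-3}\cup A_{i^*-2}^*$ and anticomplete to $A_{i^*-2}^+\cup A_{i^*-1}\cup A_{i^*}\cup A_{i^*+1}\cup A_{i^*+2}^-$. Lantern: for $r\geq 3$, an $r$-lantern is a graph $R$ whose vertex set can be partitioned into nonempty cliques $A,B_1,\dots,B_r,C_1,\dots,C_r,D$ such that: $A$ is anticomplete to $D$; $A$ is complete to $\bigcup_i B_i$ and anticomplete to $\bigcup_i C_i$; $D$ is complete to $\bigcup_i C_i$ and anticomplete to $\bigcup_i B_i$; $B_1=\{b_1,\dots,b_{|B_1|}\}$ and $C_1=\{c_1,\dots,c_{|C_1|}\}$ can be ordered so that $N_R[b_{|B_1|}]\cap C_1\subseteq\dots\subseteq N_R[b_1]\cap C_1=C_1$ and $N_R[c_{|C_1|}]\cap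 B_1\subseteq\dots\subseteq N_R[c_1]\cap B_1=B_1$; for all $i\in\{2,\dots,r\}$, $B_i$ is complete to $C_i$; for all distinct $i,j\in\{1,\dots,r\}$, $B_i\cup C_i$ is anticomplete to $B_j\cup C_j$. A lantern is an $r$-lantern for some $r\geq 3$. 6-wreath: a graph $R$ whose vertex set can be partitioned into nonempty sets $X_0,\dots,X_5$ (indices in $\mathbb{Z}_6$) that can be ordered as $X_i=\{u_1^i,\dots,u_{|X_i|}^i\}$ so that for all $i\in\mathbb{Z}_6$, $X_i\subseteq N_R[u_{|X_i|}^i]\subseteq\dots\subseteq N_R[u_1^i]=X_{i-1}\cup X_i\cup X_{i+1}$, and $X_0$ is complete to $X_1$, $X_2$ is complete to $X_3$, and $X_4$ is complete to $X_5$. 6-crown: a graph $R$ for which there are a partition of $V(R)$ into (possibly empty) cliques $C_i,D_i$ ($i\in\mathbb{Z}_6$) and $i^*\in\mathbb{Z}_6$ such that: all $C_i$ are nonempty; $D_{i^*-2},D_{i^*-1}$ are empty and $D_{i^*+1},D_{i^*+2},D_{i^*+3}$ are nonempty ($D_{i^*}$ may or may not be empty); for all $i$, $C_i$ is complete to $C_{i-1}\cup C_{i+1}$ and anticomplete to $C_{i+2}\cup C_{i+3}\cup C_{i+4}$; for all $i$, $D_i$ is complete to $C_{i-1}\cup C_i\cup C_{i+1}$ and anticomplete to $C_{i+2}\cup C_{i+3}\cup C_{i+4}$; the sets $D_i$ are pairwise anticomplete to each other. *)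

theory Defs
  imports Main "HOL-Library.Numeral_Type"
begin

record 'a graph =
  verts :: "'a set"
  edges :: "'a set set"

definition simple_graph :: "'a graph \<Rightarrow> bool" where
  "simple_graph G \<longleftrightarrow>
     finite (verts G) \<and> verts G \<noteq> {} \<and>
     (\<forall>e \<in> edges G. \<exists>u \<in> verts G. \<exists>v \<in> verts G. u \<noteq> v \<and> e = {u, v})"

definition adj :: "'a graph \<Rightarrow> 'a \<Rightarrow> 'a \<Rightarrow> bool" where
  "adj G u v \<longleftrightarrow> {u, v} \<in> edges G"

definition closed_nbhd :: "'a graph \<Rightarrow> 'a \<Rightarrow> 'a set" where
  "closed_nbhd G v = insert v {u. adj G v u}"

definition complete_to :: "'a graph \<Rightarrow> 'a set \<Rightarrow> 'a set \<Rightarrow> bool" where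
  "complete_to G X Y \<longleftrightarrow> (\<forall>x \<in> X. \<forall>y \<in> Y. adj G x y)"

definition anticomplete_to :: "'a graph \<Rightarrow> 'a set \<Rightarrow> 'a set \<Rightarrow> bool" where
  "anticomplete_to G X Y \<longleftrightarrow> (\<forall>x \<in> X. \<forall>y \<in> Y. \<not> adj G x y)"

definition clique :: "'a graph \<Rightarrow> 'a set \<Rightarrow> bool" where
  "clique G K \<longleftrightarrow> K \<subseteq> verts G \<and> (\<forall>x \<in> K. \<forall>y \<in> K. x \<noteq> y \<longrightarrow> adj G x y)"

definition complete_graph :: "'a graph \<Rightarrow> bool" where
  "complete_graph G \<longleftrightarrow> clique G (verts G)"

definition induce :: "'a graph \<Rightarrow> 'a set \<Rightarrow> 'a graph" where
  "induce G X = \<lparr> verts = X, edges = {e \<in> edges G. e \<subseteq> X} \<rparr>"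

definition induced_subgraph :: "'a graph \<Rightarrow> 'a graph \<Rightarrow> bool" where
  "induced_subgraph H G \<longleftrightarrow>
     (\<exists>X. X \<subseteq> verts G \<and> X \<noteq> {} \<and> H = induce G X)"

definition graph_complement :: "'a graph \<Rightarrow> 'a graph" where
  "graph_complement G = \<lparr> verts = verts G,
     edges = {{u, v} | u v. u \<in> verts G \<and> v \<in> verts G \<and> u \<noteq> v \<and> \<not> adj G u v} \<rparr>"

definition graph_iso :: "'a graph \<Rightarrow> 'b graph \<Rightarrow> bool" where
  "graph_iso G H \<longleftrightarrow>
     (\<exists>f. bij_betw f (verts G) (verts H) \<and>
          (\<forall>u \<in> verts G. \<forall>v \<in> verts G. adj G u v \<longleftrightarrow> adj H (f u) (f v)))"

definition graph_free :: "'b graph set \<Rightarrow> 'a graph \<Rightarrow> bool" where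
  "graph_free \<H> G \<longleftrightarrow>
     (\<forall>K. induced_subgraph K G \<longrightarrow> (\<forall>H \<in> \<H>. \<not> graph_iso K H))"

definition path_graph :: "nat \<Rightarrow> nat graph" where
  "path_graph n = \<lparr> verts = {..<n}, edges = {{i, i + 1} | i. i + 1 < n} \<rparr>"

text \<open>Meaningful for \<open>n \<ge> 3\<close> only.\<close>

definition cycle_graph :: "nat \<Rightarrow> nat graph" where
  "cycle_graph n = \<lparr> verts = {..<n}, edges = {{i, (i + 1) mod n} | i. i < n} \<rparr>"

definition connected_graph :: "'a graph \<Rightarrow> bool" where
  "connected_graph G \<longleftrightarrow>
     verts G \<noteq> {} \<and>
     (\<forall>u \<in> verts G. \<forall>v \<in> verts G. (u, v) \<in> {(x, y). adj G x y}\<^sup>*)"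

text \<open>Components are the inclusion-maximal connected induced subgraphs.\<close>

definition component :: "'a graph \<Rightarrow> 'a graph \<Rightarrow> bool" where
  "component H G \<longleftrightarrow>
     induced_subgraph H G \<and> connected_graph H \<and>
     (\<forall>K. induced_subgraph K G \<and> connected_graph K \<and> verts H \<subseteq> verts K \<longrightarrow> K = H)"

definition anticomponent :: "'a graph \<Rightarrow> 'a graph \<Rightarrow> bool" where
  "anticomponent H G \<longleftrightarrow>
     induced_subgraph H G \<and> component (graph_complement H) (graph_complement G)"

definition nontrivial_anticomponent :: "'a graph \<Rightarrow> 'a graph \<Rightarrow> bool" where
  "nontrivial_anticomponent H G \<longleftrightarrow> anticomponent H G \<and> card (verts H) \<ge> 2"

definition clique_cutset :: "'a graph \<Rightarrow> 'a set \<Rightarrow> bool" where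
  "clique_cutset G C \<longleftrightarrow>
     clique G C \<and> C \<subset> verts G \<and> \<not> connected_graph (induce G (verts G - C))"

text \<open>The blocks of a partition are given as a list, and disjointness is required of blocks at
  different positions; this allows empty blocks, possibly several of them.\<close>

definition partition_into :: "'a set \<Rightarrow> 'a set list \<Rightarrow> bool" where
  "partition_into V Xs \<longleftrightarrow> sorted_wrt disjnt Xs \<and> \<Union> (set Xs) = V"

definition ordering_of :: "'a set \<Rightarrow> 'a list \<Rightarrow> bool" where
  "ordering_of X xs \<longleftrightarrow> distinct xs \<and> set xs = X"

text \<open>\<open>f x\<^sub>n \<subseteq> \<dots> \<subseteq> f x\<^sub>1\<close> for \<open>xs = [x\<^sub>1, \<dots>, x\<^sub>n]\<close>.\<close>

definition nested :: "('a \<Rightarrow> 'b set) \<Rightarrow> 'a list \<Rightarrow> bool" where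
  "nested f xs \<longleftrightarrow> sorted_wrt (\<lambda>x y. f y \<subseteq> f x) xs"

text \<open>Below, the numeral types \<open>7\<close> and \<open>6\<close> serve as the index rings of integers modulo 7 and
  modulo 6, so index arithmetic is cyclic. In the names of the parts, the suffixes \<open>s\<close>, \<open>p\<close>
  and \<open>m\<close> stand for the superscripts star, plus and minus. The parts \<open>As i\<close>, \<open>Ap i\<close>, \<open>Am i\<close>
  of a bracelet are determined by the sets \<open>A i\<close>, so one choice of them serves all clauses.\<close>

definition bracelet7_pair :: "'a graph \<Rightarrow> (7 \<Rightarrow> 'a set) \<Rightarrow> 7 \<Rightarrow> bool" where
  "bracelet7_pair B A k \<longleftrightarrow>
     partition_into (verts B) (map A [0, 1, 2, 3, 4, 5, 6]) \<and>
     (\<forall>i. A i \<noteq> {} \<and> clique B (A i) \<and>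
          complete_to B (A i) (A (i - 1) \<union> A (i + 1)) \<and>
          anticomplete_to B (A i) (A (i - 3) \<union> A (i + 3))) \<and>
     (\<exists>As Ap Am :: 7 \<Rightarrow> 'a set.
        (\<forall>i. partition_into (A i) [As i, Ap i, Am i] \<and>
             anticomplete_to B (As i) (A (i - 2) \<union> A (i + 2)) \<and>
             anticomplete_to B (Ap i) (A (i - 2)) \<and>
             (\<forall>v \<in> Ap i. \<exists>w \<in> A (i + 2). adj B v w) \<and>
             anticomplete_to B (Am i) (A (i + 2)) \<and>
             (\<forall>v \<in> Am i. \<exists>w \<in> A (i - 2). adj B v w) \<and>
             (Ap i \<noteq> {} \<longrightarrow> (\<exists>xs. ordering_of (Ap i) xs \<and> nested (closed_nbhd B) xs)) \<and>
             (Am i \<noteq> {} \<longrightarrow> (\<exists>xs. ordering_of (Am i) xs \<and> nested (closed_nbhd B) xs)) \<and>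
             (As i \<noteq> {} \<or> \<not> complete_to B (Ap i) (A (i + 2)) \<or>
              \<not> complete_to B (Am i) (A (i - 2)))) \<and>
        A (k - 3) = As (k - 3) \<and> A (k + 3) = As (k + 3) \<and>
        A (k - 2) = As (k - 2) \<union> Ap (k - 2) \<and> A (k + 2) = As (k + 2) \<union> Am (k + 2) \<and>
        A (k - 1) = As (k - 1) \<union> Ap (k - 1) \<and> A (k + 1) = As (k + 1) \<union> Am (k + 1))"

definition bracelet7 :: "'a graph \<Rightarrow> bool" where
  "bracelet7 B \<longleftrightarrow> (\<exists>A k. bracelet7_pair B A k)"

text \<open>With \<open>k\<close> the distinguished index, \<open>Zm\<close>, \<open>Zp\<close> are the parts of \<open>A k\<close>; \<open>Rs\<close>, \<open>Rm\<close>
  those of \<open>A (k + 2)\<close>; and \<open>Ls\<close>, \<open>Lp\<close> those of \<open>A (k - 2)\<close>.\<close>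

definition thickened_emerald :: "'a graph \<Rightarrow> bool" where
  "thickened_emerald B \<longleftrightarrow>
     (\<exists>(C :: 'a set) (A :: 7 \<Rightarrow> 'a set) (k :: 7).
        partition_into (verts B) (C # map A [0, 1, 2, 3, 4, 5, 6]) \<and>
        C \<noteq> {} \<and> clique B C \<and> (\<forall>i. A i \<noteq> {} \<and> clique B (A i)) \<and>
        (\<forall>i. complete_to B (A i) (A (i - 1) \<union> A (i + 1)) \<and>
             anticomplete_to B (A i) (A (i - 3) \<union> A (i + 3))) \<and>
        (\<forall>i \<in> {k - 3, k - 1, k + 1, k + 3}.
             anticomplete_to B (A i) (A (i - 2) \<union> A (i + 2))) \<and>
        (\<exists>Zm Zp Rs Rm Ls Lp.
           sorted_wrt disjnt [Zm, Zp, Rs, Rm, Ls, Lp] \<and>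
           (\<forall>X \<in> {Zm, Zp, Rs, Rm, Ls, Lp}. X \<noteq> {} \<and> clique B X) \<and>
           A k = Zm \<union> Zp \<and> A (k + 2) = Rs \<union> Rm \<and> A (k - 2) = Ls \<union> Lp \<and>
           complete_to B Zm Lp \<and> anticomplete_to B Zm (Ls \<union> A (k + 2)) \<and>
           complete_to B Zp Rm \<and> anticomplete_to B Zp (Rs \<union> A (k - 2)) \<and>
           complete_to B C (Rs \<union> A (k + 3) \<union> A (k - 3) \<union> Ls) \<and>
           anticomplete_to B C (Lp \<union> A (k - 1) \<union> A k \<union> A (k + 1) \<union> Rm)))"

definition r_lantern :: "nat \<Rightarrow> 'a graph \<Rightarrow> bool" where
  "r_lantern r R \<longleftrightarrow> r \<ge> 3 \<and>
     (\<exists>(A :: 'a set) (B :: nat \<Rightarrow> 'a set) (C :: nat \<Rightarrow> 'a set) (D :: 'a set).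
        partition_into (verts R)
          (A # map B [1..<r + 1] @ map C [1..<r + 1] @ [D]) \<and>
        A \<noteq> {} \<and> clique R A \<and> D \<noteq> {} \<and> clique R D \<and>
        (\<forall>i \<in> {1..r}. B i \<noteq> {} \<and> clique R (B i) \<and> C i \<noteq> {} \<and> clique R (C i)) \<and>
        anticomplete_to R A D \<and>
        complete_to R A (\<Union>i \<in> {1..r}. B i) \<and> anticomplete_to R A (\<Union>i \<in> {1..r}. C i) \<and>
        complete_to R D (\<Union>i \<in> {1..r}. C i) \<and> anticomplete_to R D (\<Union>i \<in> {1..r}. B i) \<and>
        (\<exists>bs. ordering_of (B 1) bs \<and> nested (\<lambda>b. closed_nbhd R b \<inter> C 1) bs \<and>
              closed_nbhd R (hd bs) \<inter> C 1 = C 1) \<and>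
        (\<exists>cs. ordering_of (C 1) cs \<and> nested (\<lambda>c. closed_nbhd R c \<inter> B 1) cs \<and>
              closed_nbhd R (hd cs) \<inter> B 1 = B 1) \<and>
        (\<forall>i \<in> {2..r}. complete_to R (B i) (C i)) \<and>
        (\<forall>i \<in> {1..r}. \<forall>j \<in> {1..r}. i \<noteq> j \<longrightarrow>
           anticomplete_to R (B i \<union> C i) (B j \<union> C j)))"

definition lantern :: "'a graph \<Rightarrow> bool" where
  "lantern R \<longleftrightarrow> (\<exists>r \<ge> 3. r_lantern r R)"

definition wreath6 :: "'a graph \<Rightarrow> bool" where
  "wreath6 R \<longleftrightarrow>
     (\<exists>(X :: 6 \<Rightarrow> 'a set) (us :: 6 \<Rightarrow> 'a list).
        partition_into (verts R) (map X [0, 1, 2, 3, 4, 5]) \<and>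
        (\<forall>i. X i \<noteq> {} \<and> ordering_of (X i) (us i) \<and>
             X i \<subseteq> closed_nbhd R (last (us i)) \<and>
             nested (closed_nbhd R) (us i) \<and>
             closed_nbhd R (hd (us i)) = X (i - 1) \<union> X i \<union> X (i + 1)) \<and>
        complete_to R (X 0) (X 1) \<and> complete_to R (X 2) (X 3) \<and> complete_to R (X 4) (X 5))"

definition crown6 :: "'a graph \<Rightarrow> bool" where
  "crown6 R \<longleftrightarrow>
     (\<exists>(C :: 6 \<Rightarrow> 'a set) (D :: 6 \<Rightarrow> 'a set) (k :: 6).
        partition_into (verts R) (map C [0, 1, 2, 3, 4, 5] @ map D [0, 1, 2, 3, 4, 5]) \<and>
        (\<forall>i. clique R (C i) \<and> clique R (D i)) \<and>
        (\<forall>i. C i \<noteq> {}) \<and>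
        D (k - 2) = {} \<and> D (k - 1) = {} \<and>
        D (k + 1) \<noteq> {} \<and> D (k + 2) \<noteq> {} \<and> D (k + 3) \<noteq> {} \<and>
        (\<forall>i. complete_to R (C i) (C (i - 1) \<union> C (i + 1)) \<and>
             anticomplete_to R (C i) (C (i + 2) \<union> C (i + 3) \<union> C (i + 4))) \<and>
        (\<forall>i. complete_to R (D i) (C (i - 1) \<union> C i \<union> C (i + 1)) \<and>
             anticomplete_to R (D i) (C (i + 2) \<union> C (i + 3) \<union> C (i + 4))) \<and>
        (\<forall>i j. i \<noteq> j \<longrightarrow> anticomplete_to R (D i) (D j)))"

end

theory Submission
  imports Defs
begin

text \<open>
  Let \<open>G\<close> satisfy (1) and not be complete. Its nonuniversal vertices form a single anticomponent, which again has
  no clique-cutset, so assume that no vertex is universal. If \<open>K\<close> is a component of the nonneighbourhood of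
  a vertex \<open>a\<close>, then the attachments of \<open>K\<close> are not a clique, and two nonadjacent attachments together with
  \<open>a\<close> and a shortest path through \<open>K\<close> yield a hole, necessarily of length 6 or 7.

  For a 7-hole, every vertex sees three consecutive vertices of the hole, four consecutive ones, all or none;
  the last two kinds would produce a universal vertex or a clique-cutset. The four-types decide between a bracelet and a
  thickened emerald. If there is no 7-hole but a theta (two vertices joined by three disjoint paths of length 3, no other edges),
  the components left after deleting the vertices attached to all feet of one side are the legs of a lantern.
  Otherwise take a 6-hole for which the number of vertices with exactly three consecutive neighbours on it
  is maximum. Maximality excludes all other kinds of vertices, and \<open>G\<close> is a wreath, or a crown if
  three consecutive types contain a stable triple.

  Conversely, emeralds and crowns are blow-ups of fixed graphs, and in the other classes an induced \<open>P\<^sub>7\<close>,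
  \<open>C\<^sub>4\<close> or \<open>C\<^sub>5\<close> contradicts the cyclic arrangement or the nestedness of the parts.
  Except for lanterns, each class contains a hole on which every vertex has two nonadjacent neighbours,
  so removing a clique cannot disconnect it; this survives adding universal vertices.
\<close>

text \<open>Most lemmas about a hole or a theta have one shape: known adjacencies serve as rewrite
  rules, and the opposite of the claim is refuted by naming one induced \<open>P7\<close>,
  \<open>C4\<close>, \<open>C5\<close> or excluded \<open>C7\<close>. They are stated at index 0 and
  moved by rotating the hole, which avoids symbolic index arithmetic. Clique-cutsets act through
  connectivity: a property that holds at one vertex of a component and passes along its edges holds
  on all of it, which brings two nonadjacent attachments into conflict. A four-type vertex fits into
  either of two middle classes of the 7-hole. The bracelet construction is blocked only if two such
  choices are forced and clash; that clash is the emerald. The theta is excluded before the 6-hole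
  is studied, because two adjacent vertices hanging from opposite vertices of a 6-hole form a theta
  with it. Vertices with one or two neighbours on the 6-hole are not contradictory in themselves;
  they allow one or two hole vertices to be exchanged so that the set of three-types grows, whence
  the maximality. In the converse, a lantern lacks a suitable hole: on the hole through two legs, a
  vertex of a third leg sees a single hub.\<close>

lemma UNIV_7: "(UNIV :: 7 set) = {0,1,2,3,4,5,6}"
  by (rule sym, rule card_subset_eq) simp_all

lemma UNIV_6: "(UNIV :: 6 set) = {0,1,2,3,4,5}"
  by (rule sym, rule card_subset_eq) simp_all

lemma mod_7: "(7::7) = 0" "(8::7) = 1" "(9::7) = 2" "(10::7) = 3" "(11::7) = 4" "(12::7) = 5" "(13::7) = 6"
  "- (1::7) = 6" "- (2::7) = 5" "- (3::7) = 4" "- (4::7) = 3" "- (5::7) = 2" "- (6::7) = 1"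
  by simp_all

lemma mod_6: "(6::6) = 0" "(7::6) = 1" "(8::6) = 2" "(9::6) = 3" "(10::6) = 4" "(11::6) = 5"
  "- (1::6) = 5" "- (2::6) = 4" "- (3::6) = 3" "- (4::6) = 2" "- (5::6) = 1"
  by simp_all

text \<open>Subtraction of a constant becomes addition of a numeral. With \<open>mod_7\<close> and
  \<open>add.assoc\<close> every shifted index reaches the form \<open>i + n\<close>, so that equal
  indices become syntactically equal.\<close>

lemma minus_7: "i - 1 = i + (6::7)" "i - 2 = i + (5::7)" "i - 3 = i + (4::7)" "i - 4 = i + (3::7)"
  by (simp_all add: diff_eq_eq)

lemma minus_6: "i - 1 = i + (5::6)" "i - 2 = i + (4::6)" "i - 3 = i + (3::6)" "i - 4 = i + (2::6)"
  by (simp_all add: diff_eq_eq)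

lemmas arith_7 = minus_7 mod_7 add.assoc
lemmas arith_6 = minus_6 mod_6 add.assoc

text \<open>A quantifier over the index ring becomes a conjunction of instances that
  \<open>simp\<close> and \<open>argo\<close> can settle. Later proofs often quantify an offset
  \<open>d\<close> in this way and insert \<open>d = j - i\<close> at the end.\<close>

lemma all_7: "(\<forall>i::7. P i) \<longleftrightarrow> P 0 \<and> P 1 \<and> P 2 \<and> P 3 \<and> P 4 \<and> P 5 \<and> P 6"
proof -
  have "(\<forall>i::7. P i) \<longleftrightarrow> (\<forall>i\<in>{0,1,2,3,4,5,6}. P i)" by (metis UNIV_7 UNIV_I)
  then show ?thesis by simp
qed

lemma UNIV_3: "(UNIV :: 3 set) = {0,1,2}"
  by (rule sym, rule card_subset_eq) simp_all

lemma all_3: "(\<forall>i::3. P i) \<longleftrightarrow> P 0 \<and> P 1 \<and> P 2"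
proof -
  have "(\<forall>i::3. P i) \<longleftrightarrow> (\<forall>i\<in>{0,1,2}. P i)" by (metis UNIV_3 UNIV_I)
  then show ?thesis by simp
qed

lemma all_6: "(\<forall>i::6. P i) \<longleftrightarrow> P 0 \<and> P 1 \<and> P 2 \<and> P 3 \<and> P 4 \<and> P 5"
proof -
  have "(\<forall>i::6. P i) \<longleftrightarrow> (\<forall>i\<in>{0,1,2,3,4,5}. P i)" by (metis UNIV_6 UNIV_I)
  then show ?thesis by simp
qed

text \<open>Adjacency is made reflexive so that induced paths and cycles can be described without
  distinctness conditions.\<close>

definition nb :: "'a graph \<Rightarrow> 'a \<Rightarrow> 'a \<Rightarrow> bool" where
  "nb G x y \<longleftrightarrow> x = y \<or> adj G x y"

lemma nb_refl [simp]: "nb G x x" by (simp add: nb_def)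

lemma adj_commute: "adj G x y \<longleftrightarrow> adj G y x"
  by (simp add: adj_def insert_commute)

lemma nb_commute: "nb G x y \<longleftrightarrow> nb G y x"
  by (auto simp: nb_def adj_commute)

lemma nb_sym: "nb G x y \<Longrightarrow> nb G y x"
  by (simp add: nb_commute)

lemma not_nb_sym: "\<not> nb G x y \<Longrightarrow> \<not> nb G y x"
  by (simp add: nb_commute)

text \<open>The contrary assumption is supplied in both orientations, since symmetry of
  \<open>nb\<close> would loop as a rewrite rule. The explicit forbidden subgraphs below can then
  list their vertices in any order.\<close>

lemma nbI: "(\<not> nb G x y \<Longrightarrow> \<not> nb G y x \<Longrightarrow> False) \<Longrightarrow> nb G x y"
  and not_nbI: "(nb G x y \<Longrightarrow> nb G y x \<Longrightarrow> False) \<Longrightarrow> \<not> nb G x y"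
  using nb_sym[of G x y] nb_sym[of G y x] by blast+

lemma adj_irrefl: "simple_graph G \<Longrightarrow> \<not> adj G x x"
  unfolding simple_graph_def adj_def by fastforce

lemma adj_verts: "simple_graph G \<Longrightarrow> adj G x y \<Longrightarrow> x \<in> verts G \<and> y \<in> verts G"
  unfolding simple_graph_def adj_def by (metis doubleton_eq_iff)

lemma adj_iff_nb: "simple_graph G \<Longrightarrow> adj G x y \<longleftrightarrow> x \<noteq> y \<and> nb G x y"
  using adj_irrefl[of G x] by (auto simp: nb_def)

lemma nb_verts: "simple_graph G \<Longrightarrow> nb G x y \<Longrightarrow> x \<noteq> y \<Longrightarrow> x \<in> verts G \<and> y \<in> verts G"
  using adj_verts[of G x y] by (auto simp: nb_def)

lemma anticomplete_to_nbD:
  assumes "anticomplete_to G X Y" "x \<in> X" "y \<in> Y" "x \<noteq> y"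
  shows "\<not> nb G x y"
  using assms unfolding anticomplete_to_def by (auto simp: nb_def)

lemma clique_nb: "clique G K \<longleftrightarrow> K \<subseteq> verts G \<and> (\<forall>x\<in>K. \<forall>y\<in>K. nb G x y)"
  unfolding clique_def nb_def by blast

lemma adj_induce: "adj (induce G X) x y \<longleftrightarrow> adj G x y \<and> x \<in> X \<and> y \<in> X"
  by (auto simp: adj_def induce_def)

lemma verts_induce [simp]: "verts (induce G X) = X"
  by (simp add: induce_def)

lemma nb_induce: "x \<in> X \<Longrightarrow> y \<in> X \<Longrightarrow> nb (induce G X) x y \<longleftrightarrow> nb G x y"
  by (auto simp: nb_def adj_induce)

lemma simple_induce:
  assumes "simple_graph G" "X \<subseteq> verts G" "X \<noteq> {}"
  shows "simple_graph (induce G X)"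
proof -
  have "\<exists>u\<in>X. \<exists>v\<in>X. u \<noteq> v \<and> e = {u, v}" if "e \<in> edges G" "e \<subseteq> X" for e
    using that assms(1) unfolding simple_graph_def by (metis insert_subset)
  then show ?thesis
    using assms finite_subset unfolding simple_graph_def
    by (auto simp: induce_def)
qed

section \<open>Forbidden induced subgraphs as conditions on a relation\<close>

definition no_P7 :: "('a \<Rightarrow> 'a \<Rightarrow> bool) \<Rightarrow> bool" where
  "no_P7 N \<longleftrightarrow> (\<forall>a b c d e f g. N a b \<longrightarrow> N b c \<longrightarrow> N c d \<longrightarrow> N d e \<longrightarrow> N e f \<longrightarrow> N f g \<longrightarrow>
     \<not> N a c \<longrightarrow> \<not> N a d \<longrightarrow> \<not> N a e \<longrightarrow> \<not> N a f \<longrightarrow> \<not> N a g \<longrightarrow> \<not> N b d \<longrightarrow> \<not> N b e \<longrightarrow> \<not> N b f \<longrightarrow>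
     \<not> N b g \<longrightarrow> \<not> N c e \<longrightarrow> \<not> N c f \<longrightarrow> \<not> N c g \<longrightarrow> \<not> N d f \<longrightarrow> \<not> N d g \<longrightarrow> \<not> N e g \<longrightarrow> False)"

definition no_C4 :: "('a \<Rightarrow> 'a \<Rightarrow> bool) \<Rightarrow> bool" where
  "no_C4 N \<longleftrightarrow> (\<forall>a b c d. N a b \<longrightarrow> N b c \<longrightarrow> N c d \<longrightarrow> N d a \<longrightarrow> \<not> N a c \<longrightarrow> \<not> N b d \<longrightarrow> False)"

definition no_C5 :: "('a \<Rightarrow> 'a \<Rightarrow> bool) \<Rightarrow> bool" where
  "no_C5 N \<longleftrightarrow> (\<forall>a b c d e. N a b \<longrightarrow> N b c \<longrightarrow> N c d \<longrightarrow> N d e \<longrightarrow> N e a \<longrightarrow>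
     \<not> N a c \<longrightarrow> \<not> N a d \<longrightarrow> \<not> N b d \<longrightarrow> \<not> N b e \<longrightarrow> \<not> N c e \<longrightarrow> False)"

definition no_C7 :: "('a \<Rightarrow> 'a \<Rightarrow> bool) \<Rightarrow> bool" where
  "no_C7 N \<longleftrightarrow> (\<forall>a b c d e f g. N a b \<longrightarrow> N b c \<longrightarrow> N c d \<longrightarrow> N d e \<longrightarrow> N e f \<longrightarrow> N f g \<longrightarrow> N g a \<longrightarrow>
     \<not> N a c \<longrightarrow> \<not> N a d \<longrightarrow> \<not> N a e \<longrightarrow> \<not> N a f \<longrightarrow> \<not> N b d \<longrightarrow> \<not> N b e \<longrightarrow> \<not> N b f \<longrightarrow>
     \<not> N b g \<longrightarrow> \<not> N c e \<longrightarrow> \<not> N c f \<longrightarrow> \<not> N c g \<longrightarrow> \<not> N d f \<longrightarrow> \<not> N d g \<longrightarrow> \<not> N e g \<longrightarrow> False)"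

text \<open>Path and cycle graphs live on \<open>{..<n}\<close>, so the inverse \<open>g\<close> of
  the isomorphism names the vertices of a copy as \<open>g 0\<close>, \<open>g 1\<close> and so on.
  This is the form that can be compared with \<open>no_P7\<close>, \<open>no_C4\<close> and
  \<open>no_C5\<close>.\<close>

lemma contains_iff:
  assumes "simple_graph G" and vH: "verts H = {..<n}" "0 < n"
  shows "(\<exists>K. induced_subgraph K G \<and> graph_iso K H) \<longleftrightarrow>
    (\<exists>g. inj_on g {..<n} \<and> g ` {..<n} \<subseteq> verts G \<and>
         (\<forall>i<n. \<forall>j<n. adj G (g i) (g j) \<longleftrightarrow> adj H i j))"
proof
  assume "\<exists>K. induced_subgraph K G \<and> graph_iso K H"
  then obtain X f where X: "X \<subseteq> verts G" and f: "bij_betw f X {..<n}"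
    and fa: "\<forall>u\<in>X. \<forall>v\<in>X. adj (induce G X) u v \<longleftrightarrow> adj H (f u) (f v)"
    unfolding induced_subgraph_def graph_iso_def using vH by auto
  define g where "g = inv_into X f"
  have g: "bij_betw g {..<n} X" unfolding g_def using f by (rule bij_betw_inv_into)
  have fg: "f (g i) = i" if "i < n" for i
    unfolding g_def using f that by (simp add: bij_betw_inv_into_right)
  have gX: "g i \<in> X" if "i < n" for i using g that by (auto simp: bij_betw_def)
  have "\<forall>i<n. \<forall>j<n. adj G (g i) (g j) \<longleftrightarrow> adj H i j"
    using fa gX fg by (simp add: adj_induce)
  then show "\<exists>g. inj_on g {..<n} \<and> g ` {..<n} \<subseteq> verts G \<and>
         (\<forall>i<n. \<forall>j<n. adj G (g i) (g j) \<longleftrightarrow> adj H i j)"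
    using g X unfolding bij_betw_def by blast
next
  assume "\<exists>g. inj_on g {..<n} \<and> g ` {..<n} \<subseteq> verts G \<and>
         (\<forall>i<n. \<forall>j<n. adj G (g i) (g j) \<longleftrightarrow> adj H i j)"
  then obtain g where g: "inj_on g {..<n}" "g ` {..<n} \<subseteq> verts G"
    and ga: "\<forall>i<n. \<forall>j<n. adj G (g i) (g j) \<longleftrightarrow> adj H i j" by blast
  define X where "X = g ` {..<n}"
  define f where "f = inv_into {..<n} g"
  have b: "bij_betw g {..<n} X" using g unfolding X_def bij_betw_def by simp
  have f: "bij_betw f X {..<n}" unfolding f_def using b by (rule bij_betw_inv_into)
  have "adj (induce G X) u v \<longleftrightarrow> adj H (f u) (f v)" if "u \<in> X" "v \<in> X" for u v
  proof -
    have "f u < n" "f v < n" using f that by (auto simp: bij_betw_def)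
    moreover have "g (f u) = u" "g (f v) = v"
      using b that unfolding f_def by (simp_all add: bij_betw_inv_into_right)
    ultimately show ?thesis using ga that by (metis adj_induce)
  qed
  moreover have "X \<noteq> {}" "X \<subseteq> verts G" using g vH unfolding X_def by auto
  ultimately show "\<exists>K. induced_subgraph K G \<and> graph_iso K H"
    unfolding induced_subgraph_def graph_iso_def using f vH
    by (intro exI[of _ "induce G X"]) auto
qed

lemma adj_path_graph: "adj (path_graph n) i j \<longleftrightarrow> (j = i + 1 \<and> j < n) \<or> (i = j + 1 \<and> i < n)"
  unfolding adj_def path_graph_def by (auto simp: doubleton_eq_iff)

lemma adj_cycle_graph: "adj (cycle_graph n) i j \<longleftrightarrow> (i < n \<and> j = (i + 1) mod n) \<or> (j < n \<and> i = (j + 1) mod n)"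
  unfolding adj_def cycle_graph_def by (auto simp: doubleton_eq_iff)

lemma nat_less_numerals:
  "{..<4::nat} = {0,1,2,3}" "{..<5::nat} = {0,1,2,3,4}" "{..<7::nat} = {0,1,2,3,4,5,6}"
  by (simp_all add: lessThan_nat_numeral lessThan_Suc insert_commute)

lemma all_less_4: "(\<forall>i<4::nat. P i) \<longleftrightarrow> P 0 \<and> P 1 \<and> P 2 \<and> P 3"
proof -
  have "(\<forall>i<4. P i) \<longleftrightarrow> (\<forall>i\<in>{..<4}. P i)" by blast
  then show ?thesis unfolding nat_less_numerals by simp
qed

lemma all_less_5: "(\<forall>i<5::nat. P i) \<longleftrightarrow> P 0 \<and> P 1 \<and> P 2 \<and> P 3 \<and> P 4"
proof -
  have "(\<forall>i<5. P i) \<longleftrightarrow> (\<forall>i\<in>{..<5}. P i)" by blast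
  then show ?thesis unfolding nat_less_numerals by simp
qed

lemma all_less_7: "(\<forall>i<7::nat. P i) \<longleftrightarrow> P 0 \<and> P 1 \<and> P 2 \<and> P 3 \<and> P 4 \<and> P 5 \<and> P 6"
proof -
  have "(\<forall>i<7. P i) \<longleftrightarrow> (\<forall>i\<in>{..<7}. P i)" by blast
  then show ?thesis unfolding nat_less_numerals by simp
qed

lemma graph_free_iff:
  assumes s: "simple_graph G"
  shows "graph_free {path_graph 7, cycle_graph 4, cycle_graph 5} G \<longleftrightarrow>
    no_P7 (nb G) \<and> no_C4 (nb G) \<and> no_C5 (nb G)"
proof -
  have P: "(\<exists>K. induced_subgraph K G \<and> graph_iso K (path_graph 7)) \<longleftrightarrow> \<not> no_P7 (nb G)"
  proof
    assume "\<exists>K. induced_subgraph K G \<and> graph_iso K (path_graph 7)"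
    then obtain g where g: "inj_on g {..<7}" "\<forall>i<7. \<forall>j<7. adj G (g i) (g j) \<longleftrightarrow> adj (path_graph 7) i j"
      using contains_iff[OF s, of "path_graph 7" 7] by (auto simp: path_graph_def)
    have "\<forall>i<7. \<forall>j<7. nb G (g i) (g j) \<longleftrightarrow> i = j \<or> adj (path_graph 7) i j"
      using g unfolding nb_def inj_on_def by (metis lessThan_iff)
    then have H: "\<forall>i<7. \<forall>j<7. nb G (g i) (g j) \<longleftrightarrow> i = j \<or> adj (path_graph 7) i j" .
    show "\<not> no_P7 (nb G)"
    proof
      assume "no_P7 (nb G)"
      from this[unfolded no_P7_def, rule_format, of "g 0" "g 1" "g 2" "g 3" "g 4" "g 5" "g 6"] show False
        by (simp add: H[rule_format] adj_path_graph)
    qed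
  next
    assume "\<not> no_P7 (nb G)"
    then obtain a b c d e f h where
      H: "nb G a b" "nb G b c" "nb G c d" "nb G d e" "nb G e f" "nb G f h"
      "\<not> nb G a c" "\<not> nb G a d" "\<not> nb G a e" "\<not> nb G a f" "\<not> nb G a h" "\<not> nb G b d" "\<not> nb G b e" "\<not> nb G b f"
      "\<not> nb G b h" "\<not> nb G c e" "\<not> nb G c f" "\<not> nb G c h" "\<not> nb G d f" "\<not> nb G d h" "\<not> nb G e h"
      unfolding no_P7_def by blast
    define g where "g i = [a,b,c,d,e,f,h] ! i" for i
    have gs: "g 0 = a" "g 1 = b" "g 2 = c" "g 3 = d" "g 4 = e" "g 5 = f" "g 6 = h"
      by (simp_all add: g_def)
    \<comment> \<open>Distinctness is not part of \<open>no_P7\<close>; it follows because any two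
      of the vertices are nonadjacent or are told apart by a third one.\<close>
    have ne: "a \<noteq> b" "b \<noteq> c" "c \<noteq> d" "d \<noteq> e" "e \<noteq> f" "f \<noteq> h"
       "a \<noteq> c" "a \<noteq> d" "a \<noteq> e" "a \<noteq> f" "a \<noteq> h" "b \<noteq> d" "b \<noteq> e" "b \<noteq> f" "b \<noteq> h" "c \<noteq> e" "c \<noteq> f" "c \<noteq> h" "d \<noteq> f" "d \<noteq> h" "e \<noteq> h"
      using H by auto
    have inj: "inj_on g {..<7}" unfolding nat_less_numerals inj_on_def by (simp add: gs[simplified] ne ne[symmetric])
    have adj': "\<forall>i<7. \<forall>j<7. adj G (g i) (g j) \<longleftrightarrow> adj (path_graph 7) i j"
      unfolding all_less_7 gs adj_path_graph
      by (simp add: adj_iff_nb[OF s] H ne ne[symmetric] H(1-6)[THEN nb_sym] H(7-)[THEN not_nb_sym])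
    have "g ` {..<7} \<subseteq> verts G"
      using nb_verts[OF s] H(1-6) ne(1-6) unfolding nat_less_numerals by (auto simp: gs[simplified])
    then show "\<exists>K. induced_subgraph K G \<and> graph_iso K (path_graph 7)"
      using contains_iff[OF s, of "path_graph 7" 7] inj adj' by (auto simp: path_graph_def)
  qed
  have C4: "(\<exists>K. induced_subgraph K G \<and> graph_iso K (cycle_graph 4)) \<longleftrightarrow> \<not> no_C4 (nb G)"
  proof
    assume "\<exists>K. induced_subgraph K G \<and> graph_iso K (cycle_graph 4)"
    then obtain g where g: "inj_on g {..<4}" "\<forall>i<4. \<forall>j<4. adj G (g i) (g j) \<longleftrightarrow> adj (cycle_graph 4) i j"
      using contains_iff[OF s, of "cycle_graph 4" 4] by (auto simp: cycle_graph_def)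
    have "\<forall>i<4. \<forall>j<4. nb G (g i) (g j) \<longleftrightarrow> i = j \<or> adj (cycle_graph 4) i j"
      using g unfolding nb_def inj_on_def by (metis lessThan_iff)
    then have H: "\<forall>i<4. \<forall>j<4. nb G (g i) (g j) \<longleftrightarrow> i = j \<or> adj (cycle_graph 4) i j" .
    show "\<not> no_C4 (nb G)"
    proof
      assume "no_C4 (nb G)"
      from this[unfolded no_C4_def, rule_format, of "g 0" "g 1" "g 2" "g 3"] show False
        by (simp add: H[rule_format] adj_cycle_graph)
    qed
  next
    assume "\<not> no_C4 (nb G)"
    then obtain a b c d where
      H: "nb G a b" "nb G b c" "nb G c d" "nb G d a" "\<not> nb G a c" "\<not> nb G b d"
      unfolding no_C4_def by blast
    define g where "g i = [a,b,c,d] ! i" for i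
    have gs: "g 0 = a" "g 1 = b" "g 2 = c" "g 3 = d"
      by (simp_all add: g_def)
    have ne: "a \<noteq> b" "b \<noteq> c" "c \<noteq> d" "a \<noteq> c" "a \<noteq> d" "b \<noteq> d"
      using H by (auto dest: nb_sym)
    have inj: "inj_on g {..<4}" unfolding nat_less_numerals inj_on_def by (simp add: gs[simplified] ne ne[symmetric])
    have adj': "\<forall>i<4. \<forall>j<4. adj G (g i) (g j) \<longleftrightarrow> adj (cycle_graph 4) i j"
      unfolding all_less_4 gs adj_cycle_graph
      by (simp add: adj_iff_nb[OF s] H ne ne[symmetric] H(1-4)[THEN nb_sym] H(5-)[THEN not_nb_sym])
    have "g ` {..<4} \<subseteq> verts G"
      using nb_verts[OF s] H(1-4) ne unfolding nat_less_numerals by (auto simp: gs[simplified])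
    then show "\<exists>K. induced_subgraph K G \<and> graph_iso K (cycle_graph 4)"
      using contains_iff[OF s, of "cycle_graph 4" 4] inj adj' by (auto simp: cycle_graph_def)
  qed
  have C5: "(\<exists>K. induced_subgraph K G \<and> graph_iso K (cycle_graph 5)) \<longleftrightarrow> \<not> no_C5 (nb G)"
  proof
    assume "\<exists>K. induced_subgraph K G \<and> graph_iso K (cycle_graph 5)"
    then obtain g where g: "inj_on g {..<5}" "\<forall>i<5. \<forall>j<5. adj G (g i) (g j) \<longleftrightarrow> adj (cycle_graph 5) i j"
      using contains_iff[OF s, of "cycle_graph 5" 5] by (auto simp: cycle_graph_def)
    have "\<forall>i<5. \<forall>j<5. nb G (g i) (g j) \<longleftrightarrow> i = j \<or> adj (cycle_graph 5) i j"
      using g unfolding nb_def inj_on_def by (metis lessThan_iff)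
    then have H: "\<forall>i<5. \<forall>j<5. nb G (g i) (g j) \<longleftrightarrow> i = j \<or> adj (cycle_graph 5) i j" .
    show "\<not> no_C5 (nb G)"
    proof
      assume "no_C5 (nb G)"
      from this[unfolded no_C5_def, rule_format, of "g 0" "g 1" "g 2" "g 3" "g 4"] show False
        by (simp add: H[rule_format] adj_cycle_graph)
    qed
  next
    assume "\<not> no_C5 (nb G)"
    then obtain a b c d e where
      H: "nb G a b" "nb G b c" "nb G c d" "nb G d e" "nb G e a"
       "\<not> nb G a c" "\<not> nb G a d" "\<not> nb G b d" "\<not> nb G b e" "\<not> nb G c e"
      unfolding no_C5_def by blast
    define g where "g i = [a,b,c,d,e] ! i" for i
    have gs: "g 0 = a" "g 1 = b" "g 2 = c" "g 3 = d" "g 4 = e"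
      by (simp_all add: g_def)
    have ne: "a \<noteq> b" "b \<noteq> c" "c \<noteq> d" "d \<noteq> e" "a \<noteq> c" "a \<noteq> d" "a \<noteq> e" "b \<noteq> d" "b \<noteq> e" "c \<noteq> e"
      using H by (auto dest: nb_sym)
    have inj: "inj_on g {..<5}" unfolding nat_less_numerals inj_on_def by (simp add: gs[simplified] ne ne[symmetric])
    have adj': "\<forall>i<5. \<forall>j<5. adj G (g i) (g j) \<longleftrightarrow> adj (cycle_graph 5) i j"
      unfolding all_less_5 gs adj_cycle_graph
      by (simp add: adj_iff_nb[OF s] H ne ne[symmetric] H(1-5)[THEN nb_sym] H(6-)[THEN not_nb_sym])
    have "g ` {..<5} \<subseteq> verts G"
      using nb_verts[OF s] H(1-5) ne unfolding nat_less_numerals by (auto simp: gs[simplified])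
    then show "\<exists>K. induced_subgraph K G \<and> graph_iso K (cycle_graph 5)"
      using contains_iff[OF s, of "cycle_graph 5" 5] inj adj' by (auto simp: cycle_graph_def)
  qed
  show ?thesis unfolding graph_free_def using P C4 C5 by blast
qed

section \<open>Graphs with a 7-hole\<close>

locale free_graph =
  fixes G :: "'a graph"
  assumes simple: "simple_graph G"
    and no_P7: "no_P7 (nb G)" and no_C4: "no_C4 (nb G)" and no_C5: "no_C5 (nb G)"
begin

lemmas P7 = no_P7[unfolded no_P7_def, rule_format]
lemmas C4 = no_C4[unfolded no_C4_def, rule_format]
lemmas C5 = no_C5[unfolded no_C5_def, rule_format]

end

text \<open>The absence of clique-cutsets enters only in this form: the outside vertices with a
  neighbour in \<open>K\<close> separate \<open>K\<close> from \<open>v\<close>, so they cannot be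
  pairwise adjacent. \<open>K\<close> may be any such set, connected or not; usually it is a
  component of some vertex type.\<close>

locale atom_graph = free_graph +
  assumes no_clique_cutset: "\<lbrakk>K \<subseteq> verts G; K \<noteq> {}; v \<in> verts G; v \<notin> K; \<forall>k\<in>K. \<not> nb G v
    k\<rbrakk> \<Longrightarrow>
      \<exists>x\<in>verts G - K. \<exists>y\<in>verts G - K. \<not> nb G x y \<and> (\<exists>k\<in>K. nb G x k) \<and> (\<exists>k\<in>K. nb G y k)"
    and no_universal: "u \<in> verts G \<Longrightarrow> \<exists>v\<in>verts G. \<not> nb G u v"

text \<open>The last clause is connectivity in the form needed later: a property that holds at one
  vertex of \<open>K\<close> and passes along the edges inside \<open>K\<close> holds on all of
  \<open>K\<close>.\<close>

lemma nb_component: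
  assumes "z \<in> Z"
  obtains K where "z \<in> K" "K \<subseteq> Z" "\<And>x y. x \<in> K \<Longrightarrow> y \<in> Z \<Longrightarrow> nb G x y \<Longrightarrow> y \<in> K"
    "\<And>S s. \<lbrakk>S \<subseteq> K; s \<in> S; \<And>x y. x \<in> S \<Longrightarrow> y \<in> K \<Longrightarrow> nb G x y \<Longrightarrow> y \<in> S\<rbrakk> \<Longrightarrow> S = K"
proof -
  define E where "E = {(x, y). x \<in> Z \<and> y \<in> Z \<and> nb G x y}"
  define K where "K = {x. (z, x) \<in> E\<^sup>*}"
  have symE: "sym E" unfolding E_def sym_def by (auto intro: nb_sym)
  have KZ: "K \<subseteq> Z"
  proof
    fix x assume "x \<in> K"
    then have "(z, x) \<in> E\<^sup>*" by (simp add: K_def)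
    then show "x \<in> Z" by (induction) (auto simp: E_def assms)
  qed
  have zK: "z \<in> K" by (simp add: K_def)
  have cl: "y \<in> K" if "x \<in> K" "y \<in> Z" "nb G x y" for x y
  proof -
    have "(x, y) \<in> E" using that KZ by (auto simp: E_def)
    then show ?thesis using that unfolding K_def by (auto intro: rtrancl_into_rtrancl)
  qed
  have conn: "S = K" if "S \<subseteq> K" "s \<in> S" and cS: "\<And>x y. x \<in> S \<Longrightarrow> y \<in> K \<Longrightarrow> nb G x y \<Longrightarrow> y \<in> S" for S s
  proof -
    have "(s, z) \<in> E\<^sup>*"
      using that(1,2) symE unfolding K_def by (metis (no_types, lifting) mem_Collect_eq subset_iff symD sym_rtrancl)
    have "y \<in> S" if "y \<in> K" for y
    proof -
      have "(s, y) \<in> E\<^sup>*" using that \<open>(s, z) \<in> E\<^sup>*\<close> unfolding K_def by auto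
      then show ?thesis
      proof (induction)
        case base then show ?case by fact
      next
        case (step u w)
        then have "w \<in> Z" "nb G u w" "u \<in> K" using \<open>S \<subseteq> K\<close> by (auto simp: E_def)
        then show ?case using cS cl step by blast
      qed
    qed
    then show ?thesis using that(1) by blast
  qed
  show thesis by (rule that[OF zK KZ cl conn])
qed

section \<open>Vertex types with respect to a 7-hole\<close>

context free_graph
begin

definition hole7 :: "(7 \<Rightarrow> 'a) \<Rightarrow> bool" where
  "hole7 c \<longleftrightarrow> (\<forall>i j. nb G (c i) (c j) \<longleftrightarrow> j - i = 0 \<or> j - i = 1 \<or> j - i = 6)"

text \<open>\<open>T7\<close> is indexed by the middle one of three neighbours, \<open>F7\<close> by
  the first one of four. Hence \<open>F7 c i\<close> has two middle positions, \<open>i + 1\<close>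
  and \<open>i + 2\<close>, and this ambiguity governs the whole case.\<close>

definition T7 :: "(7 \<Rightarrow> 'a) \<Rightarrow> 7 \<Rightarrow> 'a set" where
  "T7 c i = {v \<in> verts G. \<forall>j. nb G v (c j) \<longleftrightarrow> j - i = 0 \<or> j - i = 1 \<or> j - i = 6}"

definition F7 :: "(7 \<Rightarrow> 'a) \<Rightarrow> 7 \<Rightarrow> 'a set" where
  "F7 c i = {v \<in> verts G. \<forall>j. nb G v (c j) \<longleftrightarrow> j - i = 0 \<or> j - i = 1 \<or> j - i = 2 \<or> j - i = 3}"

definition U7 :: "(7 \<Rightarrow> 'a) \<Rightarrow> 'a set" where
  "U7 c = {v \<in> verts G. \<forall>j. nb G v (c j)}"

definition Z7 :: "(7 \<Rightarrow> 'a) \<Rightarrow> 'a set" where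
  "Z7 c = {v \<in> verts G. \<forall>j. \<not> nb G v (c j)}"

lemma hole7D: "hole7 c \<Longrightarrow> nb G (c i) (c j) \<longleftrightarrow> j - i = 0 \<or> j - i = 1 \<or> j - i = 6"
  by (simp add: hole7_def)

lemma T7D:
  assumes "v \<in> T7 c i"
  shows "nb G v (c j) \<longleftrightarrow> j - i = 0 \<or> j - i = 1 \<or> j - i = 6"
    and "nb G (c j) v \<longleftrightarrow> j - i = 0 \<or> j - i = 1 \<or> j - i = 6"
  using assms nb_commute[of G v "c j"] by (simp_all add: T7_def)

lemma F7D:
  assumes "v \<in> F7 c i"
  shows "nb G v (c j) \<longleftrightarrow> j - i = 0 \<or> j - i = 1 \<or> j - i = 2 \<or> j - i = 3"
    and "nb G (c j) v \<longleftrightarrow> j - i = 0 \<or> j - i = 1 \<or> j - i = 2 \<or> j - i = 3"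
  using assms nb_commute[of G v "c j"] by (simp_all add: F7_def)

lemma U7D:
  assumes "v \<in> U7 c"
  shows "nb G v (c j)" and "nb G (c j) v"
  using assms nb_commute[of G v "c j"] by (simp_all add: U7_def)

lemma Z7D:
  assumes "v \<in> Z7 c"
  shows "\<not> nb G v (c j)" and "\<not> nb G (c j) v"
  using assms nb_commute[of G v "c j"] by (simp_all add: Z7_def)

lemma hole7_verts: "hole7 c \<Longrightarrow> c i \<in> verts G"
proof -
  assume h: "hole7 c"
  have "nb G (c i) (c (i + 1))" "nb G (c (i + 1)) (c (i + 2))" "\<not> nb G (c i) (c (i + 2))"
    using hole7D[OF h] by simp_all
  then show ?thesis using nb_verts[OF simple] by metis
qed

lemma hole7_T: "hole7 c \<Longrightarrow> c i \<in> T7 c i"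
  using hole7_verts[of c i] hole7D[of c i] unfolding T7_def by simp

lemma hole7_rotate: "hole7 c \<Longrightarrow> hole7 (\<lambda>j. c (k + j))"
  unfolding hole7_def by simp

lemma T7_rotate: "T7 (\<lambda>j. c (k + j)) i = T7 c (k + i)"
proof -
  have "(\<forall>j. P (c (k + j)) (j - i)) \<longleftrightarrow> (\<forall>j. P (c j) (j - (k + i)))" for P :: "'a \<Rightarrow> 7 \<Rightarrow> bool"
    by (metis (no_types, opaque_lifting) add_diff_cancel_left diff_add_cancel add.commute)
  from this[of "\<lambda>x d. nb G v x \<longleftrightarrow> d = 0 \<or> d = 1 \<or> d = 6" for v] show ?thesis by (simp add: T7_def)
qed

lemma F7_rotate: "F7 (\<lambda>j. c (k + j)) i = F7 c (k + i)"
proof -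
  have "(\<forall>j. P (c (k + j)) (j - i)) \<longleftrightarrow> (\<forall>j. P (c j) (j - (k + i)))" for P :: "'a \<Rightarrow> 7 \<Rightarrow> bool"
    by (metis (no_types, opaque_lifting) add_diff_cancel_left diff_add_cancel add.commute)
  from this[of "\<lambda>x d. nb G v x \<longleftrightarrow> d = 0 \<or> d = 1 \<or> d = 2 \<or> d = 3" for v] show ?thesis by (simp add: F7_def)
qed

text \<open>A gap of one nonneighbour closes to a \<open>C4\<close> and a gap of two to a
  \<open>C5\<close>, so every gap has length at least three. Seven positions leave room for only one
  such gap, and an interval of one or two neighbours would extend to a \<open>P7\<close>.\<close>

lemma hole7_cover:
  assumes h: "hole7 c" and v: "v \<in> verts G"
  shows "v \<in> U7 c \<or> v \<in> Z7 c \<or> (\<exists>i. v \<in> T7 c i) \<or> (\<exists>i. v \<in> F7 c i)"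
proof -
  define p where "p i = nb G v (c i)" for i
  note [simp] = hole7D[OF h] p_def[symmetric] nb_commute[of G "c j" v for j]
  have a: "p i \<Longrightarrow> p (i + 2) \<Longrightarrow> p (i + 1)" for i
    by (rule ccontr, rule C4[of v "c i" "c (i + 1)" "c (i + 2)"]) simp_all
  have b: "p i \<Longrightarrow> p (i + 3) \<Longrightarrow> p (i + 1) \<or> p (i + 2)" for i
    by (rule ccontr, rule C5[of v "c i" "c (i + 1)" "c (i + 2)" "c (i + 3)"]) simp_all
  have d: "p i \<Longrightarrow> p (i + 1) \<or> p (i + 2) \<or> p (i + 3) \<or> p (i + 4) \<or> p (i + 5)" for i
    by (rule ccontr, rule P7[of v "c i" "c (i + 1)" "c (i + 2)" "c (i + 3)" "c (i + 4)" "c (i + 5)"]) simp_all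
  have all: "(\<forall>i. p i \<longrightarrow> p (i + 2) \<longrightarrow> p (i + 1)) \<and> (\<forall>i. p i \<longrightarrow> p (i + 3) \<longrightarrow> p (i + 1) \<or> p (i + 2))
    \<and> (\<forall>i. p i \<longrightarrow> p (i + 1) \<or> p (i + 2) \<or> p (i + 3) \<or> p (i + 4) \<or> p (i + 5))"
    using a b d by blast
  have ex: "(\<exists>i::7. Q i) \<longleftrightarrow> Q 0 \<or> Q 1 \<or> Q 2 \<or> Q 3 \<or> Q 4 \<or> Q 5 \<or> Q 6" for Q
    using all_7[of "\<lambda>i. \<not> Q i"] by blast
  from all show ?thesis
    unfolding U7_def Z7_def T7_def F7_def mem_Collect_eq p_def[symmetric] ex all_7
    by (simp add: v mod_7) argo
qed

section \<open>Adjacency between the types at a 7-hole\<close>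

lemma T7_clique:
  assumes h: "hole7 c" and t': "t \<in> T7 c 0" and s': "s \<in> T7 c 0"
  shows "nb G t s"
  by (rule nbI, rule C4[of t "c 1" s "c 6"]) (simp_all add: hole7D[OF h] T7D[OF t'] T7D[OF s'])

lemma T7_T1:
  assumes h: "hole7 c" and t': "t \<in> T7 c 0" and s': "s \<in> T7 c 1"
  shows "nb G t s"
  by (rule nbI, rule P7[of t "c 0" s "c 2" "c 3" "c 4" "c 5"]) (simp_all add: hole7D[OF h] T7D[OF t'] T7D[OF s'])

lemma T7_T3:
  assumes h: "hole7 c" and t': "t \<in> T7 c 0" and s': "s \<in> T7 c 3"
  shows "\<not> nb G t s"
  by (rule not_nbI, rule C4[of t s "c 2" "c 1"]) (simp_all add: hole7D[OF h] T7D[OF t'] T7D[OF s'])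

lemma F7_clique:
  assumes h: "hole7 c" and f': "f \<in> F7 c 0" and g': "g \<in> F7 c 0"
  shows "nb G f g"
  by (rule nbI, rule C4[of f "c 0" g "c 2"]) (simp_all add: hole7D[OF h] F7D[OF f'] F7D[OF g'])

lemma F7_T1:
  assumes h: "hole7 c" and f': "f \<in> F7 c 0" and t': "t \<in> T7 c 1"
  shows "nb G f t"
  by (rule nbI, rule C4[of f "c 0" t "c 2"]) (simp_all add: hole7D[OF h] F7D[OF f'] T7D[OF t'])

lemma F7_T2:
  assumes h: "hole7 c" and f': "f \<in> F7 c 0" and t': "t \<in> T7 c 2"
  shows "nb G f t"
  by (rule nbI, rule C4[of f "c 1" t "c 3"]) (simp_all add: hole7D[OF h] F7D[OF f'] T7D[OF t'])

lemma F7_T4: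
  assumes h: "hole7 c" and f': "f \<in> F7 c 0" and t': "t \<in> T7 c 4"
  shows "\<not> nb G f t"
  by (rule not_nbI, rule C5[of f t "c 5" "c 6" "c 0"]) (simp_all add: hole7D[OF h] F7D[OF f'] T7D[OF t'])

lemma F7_T5:
  assumes h: "hole7 c" and f': "f \<in> F7 c 0" and t': "t \<in> T7 c 5"
  shows "\<not> nb G f t"
  by (rule not_nbI, rule C4[of f t "c 4" "c 3"]) (simp_all add: hole7D[OF h] F7D[OF f'] T7D[OF t'])

lemma F7_T6:
  assumes h: "hole7 c" and f': "f \<in> F7 c 0" and t': "t \<in> T7 c 6"
  shows "\<not> nb G f t"
  by (rule not_nbI, rule C5[of f t "c 5" "c 4" "c 3"]) (simp_all add: hole7D[OF h] F7D[OF f'] T7D[OF t'])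

lemma F7_F1:
  assumes h: "hole7 c" and f': "f \<in> F7 c 0" and g': "g \<in> F7 c 1"
  shows "nb G f g"
  by (rule nbI, rule C4[of f "c 1" g "c 3"]) (simp_all add: hole7D[OF h] F7D[OF f'] F7D[OF g'])

lemma F7_F2:
  assumes h: "hole7 c" and f': "f \<in> F7 c 0" and g': "g \<in> F7 c 2"
  shows "\<not> nb G f g"
  by (rule not_nbI, rule C5[of f g "c 5" "c 6" "c 0"]) (simp_all add: hole7D[OF h] F7D[OF f'] F7D[OF g'])

text \<open>The two windows share \<open>c 3\<close> and have adjacent far ends \<open>c 0\<close>
  and \<open>c 6\<close>: adjacent \<open>f\<close> and \<open>g\<close> give a \<open>C4\<close>,
  nonadjacent ones a \<open>C5\<close>. This confines the four-types to three consecutive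
  positions.\<close>

lemma F7_F3:
  assumes h: "hole7 c" and f': "f \<in> F7 c 0" and g': "g \<in> F7 c 3"
  shows "False"
proof -
  note [simp] = hole7D[OF h] F7D[OF f'] F7D[OF g']
  have *: "\<not> nb G f g" by (rule not_nbI, rule C4[of f g "c 6" "c 0"]) simp_all
  note [simp] = * *[THEN not_nb_sym]
  show False by (rule C5[of f "c 0" "c 6" g "c 3"]) simp_all
qed

lemma U7_clique:
  assumes h: "hole7 c" and u': "u \<in> U7 c" and v': "v \<in> U7 c"
  shows "nb G u v"
  by (rule nbI, rule C4[of u "c 0" v "c 2"]) (simp_all add: hole7D[OF h] U7D[OF u'] U7D[OF v'])

lemma U7_T:
  assumes h: "hole7 c" and u': "u \<in> U7 c" and t': "t \<in> T7 c 0"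
  shows "nb G u t"
  by (rule nbI, rule C4[of u "c 1" t "c 6"]) (simp_all add: hole7D[OF h] U7D[OF u'] T7D[OF t'])

lemma U7_F:
  assumes h: "hole7 c" and u': "u \<in> U7 c" and f': "f \<in> F7 c 0"
  shows "nb G u f"
  by (rule nbI, rule C4[of u "c 0" f "c 2"]) (simp_all add: hole7D[OF h] U7D[OF u'] F7D[OF f'])

lemma Z7_T:
  assumes h: "hole7 c" and z': "z \<in> Z7 c" and t': "t \<in> T7 c 0"
  shows "\<not> nb G z t"
  by (rule not_nbI, rule P7[of z t "c 1" "c 2" "c 3" "c 4" "c 5"]) (simp_all add: hole7D[OF h] Z7D[OF z'] T7D[OF t'])

lemma Z7_common:
  assumes h: "hole7 c" and z': "z \<in> Z7 c" and f': "f \<in> F7 c 0" and g': "g \<in> F7 c 2" and 1: "nb G z f" "nb G z g"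
  shows "False"
proof -
  note [simp] = hole7D[OF h] Z7D[OF z'] F7D[OF f'] F7D[OF g'] 1 1[THEN nb_sym]
  have *: "\<not> nb G f g" by (rule not_nbI, rule C5[of f g "c 5" "c 6" "c 0"]) simp_all
  note [simp] = * *[THEN not_nb_sym]
  show False by (rule C4[of z f "c 2" g]) simp_all
qed

text \<open>Being adjacent to \<open>f\<close> passes along edges of \<open>Z7\<close>, since
  otherwise such an edge runs on through \<open>f\<close>, \<open>c 0\<close>, \<open>c 6\<close>,
  \<open>c 5\<close>, \<open>c 4\<close> as a \<open>P7\<close>. Together with
  \<open>Z7_common\<close> this keeps a component of \<open>Z7\<close> from attaching to both
  \<open>f\<close> and \<open>g\<close>.\<close>

lemma Z7_step:
  assumes h: "hole7 c" and x': "x \<in> Z7 c" and y': "y \<in> Z7 c" and f': "f \<in> F7 c 0" and g': "g \<in> F7 c 2" and 1: "nb G x y"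
    "nb G x f" and 2: "\<not> nb G y f" "\<not> nb G x g"
  shows "False"
proof -
  note [simp] = hole7D[OF h] Z7D[OF x'] Z7D[OF y'] F7D[OF f'] F7D[OF g'] 1 1[THEN nb_sym] 2 2[THEN not_nb_sym]
  show False by (rule P7[of y x f "c 0" "c 6" "c 5" "c 4"]) simp_all
qed

text \<open>This decides where a four-type vertex can go: it is complete to \<open>T7 c 0\<close>,
  and then fits into the class of \<open>c 1\<close>, or complete to \<open>T7 c 3\<close>, and then
  fits into the class of \<open>c 2\<close>.\<close>

lemma F7_T_split:
  assumes h: "hole7 c" and f': "f \<in> F7 c 0" and t': "t \<in> T7 c 0" and s': "s \<in> T7 c 3" and 1: "\<not> nb G f t" "\<not> nb G f s"
  shows "False"
proof -
  note [simp] = hole7D[OF h] F7D[OF f'] T7D[OF t'] T7D[OF s'] 1 1[THEN not_nb_sym]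
  have *: "\<not> nb G t s" by (rule not_nbI, rule C4[of t s "c 2" "c 1"]) simp_all
  note [simp] = * *[THEN not_nb_sym]
  show False by (rule P7[of f "c 1" t "c 6" "c 5" "c 4" s]) simp_all
qed

section \<open>Two forced positions that clash: the configuration of the thickened emerald\<close>

lemma F7_cross:
  assumes h: "hole7 c" and f': "f \<in> F7 c 0" and g': "g \<in> F7 c 2" and t': "t \<in> T7 c 0" and s': "s \<in> T7 c 5" and 1:
    "\<not> nb G f t" "\<not> nb G g s"
  shows "nb G t s"
proof (rule ccontr)
  assume n: "\<not> nb G t s"
  note [simp] = hole7D[OF h] F7D[OF f'] F7D[OF g'] T7D[OF t'] T7D[OF s'] 1 1[THEN not_nb_sym] n n[THEN not_nb_sym]
  have *: "\<not> nb G f g" by (rule not_nbI, rule C5[of f g "c 5" "c 6" "c 0"]) simp_all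
  note [simp] = * *[THEN not_nb_sym]
  have *: "\<not> nb G f s" by (rule not_nbI, rule C4[of f s "c 4" "c 3"]) simp_all
  note [simp] = * *[THEN not_nb_sym]
  have *: "\<not> nb G g t" by (rule not_nbI, rule C4[of g t "c 1" "c 2"]) simp_all
  note [simp] = * *[THEN not_nb_sym]
  show False by (rule P7[of f "c 1" t "c 6" s "c 4" g]) simp_all
qed

text \<open>Such an \<open>h\<close> would be adjacent to \<open>f\<close> and \<open>g\<close> and,
  by \<open>C4\<close>, nonadjacent to \<open>t\<close> and \<open>s\<close>. Then \<open>t\<close>
  and \<open>s\<close> are nonadjacent because of the \<open>C5\<close> through \<open>h\<close>,
  \<open>c 1\<close>, \<open>t\<close>, \<open>s\<close>, \<open>c 4\<close>, against
  \<open>F7_cross\<close>.\<close>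

lemma F7_no_middle:
  assumes h: "hole7 c" and f': "f \<in> F7 c 0" and g': "g \<in> F7 c 2" and h': "h \<in> F7 c 1" and t': "t \<in> T7 c 0" and s':
    "s \<in> T7 c 5" and 1: "\<not> nb G f t" "\<not> nb G g s"
  shows "False"
proof -
  note [simp] = hole7D[OF h] F7D[OF f'] F7D[OF g'] F7D[OF h'] T7D[OF t'] T7D[OF s'] 1 1[THEN not_nb_sym]
  have *: "\<not> nb G f g" by (rule not_nbI, rule C5[of f g "c 5" "c 6" "c 0"]) simp_all
  note [simp] = * *[THEN not_nb_sym]
  have *: "nb G f h" by (rule nbI, rule C4[of f "c 1" h "c 3"]) simp_all
  note [simp] = * *[THEN nb_sym]
  have *: "\<not> nb G f s" by (rule not_nbI, rule C4[of f s "c 4" "c 3"]) simp_all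
  note [simp] = * *[THEN not_nb_sym]
  have *: "nb G g h" by (rule nbI, rule C4[of g "c 2" h "c 4"]) simp_all
  note [simp] = * *[THEN nb_sym]
  have *: "\<not> nb G g t" by (rule not_nbI, rule C4[of g t "c 1" "c 2"]) simp_all
  note [simp] = * *[THEN not_nb_sym]
  have *: "\<not> nb G h t" by (rule not_nbI, rule C4[of f h t "c 0"]) simp_all
  note [simp] = * *[THEN not_nb_sym]
  have *: "\<not> nb G h s" by (rule not_nbI, rule C4[of g h s "c 5"]) simp_all
  note [simp] = * *[THEN not_nb_sym]
  have *: "\<not> nb G t s" by (rule not_nbI, rule C5[of h "c 1" t s "c 4"]) simp_all
  note [simp] = * *[THEN not_nb_sym]
  show False by (rule P7[of f "c 1" t "c 6" s "c 4" g]) simp_all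
qed

text \<open>A vertex of \<open>T7 c 0\<close> is thus seen by all of \<open>F7 c 0\<close> or by
  none, so the split of \<open>T7 c 0\<close> does not depend on which four-type vertex defines it.
  \<open>E7_uniform_5\<close> does the same for \<open>F7 c 2\<close> and
  \<open>T7 c 5\<close>.\<close>

lemma E7_uniform_0:
  assumes h: "hole7 c" and f': "f \<in> F7 c 0" and e': "e \<in> F7 c 0" and g': "g \<in> F7 c 2" and r': "r \<in> T7 c 0" and s':
    "s \<in> T7 c 5" and 1: "nb G f r" and 2: "\<not> nb G e r" "\<not> nb G g s"
  shows "False"
proof -
  note [simp] = hole7D[OF h] F7D[OF f'] F7D[OF e'] F7D[OF g'] T7D[OF r'] T7D[OF s'] 1 1[THEN nb_sym] 2 2[THEN not_nb_sym]
  have *: "nb G f e" by (rule nbI, rule C4[of f "c 0" e "c 2"]) simp_all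
  note [simp] = * *[THEN nb_sym]
  have *: "\<not> nb G f g" by (rule not_nbI, rule C5[of f g "c 5" "c 6" "c 0"]) simp_all
  note [simp] = * *[THEN not_nb_sym]
  have *: "\<not> nb G f s" by (rule not_nbI, rule C4[of f s "c 4" "c 3"]) simp_all
  note [simp] = * *[THEN not_nb_sym]
  have *: "\<not> nb G e g" by (rule not_nbI, rule C5[of e g "c 5" "c 6" "c 0"]) simp_all
  note [simp] = * *[THEN not_nb_sym]
  have *: "\<not> nb G e s" by (rule not_nbI, rule C4[of e s "c 4" "c 3"]) simp_all
  note [simp] = * *[THEN not_nb_sym]
  have *: "\<not> nb G g r" by (rule not_nbI, rule C4[of f r g "c 2"]) simp_all
  note [simp] = * *[THEN not_nb_sym]
  have *: "\<not> nb G r s" by (rule not_nbI, rule C5[of f r s "c 4" "c 3"]) simp_all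
  note [simp] = * *[THEN not_nb_sym]
  show False by (rule P7[of e f r "c 6" s "c 4" g]) simp_all
qed

lemma E7_uniform_5:
  assumes h: "hole7 c" and f': "f \<in> F7 c 0" and e': "e \<in> F7 c 2" and g': "g \<in> F7 c 2" and t': "t \<in> T7 c 0" and r':
    "r \<in> T7 c 5" and 1: "nb G g r" and 2: "\<not> nb G e r" "\<not> nb G f t"
  shows "False"
proof -
  note [simp] = hole7D[OF h] F7D[OF f'] F7D[OF e'] F7D[OF g'] T7D[OF t'] T7D[OF r'] 1 1[THEN nb_sym] 2 2[THEN not_nb_sym]
  have *: "\<not> nb G f e" by (rule not_nbI, rule C5[of f e "c 5" "c 6" "c 0"]) simp_all
  note [simp] = * *[THEN not_nb_sym]
  have *: "\<not> nb G f g" by (rule not_nbI, rule C5[of f g "c 5" "c 6" "c 0"]) simp_all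
  note [simp] = * *[THEN not_nb_sym]
  have *: "\<not> nb G f r" by (rule not_nbI, rule C4[of f r g "c 2"]) simp_all
  note [simp] = * *[THEN not_nb_sym]
  have *: "nb G e g" by (rule nbI, rule C4[of e "c 2" g "c 4"]) simp_all
  note [simp] = * *[THEN nb_sym]
  have *: "\<not> nb G e t" by (rule not_nbI, rule C4[of e t "c 1" "c 2"]) simp_all
  note [simp] = * *[THEN not_nb_sym]
  have *: "\<not> nb G g t" by (rule not_nbI, rule C4[of g t "c 1" "c 2"]) simp_all
  note [simp] = * *[THEN not_nb_sym]
  have *: "\<not> nb G t r" by (rule not_nbI, rule C5[of g r t "c 1" "c 2"]) simp_all
  note [simp] = * *[THEN not_nb_sym]
  show False by (rule P7[of f "c 1" t "c 6" r g e]) simp_all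
qed

text \<open>From here to \<open>E7_T6_T1\<close>, edges between three-types at distance two are
  removed: an emerald allows such edges only inside its prescribed complete pairs. The indices in
  the names are those of the two types.\<close>

lemma E7_T0_T5:
  assumes h: "hole7 c" and f': "f \<in> F7 c 0" and g': "g \<in> F7 c 2" and t': "t \<in> T7 c 0" and r': "r \<in> T7 c 5" and 1:
    "\<not> nb G f t" and 2: "nb G g r"
  shows "\<not> nb G t r"
proof
  assume n: "nb G t r"
  note [simp] = hole7D[OF h] F7D[OF f'] F7D[OF g'] T7D[OF t'] T7D[OF r'] 1 1[THEN not_nb_sym] 2 2[THEN nb_sym] n n[THEN nb_sym]
  have *: "\<not> nb G g t" by (rule not_nbI, rule C4[of g t "c 1" "c 2"]) simp_all
  note [simp] = * *[THEN not_nb_sym]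
  show False by (rule C5[of g r t "c 1" "c 2"]) simp_all
qed

lemma E7_T0_T5_a:
  assumes h: "hole7 c" and f': "f \<in> F7 c 0" and g': "g \<in> F7 c 2" and t': "t \<in> T7 c 0" and s': "s \<in> T7 c 5" and r':
    "r \<in> T7 c 0" and 1: "\<not> nb G f t" "\<not> nb G g s" and 2: "nb G f r"
  shows "\<not> nb G r s"
proof
  assume n: "nb G r s"
  note [simp] = hole7D[OF h] F7D[OF f'] F7D[OF g'] T7D[OF t'] T7D[OF s'] T7D[OF r'] 1 1[THEN not_nb_sym] 2 2[THEN nb_sym] n n[THEN nb_sym]
  have *: "\<not> nb G f s" by (rule not_nbI, rule C4[of f s "c 4" "c 3"]) simp_all
  note [simp] = * *[THEN not_nb_sym]
  show False by (rule C5[of f r s "c 4" "c 3"]) simp_all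
qed

lemma E7_T0_T5_b:
  assumes h: "hole7 c" and f': "f \<in> F7 c 0" and g': "g \<in> F7 c 2" and t': "t \<in> T7 c 0" and s': "s \<in> T7 c 5" and r':
    "r \<in> T7 c 0" and q': "q \<in> T7 c 5" and 1: "\<not> nb G f t" "\<not> nb G g s" and 2: "nb G f r" "nb G g q"
  shows "\<not> nb G r q"
proof
  assume n: "nb G r q"
  note [simp] = hole7D[OF h] F7D[OF f'] F7D[OF g'] T7D[OF t'] T7D[OF s'] T7D[OF r'] T7D[OF q'] 1 1[THEN not_nb_sym] 2 2[THEN nb_sym] n n[THEN nb_sym]
  have *: "\<not> nb G f g" by (rule not_nbI, rule C5[of f g "c 5" "c 6" "c 0"]) simp_all
  note [simp] = * *[THEN not_nb_sym]
  have *: "\<not> nb G f q" by (rule not_nbI, rule C4[of f q g "c 2"]) simp_all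
  note [simp] = * *[THEN not_nb_sym]
  show False by (rule C5[of f r q "c 4" "c 3"]) simp_all
qed

lemma E7_T0_T2:
  assumes h: "hole7 c" and f': "f \<in> F7 c 0" and g': "g \<in> F7 c 2" and t': "t \<in> T7 c 0" and s': "s \<in> T7 c 5" and r':
    "r \<in> T7 c 0" and q': "q \<in> T7 c 2" and 1: "\<not> nb G f t" "\<not> nb G g s"
  shows "\<not> nb G r q"
proof
  assume n: "nb G r q"
  note [simp] = hole7D[OF h] F7D[OF f'] F7D[OF g'] T7D[OF t'] T7D[OF s'] T7D[OF r'] T7D[OF q'] 1 1[THEN not_nb_sym] n n[THEN nb_sym]
  have *: "\<not> nb G f g" by (rule not_nbI, rule C5[of f g "c 5" "c 6" "c 0"]) simp_all
  note [simp] = * *[THEN not_nb_sym]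
  have *: "\<not> nb G f s" by (rule not_nbI, rule C4[of f s "c 4" "c 3"]) simp_all
  note [simp] = * *[THEN not_nb_sym]
  have *: "nb G f q" by (rule nbI, rule C4[of f "c 1" q "c 3"]) simp_all
  note [simp] = * *[THEN nb_sym]
  have *: "nb G f r" by (rule nbI, rule C4[of f q r "c 0"]) simp_all
  note [simp] = * *[THEN nb_sym]
  have *: "\<not> nb G g t" by (rule not_nbI, rule C4[of g t "c 1" "c 2"]) simp_all
  note [simp] = * *[THEN not_nb_sym]
  have *: "\<not> nb G g r" by (rule not_nbI, rule C4[of f r g "c 2"]) simp_all
  note [simp] = * *[THEN not_nb_sym]
  have *: "\<not> nb G g q" by (rule not_nbI, rule C5[of g q r "c 6" "c 5"]) simp_all
  note [simp] = * *[THEN not_nb_sym]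
  have *: "nb G t s" by (rule nbI, rule P7[of f "c 1" t "c 6" s "c 4" g]) simp_all
  note [simp] = * *[THEN nb_sym]
  have *: "nb G t r" by (rule nbI, rule C4[of t "c 1" r "c 6"]) simp_all
  note [simp] = * *[THEN nb_sym]
  have *: "\<not> nb G t q" by (rule not_nbI, rule C4[of f q t "c 0"]) simp_all
  note [simp] = * *[THEN not_nb_sym]
  have *: "\<not> nb G s r" by (rule not_nbI, rule C5[of f r s "c 4" "c 3"]) simp_all
  note [simp] = * *[THEN not_nb_sym]
  have *: "\<not> nb G s q" by (rule not_nbI, rule C4[of t s q r]) simp_all
  note [simp] = * *[THEN not_nb_sym]
  show False by (rule P7[of g "c 3" q "c 1" "c 0" "c 6" s]) simp_all
qed

lemma E7_T1_T3:
  assumes h: "hole7 c" and f': "f \<in> F7 c 0" and g': "g \<in> F7 c 2" and t': "t \<in> T7 c 0" and s': "s \<in> T7 c 5" and r':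
    "r \<in> T7 c 1" and q': "q \<in> T7 c 3" and 1: "\<not> nb G f t" "\<not> nb G g s"
  shows "\<not> nb G r q"
proof
  assume n: "nb G r q"
  note [simp] = hole7D[OF h] F7D[OF f'] F7D[OF g'] T7D[OF t'] T7D[OF s'] T7D[OF r'] T7D[OF q'] 1 1[THEN not_nb_sym] n n[THEN nb_sym]
  have *: "\<not> nb G f g" by (rule not_nbI, rule C5[of f g "c 5" "c 6" "c 0"]) simp_all
  note [simp] = * *[THEN not_nb_sym]
  have *: "\<not> nb G f s" by (rule not_nbI, rule C4[of f s "c 4" "c 3"]) simp_all
  note [simp] = * *[THEN not_nb_sym]
  have *: "nb G f r" by (rule nbI, rule C4[of f "c 0" r "c 2"]) simp_all
  note [simp] = * *[THEN nb_sym]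
  have *: "nb G f q" by (rule nbI, rule C4[of f r q "c 3"]) simp_all
  note [simp] = * *[THEN nb_sym]
  have *: "\<not> nb G g t" by (rule not_nbI, rule C4[of g t "c 1" "c 2"]) simp_all
  note [simp] = * *[THEN not_nb_sym]
  have *: "nb G g q" by (rule nbI, rule C4[of g "c 2" q "c 4"]) simp_all
  note [simp] = * *[THEN nb_sym]
  have *: "nb G t s" by (rule nbI, rule P7[of f "c 1" t "c 6" s "c 4" g]) simp_all
  note [simp] = * *[THEN nb_sym]
  have *: "nb G t r" by (rule nbI, rule P7[of t "c 0" r "c 2" "c 3" "c 4" "c 5"]) simp_all
  note [simp] = * *[THEN nb_sym]
  have *: "\<not> nb G t q" by (rule not_nbI, rule C4[of f q t "c 0"]) simp_all
  note [simp] = * *[THEN not_nb_sym]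
  have *: "\<not> nb G s r" by (rule not_nbI, rule C4[of s r "c 0" "c 6"]) simp_all
  note [simp] = * *[THEN not_nb_sym]
  have *: "\<not> nb G s q" by (rule not_nbI, rule C4[of g q s "c 5"]) simp_all
  note [simp] = * *[THEN not_nb_sym]
  show False by (rule C5[of t s "c 4" q r]) simp_all
qed

lemma E7_T2_T4:
  assumes h: "hole7 c" and f': "f \<in> F7 c 0" and g': "g \<in> F7 c 2" and t': "t \<in> T7 c 0" and s': "s \<in> T7 c 5" and r':
    "r \<in> T7 c 2" and q': "q \<in> T7 c 4" and 1: "\<not> nb G f t" "\<not> nb G g s"
  shows "\<not> nb G r q"
proof
  assume n: "nb G r q"
  note [simp] = hole7D[OF h] F7D[OF f'] F7D[OF g'] T7D[OF t'] T7D[OF s'] T7D[OF r'] T7D[OF q'] 1 1[THEN not_nb_sym] n n[THEN nb_sym]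
  have *: "\<not> nb G f g" by (rule not_nbI, rule C5[of f g "c 5" "c 6" "c 0"]) simp_all
  note [simp] = * *[THEN not_nb_sym]
  have *: "\<not> nb G f s" by (rule not_nbI, rule C4[of f s "c 4" "c 3"]) simp_all
  note [simp] = * *[THEN not_nb_sym]
  have *: "nb G f r" by (rule nbI, rule C4[of f "c 1" r "c 3"]) simp_all
  note [simp] = * *[THEN nb_sym]
  have *: "\<not> nb G f q" by (rule not_nbI, rule C5[of f q "c 5" "c 6" "c 0"]) simp_all
  note [simp] = * *[THEN not_nb_sym]
  have *: "\<not> nb G g t" by (rule not_nbI, rule C4[of g t "c 1" "c 2"]) simp_all
  note [simp] = * *[THEN not_nb_sym]
  have *: "nb G g q" by (rule nbI, rule C4[of g "c 3" q "c 5"]) simp_all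
  note [simp] = * *[THEN nb_sym]
  have *: "nb G g r" by (rule nbI, rule C4[of g q r "c 2"]) simp_all
  note [simp] = * *[THEN nb_sym]
  have *: "nb G t s" by (rule nbI, rule P7[of f "c 1" t "c 6" s "c 4" g]) simp_all
  note [simp] = * *[THEN nb_sym]
  have *: "\<not> nb G t r" by (rule not_nbI, rule C4[of f r t "c 0"]) simp_all
  note [simp] = * *[THEN not_nb_sym]
  have *: "\<not> nb G t q" by (rule not_nbI, rule C4[of t q r "c 1"]) simp_all
  note [simp] = * *[THEN not_nb_sym]
  have *: "\<not> nb G s r" by (rule not_nbI, rule C4[of g r s "c 4"]) simp_all
  note [simp] = * *[THEN not_nb_sym]
  have *: "\<not> nb G s q" by (rule not_nbI, rule C5[of t s q r "c 1"]) simp_all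
  note [simp] = * *[THEN not_nb_sym]
  show False by (rule P7[of s t "c 0" f "c 2" g q]) simp_all
qed

lemma E7_T3_T5:
  assumes h: "hole7 c" and f': "f \<in> F7 c 0" and g': "g \<in> F7 c 2" and t': "t \<in> T7 c 0" and s': "s \<in> T7 c 5" and r':
    "r \<in> T7 c 3" and q': "q \<in> T7 c 5" and 1: "\<not> nb G f t" "\<not> nb G g s"
  shows "\<not> nb G r q"
proof
  assume n: "nb G r q"
  note [simp] = hole7D[OF h] F7D[OF f'] F7D[OF g'] T7D[OF t'] T7D[OF s'] T7D[OF r'] T7D[OF q'] 1 1[THEN not_nb_sym] n n[THEN nb_sym]
  have *: "\<not> nb G f g" by (rule not_nbI, rule C5[of f g "c 5" "c 6" "c 0"]) simp_all
  note [simp] = * *[THEN not_nb_sym]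
  have *: "\<not> nb G f q" by (rule not_nbI, rule C4[of f q "c 4" "c 3"]) simp_all
  note [simp] = * *[THEN not_nb_sym]
  have *: "\<not> nb G f r" by (rule not_nbI, rule C5[of f r q "c 6" "c 0"]) simp_all
  note [simp] = * *[THEN not_nb_sym]
  have *: "\<not> nb G g t" by (rule not_nbI, rule C4[of g t "c 1" "c 2"]) simp_all
  note [simp] = * *[THEN not_nb_sym]
  have *: "nb G g r" by (rule nbI, rule C4[of g "c 2" r "c 4"]) simp_all
  note [simp] = * *[THEN nb_sym]
  have *: "\<not> nb G t r" by (rule not_nbI, rule C4[of t r "c 2" "c 1"]) simp_all
  note [simp] = * *[THEN not_nb_sym]
  show False by (rule P7[of f "c 1" t "c 6" "c 5" g r]) simp_all
qed

lemma E7_T4_T6: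
  assumes h: "hole7 c" and f': "f \<in> F7 c 0" and g': "g \<in> F7 c 2" and t': "t \<in> T7 c 0" and s': "s \<in> T7 c 5" and r':
    "r \<in> T7 c 4" and q': "q \<in> T7 c 6" and 1: "\<not> nb G f t" "\<not> nb G g s"
  shows "\<not> nb G r q"
proof
  assume n: "nb G r q"
  note [simp] = hole7D[OF h] F7D[OF f'] F7D[OF g'] T7D[OF t'] T7D[OF s'] T7D[OF r'] T7D[OF q'] 1 1[THEN not_nb_sym] n n[THEN nb_sym]
  have *: "\<not> nb G f r" by (rule not_nbI, rule C5[of f r "c 5" "c 6" "c 0"]) simp_all
  note [simp] = * *[THEN not_nb_sym]
  have *: "\<not> nb G f q" by (rule not_nbI, rule C4[of f q r "c 3"]) simp_all
  note [simp] = * *[THEN not_nb_sym]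
  show False by (rule C5[of f "c 0" q r "c 3"]) simp_all
qed

lemma E7_T6_T1:
  assumes h: "hole7 c" and f': "f \<in> F7 c 0" and g': "g \<in> F7 c 2" and t': "t \<in> T7 c 0" and s': "s \<in> T7 c 5" and r':
    "r \<in> T7 c 6" and q': "q \<in> T7 c 1" and 1: "\<not> nb G f t" "\<not> nb G g s"
  shows "\<not> nb G r q"
proof
  assume n: "nb G r q"
  note [simp] = hole7D[OF h] F7D[OF f'] F7D[OF g'] T7D[OF t'] T7D[OF s'] T7D[OF r'] T7D[OF q'] 1 1[THEN not_nb_sym] n n[THEN nb_sym]
  have *: "\<not> nb G f g" by (rule not_nbI, rule C5[of f g "c 5" "c 6" "c 0"]) simp_all
  note [simp] = * *[THEN not_nb_sym]
  have *: "\<not> nb G f r" by (rule not_nbI, rule C5[of f r "c 5" "c 4" "c 3"]) simp_all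
  note [simp] = * *[THEN not_nb_sym]
  have *: "nb G f q" by (rule nbI, rule C4[of f "c 0" q "c 2"]) simp_all
  note [simp] = * *[THEN nb_sym]
  have *: "\<not> nb G g r" by (rule not_nbI, rule C5[of f "c 0" r g "c 2"]) simp_all
  note [simp] = * *[THEN not_nb_sym]
  have *: "\<not> nb G g q" by (rule not_nbI, rule C4[of f q g "c 3"]) simp_all
  note [simp] = * *[THEN not_nb_sym]
  show False by (rule C5[of g "c 2" q r "c 5"]) simp_all
qed

end

text \<open>On a chain of finite sets cardinality decides inclusion, so sorting by decreasing
  cardinality is enough. The sign in \<open>key\<close> turns the ascending \<open>sort_key\<close>
  into that order.\<close>

lemma chain_ordering:
  assumes "finite X" and "\<And>x. x \<in> X \<Longrightarrow> finite (f x)"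
    and chain: "\<And>x y. x \<in> X \<Longrightarrow> y \<in> X \<Longrightarrow> f x \<subseteq> f y \<or> f y \<subseteq> f x"
  obtains xs where "ordering_of X xs" "nested f xs"
proof -
  obtain ys where ys: "set ys = X" "distinct ys"
    using finite_distinct_list[OF assms(1)] by blast
  define key where "key x = - int (card (f x))" for x
  define xs where "xs = sort_key key ys"
  have X: "set xs = X" "distinct xs" by (simp_all add: xs_def ys)
  have "sorted (map key xs)" by (simp add: xs_def)
  then have "sorted_wrt (\<lambda>x y. key x \<le> key y) xs" by (simp add: sorted_wrt_map)
  moreover have "f y \<subseteq> f x" if "x \<in> set xs" "y \<in> set xs" "key x \<le> key y" for x y
  proof (rule ccontr)
    assume "\<not> f y \<subseteq> f x"
    then have "f x \<subset> f y" using chain that X by blast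
    then have "card (f x) < card (f y)" using that X assms(2) by (intro psubset_card_mono) auto
    then show False using that by (simp add: key_def)
  qed
  ultimately have "nested f xs" unfolding nested_def by (rule sorted_wrt_mono_rel[rotated])
  then show thesis using that X by (auto simp: ordering_of_def)
qed

lemma closed_nbhd_nb: "closed_nbhd G v = {u. nb G v u}"
  by (auto simp: closed_nbhd_def nb_def)

lemma finite_nbhd: "simple_graph G \<Longrightarrow> finite {u. nb G v u}"
proof -
  assume s: "simple_graph G"
  have "{u. nb G v u} \<subseteq> insert v (verts G)" using nb_verts[OF s] by blast
  then show ?thesis using s by (meson finite_insert finite_subset simple_graph_def)
qed

lemma complete_toI:
  "X \<inter> Y = {} \<Longrightarrow> (\<And>x y. x \<in> X \<Longrightarrow> y \<in> Y \<Longrightarrow> nb G x y) \<Longrightarrow> complete_to G X Y"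
  unfolding complete_to_def nb_def by blast

lemma anticomplete_toI: "(\<And>x y. x \<in> X \<Longrightarrow> y \<in> Y \<Longrightarrow> \<not> nb G x y) \<Longrightarrow> anticomplete_to G X Y"
  unfolding anticomplete_to_def nb_def by blast

context free_graph
begin

lemma U7_rotate: "U7 (\<lambda>j. c (k + j)) = U7 c"
  unfolding U7_def by (metis (no_types, opaque_lifting) add_diff_cancel_left' diff_add_cancel add.commute)

lemma Z7_rotate: "Z7 (\<lambda>j. c (k + j)) = Z7 c"
  unfolding Z7_def by (metis (no_types, opaque_lifting) add_diff_cancel_left' diff_add_cancel add.commute)

text \<open>Applying an index-0 lemma to the hole rotated by \<open>i\<close> and unfolding the
  rotated types yields the version at index \<open>i\<close>. These versions carry a prime.\<close>

lemmas rotate_7 = T7_rotate F7_rotate U7_rotate Z7_rotate add_0_right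

lemmas T7_clique' = T7_clique[OF hole7_rotate, unfolded rotate_7]
lemmas T7_T1' = T7_T1[OF hole7_rotate, unfolded rotate_7]
lemmas T7_T3' = T7_T3[OF hole7_rotate, unfolded rotate_7]
lemmas F7_clique' = F7_clique[OF hole7_rotate, unfolded rotate_7]
lemmas F7_T1' = F7_T1[OF hole7_rotate, unfolded rotate_7]
lemmas F7_T2' = F7_T2[OF hole7_rotate, unfolded rotate_7]
lemmas F7_T4' = F7_T4[OF hole7_rotate, unfolded rotate_7]
lemmas F7_T5' = F7_T5[OF hole7_rotate, unfolded rotate_7]
lemmas F7_T6' = F7_T6[OF hole7_rotate, unfolded rotate_7]
lemmas F7_F1' = F7_F1[OF hole7_rotate, unfolded rotate_7]
lemmas F7_F2' = F7_F2[OF hole7_rotate, unfolded rotate_7]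
lemmas F7_F3' = F7_F3[OF hole7_rotate, unfolded rotate_7]
lemmas U7_T' = U7_T[OF hole7_rotate, unfolded rotate_7]
lemmas U7_F' = U7_F[OF hole7_rotate, unfolded rotate_7]
lemmas Z7_T' = Z7_T[OF hole7_rotate, unfolded rotate_7]
lemmas Z7_common' = Z7_common[OF hole7_rotate, unfolded rotate_7]
lemmas Z7_step' = Z7_step[OF hole7_rotate, unfolded rotate_7]
lemmas F7_T_split' = F7_T_split[OF hole7_rotate, unfolded rotate_7]

text \<open>Both types prescribe translates of one pattern of neighbours. Only the offset
  \<open>d\<close> matters, and that no nonzero translation fixes the pattern is a finite
  check.\<close>

lemma T7_T7_disjoint: "i \<noteq> j \<Longrightarrow> T7 c i \<inter> T7 c j = {}"
proof (rule ccontr)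
  assume ij: "i \<noteq> j" "T7 c i \<inter> T7 c j \<noteq> {}"
  then obtain v where v: "v \<in> T7 c i" "v \<in> T7 c j" by blast
  define d where "d = j - i"
  have "\<forall>k. (k - i = 0 \<or> k - i = 1 \<or> k - i = 6) \<longleftrightarrow> (k - j = 0 \<or> k - j = 1 \<or> k - j = 6)"
    using T7D(1)[OF v(1)] T7D(1)[OF v(2)] by blast
  then have *: "(k - i = 0 \<or> k - i = 1 \<or> k - i = 6) \<longleftrightarrow> ((k - i) - d = 0 \<or> (k - i) - d = 1 \<or> (k - i) - d = 6)" for k
    by (simp add: d_def algebra_simps)
  have "\<forall>m. (m = 0 \<or> m = 1 \<or> m = 6) \<longleftrightarrow> (m - d = 0 \<or> m - d = 1 \<or> m - d = 6)"
    using *[of "m + i" for m] by simp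
  moreover have "\<forall>d. (\<forall>m. (m = 0 \<or> m = 1 \<or> m = 6) \<longleftrightarrow> (m - d = 0 \<or> m - d = 1 \<or> m - d = (6::7))) \<longrightarrow> d = 0"
    unfolding all_7 by simp
  ultimately have "d = 0" by blast
  then show False using ij by (simp add: d_def)
qed

lemma F7_F7_disjoint: "i \<noteq> j \<Longrightarrow> F7 c i \<inter> F7 c j = {}"
proof (rule ccontr)
  assume ij: "i \<noteq> j" "F7 c i \<inter> F7 c j \<noteq> {}"
  then obtain v where v: "v \<in> F7 c i" "v \<in> F7 c j" by blast
  define d where "d = j - i"
  have "\<forall>k. (k - i = 0 \<or> k - i = 1 \<or> k - i = 2 \<or> k - i = 3) \<longleftrightarrow> (k - j = 0 \<or> k - j = 1 \<or> k - j = 2 \<or> k - j = 3)"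
    using F7D(1)[OF v(1)] F7D(1)[OF v(2)] by blast
  then have *: "(k - i = 0 \<or> k - i = 1 \<or> k - i = 2 \<or> k - i = 3) \<longleftrightarrow> ((k - i) - d = 0 \<or> (k - i) - d = 1 \<or> (k - i) - d = 2 \<or> (k - i) - d = 3)" for k
    by (simp add: d_def algebra_simps)
  have "\<forall>m. (m = 0 \<or> m = 1 \<or> m = 2 \<or> m = 3) \<longleftrightarrow> (m - d = 0 \<or> m - d = 1 \<or> m - d = 2 \<or> m - d = 3)"
    using *[of "m + i" for m] by simp
  moreover have "\<forall>d. (\<forall>m. (m = 0 \<or> m = 1 \<or> m = 2 \<or> m = 3) \<longleftrightarrow> (m - d = 0 \<or> m - d = 1 \<or> m - d = 2 \<or> m - d = (3::7))) \<longrightarrow> d = 0"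
    unfolding all_7 by simp
  ultimately have "d = 0" by blast
  then show False using ij by (simp add: d_def)
qed

lemma T7_F7_disjoint: "T7 c i \<inter> F7 c j = {}"
proof (rule ccontr)
  assume ij: "T7 c i \<inter> F7 c j \<noteq> {}"
  then obtain v where v: "v \<in> T7 c i" "v \<in> F7 c j" by blast
  define d where "d = j - i"
  have "\<forall>k. (k - i = 0 \<or> k - i = 1 \<or> k - i = 6) \<longleftrightarrow> (k - j = 0 \<or> k - j = 1 \<or> k - j = 2 \<or> k - j = 3)"
    using T7D(1)[OF v(1)] F7D(1)[OF v(2)] by blast
  then have *: "(k - i = 0 \<or> k - i = 1 \<or> k - i = 6) \<longleftrightarrow> ((k - i) - d = 0 \<or> (k - i) - d = 1 \<or> (k - i) - d = 2 \<or> (k - i) - d = 3)" for k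
    by (simp add: d_def algebra_simps)
  have "\<forall>m. (m = 0 \<or> m = 1 \<or> m = 6) \<longleftrightarrow> (m - d = 0 \<or> m - d = 1 \<or> m - d = 2 \<or> m - d = 3)"
    using *[of "m + i" for m] by simp
  moreover have "\<forall>d. \<not> (\<forall>m. (m = 0 \<or> m = 1 \<or> m = 6) \<longleftrightarrow> (m - d = 0 \<or> m - d = 1 \<or> m - d = 2 \<or> m - d = (3::7)))"
    unfolding all_7 by simp
  ultimately show False by blast
qed

text \<open>By \<open>F7_F3\<close> no two occupied positions differ by 3 or 4, so they are pairwise
  at cyclic distance at most two and fit into three consecutive residues.\<close>

lemma F7_positions:
  assumes "hole7 c"
  obtains k where "\<And>j. F7 c (k + j) \<noteq> {} \<Longrightarrow> j = 0 \<or> j = 1 \<or> j = 2"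
proof -
  define p where "p j \<longleftrightarrow> F7 c j \<noteq> {}" for j
  have "\<forall>j. p j \<longrightarrow> \<not> p (j + 3)" using F7_F3'[OF assms] unfolding p_def by blast
  then have "\<exists>k. \<not> p (k + 3) \<and> \<not> p (k + 4) \<and> \<not> p (k + 5) \<and> \<not> p (k + 6)"
  proof -
    have ex: "(\<exists>i::7. Q i) \<longleftrightarrow> Q 0 \<or> Q 1 \<or> Q 2 \<or> Q 3 \<or> Q 4 \<or> Q 5 \<or> Q 6" for Q
      using all_7[of "\<lambda>i. \<not> Q i"] by blast
    assume "\<forall>j. p j \<longrightarrow> \<not> p (j + 3)"
    then show ?thesis unfolding ex all_7 by (simp add: mod_7) argo
  qed
  then obtain k where k: "\<not> p (k + 3)" "\<not> p (k + 4)" "\<not> p (k + 5)" "\<not> p (k + 6)" by blast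
  have "\<forall>j. p (k + j) \<longrightarrow> j = 0 \<or> j = 1 \<or> j = 2" unfolding all_7 using k by simp
  then show thesis using that unfolding p_def by blast
qed

text \<open>Adjacency is prescribed only at distances 0, 1 and 3. The rest follows from the absence
  of \<open>C4\<close> and \<open>C5\<close>: a vertex has distance-two neighbours on one side only,
  such edges occur at three consecutive positions at most, and the neighbourhoods are
  nested.\<close>

lemma bracelet7I:
  assumes h: "hole7 c" and cA: "\<And>i. c i \<in> A i" and cov: "(\<Union>i. A i) = verts G"
    and disj: "\<And>i j. i \<noteq> j \<Longrightarrow> A i \<inter> A j = {}"
    and A0: "\<And>i x y. x \<in> A i \<Longrightarrow> y \<in> A i \<Longrightarrow> nb G x y"
    and A1: "\<And>i x y. x \<in> A i \<Longrightarrow> y \<in> A (i + 1) \<Longrightarrow> nb G x y"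
    and A3: "\<And>i x y. x \<in> A i \<Longrightarrow> y \<in> A (i + 3) \<Longrightarrow> \<not> nb G x y"
  shows "bracelet7 G"
proof -
  have A6: "nb G x y" if "x \<in> A i" "y \<in> A (i - 1)" for i x y
    using A1[of y "i - 1" x] that nb_sym by simp
  have A4: "\<not> nb G x y" if "x \<in> A i" "y \<in> A (i - 3)" for i x y
    using A3[of y "i - 3" x] that by (auto dest: nb_sym)
  \<comment> \<open>Neighbours on both sides would close a \<open>C4\<close> or \<open>C5\<close>
    through the hole vertices \<open>c (i + 3)\<close> and \<open>c (i + 4)\<close>.\<close>
  have one_side: False if "x \<in> A i" "y \<in> A (i + 2)" "z \<in> A (i - 2)" "nb G x y" "nb G x z" for i x y z
  proof -
    have yz: "\<not> nb G y z" using A3[of y "i + 2" z] that by (simp add: arith_7)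
    let ?a = "c (i + 3)" and ?b = "c (i + 4)"
    have a: "?a \<in> A (i + 3)" and b: "?b \<in> A (i + 4)" using cA by simp_all
    have ab: "nb G ?a ?b" using hole7D[OF h] by simp
    have ya: "nb G y ?a" using A1[of y "i + 2" ?a] that a by (simp add: arith_7)
    have bz: "nb G ?b z" using A1[of ?b "i + 4" z] that b by (simp add: arith_7)
    have xa: "\<not> nb G x ?a" using A3 that a by blast
    have xb: "\<not> nb G x ?b" using A4[of x i ?b] that b by (simp add: arith_7)
    have "\<not> nb G ?a z"
      by (rule notI, rule C4[of x y ?a z]; insert that yz ya xa; (assumption | rule nb_sym, assumption | rule not_nb_sym, assumption))
    moreover have "\<not> nb G y ?b"
      by (rule notI, rule C4[of x y ?b z]; insert that yz bz xb; (assumption | rule nb_sym, assumption | rule not_nb_sym, assumption))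
    ultimately show False
      by - (rule C5[of x y ?a ?b z]; insert that ab ya bz xa xb yz; (assumption | rule nb_sym, assumption | rule not_nb_sym, assumption))
  qed
  define p where "p i \<longleftrightarrow> (\<exists>x\<in>A i. \<exists>y\<in>A (i + 2). nb G x y)" for i
  have p3: "\<not> p (i + 3)" if pi: "p i" for i
  proof
    assume "p (i + 3)"
    then obtain z w where zw: "z \<in> A (i + 3)" "w \<in> A (i + 5)" "nb G z w"
      unfolding p_def by (auto simp: arith_7)
    obtain x y where xy: "x \<in> A i" "y \<in> A (i + 2)" "nb G x y" using pi unfolding p_def by blast
    let ?a = "c (i + 6)"
    have a: "?a \<in> A (i + 6)" using cA by simp
    have "nb G y z" using A1[of y "i + 2" z] xy zw by (simp add: arith_7)
    moreover have "nb G w ?a" using A1[of w "i + 5" ?a] a zw by (simp add: arith_7)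
    moreover have "nb G ?a x" using A1[of ?a "i + 6" x] a xy by (simp add: arith_7)
    moreover have xz: "\<not> nb G x z" using A3 xy zw by blast
    moreover have yw: "\<not> nb G y w" using A3[of y "i + 2" w] xy zw by (simp add: arith_7)
    moreover have "\<not> nb G z ?a" using A3[of z "i + 3" ?a] a zw by (simp add: arith_7)
    moreover have "\<not> nb G y ?a" using A4[of y "i + 2" ?a] a xy by (simp add: arith_7)
    moreover have "\<not> nb G x w"
      by (rule notI, rule C4[of x y z w]; insert xy zw \<open>nb G y z\<close> xz yw; (assumption | rule nb_sym, assumption | rule not_nb_sym, assumption))
    ultimately show False
      by - (rule C5[of x y z w ?a]; insert xy zw; (assumption | rule nb_sym, assumption | rule not_nb_sym, assumption))
  qed
  \<comment> \<open>No two positions in \<open>p\<close> differ by three, so all lie among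
    \<open>k - 2\<close>, \<open>k - 1\<close>, \<open>k\<close>. This is precisely the freedom that
    the clauses for the distinguished index leave.\<close>
  obtain k where k: "\<not> p (k + 1)" "\<not> p (k + 2)" "\<not> p (k + 3)" "\<not> p (k + 4)"
  proof -
    have ex: "(\<exists>i::7. Q i) \<longleftrightarrow> Q 0 \<or> Q 1 \<or> Q 2 \<or> Q 3 \<or> Q 4 \<or> Q 5 \<or> Q 6" for Q
      using all_7[of "\<lambda>i. \<not> Q i"] by blast
    have "\<forall>i. p i \<longrightarrow> \<not> p (i + 3)" using p3 by blast
    then have "\<exists>k. \<not> p (k + 1) \<and> \<not> p (k + 2) \<and> \<not> p (k + 3) \<and> \<not> p (k + 4)"
      unfolding ex all_7 by (simp add: mod_7) argo
    then show thesis using that by blast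
  qed
  define Ap where "Ap i = {x \<in> A i. \<exists>y\<in>A (i + 2). nb G x y}" for i
  define Am where "Am i = {x \<in> A i. \<exists>y\<in>A (i - 2). nb G x y}" for i
  define As where "As i = A i - Ap i - Am i" for i
  have Ap0: "Ap i = {}" if "\<not> p i" for i using that unfolding Ap_def p_def by blast
  have Am0: "Am i = {}" if "\<not> p (i + 5)" for i
    using that unfolding Am_def p_def by (auto dest: nb_sym simp: arith_7)
  have ApAm: "Ap i \<inter> Am i = {}" for i unfolding Ap_def Am_def using one_side by blast
  have AV: "A i \<subseteq> verts G" for i using cov by blast
  have fin: "finite (A i)" for i using simple AV finite_subset unfolding simple_graph_def by metis
  \<comment> \<open>Only the classes at offsets 2 and 5 can distinguish two vertices of
    \<open>A i\<close>; every other class is complete or anticomplete to \<open>A i\<close>.\<close>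
  have far: "j - i = 2 \<or> j - i = 5 \<or> (\<forall>x\<in>A i. nb G x w) \<or> (\<forall>x\<in>A i. \<not> nb G x w)" if "w \<in> A j" for i j w
  proof -
    have "\<forall>d. w \<in> A (i + d) \<longrightarrow> d = 2 \<or> d = 5 \<or> (\<forall>x\<in>A i. nb G x w) \<or> (\<forall>x\<in>A i. \<not> nb G x w)"
      unfolding all_7 using A0[of _ i w] A1[of _ i w] A3[of _ i w] A4[of _ i w] A6[of _ i w]
      by (auto simp: arith_7)
    from this[rule_format, of "j - i"] show ?thesis using that by simp
  qed
  \<comment> \<open>Two witnesses of incomparability lie in the same class, the one at offset
    \<open>e\<close>. That class is a clique, so the witnesses close a \<open>C4\<close> with
    \<open>x\<close> and \<open>y\<close>.\<close>
  have chain: "closed_nbhd G x \<subseteq> closed_nbhd G y \<or> closed_nbhd G y \<subseteq> closed_nbhd G x"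
    if xy: "x \<in> A i" "y \<in> A i" and d: "\<And>j w. w \<in> A j \<Longrightarrow> nb G x w \<or> nb G y w \<Longrightarrow> j - i = e \<or> (nb G x w \<and> nb G y w)"
    for x y i and e :: 7
  proof (rule ccontr)
    assume "\<not> ?thesis"
    then obtain w w' where w: "nb G x w" "\<not> nb G y w" "nb G y w'" "\<not> nb G x w'"
      unfolding closed_nbhd_nb by blast
    have "x \<in> verts G" "y \<in> verts G" using xy AV by blast+
    then have "w \<in> verts G" "w' \<in> verts G" using w nb_verts[OF simple] by metis+
    then obtain j j' where j: "w \<in> A j" "w' \<in> A j'" using cov by blast
    have "j - i = e" "j' - i = e" using d j w by blast+
    then have "j = j'" by (simp add: diff_eq_eq)
    then have "nb G w w'" using A0 j by blast
    then show False
      by - (rule C4[of x w w' y]; insert w A0[OF xy]; (assumption | rule nb_sym, assumption | rule not_nb_sym, assumption))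
  qed
  have ordAp: "\<exists>xs. ordering_of (Ap i) xs \<and> nested (closed_nbhd G) xs" for i
  proof -
    have "closed_nbhd G x \<subseteq> closed_nbhd G y \<or> closed_nbhd G y \<subseteq> closed_nbhd G x"
      if xy: "x \<in> Ap i" "y \<in> Ap i" for x y
    proof (rule chain[of x i y 2])
      show "x \<in> A i" "y \<in> A i" using xy by (auto simp: Ap_def)
      fix j w assume w: "w \<in> A j" "nb G x w \<or> nb G y w"
      have "j - i \<noteq> 5"
      proof
        assume "j - i = 5"
        then have "j = i - 2" by (simp add: diff_eq_eq arith_7 add.commute)
        then have "x \<in> Am i \<or> y \<in> Am i" using w xy unfolding Am_def Ap_def by blast
        then show False using ApAm xy by blast
      qed
      then show "j - i = 2 \<or> nb G x w \<and> nb G y w"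
        using far[OF w(1), of i] w xy unfolding Ap_def by blast
    qed
    moreover have "finite (Ap i)" using fin by (simp add: Ap_def)
    ultimately show ?thesis using chain_ordering[of "Ap i" "closed_nbhd G"]
      by (metis closed_nbhd_nb finite_nbhd simple)
  qed
  have ordAm: "\<exists>xs. ordering_of (Am i) xs \<and> nested (closed_nbhd G) xs" for i
  proof -
    have "closed_nbhd G x \<subseteq> closed_nbhd G y \<or> closed_nbhd G y \<subseteq> closed_nbhd G x"
      if xy: "x \<in> Am i" "y \<in> Am i" for x y
    proof (rule chain[of x i y 5])
      show "x \<in> A i" "y \<in> A i" using xy by (auto simp: Am_def)
      fix j w assume w: "w \<in> A j" "nb G x w \<or> nb G y w"
      have "j - i \<noteq> 2"
      proof
        assume "j - i = 2"
        then have "j = i + 2" by (simp add: diff_eq_eq add.commute)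
        then have "x \<in> Ap i \<or> y \<in> Ap i" using w xy unfolding Am_def Ap_def by blast
        then show False using ApAm xy by blast
      qed
      then show "j - i = 5 \<or> nb G x w \<and> nb G y w"
        using far[OF w(1), of i] w xy unfolding Am_def by blast
    qed
    moreover have "finite (Am i)" using fin by (simp add: Am_def)
    ultimately show ?thesis using chain_ordering[of "Am i" "closed_nbhd G"]
      by (metis closed_nbhd_nb finite_nbhd simple)
  qed
  have "bracelet7_pair G A k" unfolding bracelet7_pair_def
    apply (rule conjI)
     defer
     apply (rule conjI)
      defer
      apply (rule exI[of _ As], rule exI[of _ Ap], rule exI[of _ Am])
  proof (intro conjI allI)
    show "partition_into (verts G) (map A [0, 1, 2, 3, 4, 5, 6])"
      unfolding partition_into_def cov[symmetric] UNIV_7 by (simp add: disjnt_def disj)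
    show "\<forall>i. A i \<noteq> {} \<and> clique G (A i) \<and> complete_to G (A i) (A (i - 1) \<union> A (i + 1)) \<and>
      anticomplete_to G (A i) (A (i - 3) \<union> A (i + 3))"
    proof (intro conjI allI)
      fix i
      show "A i \<noteq> {}" using cA by blast
      show "clique G (A i)" using AV A0 by (simp add: clique_nb)
      show "complete_to G (A i) (A (i - 1) \<union> A (i + 1))"
        using A1 A6 disj[of i "i - 1"] disj[of i "i + 1"] by (intro complete_toI) auto
      show "anticomplete_to G (A i) (A (i - 3) \<union> A (i + 3))"
        using A3 A4 by (intro anticomplete_toI) auto
    qed
    fix i
    show "partition_into (A i) [As i, Ap i, Am i]"
      using ApAm unfolding partition_into_def by (auto simp: As_def Ap_def Am_def disjnt_def)
    show "anticomplete_to G (As i) (A (i - 2) \<union> A (i + 2))"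
      by (intro anticomplete_toI) (auto simp: As_def Ap_def Am_def)
    show "anticomplete_to G (Ap i) (A (i - 2))"
      using ApAm[of i] by (intro anticomplete_toI) (auto simp: Ap_def Am_def)
    show "anticomplete_to G (Am i) (A (i + 2))"
      using ApAm[of i] by (intro anticomplete_toI) (auto simp: Ap_def Am_def)
    show "\<forall>v\<in>Ap i. \<exists>w\<in>A (i + 2). adj G v w"
      using disj[of i "i + 2"] by (auto simp: Ap_def nb_def)
    show "\<forall>v\<in>Am i. \<exists>w\<in>A (i - 2). adj G v w"
      using disj[of i "i - 2"] by (auto simp: Am_def nb_def)
    show "Ap i \<noteq> {} \<longrightarrow> (\<exists>xs. ordering_of (Ap i) xs \<and> nested (closed_nbhd G) xs)" using ordAp by blast
    show "Am i \<noteq> {} \<longrightarrow> (\<exists>xs. ordering_of (Am i) xs \<and> nested (closed_nbhd G) xs)" using ordAm by blast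
    \<comment> \<open>The hole vertex \<open>c i\<close> misses \<open>c (i + 2)\<close> and
      \<open>c (i - 2)\<close>, so it lies in \<open>As i\<close> or witnesses that its own part is
      not complete to the class across.\<close>
    have "\<not> adj G (c i) (c (i + 2))" "\<not> adj G (c i) (c (i - 2))"
      using hole7D[OF h, of i "i + 2"] hole7D[OF h, of i "i - 2"] by (simp_all add: nb_def arith_7)
    then show "As i \<noteq> {} \<or> \<not> complete_to G (Ap i) (A (i + 2)) \<or> \<not> complete_to G (Am i) (A (i - 2))"
      using cA[of i] cA[of "i + 2"] cA[of "i - 2"] unfolding As_def complete_to_def by blast
  next
    have Asd: "As i \<union> Ap i \<union> Am i = A i" for i unfolding As_def Ap_def Am_def by blast
    show "A (k - 3) = As (k - 3)" using Asd[of "k - 3"] Ap0[of "k - 3"] Am0[of "k - 3"] k by (simp add: arith_7)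
    show "A (k + 3) = As (k + 3)" using Asd[of "k + 3"] Ap0[of "k + 3"] Am0[of "k + 3"] k by (simp add: arith_7)
    show "A (k - 2) = As (k - 2) \<union> Ap (k - 2)" using Asd[of "k - 2"] Am0[of "k - 2"] k by (simp add: arith_7)
    show "A (k + 2) = As (k + 2) \<union> Am (k + 2)" using Asd[of "k + 2"] Ap0[of "k + 2"] k by (simp add: arith_7)
    show "A (k - 1) = As (k - 1) \<union> Ap (k - 1)" using Asd[of "k - 1"] Am0[of "k - 1"] k by (simp add: arith_7)
    show "A (k + 1) = As (k + 1) \<union> Am (k + 1)" using Asd[of "k + 1"] Ap0[of "k + 1"] k by (simp add: arith_7)
  qed
  then show ?thesis unfolding bracelet7_def by blast
qed

end

context atom_graph
begin

text \<open>A component of \<open>Z7\<close> could attach only to vertices of types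
  \<open>U7\<close> and \<open>F7\<close>. Those that attach are shown to be pairwise adjacent, so
  they would separate the component from the hole as a clique.\<close>

lemma Z7_empty:
  assumes h: "hole7 c"
  shows "Z7 c = {}"
proof (rule ccontr)
  assume "Z7 c \<noteq> {}"
  then obtain z where z: "z \<in> Z7 c" by blast
  obtain K where K: "z \<in> K" "K \<subseteq> Z7 c" "\<And>x y. x \<in> K \<Longrightarrow> y \<in> Z7 c \<Longrightarrow> nb G x y \<Longrightarrow> y \<in> K"
    "\<And>S s. \<lbrakk>S \<subseteq> K; s \<in> S; \<And>x y. x \<in> S \<Longrightarrow> y \<in> K \<Longrightarrow> nb G x y \<Longrightarrow> y \<in> S\<rbrakk> \<Longrightarrow> S = K"
    using nb_component[OF z, of G thesis] by blast
  have KV: "K \<subseteq> verts G" using K(2) by (auto simp: Z7_def)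
  have c0: "c 0 \<notin> K" "\<forall>k\<in>K. \<not> nb G (c 0) k"
    using K(2) Z7D(2)[of _ c 0] nb_refl[of G "c 0"] by blast+
  obtain x y where xy: "x \<in> verts G - K" "y \<in> verts G - K" "\<not> nb G x y"
    "\<exists>k\<in>K. nb G x k" "\<exists>k\<in>K. nb G y k"
  proof -
    have "K \<noteq> {}" using K(1) by blast
    from no_clique_cutset[OF KV this hole7_verts[OF h] c0] obtain x y where xy: "x \<in> verts G - K" "y \<in> verts G - K" "\<not> nb G x y \<and> (\<exists>k\<in>K. nb G x k) \<and> (\<exists>k\<in>K. nb G y k)"
      by (elim bexE)
    show thesis by (rule that[of x y]) (use xy in simp_all)
  qed
  have UF: "x \<in> U7 c \<or> (\<exists>i. x \<in> F7 c i)" if x: "x \<in> verts G - K" "\<exists>k\<in>K. nb G x k" for x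
  proof -
    obtain k where k: "k \<in> K" "nb G k x" using x nb_commute[of G x] by auto
    then have "x \<notin> Z7 c" using K(3) x by blast
    moreover have "x \<notin> T7 c i" for i using Z7_T'[OF h, of k x i] k K(2) by blast
    ultimately show ?thesis using hole7_cover[OF h] x by blast
  qed
  \<comment> \<open>Four-types two positions apart are the nonadjacent ones. Adjacency to
    \<open>f\<close> spreads over the whole component, but no vertex of it sees both
    \<open>f\<close> and \<open>g\<close>.\<close>
  have F2: False if fg: "f \<in> F7 c i" "g \<in> F7 c (i + 2)" and nfg: "\<exists>k\<in>K. nb G f k" "\<exists>k\<in>K. nb G g k" for f g i
  proof -
    define S where "S = {k \<in> K. nb G k f}"
    have com: "\<not> (nb G k f \<and> nb G k g)" if "k \<in> K" for k
      using Z7_common'[OF h, of k f i g] that K(2) fg by blast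
    obtain s where "s \<in> S" using nfg(1) nb_commute[of G f] unfolding S_def by auto
    have "S = K"
    proof (rule K(4)[of S s])
      show "S \<subseteq> K" by (auto simp: S_def)
      show "s \<in> S" by fact
      fix x y assume "x \<in> S" "y \<in> K" "nb G x y"
      then show "y \<in> S" using Z7_step'[OF h, of x y f i g] com[of x] K(2) fg unfolding S_def by blast
    qed
    then show False using com nfg(2) nb_commute[of G g] unfolding S_def by auto
  qed
  show False
  proof (cases "x \<in> U7 c \<or> y \<in> U7 c")
    case True
    then show False
      using UF[OF xy(1,4)] UF[OF xy(2,5)] xy(3) not_nb_sym[OF xy(3)] U7_clique[OF h] U7_F'[OF h] by blast
  next
    case False
    then obtain i j where ij: "x \<in> F7 c i" "y \<in> F7 c j" using UF xy by blast
    have "\<forall>d. y \<in> F7 c (i + d) \<longrightarrow> False"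
      unfolding all_7
    proof (intro conjI impI)
      assume "y \<in> F7 c (i + 0)" then show False using F7_clique'[OF h] ij xy by simp
    next
      assume "y \<in> F7 c (i + 1)" then show False using F7_F1'[OF h] ij xy by blast
    next
      assume "y \<in> F7 c (i + 2)" then show False using F2 ij xy by blast
    next
      assume "y \<in> F7 c (i + 3)" then show False using F7_F3'[OF h] ij xy by blast
    next
      assume "y \<in> F7 c (i + 4)" then show False using F7_F3'[OF h, of y "i + 4" x] ij xy by (simp add: arith_7)
    next
      assume "y \<in> F7 c (i + 5)" then show False using F2[of y "i + 5" x] ij xy by (simp add: arith_7)
    next
      assume "y \<in> F7 c (i + 6)" then show False using F7_F1'[OF h, of y "i + 6" x] ij xy not_nb_sym[OF xy(3)] by (auto simp: arith_7)
    qed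
    from this[rule_format, of "j - i"] ij show False by simp
  qed
qed

lemma U7_empty:
  assumes h: "hole7 c"
  shows "U7 c = {}"
proof (rule ccontr)
  assume "U7 c \<noteq> {}"
  then obtain u where u: "u \<in> U7 c" by blast
  then have "u \<in> verts G" by (simp add: U7_def)
  then obtain v where v: "v \<in> verts G" "\<not> nb G u v" using no_universal by blast
  then show False
    using hole7_cover[OF h v(1)] U7_clique[OF h u] U7_T'[OF h, of u] U7_F'[OF h, of u] u
    by (auto simp: Z7_empty[OF h])
qed

end

context free_graph
begin

text \<open>A vertex of \<open>F7 c i\<close> joins class \<open>i + 1\<close> if it is in
  \<open>Pi\<close> and class \<open>i + 2\<close> if it is in \<open>Qi\<close>; the completeness
  hypotheses are those needed for that place. The last one avoids the clash: \<open>Q0\<close> and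
  \<open>P2\<close> would land in the neighbouring classes 2 and 3, but \<open>F7 c 0\<close> is
  anticomplete to \<open>F7 c 2\<close>.\<close>

lemma hole7_partition_bracelet:
  assumes h: "hole7 c" and cov: "verts G = (\<Union>i. T7 c i) \<union> F7 c 0 \<union> F7 c 1 \<union> F7 c 2"
    and P: "P0 \<union> Q0 = F7 c 0" "P0 \<inter> Q0 = {}" "P1 \<union> Q1 = F7 c 1" "P1 \<inter> Q1 = {}" "P2 \<union> Q2 = F7 c 2" "P2 \<inter> Q2 = {}"
    and T0: "\<And>f t. f \<in> P0 \<Longrightarrow> t \<in> T7 c 0 \<Longrightarrow> nb G f t" and T3: "\<And>f t. f \<in> Q0 \<Longrightarrow> t \<in> T7 c 3 \<Longrightarrow> nb G f t"
    and T1: "\<And>f t. f \<in> P1 \<Longrightarrow> t \<in> T7 c 1 \<Longrightarrow> nb G f t" and T4: "\<And>f t. f \<in> Q1 \<Longrightarrow> t \<in> T7 c 4 \<Longrightarrow> nb G f t"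
    and T2: "\<And>f t. f \<in> P2 \<Longrightarrow> t \<in> T7 c 2 \<Longrightarrow> nb G f t" and T5: "\<And>f t. f \<in> Q2 \<Longrightarrow> t \<in> T7 c 5 \<Longrightarrow> nb G f t"
    and or: "Q0 = {} \<or> P2 = {}"
  shows "bracelet7 G"
proof -
  define B where "B i = (if i = 1 then P0 else if i = 2 then Q0 \<union> P1 else if i = 3 then Q1 \<union> P2 else if i = 4 then Q2 else {})" for i :: 7
  define A where "A i = T7 c i \<union> B i" for i
  have sub: "P0 \<subseteq> F7 c 0" "Q0 \<subseteq> F7 c 0" "P1 \<subseteq> F7 c 1" "Q1 \<subseteq> F7 c 1" "P2 \<subseteq> F7 c 2" "Q2 \<subseteq> F7 c 2"
    using P by blast+
  have Feq: "f \<in> F7 c 0 \<longleftrightarrow> f \<in> P0 \<or> f \<in> Q0" "f \<in> F7 c 1 \<longleftrightarrow> f \<in> P1 \<or> f \<in> Q1" "f \<in> F7 c 2 \<longleftrightarrow> f \<in> P2 \<or> f \<in> Q2" for f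
    using P by blast+
  note FT = F7_T1'[OF h, of _ 0] F7_T1'[OF h, of _ 1] F7_T1'[OF h, of _ 2]
    F7_T2'[OF h, of _ 0] F7_T2'[OF h, of _ 1] F7_T2'[OF h, of _ 2]
  note FT0 = F7_T4'[OF h, of _ 0] F7_T4'[OF h, of _ 1] F7_T4'[OF h, of _ 2]
    F7_T5'[OF h, of _ 0] F7_T5'[OF h, of _ 1] F7_T5'[OF h, of _ 2]
    F7_T6'[OF h, of _ 0] F7_T6'[OF h, of _ 1] F7_T6'[OF h, of _ 2]
  note FF = F7_clique'[OF h, of _ 0] F7_clique'[OF h, of _ 1] F7_clique'[OF h, of _ 2]
    F7_F1'[OF h, of _ 0] F7_F1'[OF h, of _ 1]
  note FF2 = F7_F2'[OF h, of _ 0]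
  note [simp] = mod_7
  show ?thesis
  proof (rule bracelet7I[OF h, of A])
    show "c i \<in> A i" for i using hole7_T[OF h] by (simp add: A_def)
    have "\<Union> (range B) = F7 c 0 \<union> F7 c 1 \<union> F7 c 2" unfolding UNIV_7 using P by (auto simp: B_def)
    then show "\<Union> (range A) = verts G" unfolding A_def cov by blast
    have BF: "B i \<inter> T7 c j = {}" for i j
      using T7_F7_disjoint[of c j 0] T7_F7_disjoint[of c j 1] T7_F7_disjoint[of c j 2] sub unfolding B_def by (auto split: if_splits)
    have BB: "\<forall>i j. i \<noteq> j \<longrightarrow> B i \<inter> B j = {}"
      unfolding all_7 using F7_F7_disjoint[of 0 1 c] F7_F7_disjoint[of 0 2 c] F7_F7_disjoint[of 1 2 c] sub P(2,4,6)
      by (simp add: B_def) blast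
    show "A i \<inter> A j = {}" if "i \<noteq> j" for i j
      using that BB BF T7_T7_disjoint[OF that, of c] unfolding A_def by blast
    have TT: "nb G x y" if "x \<in> T7 c i" "y \<in> T7 c i \<or> y \<in> T7 c (i + 1)" for i x y
      using that T7_clique'[OF h] T7_T1'[OF h] by blast
    have 1: "\<forall>i. \<forall>f\<in>B i. \<forall>t\<in>T7 c i \<union> T7 c (i + 1). nb G f t"
      unfolding all_7 using FT T0 T1 T2 T3 T4 T5 by (simp add: B_def ball_Un Feq) blast?
    have 2: "\<forall>i. \<forall>f\<in>B (i + 1). \<forall>t\<in>T7 c i. nb G f t"
      unfolding all_7 using FT T0 T1 T2 T3 T4 T5 by (simp add: B_def ball_Un Feq) blast?
    have 3: "\<forall>i. \<forall>f\<in>B i. \<forall>g\<in>B i \<union> B (i + 1). nb G f g"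
      unfolding all_7 using FF FF[THEN nb_sym] or by (auto simp add: B_def ball_Un Feq)
    have BB: "nb G f t" if "f \<in> B i" "t \<in> T7 c i \<or> t \<in> T7 c (i + 1)" for f t i
      using that 1 by blast
    have BB': "nb G f t" if "f \<in> B (i + 1)" "t \<in> T7 c i" for f t i
      using that 2 by blast
    have BBB: "nb G f g" if "f \<in> B i" "g \<in> B i \<or> g \<in> B (i + 1)" for f g i
      using that 3 by blast
    show "nb G x y" if "x \<in> A i" "y \<in> A i" for i x y
      using that TT[of x i y] BB[of x i y] BB[of y i x] BBB[of x i y] nb_sym[of G y x] unfolding A_def by blast
    show "nb G x y" if "x \<in> A i" "y \<in> A (i + 1)" for i x y
      using that TT[of x i y] BB[of x i y] BB'[of y i x] BBB[of x i y] nb_sym[of G y x] unfolding A_def by blast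
    have 4: "\<forall>i. \<forall>f\<in>B i. \<forall>t\<in>T7 c (i + 3) \<union> T7 c (i + 4). \<not> nb G f t"
      unfolding all_7 using FT0 by (simp add: B_def ball_Un Feq)
    have 5: "\<forall>i. \<forall>f\<in>B i. \<forall>g\<in>B (i + 3). \<not> nb G f g"
      unfolding all_7 using FF2 by (auto simp add: B_def ball_Un Feq)
    have N3: "\<not> nb G f t" if "f \<in> B i" "t \<in> T7 c (i + 3) \<or> t \<in> T7 c (i + 4)" for f t i
      using that 4 by blast
    have N3': "\<not> nb G f g" if "f \<in> B i" "g \<in> B (i + 3)" for f g i
      using that 5 by blast
    show "\<not> nb G x y" if "x \<in> A i" "y \<in> A (i + 3)" for i x y
      using that T7_T3'[OF h, of x i y] N3[of x i y] N3[of y "i + 3" x] N3'[of x i y] nb_sym[of G x y]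
      unfolding A_def by (auto simp: arith_7)
  qed
qed

end

context atom_graph
begin

text \<open>The distinguished index is 3. The extra clique consists of the vertices of
  \<open>T7 c 0\<close> missed by \<open>f0\<close>; class 1 splits into \<open>T7 c 1\<close> and
  \<open>F7 c 0\<close>, class 3 into \<open>T7 c 3\<close> and \<open>F7 c 2\<close>, and class 5
  into the vertices missed and seen by \<open>g0\<close>.\<close>

lemma thickened_emeraldI:
  assumes h: "hole7 c" and cov: "verts G = (\<Union>i. T7 c i) \<union> F7 c 0 \<union> F7 c 2"
    and f0: "f0 \<in> F7 c 0" "t0 \<in> T7 c 0" "\<not> nb G f0 t0"
    and g0: "g0 \<in> F7 c 2" "s0 \<in> T7 c 5" "\<not> nb G g0 s0"
  shows "thickened_emerald G"
proof -
  define E where "E = {t \<in> T7 c 0. \<not> nb G f0 t}"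
  define A0 where "A0 = {t \<in> T7 c 0. nb G f0 t}"
  define Rs where "Rs = {t \<in> T7 c 5. \<not> nb G g0 t}"
  define Rm where "Rm = {t \<in> T7 c 5. nb G g0 t}"
  have T0: "T7 c 0 = E \<union> A0" and T5: "T7 c 5 = Rs \<union> Rm" by (auto simp: E_def A0_def Rs_def Rm_def)
  define A where "A i = (if i = 0 then A0 else if i = 1 then T7 c 1 \<union> F7 c 0 else if i = 3 then T7 c 3 \<union> F7 c 2 else T7 c i)" for i :: 7
  note b = f0(1) g0(1) f0(2) g0(2) and nn = f0(3) g0(3)
  have A0D: "t \<in> T7 c 0 \<and> nb G f0 t" if "t \<in> A0" for t using that by (simp add: A0_def)
  have ED: "t \<in> T7 c 0 \<and> \<not> nb G f0 t" if "t \<in> E" for t using that by (simp add: E_def)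
  have RsD: "t \<in> T7 c 5 \<and> \<not> nb G g0 t" if "t \<in> Rs" for t using that by (simp add: Rs_def)
  have RmD: "t \<in> T7 c 5 \<and> nb G g0 t" if "t \<in> Rm" for t using that by (simp add: Rm_def)
  have F0_A0: "nb G f t" if "f \<in> F7 c 0" "t \<in> A0" for f t
    using E7_uniform_0[OF h f0(1) that(1) g0(1) _ g0(2) _ _ g0(3), of t] A0D[OF that(2)] by blast
  have F0_E: "\<not> nb G f t" if "f \<in> F7 c 0" "t \<in> E" for f t
    using E7_uniform_0[OF h that(1) f0(1) g0(1) _ g0(2) _ _ g0(3), of t] ED[OF that(2)] by blast
  have F2_Rm: "nb G f t" if "f \<in> F7 c 2" "t \<in> Rm" for f t
    using E7_uniform_5[OF h f0(1) that(1) g0(1) f0(2) _ _ _ f0(3), of t] RmD[OF that(2)] by blast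
  have F2_Rs: "\<not> nb G f t" if "f \<in> F7 c 2" "t \<in> Rs" for f t
    using E7_uniform_5[OF h f0(1) g0(1) that(1) f0(2) _ _ _ f0(3), of t] RsD[OF that(2)] by blast
  have E_Rs: "nb G t s" if "t \<in> E" "s \<in> Rs" for t s
    using F7_cross[OF h f0(1) g0(1), of t s] ED[OF that(1)] RsD[OF that(2)] by blast
  have E_Rm: "\<not> nb G t s" if "t \<in> E" "s \<in> Rm" for t s
    using E7_T0_T5[OF h f0(1) g0(1), of t s] ED[OF that(1)] RmD[OF that(2)] by blast
  have A0_T5: "\<not> nb G t s" if "t \<in> A0" "s \<in> T7 c 5" for t s
    using E7_T0_T5_a[OF h f0(1) g0(1) f0(2) _ _ f0(3), of s t] E7_T0_T5_b[OF h b _ _ nn, of t s]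
      A0D[OF that(1)] that(2) by blast
  \<comment> \<open>By uniformity every \<open>f\<close> of this type misses \<open>t0\<close>, so
    \<open>F7_T_split\<close> leaves only completeness to \<open>T7 c 3\<close>.\<close>
  have F0_T3: "nb G f t" if "f \<in> F7 c 0" "t \<in> T7 c 3" for f t
    using F7_T_split[OF h that(1) f0(2) that(2)] F0_E[OF that(1), of t0] f0 by (auto simp: E_def)
  have F2_T2: "nb G f t" if "f \<in> F7 c 2" "t \<in> T7 c 2" for f t
    using F7_T_split'[OF h that(1) that(2), of s0] F2_Rs[OF that(1), of s0] g0 by (auto simp: Rs_def)
  have TT: "nb G x y" if "x \<in> T7 c i" "y \<in> T7 c i \<or> y \<in> T7 c (i + 1)" for i x y
    using that T7_clique'[OF h] T7_T1'[OF h] by blast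
  note dT = T7_T7_disjoint[of _ _ c] and dF = T7_F7_disjoint[of c] and dFF = F7_F7_disjoint[of 0 2 c]
  have "\<forall>i. \<forall>x\<in>T7 c i. \<forall>y\<in>T7 c (i + 1). nb G x y \<and> nb G y x" using TT nb_sym by metis
  note TT1 = this[unfolded all_7 mod_7, simplified mod_7]
  have "\<forall>i. \<forall>x\<in>T7 c i. \<forall>y\<in>T7 c (i + 3). \<not> nb G x y \<and> \<not> nb G y x"
    using T7_T3'[OF h] nb_sym by metis
  note TT3 = this[unfolded all_7 mod_7, simplified mod_7]
  have F: "nb G f t \<and> nb G t f" if "f \<in> F7 c i" "t \<in> F7 c i \<or> t \<in> T7 c (i + 1) \<or> t \<in> T7 c (i + 2)" for f t i
    using that F7_clique'[OF h, of f i t] F7_T1'[OF h, of f i t] F7_T2'[OF h, of f i t] nb_sym[of G f t] by blast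
  have FN: "\<not> nb G f t \<and> \<not> nb G t f" if "f \<in> F7 c i" "t \<in> T7 c (i + 4) \<or> t \<in> T7 c (i + 5) \<or> t \<in> T7 c (i + 6)" for f t i
    using that F7_T4'[OF h, of f i t] F7_T5'[OF h, of f i t] F7_T6'[OF h, of f i t] nb_sym[of G t f] by blast
  have TV: "T7 c i \<subseteq> verts G" "F7 c i \<subseteq> verts G" for i by (auto simp: T7_def F7_def)
  have AV: "A i \<subseteq> verts G" for i using TV by (auto simp: A_def A0_def)
  have A0A0: "nb G x y" if "x \<in> A0" "y \<in> A0" for x y using that A0D TT[of x 0 y] by blast
  have A_clique: "\<forall>i. \<forall>x\<in>A i. \<forall>y\<in>A i. nb G x y"
    unfolding all_7 using TT A0A0 F[of _ 0] F[of _ 2] A0D by (auto simp: A_def mod_7)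
  have A_succ: "\<forall>i. \<forall>x\<in>A i. \<forall>y\<in>A (i + 1). nb G x y"
    unfolding all_7 using TT1 F0_A0[THEN nb_sym] F[of _ 0] F[of _ 2] F2_T2[THEN nb_sym] A0D
    by (auto simp: A_def mod_7)
  have A_far: "\<forall>i. \<forall>x\<in>A i. \<forall>y\<in>A (i + 3). \<not> nb G x y"
    unfolding all_7 using TT3 FN[of _ 0] FN[of _ 2] A0D by (auto simp: A_def mod_7)
  have A_disj: "\<forall>i j. i \<noteq> j \<longrightarrow> A i \<inter> A j = {}"
  proof (intro allI impI)
    fix i j :: 7
    assume ij: "i \<noteq> j"
    define B where "B i = (if i = 1 then F7 c 0 else if i = 3 then F7 c 2 else {})" for i :: 7
    have "A i \<subseteq> T7 c i \<union> B i" for i by (auto simp: A_def A0_def B_def)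
    moreover have "B i \<inter> T7 c j = {}" for i j using dF[of j 0] dF[of j 2] by (auto simp: B_def)
    moreover have "B i \<inter> B j = {}" using ij dFF by (auto simp: B_def)
    ultimately show "A i \<inter> A j = {}" using dT[OF ij] by blast
  qed
  have E_disj: "\<forall>i. E \<inter> A i = {}"
  proof
    fix i
    have "E \<subseteq> T7 c 0" by (auto simp: E_def)
    moreover have "A i \<subseteq> T7 c i \<union> F7 c 0 \<union> F7 c 2" by (auto simp: A_def A0_def)
    moreover have "E \<inter> A0 = {}" by (auto simp: E_def A0_def)
    ultimately show "E \<inter> A i = {}"
      using dT[of 0 i] dF[of 0 0] dF[of 0 2] by (cases "i = 0") (auto simp: A_def)
  qed
  \<comment> \<open>The hole vertex \<open>c 0\<close> stays in class 0 and not in \<open>E\<close>,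
    because \<open>f0\<close> sees it; this keeps class 0 nonempty.\<close>
  have cA: "c i \<in> A i" for i
    using hole7_T[OF h, of i] F7D[OF f0(1), of 0] by (auto simp: A_def A0_def)
  have uni: "verts G = E \<union> (\<Union>i. A i)"
    unfolding cov UNIV_7 using T0 by (auto simp: A_def)
  have EV: "E \<subseteq> verts G" using TV by (auto simp: E_def)
  have n02: "\<not> nb G x y" if "x \<in> T7 c 0" "y \<in> T7 c 2" for x y using E7_T0_T2[OF h b that nn] .
  have n13: "\<not> nb G x y" if "x \<in> T7 c 1" "y \<in> T7 c 3" for x y using E7_T1_T3[OF h b that nn] .
  have n24: "\<not> nb G x y" if "x \<in> T7 c 2" "y \<in> T7 c 4" for x y using E7_T2_T4[OF h b that nn] .
  have n35: "\<not> nb G x y" if "x \<in> T7 c 3" "y \<in> T7 c 5" for x y using E7_T3_T5[OF h b that nn] .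
  have n46: "\<not> nb G x y" if "x \<in> T7 c 4" "y \<in> T7 c 6" for x y using E7_T4_T6[OF h b that nn] .
  have n61: "\<not> nb G x y" if "x \<in> T7 c 6" "y \<in> T7 c 1" for x y using E7_T6_T1[OF h b that nn] .
  note far2 = n02 n13 n24 n35 n46 n61 n02[THEN not_nb_sym] n13[THEN not_nb_sym] n24[THEN not_nb_sym]
    n35[THEN not_nb_sym] n46[THEN not_nb_sym] n61[THEN not_nb_sym]
  show ?thesis unfolding thickened_emerald_def
    apply (rule exI[of _ E], rule exI[of _ A], rule exI[of _ 3])
  proof (intro conjI)
    show "partition_into (verts G) (E # map A [0, 1, 2, 3, 4, 5, 6])"
      unfolding partition_into_def uni UNIV_7 using A_disj E_disj by (simp add: disjnt_def)
    show "E \<noteq> {}" using f0 by (auto simp: E_def)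
    show "clique G E" using EV TT[of _ 0] ED by (auto simp: clique_nb)
    show "\<forall>i. A i \<noteq> {} \<and> clique G (A i)" using cA AV A_clique unfolding clique_nb by blast
    show "\<forall>i. complete_to G (A i) (A (i - 1) \<union> A (i + 1)) \<and> anticomplete_to G (A i) (A (i - 3) \<union> A (i + 3))"
    proof (intro allI conjI)
      fix i
      have "nb G x y" if "x \<in> A i" "y \<in> A (i - 1)" for x y
        using A_succ[rule_format, of y "i - 1" x] that by (simp add: nb_sym)
      then show "complete_to G (A i) (A (i - 1) \<union> A (i + 1))"
        using A_succ A_disj[rule_format, of i "i - 1"] A_disj[rule_format, of i "i + 1"]
        by (intro complete_toI) auto
      have "\<not> nb G x y" if "x \<in> A i" "y \<in> A (i - 3)" for x y
        using A_far[rule_format, of y "i - 3" x] that nb_sym[of G x y] by auto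
      then show "anticomplete_to G (A i) (A (i - 3) \<union> A (i + 3))"
        using A_far by (intro anticomplete_toI) auto
    qed
    have far': "\<forall>i\<in>{0, 2, 4, 6}. \<forall>x\<in>A i. \<forall>y\<in>A (i + 5) \<union> A (i + 2). \<not> nb G x y"
      using far2 A0_T5 A0D FN[of _ 0] FN[of _ 2] by (auto simp: A_def mod_7)
    have "{3 - 3, 3 - 1, 3 + 1, 3 + 3} = {0, 2, 4, 6 :: 7}" by simp
    then show "\<forall>i\<in>{3 - 3, 3 - 1, 3 + 1, 3 + 3}. anticomplete_to G (A i) (A (i - 2) \<union> A (i + 2))"
      using far' by (simp only: minus_7) (meson anticomplete_toI)
    show "\<exists>Zm Zp Rs Rm Ls Lp.
           sorted_wrt disjnt [Zm, Zp, Rs, Rm, Ls, Lp] \<and>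
           (\<forall>X \<in> {Zm, Zp, Rs, Rm, Ls, Lp}. X \<noteq> {} \<and> clique G X) \<and>
           A 3 = Zm \<union> Zp \<and> A (3 + 2) = Rs \<union> Rm \<and> A (3 - 2) = Ls \<union> Lp \<and>
           complete_to G Zm Lp \<and> anticomplete_to G Zm (Ls \<union> A (3 + 2)) \<and>
           complete_to G Zp Rm \<and> anticomplete_to G Zp (Rs \<union> A (3 - 2)) \<and>
           complete_to G E (Rs \<union> A (3 + 3) \<union> A (3 - 3) \<union> Ls) \<and>
           anticomplete_to G E (Lp \<union> A (3 - 1) \<union> A 3 \<union> A (3 + 1) \<union> Rm)"
      apply (rule exI[of _ "T7 c 3"], rule exI[of _ "F7 c 2"], rule exI[of _ Rs], rule exI[of _ Rm],
          rule exI[of _ "T7 c 1"], rule exI[of _ "F7 c 0"])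
    proof (intro conjI)
      note dd = dT[of 1 3] dT[of 1 5] dT[of 3 5] dF[of 1 0] dF[of 1 2] dF[of 3 0] dF[of 3 2] dF[of 5 0] dF[of 5 2] dFF
      have RR: "Rs \<inter> Rm = {}" "Rs \<subseteq> T7 c 5" "Rm \<subseteq> T7 c 5" by (auto simp: Rs_def Rm_def)
      show "sorted_wrt disjnt [T7 c 3, F7 c 2, Rs, Rm, T7 c 1, F7 c 0]"
      proof -
        have 1: "T7 c 3 \<inter> F7 c 2 = {}" "T7 c 3 \<inter> T7 c 1 = {}" "T7 c 3 \<inter> F7 c 0 = {}" "T7 c 1 \<inter> F7 c 0 = {}"
          "F7 c 2 \<inter> T7 c 1 = {}" "F7 c 2 \<inter> F7 c 0 = {}"
          using dF[of 3 2] dF[of 3 0] dF[of 1 0] dF[of 1 2] dFF dT[of 3 1] by (simp_all add: Int_commute)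
        have 2: "X \<inter> Rs = {}" "X \<inter> Rm = {}" "Rs \<inter> X = {}" "Rm \<inter> X = {}"
          if "X = T7 c 3 \<or> X = T7 c 1 \<or> X = F7 c 2 \<or> X = F7 c 0" for X
        proof -
          have "T7 c 5 \<inter> X = {}" using that dT[of 5 3] dT[of 5 1] dF[of 5 2] dF[of 5 0] by auto
          then show "X \<inter> Rs = {}" "X \<inter> Rm = {}" "Rs \<inter> X = {}" "Rm \<inter> X = {}" using RR(2,3) by blast+
        qed
        show ?thesis by (simp add: disjnt_def 1 2 RR(1))
      qed
      have "c 3 \<in> T7 c 3" "c 1 \<in> T7 c 1" using hole7_T[OF h] by blast+
      moreover have "c 5 \<in> Rm" using hole7_T[OF h, of 5] F7D[OF g0(1), of 5] by (simp add: Rm_def)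
      moreover have "s0 \<in> Rs" using g0 by (simp add: Rs_def)
      ultimately have ne: "T7 c 3 \<noteq> {}" "F7 c 2 \<noteq> {}" "Rs \<noteq> {}" "Rm \<noteq> {}" "T7 c 1 \<noteq> {}" "F7 c 0 \<noteq> {}"
        using f0(1) g0(1) by auto
      have cl: "clique G (T7 c i)" "clique G (F7 c i)" for i
        using TV TT F unfolding clique_nb by blast+
      have "clique G Rs" "clique G Rm"
        using RR TV(1)[of 5] TT[of _ 5] unfolding clique_nb by blast+
      then show "\<forall>X \<in> {T7 c 3, F7 c 2, Rs, Rm, T7 c 1, F7 c 0}. X \<noteq> {} \<and> clique G X"
        unfolding ball_simps by (intro conjI ne cl TrueI)
      show "A 3 = T7 c 3 \<union> F7 c 2" "A (3 + 2) = Rs \<union> Rm" "A (3 - 2) = T7 c 1 \<union> F7 c 0"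
        using T5 by (simp_all add: A_def)
      show "complete_to G (T7 c 3) (F7 c 0)"
        using F0_T3[THEN nb_sym] dF by (intro complete_toI) auto
      show "anticomplete_to G (T7 c 3) (T7 c 1 \<union> A (3 + 2))"
        using far2 by (intro anticomplete_toI) (auto simp: A_def)
      show "complete_to G (F7 c 2) Rm" using F2_Rm dd RR by (intro complete_toI) auto
      show "anticomplete_to G (F7 c 2) (Rs \<union> A (3 - 2))"
        using F2_Rs FN[of _ 2] F7_F2'[OF h, of _ 0, THEN not_nb_sym] by (intro anticomplete_toI) (auto simp: A_def mod_7)
      show "complete_to G E (Rs \<union> A (3 + 3) \<union> A (3 - 3) \<union> T7 c 1)"
      proof (rule complete_toI)
        show "E \<inter> (Rs \<union> A (3 + 3) \<union> A (3 - 3) \<union> T7 c 1) = {}"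
          using E_disj RR(2) dT[of 0 1] dT[of 0 5] by (auto simp: E_def)
        fix x y assume "x \<in> E" "y \<in> Rs \<union> A (3 + 3) \<union> A (3 - 3) \<union> T7 c 1"
        then show "nb G x y"
          using E_Rs ED[of x] TT1 A0D[of y] TT[of x 0 y] by (auto simp: A_def mod_7)
      qed
      show "anticomplete_to G E (F7 c 0 \<union> A (3 - 1) \<union> A 3 \<union> A (3 + 1) \<union> Rm)"
      proof (rule anticomplete_toI)
        fix x y assume "x \<in> E" "y \<in> F7 c 0 \<union> A (3 - 1) \<union> A 3 \<union> A (3 + 1) \<union> Rm"
        then show "\<not> nb G x y"
          using E_Rm[of x y] F0_E[THEN not_nb_sym, of y x] ED[of x] TT3 far2 FN[of _ 2] by (auto simp: A_def mod_7)
      qed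
    qed
  qed
qed

text \<open>After rotation the four-types sit at positions 0, 1, 2. If all of \<open>F7 d 0\<close>
  can go to class 1, or all of \<open>F7 d 2\<close> to class 4, the clash is avoidable and a
  bracelet results. Otherwise both are forced towards each other, the middle type is empty, and the
  graph is an emerald.\<close>

theorem hole7_structure:
  assumes "hole7 c"
  shows "bracelet7 G \<or> thickened_emerald G"
proof -
  obtain k where k: "\<And>j. F7 c (k + j) \<noteq> {} \<Longrightarrow> j = 0 \<or> j = 1 \<or> j = 2"
    using F7_positions[OF assms] by blast
  define d where "d = (\<lambda>j. c (k + j))"
  have h: "hole7 d" unfolding d_def using assms by (rule hole7_rotate)
  have Fd: "F7 d j \<noteq> {} \<Longrightarrow> j = 0 \<or> j = 1 \<or> j = 2" for j
    using k unfolding d_def F7_rotate .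
  have "verts G \<subseteq> (\<Union>i. T7 d i) \<union> F7 d 0 \<union> F7 d 1 \<union> F7 d 2"
  proof
    fix v assume "v \<in> verts G"
    then consider i where "v \<in> T7 d i" | i where "v \<in> F7 d i"
      using hole7_cover[OF h] U7_empty[OF h] Z7_empty[OF h] by blast
    then show "v \<in> (\<Union>i. T7 d i) \<union> F7 d 0 \<union> F7 d 1 \<union> F7 d 2"
      using Fd by cases blast+
  qed
  then have cov: "verts G = (\<Union>i. T7 d i) \<union> F7 d 0 \<union> F7 d 1 \<union> F7 d 2"
    by (auto simp: T7_def F7_def)
  define P1 where "P1 = {f \<in> F7 d 1. \<forall>t\<in>T7 d 1. nb G f t}"
  have P1': "P1 \<subseteq> F7 d 1" "\<And>f t. f \<in> P1 \<Longrightarrow> t \<in> T7 d 1 \<Longrightarrow> nb G f t" unfolding P1_def by blast+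
  have P1: "nb G f t" if "f \<in> F7 d 1 - P1" "t \<in> T7 d 4" for f t
    using that F7_T_split'[OF h, of f 1 _ t] unfolding P1_def by auto
  have F0: "nb G f t" if "f \<in> F7 d 0" "t \<in> T7 d 3" "\<exists>s\<in>T7 d 0. \<not> nb G f s" for f t
    using that F7_T_split'[OF h, of f 0 _ t] by auto
  have F2: "nb G f t" if "f \<in> F7 d 2" "t \<in> T7 d 5" "\<exists>s\<in>T7 d 2. \<not> nb G f s" for f t
    using that F7_T_split'[OF h, of f 2 _ t] by auto
  show ?thesis
  proof (cases "\<forall>f\<in>F7 d 0. \<forall>t\<in>T7 d 0. nb G f t")
    case True
    define P2 where "P2 = {f \<in> F7 d 2. \<forall>t\<in>T7 d 2. nb G f t}"
      have P2: "P2 \<subseteq> F7 d 2" "\<And>f t. f \<in> P2 \<Longrightarrow> t \<in> T7 d 2 \<Longrightarrow> nb G f t"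
        "\<And>f t. f \<in> F7 d 2 - P2 \<Longrightarrow> t \<in> T7 d 5 \<Longrightarrow> nb G f t"
        unfolding P2_def using F2 by blast+
    have "bracelet7 G"
      by (rule hole7_partition_bracelet[OF h cov, of "F7 d 0" "{}" P1 "F7 d 1 - P1" P2 "F7 d 2 - P2"])
        (use True P1 P1' P2 in blast)+
    then show ?thesis ..
  next
    case False
    then obtain f0 t0 where f0: "f0 \<in> F7 d 0" "t0 \<in> T7 d 0" "\<not> nb G f0 t0" by blast
    show ?thesis
    proof (cases "\<forall>f\<in>F7 d 2. \<forall>t\<in>T7 d 5. nb G f t")
      case True
      define P0 where "P0 = {f \<in> F7 d 0. \<forall>t\<in>T7 d 0. nb G f t}"
      have P0: "P0 \<subseteq> F7 d 0" "\<And>f t. f \<in> P0 \<Longrightarrow> t \<in> T7 d 0 \<Longrightarrow> nb G f t"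
        "\<And>f t. f \<in> F7 d 0 - P0 \<Longrightarrow> t \<in> T7 d 3 \<Longrightarrow> nb G f t"
        unfolding P0_def using F0 by blast+
      have "bracelet7 G"
        by (rule hole7_partition_bracelet[OF h cov, of P0 "F7 d 0 - P0" P1 "F7 d 1 - P1" "{}" "F7 d 2"])
          (use True P1 P1' P0 in blast)+
      then show ?thesis ..
    next
      case False
      then obtain g0 s0 where g0: "g0 \<in> F7 d 2" "s0 \<in> T7 d 5" "\<not> nb G g0 s0" by blast
      have "F7 d 1 = {}" using F7_no_middle[OF h f0(1) g0(1) _ f0(2) g0(2) f0(3) g0(3)] by blast
      then have "thickened_emerald G" using cov thickened_emeraldI[OF h _ f0 g0] by simp
      then show ?thesis ..
    qed
  qed
qed

end

section \<open>Graphs with a theta\<close>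

locale atom_no_C7 = atom_graph +
  assumes no_C7: "no_C7 (nb G)"
begin

lemmas C7 = no_C7[unfolded no_C7_def, rule_format]

section \<open>A set attached to both ends of an induced path \<open>a\<close>, \<open>b\<close>,
  \<open>c\<close>, \<open>d\<close>\<close>

lemma pa_common:
  assumes p: "nb G a b" "nb G b c" "nb G c d" "\<not> nb G a c" "\<not> nb G a d" "\<not> nb G b d" and 1: "nb G y a" "nb G z a" and 2:
    "\<not> nb G e a" and 3: "nb G e y" "nb G e z"
  shows "nb G y z"
  by (rule nbI, rule C4[of y e z a]) (simp_all add: p p(1-3)[THEN nb_sym] p(4-6)[THEN not_nb_sym] 1 1[THEN nb_sym] 2 2[THEN not_nb_sym] 3 3[THEN nb_sym])

lemma pa_cross:
  assumes p: "nb G a b" "nb G b c" "nb G c d" "\<not> nb G a c" "\<not> nb G a d" "\<not> nb G b d" and 1: "nb G y a" "nb G z a" and 2: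
    "\<not> nb G e a" "\<not> nb G f a" and 3: "nb G e y" "nb G f z" and 4: "\<not> nb G e z" "\<not> nb G f y" "\<not> nb G y z"
  shows "\<not> nb G e f"
  by (rule not_nbI, rule C5[of y e f z a]) (simp_all add: p p(1-3)[THEN nb_sym] p(4-6)[THEN not_nb_sym] 1 1[THEN nb_sym] 2 2[THEN not_nb_sym] 3 3[THEN nb_sym] 4 4[THEN not_nb_sym])

text \<open>In this group \<open>y\<close>, \<open>z\<close>, \<open>m\<close>, \<open>n\<close>
  stand for neighbours of \<open>a\<close>, and \<open>e\<close>, \<open>f\<close> for neighbours of
  \<open>d\<close>, in a component that sees neither \<open>b\<close> nor \<open>c\<close>. The
  detour over \<open>d\<close>, \<open>c\<close>, \<open>b\<close> is what lengthens a short path in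
  the component to a \<open>P7\<close>.\<close>

lemma pa_mid:
  assumes p: "nb G a b" "nb G b c" "nb G c d" "\<not> nb G a c" "\<not> nb G a d" "\<not> nb G b d" and 1: "\<not> nb G y b"
    "\<not> nb G y c" "\<not> nb G y d" "\<not> nb G z b" "\<not> nb G z c" "\<not> nb G z d" "\<not> nb G m b" "\<not> nb G m c"
    "\<not> nb G m d" "\<not> nb G f b" "\<not> nb G f c" and 2: "nb G f d" "nb G f z" and 3: "\<not> nb G f y" and 4: "nb G m y" "nb G m z"
    and 5: "\<not> nb G m f" "\<not> nb G y z"
  shows "False"
proof -
  note [simp] = p p(1-3)[THEN nb_sym] p(4-6)[THEN not_nb_sym] 1 1[THEN not_nb_sym] 2 2[THEN nb_sym] 3 3[THEN not_nb_sym] 4 4[THEN nb_sym] 5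
    5[THEN not_nb_sym]
  show False by (rule P7[of y m z f d c b]) simp_all
qed

lemma pa_step:
  assumes p: "nb G a b" "nb G b c" "nb G c d" "\<not> nb G a c" "\<not> nb G a d" "\<not> nb G b d" and 1: "\<not> nb G y b"
    "\<not> nb G y c" "\<not> nb G y d" "\<not> nb G m b" "\<not> nb G m c" "\<not> nb G m d" "\<not> nb G n b" "\<not> nb G n c"
    "\<not> nb G n d" "\<not> nb G e b" "\<not> nb G e c" and 2: "nb G e d" "nb G e y" "nb G m y" and 3: "\<not> nb G n y" and 4: "nb G m n"
    and 5: "\<not> nb G m e" "\<not> nb G n e"
  shows "False"
proof -
  note [simp] = p p(1-3)[THEN nb_sym] p(4-6)[THEN not_nb_sym] 1 1[THEN not_nb_sym] 2 2[THEN nb_sym] 3 3[THEN not_nb_sym] 4 4[THEN nb_sym] 5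
    5[THEN not_nb_sym]
  show False by (rule P7[of n m y e d c b]) simp_all
qed

lemma pa_P3:
  assumes p: "nb G a b" "nb G b c" "nb G c d" "\<not> nb G a c" "\<not> nb G a d" "\<not> nb G b d" and 1: "\<not> nb G y b"
    "\<not> nb G y c" "\<not> nb G y d" "\<not> nb G z b" "\<not> nb G z c" "\<not> nb G z d" "\<not> nb G m b" "\<not> nb G m c"
    "\<not> nb G m d" "\<not> nb G e b" "\<not> nb G e c" and 2: "nb G e d" "nb G f d" "nb G e y" "nb G f z" and 3: "\<not> nb G e z"
    "\<not> nb G e f" and 4: "nb G m y" "nb G m z" and 5: "\<not> nb G y z"
  shows "False"
proof -
  note [simp] = p p(1-3)[THEN nb_sym] p(4-6)[THEN not_nb_sym] 1 1[THEN not_nb_sym] 2 2[THEN nb_sym] 3 3[THEN not_nb_sym] 4 4[THEN nb_sym] 5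
    5[THEN not_nb_sym]
  have *: "nb G e m" by (rule nbI, rule P7[of z m y e d c b]) simp_all
  note [simp] = * *[THEN nb_sym]
  have *: "\<not> nb G f m" by (rule not_nbI, rule C4[of e m f d]) simp_all
  note [simp] = * *[THEN not_nb_sym]
  show False by (rule C5[of z f d e m]) simp_all
qed

text \<open>Because \<open>y\<close> has a partner \<open>e\<close> next to \<open>d\<close>, a
  common neighbour \<open>u\<close> of \<open>a\<close> and \<open>d\<close> that misses
  \<open>y\<close> would close a \<open>C4\<close> or \<open>C5\<close> with \<open>y\<close> and
  \<open>e\<close>.\<close>

lemma pa_U:
  assumes p: "nb G a b" "nb G b c" "nb G c d" "\<not> nb G a c" "\<not> nb G a d" "\<not> nb G b d" and 1: "nb G y a" and 2:
    "\<not> nb G y d" "\<not> nb G e a" and 3: "nb G e d" "nb G e y" "nb G u a" "nb G u d"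
  shows "nb G u y"
proof (rule ccontr)
  assume n: "\<not> nb G u y"
  note [simp] = p p(1-3)[THEN nb_sym] p(4-6)[THEN not_nb_sym] 1 1[THEN nb_sym] 2 2[THEN not_nb_sym] 3 3[THEN nb_sym] n n[THEN not_nb_sym]
  have *: "\<not> nb G e u" by (rule not_nbI, rule C4[of y e u a]) simp_all
  note [simp] = * *[THEN not_nb_sym]
  show False by (rule C5[of y e d u a]) simp_all
qed

end

text \<open>Indexing the legs by the type \<open>3\<close> lets every statement be used for any
  permutation of the legs.\<close>

locale theta_graph = atom_no_C7 +
  fixes a d :: 'a and b c :: "3 \<Rightarrow> 'a"
  assumes theta: "nb G (b i) (b j) \<longleftrightarrow> i = j" "nb G (c i) (c j) \<longleftrightarrow> i = j"
    "nb G (b i) (c j) \<longleftrightarrow> i = j"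
    "nb G a (b i)" "nb G d (c i)" "\<not> nb G a (c i)" "\<not> nb G d (b i)" "\<not> nb G a d"
begin

lemma theta_sym [simp]: "nb G (c i) (b j) \<longleftrightarrow> i = j" "nb G (b i) a" "nb G (c i) d" "\<not> nb G (c i) a" "\<not> nb G (b i) d" "\<not> nb G d a"
  using theta nb_sym[of G] by (metis, metis, metis, metis, metis, metis)

declare theta [simp]

text \<open>The lemmas \<open>th_cl1\<close> to \<open>th_cl6\<close> forbid local patterns in the
  trace of a vertex on the theta and are the clauses behind \<open>theta_types\<close>. The suffix
  \<open>d\<close> marks the mirror image that exchanges \<open>a\<close> with \<open>d\<close> and
  \<open>b\<close> with \<open>c\<close>.\<close>

lemma th_cl1:
  assumes ijk: "i \<noteq> j" "i \<noteq> k" "j \<noteq> k" and 1: "nb G v a" and 2: "\<not> nb G v (b i)" and 3: "nb G v (c i)"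
  shows "False"
proof -
  note [simp] = ijk ijk[symmetric] 1 1[THEN nb_sym] 2 2[THEN not_nb_sym] 3 3[THEN nb_sym]
  show False by (rule C4[of v a "b i" "c i"]) simp_all
qed

lemma th_cl1d:
  assumes ijk: "i \<noteq> j" "i \<noteq> k" "j \<noteq> k" and 1: "nb G v d" and 2: "\<not> nb G v (c i)" and 3: "nb G v (b i)"
  shows "False"
proof -
  note [simp] = ijk ijk[symmetric] 1 1[THEN nb_sym] 2 2[THEN not_nb_sym] 3 3[THEN nb_sym]
  show False by (rule C4[of v "b i" "c i" d]) simp_all
qed

lemma th_cl2:
  assumes ijk: "i \<noteq> j" "i \<noteq> k" "j \<noteq> k" and 1: "\<not> nb G v a" and 2: "nb G v (b i)" and 3: "\<not> nb G v (b j)" and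
    4: "nb G v (c j)"
  shows "False"
proof -
  note [simp] = ijk ijk[symmetric] 1 1[THEN not_nb_sym] 2 2[THEN nb_sym] 3 3[THEN not_nb_sym] 4 4[THEN nb_sym]
  show False by (rule C5[of v "b i" a "b j" "c j"]) simp_all
qed

lemma th_cl2d:
  assumes ijk: "i \<noteq> j" "i \<noteq> k" "j \<noteq> k" and 1: "\<not> nb G v d" and 2: "nb G v (c i)" and 3: "\<not> nb G v (c j)" and
    4: "nb G v (b j)"
  shows "False"
proof -
  note [simp] = ijk ijk[symmetric] 1 1[THEN not_nb_sym] 2 2[THEN nb_sym] 3 3[THEN not_nb_sym] 4 4[THEN nb_sym]
  show False by (rule C5[of v "b j" "c j" d "c i"]) simp_all
qed

lemma th_cl3:
  assumes ijk: "i \<noteq> j" "i \<noteq> k" "j \<noteq> k" and 1: "\<not> nb G v a" and 2: "nb G v (b i)" "nb G v (b j)"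
  shows "False"
proof -
  note [simp] = ijk ijk[symmetric] 1 1[THEN not_nb_sym] 2 2[THEN nb_sym]
  show False by (rule C4[of v "b i" a "b j"]) simp_all
qed

lemma th_cl3d:
  assumes ijk: "i \<noteq> j" "i \<noteq> k" "j \<noteq> k" and 1: "\<not> nb G v d" and 2: "nb G v (c i)" "nb G v (c j)"
  shows "False"
proof -
  note [simp] = ijk ijk[symmetric] 1 1[THEN not_nb_sym] 2 2[THEN nb_sym]
  show False by (rule C4[of v "c i" d "c j"]) simp_all
qed

lemma th_cl4:
  assumes ijk: "i \<noteq> j" "i \<noteq> k" "j \<noteq> k" and 1: "\<not> nb G v a" and 2: "nb G v (b i)" and 3: "\<not> nb G v (b j)"
    "\<not> nb G v (c j)" "\<not> nb G v (c k)" "\<not> nb G v d"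
  shows "False"
proof -
  note [simp] = ijk ijk[symmetric] 1 1[THEN not_nb_sym] 2 2[THEN nb_sym] 3 3[THEN not_nb_sym]
  show False by (rule P7[of v "b i" a "b j" "c j" d "c k"]) simp_all
qed

lemma th_cl4d:
  assumes ijk: "i \<noteq> j" "i \<noteq> k" "j \<noteq> k" and 1: "\<not> nb G v d" and 2: "nb G v (c i)" and 3: "\<not> nb G v (c j)"
    "\<not> nb G v (b j)" "\<not> nb G v (b k)" "\<not> nb G v a"
  shows "False"
proof -
  note [simp] = ijk ijk[symmetric] 1 1[THEN not_nb_sym] 2 2[THEN nb_sym] 3 3[THEN not_nb_sym]
  show False by (rule P7[of v "c i" d "c j" "b j" a "b k"]) simp_all
qed

lemma th_cl5:
  assumes ijk: "i \<noteq> j" "i \<noteq> k" "j \<noteq> k" and 1: "nb G v a" and 2: "\<not> nb G v (b i)" "\<not> nb G v (c i)" and 3: "nb G v d"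
  shows "False"
proof -
  note [simp] = ijk ijk[symmetric] 1 1[THEN nb_sym] 2 2[THEN not_nb_sym] 3 3[THEN nb_sym]
  show False by (rule C5[of v a "b i" "c i" d]) simp_all
qed

lemma th_cl6:
  assumes ijk: "i \<noteq> j" "i \<noteq> k" "j \<noteq> k" and 1: "nb G v (b i)" "nb G v (b j)" and 2: "\<not> nb G v (b k)"
    "\<not> nb G v (c j)" "\<not> nb G v (c k)" "\<not> nb G v d"
  shows "False"
proof -
  note [simp] = ijk ijk[symmetric] 1 1[THEN nb_sym] 2 2[THEN not_nb_sym]
  show False by (rule P7[of "b i" v "b j" "c j" d "c k" "b k"]) simp_all
qed

lemma th_cl6d:
  assumes ijk: "i \<noteq> j" "i \<noteq> k" "j \<noteq> k" and 1: "nb G v (c i)" "nb G v (c j)" and 2: "\<not> nb G v (c k)"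
    "\<not> nb G v (b j)" "\<not> nb G v (b k)" "\<not> nb G v a"
  shows "False"
proof -
  note [simp] = ijk ijk[symmetric] 1 1[THEN nb_sym] 2 2[THEN not_nb_sym]
  show False by (rule P7[of "c i" v "c j" "b j" a "b k" "c k"]) simp_all
qed

lemma th_bb:
  assumes ijk: "i \<noteq> j" "i \<noteq> k" "j \<noteq> k" and 1: "nb G u (b i)" "nb G u (b j)" "nb G v (b i)" "nb G v (b j)"
  shows "nb G u v"
  by (rule nbI, rule C4[of u "b i" v "b j"]) (simp_all add: ijk ijk[symmetric] 1 1[THEN nb_sym])

lemma th_cc:
  assumes ijk: "i \<noteq> j" "i \<noteq> k" "j \<noteq> k" and 1: "nb G u (c i)" "nb G u (c j)" "nb G v (c i)" "nb G v (c j)"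
  shows "nb G u v"
  by (rule nbI, rule C4[of u "c i" v "c j"]) (simp_all add: ijk ijk[symmetric] 1 1[THEN nb_sym])

lemma th_AD:
  assumes ijk: "i \<noteq> j" "i \<noteq> k" "j \<noteq> k" and 1: "nb G u (b i)" "nb G v (c i)" and 2: "\<not> nb G u (c i)" "\<not> nb G v (b i)"
  shows "\<not> nb G u v"
  by (rule not_nbI, rule C4[of u v "c i" "b i"]) (simp_all add: ijk ijk[symmetric] 1 1[THEN nb_sym] 2 2[THEN not_nb_sym])

lemma th_Z:
  assumes ijk: "i \<noteq> j" "i \<noteq> k" "j \<noteq> k" and 1: "\<not> nb G z a" "\<not> nb G z d" "\<not> nb G z (b j)"
    "\<not> nb G z (c j)" "\<not> nb G z (c k)" and 2: "nb G x a" and 3: "\<not> nb G x d" "\<not> nb G x (b j)" "\<not> nb G x (c j)"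
    "\<not> nb G x (c k)"
  shows "\<not> nb G z x"
  by (rule not_nbI, rule P7[of z x a "b j" "c j" d "c k"]) (simp_all add: ijk ijk[symmetric] 1 1[THEN not_nb_sym] 2 2[THEN nb_sym] 3 3[THEN not_nb_sym])

lemma th_Zd:
  assumes ijk: "i \<noteq> j" "i \<noteq> k" "j \<noteq> k" and 1: "\<not> nb G z a" "\<not> nb G z d" "\<not> nb G z (b j)"
    "\<not> nb G z (b k)" "\<not> nb G z (c j)" and 2: "nb G x d" and 3: "\<not> nb G x a" "\<not> nb G x (b j)" "\<not> nb G x (b k)"
    "\<not> nb G x (c j)"
  shows "\<not> nb G z x"
  by (rule not_nbI, rule P7[of z x d "c j" "b j" a "b k"]) (simp_all add: ijk ijk[symmetric] 1 1[THEN not_nb_sym] 2 2[THEN nb_sym] 3 3[THEN not_nb_sym])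

lemma th_N1_N2_BB:
  assumes ijk: "i \<noteq> j" "i \<noteq> k" "j \<noteq> k" and 1: "\<not> nb G x d" "\<not> nb G x (b j)" "\<not> nb G x (b k)"
    "\<not> nb G x (c k)" and 2: "nb G x (b i)" and 3: "\<not> nb G y d" "\<not> nb G y (b i)" "\<not> nb G y (b k)" "\<not> nb G y (c i)"
    "\<not> nb G y (c k)" and 4: "nb G y (b j)"
  shows "\<not> nb G x y"
proof
  assume n: "nb G x y"
  note [simp] = ijk ijk[symmetric] 1 1[THEN not_nb_sym] 2 2[THEN nb_sym] 3 3[THEN not_nb_sym] 4 4[THEN nb_sym] n n[THEN nb_sym]
  have *: "\<not> nb G x (c i)" by (rule not_nbI, rule P7[of "b j" y x "c i" d "c k" "b k"]) simp_all
  note [simp] = * *[THEN not_nb_sym]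
  show False by (rule P7[of y x "b i" "c i" d "c k" "b k"]) simp_all
qed

lemma th_N1_N2_BC:
  assumes ijk: "i \<noteq> j" "i \<noteq> k" "j \<noteq> k" and 1: "\<not> nb G x d" and 2: "nb G x (b i)" "nb G y d" and 3:
    "\<not> nb G y (b i)" "\<not> nb G y (c i)"
  shows "\<not> nb G x y"
proof
  assume n: "nb G x y"
  note [simp] = ijk ijk[symmetric] 1 1[THEN not_nb_sym] 2 2[THEN nb_sym] 3 3[THEN not_nb_sym] n n[THEN nb_sym]
  have *: "\<not> nb G x (c i)" by (rule not_nbI, rule C4[of x y d "c i"]) simp_all
  note [simp] = * *[THEN not_nb_sym]
  show False by (rule C5[of x y d "c i" "b i"]) simp_all
qed

lemma th_N1_N2_CC:
  assumes ijk: "i \<noteq> j" "i \<noteq> k" "j \<noteq> k" and 1: "\<not> nb G x a" "\<not> nb G x (b k)" "\<not> nb G x (c j)"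
    "\<not> nb G x (c k)" and 2: "nb G x (c i)" and 3: "\<not> nb G y a" "\<not> nb G y (b i)" "\<not> nb G y (b k)" "\<not> nb G y (c i)"
    "\<not> nb G y (c k)" and 4: "nb G y (c j)"
  shows "\<not> nb G x y"
proof
  assume n: "nb G x y"
  note [simp] = ijk ijk[symmetric] 1 1[THEN not_nb_sym] 2 2[THEN nb_sym] 3 3[THEN not_nb_sym] 4 4[THEN nb_sym] n n[THEN nb_sym]
  have *: "\<not> nb G x (b i)" by (rule not_nbI, rule P7[of "c j" y x "b i" a "b k" "c k"]) simp_all
  note [simp] = * *[THEN not_nb_sym]
  show False by (rule P7[of y x "c i" "b i" a "b k" "c k"]) simp_all
qed

lemma th_N_L_C:
  assumes ijk: "i \<noteq> j" "i \<noteq> k" "j \<noteq> k" and 1: "\<not> nb G q a" and 2: "nb G q (c i)" "nb G x a" and 3: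
    "\<not> nb G x (b i)" "\<not> nb G x (c i)"
  shows "\<not> nb G q x"
proof
  assume n: "nb G q x"
  note [simp] = ijk ijk[symmetric] 1 1[THEN not_nb_sym] 2 2[THEN nb_sym] 3 3[THEN not_nb_sym] n n[THEN nb_sym]
  have *: "\<not> nb G q (b i)" by (rule not_nbI, rule C4[of q x a "b i"]) simp_all
  note [simp] = * *[THEN not_nb_sym]
  show False by (rule C5[of q x a "b i" "c i"]) simp_all
qed

lemma th_N_L_B:
  assumes ijk: "i \<noteq> j" "i \<noteq> k" "j \<noteq> k" and 1: "\<not> nb G q d" and 2: "nb G q (b i)" "nb G x d" and 3:
    "\<not> nb G x (b i)" "\<not> nb G x (c i)"
  shows "\<not> nb G q x"
proof
  assume n: "nb G q x"
  note [simp] = ijk ijk[symmetric] 1 1[THEN not_nb_sym] 2 2[THEN nb_sym] 3 3[THEN not_nb_sym] n n[THEN nb_sym]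
  have *: "\<not> nb G q (c i)" by (rule not_nbI, rule C4[of q x d "c i"]) simp_all
  note [simp] = * *[THEN not_nb_sym]
  show False by (rule C5[of q x d "c i" "b i"]) simp_all
qed

lemma th_N_L_N_B:
  assumes ijk: "i \<noteq> j" "i \<noteq> k" "j \<noteq> k" and 1: "\<not> nb G q d" "\<not> nb G q (b j)" "\<not> nb G q (b k)"
    "\<not> nb G q (c j)" "\<not> nb G q (c k)" and 2: "nb G q (b i)" and 3: "\<not> nb G x d" "\<not> nb G x (b i)" "\<not> nb G x (b j)"
    "\<not> nb G x (b k)" "\<not> nb G x (c i)" "\<not> nb G x (c j)" "\<not> nb G x (c k)" "\<not> nb G y d" "\<not> nb G y (b k)"
    "\<not> nb G y (c i)" "\<not> nb G y (c k)" and 4: "nb G q x" "nb G x y" and 5: "\<not> nb G q y"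
  shows "False"
proof -
  note [simp] = ijk ijk[symmetric] 1 1[THEN not_nb_sym] 2 2[THEN nb_sym] 3 3[THEN not_nb_sym] 4 4[THEN nb_sym] 5 5[THEN not_nb_sym]
  have *: "\<not> nb G q (c i)" by (rule not_nbI, rule P7[of y x q "c i" d "c k" "b k"]) simp_all
  note [simp] = * *[THEN not_nb_sym]
  show False by (rule P7[of x q "b i" "c i" d "c j" "b j"]) simp_all
qed

lemma th_N_L_N_C:
  assumes ijk: "i \<noteq> j" "i \<noteq> k" "j \<noteq> k" and 1: "\<not> nb G q a" "\<not> nb G q (b j)" "\<not> nb G q (b k)"
    "\<not> nb G q (c j)" "\<not> nb G q (c k)" and 2: "nb G q (c i)" and 3: "\<not> nb G x a" "\<not> nb G x (b i)" "\<not> nb G x (b j)"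
    "\<not> nb G x (b k)" "\<not> nb G x (c i)" "\<not> nb G x (c j)" "\<not> nb G x (c k)" "\<not> nb G y a" "\<not> nb G y (b i)"
    "\<not> nb G y (b k)" "\<not> nb G y (c k)" and 4: "nb G q x" "nb G x y" and 5: "\<not> nb G q y"
  shows "False"
proof -
  note [simp] = ijk ijk[symmetric] 1 1[THEN not_nb_sym] 2 2[THEN nb_sym] 3 3[THEN not_nb_sym] 4 4[THEN nb_sym] 5 5[THEN not_nb_sym]
  have *: "\<not> nb G q (b i)" by (rule not_nbI, rule P7[of y x q "b i" a "b k" "c k"]) simp_all
  note [simp] = * *[THEN not_nb_sym]
  show False by (rule P7[of x q "c i" "b i" a "b j" "c j"]) simp_all
qed

lemma th_N_L_L_BB:
  assumes ijk: "i \<noteq> j" "i \<noteq> k" "j \<noteq> k" and 1: "\<not> nb G q d" "\<not> nb G q (b j)" "\<not> nb G q (c j)" and 2: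
    "nb G q (b i)" and 3: "\<not> nb G x d" "\<not> nb G x (b i)" "\<not> nb G x (b j)" "\<not> nb G x (c i)" "\<not> nb G x (c j)"
    "\<not> nb G y d" "\<not> nb G y (b j)" "\<not> nb G y (c i)" "\<not> nb G y (c j)" and 4: "nb G q x" "nb G x y" and 5:
    "\<not> nb G q y"
  shows "False"
proof -
  note [simp] = ijk ijk[symmetric] 1 1[THEN not_nb_sym] 2 2[THEN nb_sym] 3 3[THEN not_nb_sym] 4 4[THEN nb_sym] 5 5[THEN not_nb_sym]
  have *: "\<not> nb G q (c i)" by (rule not_nbI, rule P7[of y x q "c i" d "c j" "b j"]) simp_all
  note [simp] = * *[THEN not_nb_sym]
  show False by (rule P7[of x q "b i" "c i" d "c j" "b j"]) simp_all
qed

lemma th_N_L_L_BC: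
  assumes ijk: "i \<noteq> j" "i \<noteq> k" "j \<noteq> k" and 1: "\<not> nb G q d" "\<not> nb G q (b j)" "\<not> nb G q (c j)" and 2:
    "nb G q (b i)" and 3: "\<not> nb G x d" "\<not> nb G x (b i)" "\<not> nb G x (b j)" "\<not> nb G x (c j)" and 4: "nb G y d" and 5:
    "\<not> nb G y (b i)" "\<not> nb G y (b j)" "\<not> nb G y (c j)" and 6: "nb G q x" "nb G x y" and 7: "\<not> nb G q y"
  shows "False"
proof -
  note [simp] = ijk ijk[symmetric] 1 1[THEN not_nb_sym] 2 2[THEN nb_sym] 3 3[THEN not_nb_sym] 4 4[THEN nb_sym] 5 5[THEN not_nb_sym] 6
    6[THEN nb_sym] 7 7[THEN not_nb_sym]
  show False by (rule P7[of "b i" q x y d "c j" "b j"]) simp_all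
qed

lemma th_N_L_L_CC:
  assumes ijk: "i \<noteq> j" "i \<noteq> k" "j \<noteq> k" and 1: "\<not> nb G q a" "\<not> nb G q (b j)" "\<not> nb G q (c j)" and 2:
    "nb G q (c i)" and 3: "\<not> nb G x a" "\<not> nb G x (b i)" "\<not> nb G x (b j)" "\<not> nb G x (c i)" "\<not> nb G x (c j)"
    "\<not> nb G y a" "\<not> nb G y (b i)" "\<not> nb G y (b j)" "\<not> nb G y (c j)" and 4: "nb G q x" "nb G x y" and 5:
    "\<not> nb G q y"
  shows "False"
proof -
  note [simp] = ijk ijk[symmetric] 1 1[THEN not_nb_sym] 2 2[THEN nb_sym] 3 3[THEN not_nb_sym] 4 4[THEN nb_sym] 5 5[THEN not_nb_sym]
  have *: "\<not> nb G q (b i)" by (rule not_nbI, rule P7[of y x q "b i" a "b j" "c j"]) simp_all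
  note [simp] = * *[THEN not_nb_sym]
  show False by (rule P7[of x q "c i" "b i" a "b j" "c j"]) simp_all
qed

lemma th_N_L_L_CB:
  assumes ijk: "i \<noteq> j" "i \<noteq> k" "j \<noteq> k" and 1: "\<not> nb G q a" "\<not> nb G q (b j)" "\<not> nb G q (c j)" and 2:
    "nb G q (c i)" and 3: "\<not> nb G x a" "\<not> nb G x (b j)" "\<not> nb G x (c i)" "\<not> nb G x (c j)" and 4: "nb G y a" and 5:
    "\<not> nb G y (b j)" "\<not> nb G y (c i)" "\<not> nb G y (c j)" and 6: "nb G q x" "nb G x y" and 7: "\<not> nb G q y"
  shows "False"
proof -
  note [simp] = ijk ijk[symmetric] 1 1[THEN not_nb_sym] 2 2[THEN nb_sym] 3 3[THEN not_nb_sym] 4 4[THEN nb_sym] 5 5[THEN not_nb_sym] 6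
    6[THEN nb_sym] 7 7[THEN not_nb_sym]
  show False by (rule P7[of "c i" q x y a "b j" "c j"]) simp_all
qed

text \<open>\<open>AA\<close> and \<open>DD\<close> collect the alternatives to the hubs
  \<open>a\<close> and \<open>d\<close>, \<open>UU\<close> the candidates for universal vertices,
  and the components of \<open>RR\<close> will be the legs. The definitions refer to
  \<open>b\<close> and \<open>c\<close> only, so another choice of hubs leaves these sets
  unchanged.\<close>

definition AA :: "'a set" where "AA = {v \<in> verts G. \<forall>i. nb G v (b i) \<and> \<not> nb G v (c i)}"
definition DD :: "'a set" where "DD = {v \<in> verts G. \<forall>i. nb G v (c i) \<and> \<not> nb G v (b i)}"
definition UU :: "'a set" where "UU = {v \<in> verts G. \<forall>i. nb G v (c i) \<and> nb G v (b i)}"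
definition RR :: "'a set" where "RR = verts G - (AA \<union> DD \<union> UU)"

text \<open>What the clauses leave over: the trace of a hub, of a universal vertex, nothing at all,
  or one hub with feet on at most one leg.\<close>

lemma theta_types:
  defines "T \<equiv> \<lambda>v. ((\<forall>i. nb G v (b i)) \<and> (\<forall>i. nb G v (c i)) \<and> nb G v a \<and> nb G v d)
    \<or> ((\<forall>i. nb G v (b i)) \<and> (\<forall>i. \<not> nb G v (c i)) \<and> nb G v a \<and> \<not> nb G v d)
    \<or> ((\<forall>i. \<not> nb G v (b i)) \<and> (\<forall>i. nb G v (c i)) \<and> \<not> nb G v a \<and> nb G v d)
    \<or> ((\<forall>i. \<not> nb G v (b i)) \<and> (\<forall>i. \<not> nb G v (c i)) \<and> \<not> nb G v a \<and> \<not> nb G v d)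
    \<or> (nb G v a \<and> \<not> nb G v d \<and> (\<forall>i. nb G v (c i) \<longrightarrow> nb G v (b i)) \<and> (\<forall>i j. nb G v (b i) \<longrightarrow> nb G v (b j) \<longrightarrow> i = j))
    \<or> (\<not> nb G v a \<and> nb G v d \<and> (\<forall>i. nb G v (b i) \<longrightarrow> nb G v (c i)) \<and> (\<forall>i j. nb G v (c i) \<longrightarrow> nb G v (c j) \<longrightarrow> i = j))"
  shows "T v"
proof -
  define p q where "p i = nb G v (b i)" and "q i = nb G v (c i)" for i
  define e f where "e = nb G v a" and "f = nb G v d"
  note defs = p_def q_def e_def f_def
  have d3: "(0::3) \<noteq> 1" "(0::3) \<noteq> 2" "(1::3) \<noteq> 2" "(1::3) \<noteq> 0" "(2::3) \<noteq> 0" "(2::3) \<noteq> 1" by simp_all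
  have cl: "\<not> (e \<and> \<not> p i \<and> q i) \<and> \<not> (f \<and> \<not> q i \<and> p i) \<and> \<not> (\<not> e \<and> p i \<and> \<not> p j \<and> q j) \<and> \<not> (\<not> f \<and> q i \<and> \<not> q j \<and> p j)
    \<and> \<not> (\<not> e \<and> p i \<and> p j) \<and> \<not> (\<not> f \<and> q i \<and> q j) \<and> \<not> (\<not> e \<and> p i \<and> \<not> p j \<and> \<not> q j \<and> \<not> q k \<and> \<not> f)
    \<and> \<not> (\<not> f \<and> q i \<and> \<not> q j \<and> \<not> p j \<and> \<not> p k \<and> \<not> e) \<and> \<not> (e \<and> \<not> p i \<and> \<not> q i \<and> f)
    \<and> \<not> (p i \<and> p j \<and> \<not> p k \<and> \<not> q j \<and> \<not> q k \<and> \<not> f) \<and> \<not> (q i \<and> q j \<and> \<not> q k \<and> \<not> p j \<and> \<not> p k \<and> \<not> e)"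
    if ijk: "i \<noteq> j" "i \<noteq> k" "j \<noteq> k" for i j k
    unfolding defs using th_cl1[OF ijk, of v] th_cl1d[OF ijk, of v] th_cl2[OF ijk, of v] th_cl2d[OF ijk, of v]
      th_cl3[OF ijk, of v] th_cl3d[OF ijk, of v] th_cl4[OF ijk, of v] th_cl4d[OF ijk, of v] th_cl5[OF ijk, of v]
      th_cl6[OF ijk, of v] th_cl6d[OF ijk, of v] by blast
  have "T v \<longleftrightarrow> ((\<forall>i. p i) \<and> (\<forall>i. q i) \<and> e \<and> f)
    \<or> ((\<forall>i. p i) \<and> (\<forall>i. \<not> q i) \<and> e \<and> \<not> f)
    \<or> ((\<forall>i. \<not> p i) \<and> (\<forall>i. q i) \<and> \<not> e \<and> f)
    \<or> ((\<forall>i. \<not> p i) \<and> (\<forall>i. \<not> q i) \<and> \<not> e \<and> \<not> f)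
    \<or> (e \<and> \<not> f \<and> (\<forall>i. q i \<longrightarrow> p i) \<and> (\<forall>i j. p i \<longrightarrow> p j \<longrightarrow> i = j))
    \<or> (\<not> e \<and> f \<and> (\<forall>i. p i \<longrightarrow> q i) \<and> (\<forall>i j. q i \<longrightarrow> q j \<longrightarrow> i = j))"
    unfolding T_def defs ..
  \<comment> \<open>The clauses speak about ordered triples of distinct legs; all six orderings are
    supplied, after which the claim is propositional.\<close>
  moreover have "\<dots>"
    using cl[OF d3(1,2,3)] cl[OF d3(2,1,6)] cl[OF d3(4,3,2)] cl[OF d3(3,4,5)] cl[OF d3(5,6,1)] cl[OF d3(6,5,4)]
    unfolding all_3 by (simp add: d3) argo
  ultimately show ?thesis by blast
qed

text \<open>Positions of a vertex of \<open>RR\<close>: \<open>idxB i\<close> and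
  \<open>idxC i\<close> place it on leg \<open>i\<close>, \<open>leafA\<close> and
  \<open>leafD\<close> mean that it sees a hub but no foot, and \<open>far\<close> that it sees
  nothing of the theta. Leaves may still belong to a leg through other vertices.\<close>

definition idxB :: "3 \<Rightarrow> 'a \<Rightarrow> bool" where
  "idxB i x \<longleftrightarrow> nb G x a \<and> \<not> nb G x d \<and> nb G x (b i) \<and> (\<forall>m. m \<noteq> i \<longrightarrow> \<not> nb G x (b m) \<and> \<not> nb G x (c m))"
definition idxC :: "3 \<Rightarrow> 'a \<Rightarrow> bool" where
  "idxC i x \<longleftrightarrow> nb G x d \<and> \<not> nb G x a \<and> nb G x (c i) \<and> (\<forall>m. m \<noteq> i \<longrightarrow> \<not> nb G x (b m) \<and> \<not> nb G x (c m))"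
definition leafA :: "'a \<Rightarrow> bool" where
  "leafA x \<longleftrightarrow> nb G x a \<and> \<not> nb G x d \<and> (\<forall>m. \<not> nb G x (b m) \<and> \<not> nb G x (c m))"
definition leafD :: "'a \<Rightarrow> bool" where
  "leafD x \<longleftrightarrow> nb G x d \<and> \<not> nb G x a \<and> (\<forall>m. \<not> nb G x (b m) \<and> \<not> nb G x (c m))"
definition far :: "'a \<Rightarrow> bool" where
  "far x \<longleftrightarrow> \<not> nb G x d \<and> \<not> nb G x a \<and> (\<forall>m. \<not> nb G x (b m) \<and> \<not> nb G x (c m))"

lemmas idx_defs = idxB_def idxC_def leafA_def leafD_def far_def

lemma RR_types:
  assumes "x \<in> RR"
  shows "(\<exists>i. idxB i x) \<or> (\<exists>i. idxC i x) \<or> leafA x \<or> leafD x \<or> far x"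
proof -
  have n: "x \<in> verts G" "\<not> (\<forall>i. nb G x (b i) \<and> \<not> nb G x (c i))" "\<not> (\<forall>i. nb G x (c i) \<and> \<not> nb G x (b i))"
    "\<not> (\<forall>i. nb G x (c i) \<and> nb G x (b i))"
    using assms unfolding RR_def AA_def DD_def UU_def by auto
  consider "nb G x a \<and> \<not> nb G x d \<and> (\<forall>i. nb G x (c i) \<longrightarrow> nb G x (b i)) \<and> (\<forall>i j. nb G x (b i) \<longrightarrow> nb G x (b j) \<longrightarrow> i = j)"
    | "\<not> nb G x a \<and> nb G x d \<and> (\<forall>i. nb G x (b i) \<longrightarrow> nb G x (c i)) \<and> (\<forall>i j. nb G x (c i) \<longrightarrow> nb G x (c j) \<longrightarrow> i = j)"
    | "far x"
    using theta_types[of x] n unfolding far_def by blast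
  then show ?thesis
  proof cases
    case 1
    show ?thesis
    proof (cases "\<exists>i. nb G x (b i)")
      case True
      then obtain i where "nb G x (b i)" by blast
      then have "idxB i x" using 1 unfolding idxB_def by blast
      then show ?thesis by blast
    next
      case False
      then have "leafA x" using 1 unfolding leafA_def by blast
      then show ?thesis by blast
    qed
  next
    case 2
    show ?thesis
    proof (cases "\<exists>i. nb G x (c i)")
      case True
      then obtain i where "nb G x (c i)" by blast
      then have "idxC i x" using 2 unfolding idxC_def by blast
      then show ?thesis by blast
    next
      case False
      then have "leafD x" using 2 unfolding leafD_def by blast
      then show ?thesis by blast
    qed
  next
    case 3 then show ?thesis by blast
  qed
qed

lemma third: "\<exists>k :: 3. i \<noteq> k \<and> j \<noteq> k"
proof -
  have "\<forall>i j :: 3. \<not> (\<forall>k. \<not> (i \<noteq> k \<and> j \<noteq> k))" unfolding all_3 by simp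
  then show ?thesis by blast
qed

lemma obtain_indices:
  obtains j k :: 3 where "i \<noteq> j" "i \<noteq> k" "j \<noteq> k"
  using third[of i i] third[of i] by metis

lemma idx_far:
  assumes "idxB i x \<or> idxC i x \<or> leafA x \<or> leafD x" "far z"
  shows "\<not> nb G z x"
proof -
  obtain j k where ijk: "i \<noteq> j" "i \<noteq> k" "j \<noteq> k" using obtain_indices by blast
  show ?thesis using assms th_Z[OF ijk, of z x] th_Zd[OF ijk, of z x] ijk unfolding idx_defs by metis
qed

lemma idx_idx:
  assumes "idxB i x \<or> idxC i x" "idxB j y \<or> idxC j y" "i \<noteq> j"
  shows "\<not> nb G x y"
proof -
  obtain k where ijk: "i \<noteq> j" "i \<noteq> k" "j \<noteq> k" using third assms(3) by blast
  have jik: "j \<noteq> i" "j \<noteq> k" "i \<noteq> k" using ijk by auto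
  have BC: "\<not> nb G x y" if "idxB i x" "idxC j y" "i \<noteq> j" "i \<noteq> k" "j \<noteq> k" for i j x y
    using that th_N1_N2_BC[OF that(3-5), of x y] unfolding idx_defs by simp
  have BB: "\<not> nb G x y" if "idxB i x" "idxB j y"
    using that ijk th_N1_N2_BB[OF ijk, of x y] unfolding idx_defs by simp
  have CC: "\<not> nb G x y" if "idxC i x" "idxC j y"
    using that ijk th_N1_N2_CC[OF ijk, of x y] unfolding idx_defs by simp
  show ?thesis using assms BB CC BC[of i x j y] BC[of j y i x] ijk jik not_nb_sym[of G y x] by blast
qed

text \<open>A leaf attached to \<open>q\<close> on leg \<open>i\<close> leads neither to another leg
  nor to a leaf that \<open>q\<close> does not see. Leaves therefore build no bridge between
  different legs.\<close>

lemma leaf_step: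
  assumes q: "idxB i q \<or> idxC i q" and x: "leafA x \<or> leafD x" and qx: "nb G q x"
    and y: "idxB j y \<or> idxC j y \<or> leafA y \<or> leafD y" and ij: "i \<noteq> j" and qy: "\<not> nb G q y"
  shows "\<not> nb G x y"
proof
  assume xy: "nb G x y"
  obtain k where ijk: "i \<noteq> j" "i \<noteq> k" "j \<noteq> k" using third ij by blast
  show False
  proof (cases "idxB i q")
    case q: True
    then have x: "leafA x" using x qx th_N_L_B[OF ijk, of q x] ijk unfolding idx_defs by auto
    consider "idxB j y" | "idxC j y" | "leafA y" | "leafD y" using y by blast
    then show False
    proof cases
      case 1 then show False using q x xy qx qy th_N_L_N_B[OF ijk, of q x y] ijk unfolding idx_defs by simp
    next
      case 2
      have jik: "j \<noteq> i" "j \<noteq> k" "i \<noteq> k" using ijk by auto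
      show False using 2 q x nb_sym[OF xy] th_N_L_C[OF jik, of y x] jik unfolding idx_defs by simp
    next
      case 3 then show False using q x xy qx qy th_N_L_L_BB[OF ijk, of q x y] ijk unfolding idx_defs by simp
    next
      case 4 then show False using q x xy qx qy th_N_L_L_BC[OF ijk, of q x y] ijk unfolding idx_defs by simp
    qed
  next
    case False
    then have q: "idxC i q" using q by blast
    then have x: "leafD x" using x qx th_N_L_C[OF ijk, of q x] ijk unfolding idx_defs by auto
    consider "idxB j y" | "idxC j y" | "leafA y" | "leafD y" using y by blast
    then show False
    proof cases
      case 2 then show False using q x xy qx qy th_N_L_N_C[OF ijk, of q x y] ijk unfolding idx_defs by simp
    next
      case 1
      have jik: "j \<noteq> i" "j \<noteq> k" "i \<noteq> k" using ijk by auto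
      show False using 1 q x nb_sym[OF xy] th_N_L_B[OF jik, of y x] jik unfolding idx_defs by simp
    next
      case 4 then show False using q x xy qx qy th_N_L_L_CC[OF ijk, of q x y] ijk unfolding idx_defs by simp
    next
      case 3 then show False using q x xy qx qy th_N_L_L_CB[OF ijk, of q x y] ijk unfolding idx_defs by simp
    qed
  qed
qed

lemma bc_RR: "b i \<in> RR" "c i \<in> RR" "idxB i (b i)" "idxC i (c i)"
proof -
  obtain j where j: "i \<noteq> j" using obtain_indices by blast
  have "b i \<in> verts G" "c i \<in> verts G" using nb_verts[OF simple, of a "b i"] nb_verts[OF simple, of d "c i"] theta(4,5,6,7)
    by (metis nb_refl theta(1,2) j)+
  then show "b i \<in> RR" "c i \<in> RR" using j unfolding RR_def AA_def DD_def UU_def by auto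
  show "idxB i (b i)" "idxC i (c i)" unfolding idx_defs by auto
qed

text \<open>The vertices on leg \<open>i\<close> and the leaves hanging directly on them are closed
  under adjacency within \<open>K\<close>, so they exhaust \<open>K\<close>, and no foot of another
  leg is among them.\<close>

lemma component_index:
  assumes K: "K \<subseteq> RR"
    "\<And>S s. \<lbrakk>S \<subseteq> K; s \<in> S; \<And>x y. x \<in> S \<Longrightarrow> y \<in> K \<Longrightarrow> nb G x y \<Longrightarrow> y \<in> S\<rbrakk> \<Longrightarrow> S = K"
    and bi: "b i \<in> K \<or> c i \<in> K" and bj: "b j \<in> K \<or> c j \<in> K"
  shows "i = j"
proof (rule ccontr)
  assume ij: "i \<noteq> j"
  define S where "S = {x \<in> K. idxB i x \<or> idxC i x \<or> ((leafA x \<or> leafD x) \<and> (\<exists>q. (idxB i q \<or> idxC i q) \<and> nb G q x))}"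
  obtain s where s: "s \<in> S" using bi bc_RR unfolding S_def by blast
  have cl: "y \<in> S" if xy: "x \<in> S" "y \<in> K" "nb G x y" for x y
  proof -
    have ty: "(\<exists>i. idxB i y) \<or> (\<exists>i. idxC i y) \<or> leafA y \<or> leafD y \<or> far y" using RR_types K(1) xy(2) by blast
    have nf: "\<not> far y" using idx_far[of i x y] xy nb_sym[OF xy(3)] unfolding S_def by blast
    show ?thesis
    proof (cases "idxB i x \<or> idxC i x")
      case True
      then show ?thesis using ty nf idx_idx[OF True] xy unfolding S_def by blast
    next
      case False
      then obtain q where q: "idxB i q \<or> idxC i q" "nb G q x" and x: "leafA x \<or> leafD x" using xy unfolding S_def by blast
      obtain m where m: "i \<noteq> m" using ij by blast
      show ?thesis
      proof (rule ccontr)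
        assume "y \<notin> S"
        then have qy: "\<not> ((leafA y \<or> leafD y) \<and> nb G q y)" "\<not> idxB i y" "\<not> idxC i y" using q xy(2) unfolding S_def by blast+
        then consider n where "idxB n y \<or> idxC n y" "n \<noteq> i" | "leafA y \<or> leafD y" using ty nf by blast
        then show False
        proof cases
          case 1
          then have "\<not> nb G q y" using idx_idx[OF q(1), of n y] by blast
          then show False using leaf_step[OF q(1) x q(2), of n y] 1 xy(3) by blast
        next
          case 2
          then show False using leaf_step[OF q(1) x q(2) _ m, of y] qy xy(3) by blast
        qed
      qed
    qed
  qed
  have "S = K" by (rule K(2)[OF _ s cl]) (auto simp: S_def)
  then have "b j \<in> S \<or> c j \<in> S" using bj by blast
  then show False using ij unfolding S_def idx_defs by auto
qed

end

lemma nested_hd: "nested f xs \<Longrightarrow> x \<in> set xs \<Longrightarrow> f x \<subseteq> f (hd xs)"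
  unfolding nested_def by (cases xs) auto

lemma no_clique_cutset_obtain:
  assumes "atom_graph G" "K \<subseteq> verts G" "K \<noteq> {}" "v \<in> verts G" "v \<notin> K" "\<forall>k\<in>K. \<not> nb G v k"
  obtains x y k l where "x \<in> verts G" "x \<notin> K" "y \<in> verts G" "y \<notin> K" "\<not> nb G x y" "k \<in> K" "nb G x k" "l \<in> K" "nb G y l"
proof -
  from atom_graph.no_clique_cutset[OF assms] obtain x y
    where xy: "x \<in> verts G - K" "y \<in> verts G - K" "\<not> nb G x y \<and> (\<exists>k\<in>K. nb G x k) \<and> (\<exists>k\<in>K. nb G y k)"
    by (elim bexE)
  from xy(3) obtain k l where "k \<in> K" "nb G x k" "l \<in> K" "nb G y l" by (elim conjE bexE)
  then show thesis using that[of x y k l] xy by simp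
qed

section \<open>The two sides of a component\<close>

context atom_no_C7
begin

text \<open>Vertices of \<open>B\<close> without a neighbour in \<open>C\<close> would form
  components whose attachments are a clique. \<open>Q\<close> stands for the outside vertices that
  see \<open>B\<close>; it is a clique and complete to the part of \<open>B\<close> that does have
  neighbours in \<open>C\<close>.\<close>

lemma side_cover:
  assumes p: "nb G a b" "nb G b c" "nb G c d" "\<not> nb G a c" "\<not> nb G a d" "\<not> nb G b d"
    and V: "B \<subseteq> verts G"
    and B: "\<And>y. y \<in> B \<Longrightarrow> nb G y a \<and> \<not> nb G y b \<and> \<not> nb G y c \<and> \<not> nb G y d"
    and C: "\<And>e. e \<in> C \<Longrightarrow> \<not> nb G e a \<and> \<not> nb G e b \<and> \<not> nb G e c \<and> nb G e d"
    and nbrs: "\<And>x y. y \<in> B \<Longrightarrow> x \<in> verts G \<Longrightarrow> nb G x y \<Longrightarrow> x \<in> B \<or> x \<in> C \<or> x \<in> Q"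
    and Q: "\<And>x y. x \<in> Q \<Longrightarrow> y \<in> Q \<Longrightarrow> nb G x y"
    and QB: "\<And>q y e. q \<in> Q \<Longrightarrow> y \<in> B \<Longrightarrow> e \<in> C \<Longrightarrow> nb G e y \<Longrightarrow> nb G q y"
    and y: "y \<in> B"
  shows "\<exists>e\<in>C. nb G e y"
proof (rule ccontr)
  assume ny: "\<not> (\<exists>e\<in>C. nb G e y)"
  define Z where "Z = {y \<in> B. \<forall>e\<in>C. \<not> nb G e y}"
  have yZ: "y \<in> Z" using y ny by (auto simp: Z_def)
  obtain M where M: "y \<in> M" "M \<subseteq> Z" "\<And>x y. x \<in> M \<Longrightarrow> y \<in> Z \<Longrightarrow> nb G x y \<Longrightarrow> y \<in> M"
    "\<And>S s. \<lbrakk>S \<subseteq> M; s \<in> S; \<And>x y. x \<in> S \<Longrightarrow> y \<in> M \<Longrightarrow> nb G x y \<Longrightarrow> y \<in> S\<rbrakk> \<Longrightarrow> S = M"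
    using nb_component[OF yZ, of G thesis] by blast
  have ZB: "Z \<subseteq> B" by (auto simp: Z_def)
  have "c \<noteq> d" using p by auto
  then have dV: "d \<in> verts G" using nb_verts[OF simple p(3)] by blast
  have MB: "M \<subseteq> B" using M(2) ZB by blast
  have dM: "d \<notin> M" "\<forall>k\<in>M. \<not> nb G d k"
  proof -
    show "d \<notin> M" using B[of d] MB by auto
    show "\<forall>k\<in>M. \<not> nb G d k"
    proof
      fix k assume "k \<in> M"
      then have "\<not> nb G k d" using B MB by blast
      then show "\<not> nb G d k" by (rule not_nb_sym)
    qed
  qed
  obtain x z k l where xz: "x \<in> verts G" "x \<notin> M" "z \<in> verts G" "z \<notin> M" "\<not> nb G x z" "k \<in> M" "nb G x k" "l \<in> M" "nb G z l"
  proof -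
    have "M \<subseteq> verts G" "M \<noteq> {}" using MB V M(1) by auto
    from no_clique_cutset_obtain[OF atom_graph_axioms this dV dM] show thesis using that by blast
  qed
  have cl: "w \<in> B - Z \<or> w \<in> Q" if "w \<in> verts G" "w \<notin> M" "k \<in> M" "nb G w k" for w k
  proof -
    have "k \<in> B" "k \<in> Z" using that M(2) ZB by auto
    then have "w \<in> B \<or> w \<in> C \<or> w \<in> Q" "w \<notin> C" using nbrs[of k w] that by (auto simp: Z_def)
    moreover have "w \<notin> Z" using M(3)[of k w] nb_sym[OF that(4)] that by blast
    ultimately show ?thesis by blast
  qed
  have xQ: "x \<in> B - Z \<or> x \<in> Q" and zQ: "z \<in> B - Z \<or> z \<in> Q" using cl xz by blast+
  \<comment> \<open>A nonadjacent pair of attachments cannot involve \<open>Q\<close>, which is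
    complete to itself and to \<open>B - Z\<close>; so both have neighbours in
    \<open>C\<close>.\<close>
  have "x \<in> B - Z" "z \<in> B - Z"
  proof -
    have QZ: "nb G q w" if "q \<in> Q" "w \<in> B - Z" for q w using that QB[of q w] by (auto simp: Z_def)
    show "x \<in> B - Z" using xQ zQ xz(5) Q[of x z] QZ[of x z] by blast
    show "z \<in> B - Z" using xQ zQ xz(5) Q[of x z] QZ[of z x] nb_sym[of G z x] by blast
  qed
  then obtain e f where e: "e \<in> C" "nb G e x" "x \<in> B" and f: "f \<in> C" "nb G f z" "z \<in> B" by (auto simp: Z_def)
  have ez: "\<not> nb G e z" using pa_common[OF p, where y = x and z = z and e = e] B[OF e(3)] B[OF f(3)] C[OF e(1)] e f xz(5) by blast
  have fx: "\<not> nb G f x" using pa_common[OF p, where y = x and z = z and e = f] B[OF e(3)] B[OF f(3)] C[OF f(1)] e f xz(5) by blast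
  have ef: "\<not> nb G e f" using pa_cross[OF p, where y = x and z = z and e = e and f = f] B[OF e(3)] B[OF f(3)] C[OF e(1)] C[OF f(1)] e f ez fx xz(5) by blast
  have MN: "nb G m a \<and> \<not> nb G m b \<and> \<not> nb G m c \<and> \<not> nb G m d \<and> \<not> nb G m e \<and> \<not> nb G m f" if "m \<in> M" for m
    using B[of m] that M(2) ZB e(1) f(1) not_nb_sym[of G e m] not_nb_sym[of G f m] by (auto simp: Z_def)
  have mid: False if "m \<in> M" "nb G m x" "nb G m z" for m
    using pa_mid[OF p, where y = x and z = z and f = f and m = m] B[OF e(3)] B[OF f(3)] C[OF e(1)] C[OF f(1)] MN[OF that(1)] that(2,3) e f ez fx ef xz(5)
    by blast
  \<comment> \<open>Adjacency to \<open>x\<close> spreads over all of \<open>M\<close> and reaches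
    \<open>l\<close>, which then sees both \<open>x\<close> and \<open>z\<close>; this is what
    \<open>mid\<close> excludes.\<close>
  define S where "S = {m \<in> M. nb G m x}"
  have "S = M"
  proof (rule M(4)[of S k])
    show "S \<subseteq> M" by (auto simp: S_def)
    show "k \<in> S" using xz nb_sym by (auto simp: S_def)
    fix m n assume mn: "m \<in> S" "n \<in> M" "nb G m n"
    then have "m \<in> M" "nb G m x" by (auto simp: S_def)
    then show "n \<in> S" using pa_step[OF p, where y = x and e = e and m = m and n = n] B[OF e(3)] B[OF f(3)] C[OF e(1)] C[OF f(1)] MN[of m] MN[of n] mid[of m]
        mn e f ez fx ef xz(5) unfolding S_def by blast
  qed
  then have "l \<in> S" using xz by blast
  then show False using mid[of l] xz(8) nb_sym[OF xz(9)] unfolding S_def by blast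
qed

text \<open>\<open>B\<close> contains no induced path on three vertices, and different cliques of
  \<open>B\<close> cannot be joined through \<open>C\<close> because of \<open>pa_cross\<close>.
  Connectivity of \<open>B\<close> together with \<open>C\<close> leaves a single clique.\<close>

lemma side_clique:
  assumes p: "nb G a b" "nb G b c" "nb G c d" "\<not> nb G a c" "\<not> nb G a d" "\<not> nb G b d"
    and B: "\<And>y. y \<in> B \<Longrightarrow> nb G y a \<and> \<not> nb G y b \<and> \<not> nb G y c \<and> \<not> nb G y d"
    and C: "\<And>e. e \<in> C \<Longrightarrow> \<not> nb G e a \<and> \<not> nb G e b \<and> \<not> nb G e c \<and> nb G e d"
    and BC: "\<And>y. y \<in> B \<Longrightarrow> \<exists>e\<in>C. nb G e y" and CB: "\<And>e. e \<in> C \<Longrightarrow> \<exists>y\<in>B. nb G e y"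
    and conn: "\<And>S s. \<lbrakk>S \<subseteq> B \<union> C; s \<in> S; \<And>x y. x \<in> S \<Longrightarrow> y \<in> B \<union> C \<Longrightarrow> nb G x y \<Longrightarrow> y \<in> S\<rbrakk> \<Longrightarrow> S = B \<union> C"
    and yz: "y \<in> B" "z \<in> B"
  shows "nb G y z"
proof (rule ccontr)
  assume nyz: "\<not> nb G y z"
  have com: "nb G y z" if "y \<in> B" "z \<in> B" "e \<in> C" "nb G e y" "nb G e z" for y z e
    using pa_common[OF p, where y = y and z = z and e = e] B[OF that(1)] B[OF that(2)] C[OF that(3)] that by blast
  have cross: "\<not> nb G e f" if "y \<in> B" "z \<in> B" "\<not> nb G y z" "e \<in> C" "f \<in> C" "nb G e y" "nb G f z" for y z e f
    using pa_cross[OF p, where y = y and z = z and e = e and f = f] B[OF that(1)] B[OF that(2)] C[OF that(4)] C[OF that(5)] com[of y z e] com[of y z f] that by blast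
  have P3: "nb G y z" if P: "y \<in> B" "m \<in> B" "z \<in> B" "nb G m y" "nb G m z" for y z m
  proof (rule ccontr)
    assume n: "\<not> nb G y z"
    obtain e f where ef: "e \<in> C" "nb G e y" "f \<in> C" "nb G f z" using BC P(1,3) by blast
    show False
      using pa_P3[OF p, where y = y and z = z and e = e and f = f and m = m] B[OF P(1)] B[OF P(2)] B[OF P(3)] C[OF ef(1)] C[OF ef(3)] com[of y z e] com[of y z f]
        cross[of y z e f] P ef n by blast
  qed
  \<comment> \<open>\<open>Y\<close> is the clique of \<open>y\<close> within \<open>B\<close>, and
    \<open>S\<close> adds what it sees in \<open>C\<close>. No edge leaves \<open>S\<close>, so
    \<open>S\<close> is everything and contains \<open>z\<close>.\<close>
  define Y where "Y = {w \<in> B. nb G w y}"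
  define S where "S = Y \<union> {e \<in> C. \<exists>w\<in>Y. nb G e w}"
  have "S = B \<union> C"
  proof (rule conn[of S y])
    show "S \<subseteq> B \<union> C" by (auto simp: S_def Y_def)
    show "y \<in> S" using yz by (auto simp: S_def Y_def)
    fix x w assume x: "x \<in> S" and w: "w \<in> B \<union> C" and xw: "nb G x w"
    have YY: "v \<in> Y" if "u \<in> Y" "v \<in> B" "nb G u v" for u v
      using P3[of v u y] that yz by (auto simp: Y_def)
    show "w \<in> S"
    proof (cases "x \<in> Y")
      case True
      then show ?thesis using YY[of x w] w xw nb_sym[OF xw] unfolding S_def by blast
    next
      case False
      then obtain u where u: "x \<in> C" "u \<in> Y" "nb G x u" using x by (auto simp: S_def)
      have uB: "u \<in> B" using u by (auto simp: Y_def)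
      show ?thesis
      proof (cases "w \<in> B")
        case True
        then show ?thesis using com[OF uB True u(1,3) xw] YY[OF u(2) True] by (auto simp: S_def)
      next
        case False
        then have wC: "w \<in> C" using w by blast
        then obtain v where v: "v \<in> B" "nb G w v" using CB by blast
        show ?thesis
        proof (rule ccontr)
          assume n: "w \<notin> S"
          then have "v \<notin> Y" using v wC by (auto simp: S_def)
          then have "\<not> nb G u v" using YY[OF u(2) v(1)] by blast
          then show False using cross[OF uB v(1) _ u(1) wC u(3) v(2)] xw by blast
        qed
      qed
    qed
  qed
  then have "z \<in> S" using yz by blast
  then have "z \<in> Y \<or> z \<in> C" by (auto simp: S_def)
  then show False using nyz nb_sym[of G z y] B[OF yz(2)] C[of z] by (auto simp: Y_def)
qed

end

section \<open>Hubs, legs and the lantern\<close>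

context theta_graph
begin

lemma AA_types: "x \<in> AA \<Longrightarrow> nb G x a \<and> \<not> nb G x d" and DD_types: "x \<in> DD \<Longrightarrow> nb G x d \<and> \<not> nb G x a"
  and UU_types: "x \<in> UU \<Longrightarrow> nb G x a \<and> nb G x d"
proof -
  \<comment> \<open>Rules out those disjuncts of \<open>theta_types\<close> in which feet of at most
    one leg are seen.\<close>
  have n: "\<not> (\<forall>i j :: 3. i = j)" by (metis zero_neq_one)
  show "x \<in> AA \<Longrightarrow> nb G x a \<and> \<not> nb G x d" using theta_types[of x] n unfolding AA_def by (elim disjE) auto
  show "x \<in> DD \<Longrightarrow> nb G x d \<and> \<not> nb G x a" using theta_types[of x] n unfolding DD_def by (elim disjE) auto
  show "x \<in> UU \<Longrightarrow> nb G x a \<and> nb G x d" using theta_types[of x] n unfolding UU_def by (elim disjE) auto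
qed

lemma ad_mem: "a \<in> AA" "d \<in> DD"
proof -
  have "a \<noteq> b 0" "d \<noteq> c 0" using theta(1)[of 0 1] theta(2)[of 0 1] theta(4)[of 1] theta(5)[of 1] by (auto simp del: theta)
  then have "a \<in> verts G" "d \<in> verts G" using nb_verts[OF simple theta(4)] nb_verts[OF simple theta(5)] by blast+
  then show "a \<in> AA" "d \<in> DD" unfolding AA_def DD_def by auto
qed

lemma hub_adj:
  shows "x \<in> AA \<Longrightarrow> y \<in> AA \<Longrightarrow> nb G x y" "x \<in> DD \<Longrightarrow> y \<in> DD \<Longrightarrow> nb G x y" "x \<in> UU \<Longrightarrow> y \<in> UU \<Longrightarrow> nb G x y"
    "x \<in> UU \<Longrightarrow> y \<in> AA \<Longrightarrow> nb G x y" "x \<in> UU \<Longrightarrow> y \<in> DD \<Longrightarrow> nb G x y" "x \<in> AA \<Longrightarrow> y \<in> DD \<Longrightarrow> \<not> nb G x y"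
proof -
  obtain j k :: 3 where ijk: "0 \<noteq> j" "0 \<noteq> k" "j \<noteq> k" using obtain_indices by blast
  note 1 = th_bb[OF ijk, of x y] and 2 = th_cc[OF ijk, of x y] and 3 = th_AD[OF ijk, of x y]
  show "x \<in> AA \<Longrightarrow> y \<in> AA \<Longrightarrow> nb G x y" using 1 unfolding AA_def by blast
  show "x \<in> DD \<Longrightarrow> y \<in> DD \<Longrightarrow> nb G x y" using 2 unfolding DD_def by blast
  show "x \<in> UU \<Longrightarrow> y \<in> UU \<Longrightarrow> nb G x y" using 1 unfolding UU_def by blast
  show "x \<in> UU \<Longrightarrow> y \<in> AA \<Longrightarrow> nb G x y" using 1 unfolding UU_def AA_def by blast
  show "x \<in> UU \<Longrightarrow> y \<in> DD \<Longrightarrow> nb G x y" using 2 unfolding UU_def DD_def by blast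
  show "x \<in> AA \<Longrightarrow> y \<in> DD \<Longrightarrow> \<not> nb G x y" using 3 unfolding AA_def DD_def by blast
qed

text \<open>Any member of \<open>AA\<close> and of \<open>DD\<close> can serve as hubs. As
  \<open>RR\<close> depends only on \<open>b\<close> and \<open>c\<close>, its components remain the
  same, and statements about \<open>a\<close> and \<open>d\<close> transfer to all of
  \<open>AA\<close> and \<open>DD\<close>.\<close>

lemma theta_replace:
  assumes "x \<in> AA" "y \<in> DD"
  shows "theta_graph G x y b c"
proof
  show "nb G (b i) (b j) \<longleftrightarrow> i = j" "nb G (c i) (c j) \<longleftrightarrow> i = j" "nb G (b i) (c j) \<longleftrightarrow> i = j" for i j
    by simp_all
  show "nb G x (b i)" "\<not> nb G x (c i)" "nb G y (c i)" "\<not> nb G y (b i)" for i using assms unfolding AA_def DD_def by blast+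
  show "\<not> nb G x y" using hub_adj(6)[OF assms] .
qed

definition comp_RR :: "'a set \<Rightarrow> bool" where
  "comp_RR K \<longleftrightarrow> K \<noteq> {} \<and> K \<subseteq> RR \<and> (\<forall>x\<in>K. \<forall>y\<in>RR. nb G x y \<longrightarrow> y \<in> K) \<and>
     (\<forall>S s. S \<subseteq> K \<longrightarrow> s \<in> S \<longrightarrow> (\<forall>x\<in>S. \<forall>y\<in>K. nb G x y \<longrightarrow> y \<in> S) \<longrightarrow> S = K)"

lemma comp_RRD:
  assumes "comp_RR K"
  shows "K \<noteq> {}" "K \<subseteq> RR" "x \<in> K \<Longrightarrow> y \<in> RR \<Longrightarrow> nb G x y \<Longrightarrow> y \<in> K"
    "\<lbrakk>S \<subseteq> K; s \<in> S; \<And>x y. x \<in> S \<Longrightarrow> y \<in> K \<Longrightarrow> nb G x y \<Longrightarrow> y \<in> S\<rbrakk> \<Longrightarrow> S = K"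
proof -
  from assms have K: "K \<noteq> {}" "K \<subseteq> RR" "\<forall>x\<in>K. \<forall>y\<in>RR. nb G x y \<longrightarrow> y \<in> K"
    "\<forall>S s. S \<subseteq> K \<longrightarrow> s \<in> S \<longrightarrow> (\<forall>x\<in>S. \<forall>y\<in>K. nb G x y \<longrightarrow> y \<in> S) \<longrightarrow> S = K"
    unfolding comp_RR_def by simp_all
  show "K \<noteq> {}" "K \<subseteq> RR" by fact+
  show "x \<in> K \<Longrightarrow> y \<in> RR \<Longrightarrow> nb G x y \<Longrightarrow> y \<in> K" using K(3) by blast
  show "\<lbrakk>S \<subseteq> K; s \<in> S; \<And>x y. x \<in> S \<Longrightarrow> y \<in> K \<Longrightarrow> nb G x y \<Longrightarrow> y \<in> S\<rbrakk> \<Longrightarrow> S = K"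
    by (rule K(4)[rule_format])
qed

text \<open>A \<open>far\<close> vertex has only \<open>far\<close> neighbours in \<open>RR\<close>,
  so one of them makes the whole component \<open>far\<close>. In its absence, each remaining type
  sees exactly one of the two hubs.\<close>

lemma comp_ad:
  assumes K: "comp_RR K"
  shows "(\<forall>k\<in>K. \<not> nb G k a \<and> \<not> nb G k d) \<or> (\<forall>k\<in>K. nb G k a \<longleftrightarrow> \<not> nb G k d)"
proof (cases "\<exists>s\<in>K. far s")
  case True
  then obtain s where s: "s \<in> K" "far s" by blast
  have "{k \<in> K. far k} = K"
  proof (rule comp_RRD(4)[OF K, of _ s])
    show "{k \<in> K. far k} \<subseteq> K" "s \<in> {k \<in> K. far k}" using s by auto
    fix x y assume "x \<in> {k \<in> K. far k}" "y \<in> K" "nb G x y"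
    then show "y \<in> {k \<in> K. far k}" using idx_far[of _ y x] RR_types[of y] comp_RRD(2)[OF K] by blast
  qed
  then show ?thesis unfolding far_def by blast
next
  case False
  have "nb G k a \<longleftrightarrow> \<not> nb G k d" if "k \<in> K" for k
    using RR_types[of k] that False comp_RRD(2)[OF K] unfolding idx_defs by blast
  then show ?thesis by blast
qed

lemma comp_hubs:
  assumes K: "comp_RR K" and "x \<in> AA" "y \<in> DD"
  shows "(\<forall>k\<in>K. \<not> nb G k x \<and> \<not> nb G k y) \<or> (\<forall>k\<in>K. nb G k x \<longleftrightarrow> \<not> nb G k y)"
proof -
  interpret t: theta_graph G x y b c using assms(2,3) by (rule theta_replace)
  show ?thesis using t.comp_ad[OF K] .
qed

text \<open>By \<open>component_index\<close> a component meets at most one leg of the theta, so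
  another leg is missed by it altogether. That leg supplies the outside vertex for the cutset
  argument and the path for \<open>side_cover\<close>.\<close>

lemma comp_avoid:
  assumes K: "comp_RR K"
  obtains j where "b j \<notin> K" "c j \<notin> K" "\<And>k. k \<in> K \<Longrightarrow> \<not> nb G k (b j) \<and> \<not> nb G k (c j)"
proof -
  obtain i j :: 3 where ij: "i \<noteq> j" using obtain_indices by blast
  have "i = j" if 1: "b i \<in> K \<or> c i \<in> K" and 2: "b j \<in> K \<or> c j \<in> K"
  proof (rule component_index[OF comp_RRD(2)[OF K] _ 1 2])
    fix S s assume "S \<subseteq> K" "s \<in> S" "\<And>x y. x \<in> S \<Longrightarrow> y \<in> K \<Longrightarrow> nb G x y \<Longrightarrow> y \<in> S"
    then show "S = K" by (rule comp_RRD(4)[OF K])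
  qed
  then obtain j where j: "b j \<notin> K" "c j \<notin> K" using ij by blast
  then have "\<not> nb G k (b j) \<and> \<not> nb G k (c j)" if "k \<in> K" for k
    using comp_RRD(3)[OF K that] bc_RR by blast
  then show thesis using that j by blast
qed

lemma RR_verts: "RR \<subseteq> verts G" by (auto simp: RR_def)

text \<open>Attachments of a component lie in \<open>AA\<close>, \<open>DD\<close> and
  \<open>UU\<close>, and only a pair from \<open>AA\<close> and \<open>DD\<close> can be
  nonadjacent. Hence some hubs on both sides are seen, which selects the second alternative of
  \<open>comp_hubs\<close>, first for these hubs and then for all.\<close>

lemma comp_structure:
  assumes K: "comp_RR K"
  shows "\<And>k. k \<in> K \<Longrightarrow> nb G k a \<longleftrightarrow> \<not> nb G k d"
    and "\<And>k x. k \<in> K \<Longrightarrow> x \<in> AA \<Longrightarrow> nb G k x \<longleftrightarrow> nb G k a"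
    and "\<And>k y. k \<in> K \<Longrightarrow> y \<in> DD \<Longrightarrow> nb G k y \<longleftrightarrow> nb G k d"
    and "\<exists>k\<in>K. nb G k a" and "\<exists>k\<in>K. nb G k d"
proof -
  obtain j where j: "b j \<notin> K" "c j \<notin> K" "\<And>k. k \<in> K \<Longrightarrow> \<not> nb G k (b j) \<and> \<not> nb G k (c j)"
    using comp_avoid[OF K] by blast
  have bV: "b j \<in> verts G" using bc_RR RR_verts by blast
  have nb': "\<forall>k\<in>K. \<not> nb G (b j) k" using j(3) not_nb_sym[of G _ "b j"] by blast
  have KV: "K \<subseteq> verts G" using comp_RRD(2)[OF K] RR_verts by blast
  obtain x y k l where xy: "x \<in> verts G" "x \<notin> K" "y \<in> verts G" "y \<notin> K" "\<not> nb G x y" "k \<in> K" "nb G x k" "l \<in> K" "nb G y l"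
    using no_clique_cutset_obtain[OF atom_graph_axioms KV comp_RRD(1)[OF K] bV j(1) nb'] by blast
  have "x \<notin> RR" "y \<notin> RR" using comp_RRD(3)[OF K] xy nb_sym[OF xy(7)] nb_sym[OF xy(9)] by blast+
  then have "x \<in> AA \<or> x \<in> DD \<or> x \<in> UU" "y \<in> AA \<or> y \<in> DD \<or> y \<in> UU" using xy unfolding RR_def by blast+
  then have "(x \<in> AA \<and> y \<in> DD) \<or> (x \<in> DD \<and> y \<in> AA)"
    using hub_adj[of x y] hub_adj[of y x] xy(5) not_nb_sym[OF xy(5)] by blast
  then obtain p q k l where pq: "p \<in> AA" "q \<in> DD" "k \<in> K" "nb G k p" "l \<in> K" "nb G l q"
    using xy nb_sym[OF xy(7)] nb_sym[OF xy(9)] by blast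
  have h: "\<forall>k\<in>K. nb G k p \<longleftrightarrow> \<not> nb G k q" using comp_hubs[OF K pq(1,2)] pq by blast
  have h1: "\<forall>k\<in>K. nb G k x \<longleftrightarrow> \<not> nb G k q" if "x \<in> AA" for x using comp_hubs[OF K that pq(2)] pq by blast
  have h2: "\<forall>k\<in>K. nb G k p \<longleftrightarrow> \<not> nb G k y" if "y \<in> DD" for y using comp_hubs[OF K pq(1) that] pq by blast
  show "nb G k a \<longleftrightarrow> \<not> nb G k d" if "k \<in> K" for k using h h1[OF ad_mem(1)] h2[OF ad_mem(2)] that by blast
  show "nb G k x \<longleftrightarrow> nb G k a" if "k \<in> K" "x \<in> AA" for k x using h1[OF ad_mem(1)] h1[OF that(2)] that by blast
  show "nb G k y \<longleftrightarrow> nb G k d" if "k \<in> K" "y \<in> DD" for k y using h2[OF ad_mem(2)] h2[OF that(2)] that by blast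
  show "\<exists>k\<in>K. nb G k a" "\<exists>k\<in>K. nb G k d" using h h1[OF ad_mem(1)] h2[OF ad_mem(2)] pq by blast+
qed

text \<open>The path \<open>a\<close>, \<open>b j\<close>, \<open>c j\<close>, \<open>d\<close>
  along an avoided leg makes the side lemmas applicable; reading it backwards gives the statements
  for the other side.\<close>

lemma comp_sides:
  assumes K: "comp_RR K"
  defines "B \<equiv> {k \<in> K. nb G k a}" and "C \<equiv> {k \<in> K. nb G k d}"
  shows "\<And>y. y \<in> B \<Longrightarrow> \<exists>e\<in>C. nb G e y" "\<And>e. e \<in> C \<Longrightarrow> \<exists>y\<in>B. nb G e y"
    "\<And>y z. y \<in> B \<Longrightarrow> z \<in> B \<Longrightarrow> nb G y z" "\<And>y z. y \<in> C \<Longrightarrow> z \<in> C \<Longrightarrow> nb G y z"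
    "\<And>u k. u \<in> UU \<Longrightarrow> k \<in> K \<Longrightarrow> nb G u k"
proof -
  note st = comp_structure[OF K]
  obtain j where j: "b j \<notin> K" "c j \<notin> K" "\<And>k. k \<in> K \<Longrightarrow> \<not> nb G k (b j) \<and> \<not> nb G k (c j)"
    using comp_avoid[OF K] by blast
  have p: "nb G a (b j)" "nb G (b j) (c j)" "nb G (c j) d" "\<not> nb G a (c j)" "\<not> nb G a d" "\<not> nb G (b j) d"
    by simp_all
  have p': "nb G d (c j)" "nb G (c j) (b j)" "nb G (b j) a" "\<not> nb G d (b j)" "\<not> nb G d a" "\<not> nb G (c j) a"
    by simp_all
  have B: "nb G y a \<and> \<not> nb G y (b j) \<and> \<not> nb G y (c j) \<and> \<not> nb G y d" if "y \<in> B" for y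
    using that st(1) j(3) unfolding B_def by blast
  have C: "\<not> nb G e a \<and> \<not> nb G e (b j) \<and> \<not> nb G e (c j) \<and> nb G e d" if "e \<in> C" for e
    using that st(1) j(3) unfolding C_def by blast
  have B': "nb G e d \<and> \<not> nb G e (c j) \<and> \<not> nb G e (b j) \<and> \<not> nb G e a" if "e \<in> C" for e using C[OF that] by blast
  have C': "\<not> nb G y d \<and> \<not> nb G y (c j) \<and> \<not> nb G y (b j) \<and> nb G y a" if "y \<in> B" for y using B[OF that] by blast
  have KV: "K \<subseteq> verts G" using comp_RRD(2)[OF K] RR_verts by blast
  have BV: "B \<subseteq> verts G" "C \<subseteq> verts G" using KV unfolding B_def C_def by blast+
  have KBC: "K = B \<union> C" using st(1) unfolding B_def C_def by blast
  have out: "x \<in> K \<or> x \<in> AA \<or> x \<in> DD \<or> x \<in> UU" if "y \<in> K" "x \<in> verts G" "nb G x y" for x y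
    using comp_RRD(3)[OF K that(1)] nb_sym[OF that(3)] that(2) unfolding RR_def by blast
  have Uab: "nb G u a" "nb G u d" "nb G u (b j)" "nb G u (c j)" if "u \<in> UU" for u
    using that UU_types[OF that] unfolding UU_def by blast+
  have UB: "nb G u y" if "u \<in> UU" "y \<in> B" "e \<in> C" "nb G e y" for u y e
    using pa_U[OF p, where y = y and e = e and u = u] B[OF that(2)] C[OF that(3)] Uab[OF that(1)] that by blast
  have UC: "nb G u e" if "u \<in> UU" "e \<in> C" "y \<in> B" "nb G y e" for u y e
    using pa_U[OF p', where y = e and e = y and u = u] B'[OF that(2)] C'[OF that(3)] Uab[OF that(1)] that by blast
  show BC: "\<exists>e\<in>C. nb G e y" if "y \<in> B" for y
  proof (rule side_cover[OF p BV(1), where C = C and Q = "AA \<union> UU" and y = y])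
    show "y \<in> B" by fact
    show "nb G y a \<and> \<not> nb G y (b j) \<and> \<not> nb G y (c j) \<and> \<not> nb G y d" if "y \<in> B" for y by (rule B[OF that])
    show "\<not> nb G e a \<and> \<not> nb G e (b j) \<and> \<not> nb G e (c j) \<and> nb G e d" if "e \<in> C" for e by (rule C[OF that])
    show "x \<in> B \<or> x \<in> C \<or> x \<in> AA \<union> UU" if "y \<in> B" "x \<in> verts G" "nb G x y" for x y
      using out[of y x] st(3)[of y x] that B[OF that(1)] KBC nb_sym[OF that(3)] by blast
    show "nb G x y" if "x \<in> AA \<union> UU" "y \<in> AA \<union> UU" for x y
      using that hub_adj[of x y] hub_adj[of y x] nb_sym[of G y x] by blast
    show "nb G q y" if "q \<in> AA \<union> UU" "y \<in> B" "e \<in> C" "nb G e y" for q y e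
      using that UB[of q y e] st(2)[of y q] B[OF that(2)] KBC nb_sym[of G y q] by blast
  qed
  show CB: "\<exists>y\<in>B. nb G e y" if "e \<in> C" for e
  proof -
    have "\<exists>y\<in>B. nb G y e"
    proof (rule side_cover[OF p' BV(2), where C = B and Q = "DD \<union> UU" and y = e])
      show "e \<in> C" by fact
      show "nb G e d \<and> \<not> nb G e (c j) \<and> \<not> nb G e (b j) \<and> \<not> nb G e a" if "e \<in> C" for e by (rule B'[OF that])
      show "\<not> nb G y d \<and> \<not> nb G y (c j) \<and> \<not> nb G y (b j) \<and> nb G y a" if "y \<in> B" for y by (rule C'[OF that])
      show "x \<in> C \<or> x \<in> B \<or> x \<in> DD \<union> UU" if "y \<in> C" "x \<in> verts G" "nb G x y" for x y
        using out[of y x] st(2)[of y x] that C[OF that(1)] KBC nb_sym[OF that(3)] by blast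
      show "nb G x y" if "x \<in> DD \<union> UU" "y \<in> DD \<union> UU" for x y
        using that hub_adj[of x y] hub_adj[of y x] nb_sym[of G y x] by blast
      show "nb G q y" if "q \<in> DD \<union> UU" "y \<in> C" "e \<in> B" "nb G e y" for q y e
        using that UC[of q y e] st(3)[of y q] C[OF that(2)] KBC nb_sym[of G y q] by blast
    qed
    then show ?thesis using nb_commute[of G e] by blast
  qed
  have BC': "\<exists>e\<in>B. nb G e y" if "y \<in> C" for y using CB[OF that] nb_commute[of G y] by blast
  have CB': "\<exists>y\<in>C. nb G e y" if "e \<in> B" for e using BC[OF that] nb_commute[of G e] by blast
  have conn: "S = B \<union> C" if "S \<subseteq> B \<union> C" "s \<in> S" "\<And>x y. x \<in> S \<Longrightarrow> y \<in> B \<union> C \<Longrightarrow> nb G x y \<Longrightarrow> y \<in> S" for S s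
    using comp_RRD(4)[OF K, of S s] that unfolding KBC by blast
  have conn': "S = C \<union> B" if "S \<subseteq> C \<union> B" "s \<in> S" "\<And>x y. x \<in> S \<Longrightarrow> y \<in> C \<union> B \<Longrightarrow> nb G x y \<Longrightarrow> y \<in> S" for S s
    using conn[of S s] that by blast
  show "nb G y z" if "y \<in> B" "z \<in> B" for y z
  proof (rule side_clique[OF p, where B = B and C = C])
    show "y \<in> B" "z \<in> B" by fact+
  qed (fact B C BC CB conn)+
  show "nb G y z" if "y \<in> C" "z \<in> C" for y z
  proof (rule side_clique[OF p', where B = C and C = B])
    show "y \<in> C" "z \<in> C" by fact+
  qed (fact B' C' BC' CB' conn')+
  show "nb G u k" if "u \<in> UU" "k \<in> K" for u k
    using UB[OF that(1)] UC[OF that(1)] BC[of k] BC'[of k] that(2) unfolding KBC by blast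
qed

lemma comp_RR_exists:
  assumes "x \<in> RR"
  obtains K where "comp_RR K" "x \<in> K"
proof -
  obtain K where K: "x \<in> K" "K \<subseteq> RR" "\<And>x y. x \<in> K \<Longrightarrow> y \<in> RR \<Longrightarrow> nb G x y \<Longrightarrow> y \<in> K"
    "\<And>S s. \<lbrakk>S \<subseteq> K; s \<in> S; \<And>x y. x \<in> S \<Longrightarrow> y \<in> K \<Longrightarrow> nb G x y \<Longrightarrow> y \<in> S\<rbrakk> \<Longrightarrow> S = K"
    using nb_component[OF assms, of G thesis] by blast
  have "comp_RR K" unfolding comp_RR_def
  proof (intro conjI ballI allI impI)
    show "K \<noteq> {}" "K \<subseteq> RR" using K(1,2) by auto
    show "y \<in> K" if "x \<in> K" "y \<in> RR" "nb G x y" for x y using K(3) that .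
    show "S = K" if "S \<subseteq> K" "s \<in> S" "\<forall>x\<in>S. \<forall>y\<in>K. nb G x y \<longrightarrow> y \<in> S" for S s
      by (rule K(4)) (use that in auto)
  qed
  then show thesis using that K(1) by blast
qed

lemma comp_RR_eq:
  assumes K: "comp_RR K" "comp_RR L" "x \<in> K" "x \<in> L"
  shows "K = L"
proof -
  have "K \<inter> L = K"
    by (rule comp_RRD(4)[OF K(1), of _ x]) (use K comp_RRD(3)[OF K(2)] comp_RRD(2)[OF K(1)] in auto)
  moreover have "L \<inter> K = L"
    by (rule comp_RRD(4)[OF K(2), of _ x]) (use K comp_RRD(3)[OF K(1)] comp_RRD(2)[OF K(2)] in auto)
  ultimately show ?thesis by blast
qed

text \<open>A member would be universal: it is adjacent to all hubs by \<open>hub_adj\<close> and to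
  every component by \<open>comp_sides\<close>.\<close>

lemma UU_empty: "UU = {}"
proof (rule ccontr)
  assume "UU \<noteq> {}"
  then obtain u where u: "u \<in> UU" by blast
  then have "u \<in> verts G" by (simp add: UU_def)
  then obtain v where v: "v \<in> verts G" "\<not> nb G u v" using no_universal by blast
  then have "v \<in> RR" using hub_adj(3,4,5)[OF u] unfolding RR_def by blast
  then obtain K where "comp_RR K" "v \<in> K" using comp_RR_exists by blast
  then show False using comp_sides(5)[OF _ u] v by blast
qed

definition incomplete :: "'a set \<Rightarrow> bool" where
  "incomplete K \<longleftrightarrow> (\<exists>y\<in>K. \<exists>e\<in>K. nb G y a \<and> nb G e d \<and> \<not> nb G y e)"

text \<open>From two incomplete legs, the path \<open>e\<close>, \<open>p\<close>, \<open>y\<close>,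
  \<open>a\<close>, \<open>z\<close>, \<open>q\<close>, \<open>f\<close> passes over the hub and
  uses the missing edge of each leg; it is an induced \<open>P7\<close>. So a single leg may be
  merely nested.\<close>

lemma incomplete_unique:
  assumes K: "comp_RR K" "incomplete K" and L: "comp_RR L" "incomplete L"
  shows "K = L"
proof (rule ccontr)
  assume KL: "K \<noteq> L"
  have no: "\<not> nb G x y" if "x \<in> K" "y \<in> L" for x y
    using comp_RRD(3)[OF K(1) that(1), of y] comp_RRD(2)[OF L(1)] comp_RR_eq[OF K(1) L(1), of y] that KL by blast
  have no': "\<not> nb G y x" if "x \<in> K" "y \<in> L" for x y using not_nb_sym[OF no[OF that]] .
  obtain y e where y: "y \<in> K" "e \<in> K" "nb G y a" "nb G e d" "\<not> nb G y e" using K(2) unfolding incomplete_def by blast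
  obtain z f where z: "z \<in> L" "f \<in> L" "nb G z a" "nb G f d" "\<not> nb G z f" using L(2) unfolding incomplete_def by blast
  obtain p where p: "p \<in> K" "nb G p d" "nb G p y" using comp_sides(1)[OF K(1), of y] y by blast
  obtain q where q: "q \<in> L" "nb G q d" "nb G q z" using comp_sides(1)[OF L(1), of z] z by blast
  have ep: "nb G e p" using comp_sides(4)[OF K(1)] y p by blast
  have qf: "nb G q f" using comp_sides(4)[OF L(1)] z q by blast
  note sK = comp_structure(1)[OF K(1)] and sL = comp_structure(1)[OF L(1)]
  have [simp]: "\<not> nb G e a" "\<not> nb G p a" "\<not> nb G f a" "\<not> nb G q a"
    using sK[OF y(2)] sK[OF p(1)] sL[OF z(2)] sL[OF q(1)] y p z q by auto
  note [simp] = y(3,5) z(3,5) p(3) q(3) ep qf y(3)[THEN nb_sym] y(5)[THEN not_nb_sym] z(3)[THEN nb_sym] q(3)[THEN nb_sym]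
  show False
    by (rule P7[of e p y a z q f]) (simp_all add: no y(1,2) p(1) z(1,2) q(1) not_nb_sym)
qed

text \<open>Two incomparable neighbourhoods between the cliques \<open>X\<close> and
  \<open>Y\<close> would give a \<open>C4\<close>, so they form a chain. As every vertex of
  \<open>Y\<close> is covered, the largest neighbourhood is all of \<open>Y\<close>.\<close>

lemma chain_top:
  assumes XY: "X \<subseteq> verts G" "X \<noteq> {}" "\<And>x y. x \<in> X \<Longrightarrow> y \<in> X \<Longrightarrow> nb G x y"
    "\<And>x y. x \<in> Y \<Longrightarrow> y \<in> Y \<Longrightarrow> nb G x y"
    and cov: "\<And>y. y \<in> Y \<Longrightarrow> \<exists>x\<in>X. nb G x y"
  shows "\<exists>xs. ordering_of X xs \<and> nested (\<lambda>x. closed_nbhd G x \<inter> Y) xs \<and> closed_nbhd G (hd xs) \<inter> Y = Y"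
proof -
  have "finite X" using XY(1) simple finite_subset unfolding simple_graph_def by blast
  moreover have "closed_nbhd G x \<inter> Y \<subseteq> closed_nbhd G z \<inter> Y \<or> closed_nbhd G z \<inter> Y \<subseteq> closed_nbhd G x \<inter> Y"
    if "x \<in> X" "z \<in> X" for x z
  proof (rule ccontr)
    assume "\<not> ?thesis"
    then obtain u v where "u \<in> Y" "v \<in> Y" "nb G x u" "\<not> nb G z u" "nb G z v" "\<not> nb G x v"
      unfolding closed_nbhd_nb by blast
    then show False
      using C4[of x u v z] XY(3)[OF that(2,1)] XY(4)[of u v] nb_sym[of G z v] not_nb_sym[of G z u] by blast
  qed
  moreover have "finite (closed_nbhd G x \<inter> Y)" for x
    using finite_nbhd[OF simple] by (simp add: closed_nbhd_nb)
  ultimately obtain xs where xs: "ordering_of X xs" "nested (\<lambda>x. closed_nbhd G x \<inter> Y) xs"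
    using chain_ordering[of X "\<lambda>x. closed_nbhd G x \<inter> Y"] by blast
  have "y \<in> closed_nbhd G (hd xs)" if y: "y \<in> Y" for y
  proof -
    obtain x where "x \<in> X" "nb G x y" using cov y by blast
    then have "x \<in> set xs" "y \<in> closed_nbhd G x \<inter> Y" using xs y by (auto simp: ordering_of_def closed_nbhd_nb)
    then show ?thesis using nested_hd[OF xs(2)] by blast
  qed
  then show ?thesis using xs by blast
qed

theorem lantern: "lantern G"
proof -
  define \<K> where "\<K> = {K. comp_RR K}"
  have KRR: "K \<subseteq> RR" if "K \<in> \<K>" for K using that comp_RRD(2) by (simp add: \<K>_def)
  have "\<K> \<subseteq> Pow (verts G)" using KRR RR_verts by blast
  then have fin: "finite \<K>" using simple finite_subset unfolding simple_graph_def by blast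
  have "\<exists>K. K \<in> \<K> \<and> b i \<in> K" for i using comp_RR_exists[OF bc_RR(1)[of i]] unfolding \<K>_def by blast
  then obtain k where k: "\<And>i. k i \<in> \<K>" "\<And>i. b i \<in> k i" by metis
  \<comment> \<open>The three feet \<open>b i\<close> lie in different components, which yields the
    three legs that a lantern needs.\<close>
  have "inj k"
  proof (rule injI, rule ccontr)
    fix i j assume ij: "k i = k j" "i \<noteq> j"
    have "comp_RR (k i)" using k(1) by (simp add: \<K>_def)
    then show False using component_index[of "k i" i j] comp_RRD(2,4)[of "k i"] k(2)[of i] k(2)[of j] ij
      by metis
  qed
  then have "card (range k) = 3" by (simp add: card_image)
  moreover have "range k \<subseteq> \<K>" using k(1) by blast
  ultimately have c3: "card \<K> \<ge> 3" using fin by (metis card_mono)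
  \<comment> \<open>\<open>K0\<close> is the incomplete component if there is one, and otherwise an
    arbitrary component.\<close>
  obtain K0 where K0: "K0 \<in> \<K>" "\<And>K. K \<in> \<K> \<Longrightarrow> K \<noteq> K0 \<Longrightarrow> \<not> incomplete K"
    using incomplete_unique k(1) unfolding \<K>_def by (metis mem_Collect_eq)
  obtain Ks' where Ks': "set Ks' = \<K> - {K0}" "distinct Ks'" using finite_distinct_list fin by (metis finite_Diff)
  define Ks where "Ks = K0 # Ks'"
  have Ks: "set Ks = \<K>" "distinct Ks" using Ks' K0 by (auto simp: Ks_def)
  define r where "r = length Ks"
  have r3: "r \<ge> 3" using c3 Ks distinct_card[OF Ks(2)] by (simp add: r_def)
  \<comment> \<open>Legs are numbered from 1 while lists count from 0. Since \<open>K0\<close> heads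
    \<open>Ks\<close>, it becomes leg 1, the one that need not be complete.\<close>
  define K where "K i = Ks ! (i - 1)" for i
  define B where "B i = {x \<in> K i. nb G x a}" for i
  define C where "C i = {x \<in> K i. nb G x d}" for i
  have KK: "comp_RR (K i)" if "i \<in> {1..r}" for i
  proof -
    have "i - 1 < length Ks" using that by (auto simp: r_def)
    then have "K i \<in> \<K>" using nth_mem[of "i - 1" Ks] Ks(1) by (simp add: K_def)
    then show ?thesis by (simp add: \<K>_def)
  qed
  have Kinj: "i = j" if "i \<in> {1..r}" "j \<in> {1..r}" "K i = K j" for i j
  proof -
    have "i - 1 = j - 1" using that nth_eq_iff_index_eq[OF Ks(2), of "i - 1" "j - 1"] unfolding K_def r_def by auto
    then show ?thesis using that by auto
  qed
  have Kdisj: "K i \<inter> K j = {}" if "i \<in> {1..r}" "j \<in> {1..r}" "i \<noteq> j" for i j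
    using comp_RR_eq[OF KK[OF that(1)] KK[OF that(2)]] Kinj[OF that(1,2)] that(3) by blast
  have Kanti: "\<not> nb G x y" if "i \<in> {1..r}" "j \<in> {1..r}" "i \<noteq> j" "x \<in> K i" "y \<in> K j" for i j x y
    using comp_RRD(3)[OF KK[OF that(1)] that(4), of y] comp_RRD(2)[OF KK[OF that(2)]] that(5) Kdisj[OF that(1,2,3)] by blast
  have Ksub: "K i \<subseteq> RR" if "i \<in> {1..r}" for i using comp_RRD(2)[OF KK[OF that]] .
  have KBC: "B i \<union> C i = K i" "B i \<inter> C i = {}" if "i \<in> {1..r}" for i
    using comp_structure(1)[OF KK[OF that]] unfolding B_def C_def by blast+
  have RRcov: "RR = (\<Union>i\<in>{1..r}. K i)"
  proof
    show "(\<Union>i\<in>{1..r}. K i) \<subseteq> RR" using Ksub by blast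
    show "RR \<subseteq> (\<Union>i\<in>{1..r}. K i)"
    proof
      fix x assume "x \<in> RR"
      then obtain L where L: "L \<in> set Ks" "x \<in> L" using comp_RR_exists Ks(1) unfolding \<K>_def by blast
      then obtain n where "n < length Ks" "Ks ! n = L" by (auto simp: in_set_conv_nth)
      then have "Suc n \<in> {1..r}" "K (Suc n) = L" by (auto simp: r_def K_def)
      then show "x \<in> (\<Union>i\<in>{1..r}. K i)" using L by blast
    qed
  qed
  have sides: "B i \<noteq> {}" "C i \<noteq> {}" "B i \<subseteq> verts G" "C i \<subseteq> verts G"
    "\<And>y. y \<in> B i \<Longrightarrow> \<exists>e\<in>C i. nb G e y" "\<And>e. e \<in> C i \<Longrightarrow> \<exists>y\<in>B i. nb G e y"
    "\<And>y z. y \<in> B i \<Longrightarrow> z \<in> B i \<Longrightarrow> nb G y z" "\<And>y z. y \<in> C i \<Longrightarrow> z \<in> C i \<Longrightarrow> nb G y z" if "i \<in> {1..r}" for i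
    using comp_sides[OF KK[OF that]] comp_structure(4,5)[OF KK[OF that]] Ksub[OF that] RR_verts unfolding B_def C_def by blast+
  have AB: "nb G x y" if "x \<in> AA" "y \<in> B i" "i \<in> {1..r}" for x y i
    using comp_structure(2)[OF KK[OF that(3)], of y x] that nb_sym[of G y x] unfolding B_def by blast
  have AC: "\<not> nb G x y" if "x \<in> AA" "y \<in> C i" "i \<in> {1..r}" for x y i
    using comp_structure(1,2)[OF KK[OF that(3)], of y] that nb_sym[of G x y] unfolding C_def by blast
  have DC: "nb G x y" if "x \<in> DD" "y \<in> C i" "i \<in> {1..r}" for x y i
    using comp_structure(3)[OF KK[OF that(3)], of y x] that nb_sym[of G y x] unfolding C_def by blast
  have DB: "\<not> nb G x y" if "x \<in> DD" "y \<in> B i" "i \<in> {1..r}" for x y i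
    using comp_structure(1)[OF KK[OF that(3)], of y] comp_structure(3)[OF KK[OF that(3)], of y x] that nb_sym[of G x y] unfolding B_def by blast
  have AAV: "AA \<subseteq> verts G" "DD \<subseteq> verts G" by (auto simp: AA_def DD_def)
  have dAD: "AA \<inter> DD = {}" unfolding AA_def DD_def by blast
  have dR: "AA \<inter> RR = {}" "DD \<inter> RR = {}" by (auto simp: RR_def)
  have V0: "verts G = AA \<union> DD \<union> RR" using UU_empty AAV RR_verts unfolding RR_def by blast
  have V: "verts G = AA \<union> (\<Union>i\<in>{1..r}. B i) \<union> (\<Union>i\<in>{1..r}. C i) \<union> DD"
  proof -
    have "(\<Union>i\<in>{1..r}. K i) = (\<Union>i\<in>{1..r}. B i \<union> C i)" by (rule SUP_cong) (simp_all add: KBC(1))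
    then have "RR = (\<Union>i\<in>{1..r}. B i) \<union> (\<Union>i\<in>{1..r}. C i)" unfolding RRcov UN_Un_distrib .
    with V0 show ?thesis by auto
  qed
  have r1: "{Suc 0..<Suc r} = {1..r}" by auto
  have BK: "B i \<subseteq> K i" "C i \<subseteq> K i" for i by (auto simp: B_def C_def)
  have upt: "sorted_wrt P [1..<r + 1]" if "\<And>i j. i \<in> {1..r} \<Longrightarrow> j \<in> {1..r} \<Longrightarrow> i < j \<Longrightarrow> P i j" for P :: "nat \<Rightarrow> nat \<Rightarrow> bool"
    by (rule sorted_wrt_mono_rel[OF _ sorted_wrt_upt]) (use that in auto)
  have part: "partition_into (verts G) (AA # map B [1..<r + 1] @ map C [1..<r + 1] @ [DD])"
    unfolding partition_into_def
  proof
    show "\<Union> (set (AA # map B [1..<r + 1] @ map C [1..<r + 1] @ [DD])) = verts G"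
    proof -
      have r2: "set [1..<r + 1] = {1..r}" by auto
      show ?thesis unfolding V by (simp only: list.set set_append set_map r2) (simp add: Un_ac)
    qed
    have 1: "sorted_wrt disjnt (map B [1..<r + 1])" "sorted_wrt disjnt (map C [1..<r + 1])"
    proof -
      have "disjnt (B i) (B j) \<and> disjnt (C i) (C j)" if "i \<in> {1..r}" "j \<in> {1..r}" "i < j" for i j
        using Kdisj[OF that(1,2)] BK[of i] BK[of j] that(3) unfolding disjnt_def by blast
      then show "sorted_wrt disjnt (map B [1..<r + 1])" "sorted_wrt disjnt (map C [1..<r + 1])"
        unfolding sorted_wrt_map by (blast intro: upt)+
    qed
    have 2: "disjnt (B i) (C j)" if "i \<in> {1..r}" "j \<in> {1..r}" for i j
      using Kdisj[OF that] BK[of i] BK[of j] KBC(2)[OF that(1)] unfolding disjnt_def by (cases "i = j") blast+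
    have 3: "disjnt AA (B i)" "disjnt AA (C i)" "disjnt (B i) DD" "disjnt (C i) DD" if "i \<in> {1..r}" for i
      using dR Ksub[OF that] BK[of i] unfolding disjnt_def by blast+
    define Bs Cs where "Bs = map B [1..<r + 1]" and "Cs = map C [1..<r + 1]"
    have r2: "set [1..<r + 1] = {1..r}" by auto
    have "\<forall>X\<in>set Bs. disjnt AA X \<and> disjnt X DD \<and> (\<forall>Y\<in>set Cs. disjnt X Y)" "\<forall>X\<in>set Cs. disjnt AA X \<and> disjnt X DD"
      unfolding Bs_def Cs_def set_map r2 using 2 3 by blast+
    moreover have "sorted_wrt disjnt Bs" "sorted_wrt disjnt Cs" using 1 unfolding Bs_def Cs_def .
    ultimately have "sorted_wrt disjnt (AA # Bs @ Cs @ [DD])" using dAD by (auto simp: sorted_wrt_append disjnt_def)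
    then show "sorted_wrt disjnt (AA # map B [1..<r + 1] @ map C [1..<r + 1] @ [DD])" unfolding Bs_def Cs_def .
  qed
  have comp: "\<not> incomplete (K i)" if "i \<in> {2..r}" for i
  proof -
    have "K 1 = K0" by (simp add: K_def Ks_def)
    then have "K i \<noteq> K0" using Kinj[of i 1] that r3 by auto
    then show ?thesis using K0(2)[of "K i"] KK[of i] that by (simp add: \<K>_def)
  qed
  have "r_lantern r G" unfolding r_lantern_def
    apply (rule conjI, rule r3)
    apply (rule exI[of _ AA], rule exI[of _ B], rule exI[of _ C], rule exI[of _ DD])
  proof (intro conjI)
    have one: "1 \<in> {1..r}" using r3 by auto
    show "partition_into (verts G) (AA # map B [1..<r + 1] @ map C [1..<r + 1] @ [DD])" by (rule part)
    show "AA \<noteq> {}" "DD \<noteq> {}" using ad_mem by auto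
    show "clique G AA" "clique G DD" using AAV hub_adj(1,2) unfolding clique_nb by blast+
    show "\<forall>i\<in>{1..r}. B i \<noteq> {} \<and> clique G (B i) \<and> C i \<noteq> {} \<and> clique G (C i)"
    proof
      fix i assume i: "i \<in> {1..r}"
      show "B i \<noteq> {} \<and> clique G (B i) \<and> C i \<noteq> {} \<and> clique G (C i)"
        unfolding clique_nb using sides(1,2,3,4)[OF i] sides(7)[OF i] sides(8)[OF i] by simp
    qed
    show "anticomplete_to G AA DD" using hub_adj(6) by (intro anticomplete_toI)
    show "complete_to G AA (\<Union>i\<in>{1..r}. B i)"
      by (rule complete_toI) (use AB BK Ksub dR in blast)+
    show "anticomplete_to G AA (\<Union>i\<in>{1..r}. C i)"
      by (rule anticomplete_toI) (use AC in blast)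
    show "complete_to G DD (\<Union>i\<in>{1..r}. C i)"
      by (rule complete_toI) (use DC BK Ksub dR in blast)+
    show "anticomplete_to G DD (\<Union>i\<in>{1..r}. B i)"
      by (rule anticomplete_toI) (use DB in blast)
    have BC: "\<exists>e\<in>B 1. nb G e y" if "y \<in> C 1" for y using sides(6)[OF one that] nb_commute[of G y] by blast
    have CB: "\<exists>e\<in>C 1. nb G e y" if "y \<in> B 1" for y using sides(5)[OF one that] .
    show "\<exists>bs. ordering_of (B 1) bs \<and> nested (\<lambda>b. closed_nbhd G b \<inter> C 1) bs \<and> closed_nbhd G (hd bs) \<inter> C 1 = C 1"
      by (rule chain_top) (fact sides(3)[OF one] sides(1)[OF one] sides(7)[OF one] sides(8)[OF one] BC)+
    show "\<exists>cs. ordering_of (C 1) cs \<and> nested (\<lambda>c. closed_nbhd G c \<inter> B 1) cs \<and> closed_nbhd G (hd cs) \<inter> B 1 = B 1"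
      by (rule chain_top) (fact sides(4)[OF one] sides(2)[OF one] sides(7)[OF one] sides(8)[OF one] CB)+
    show "\<forall>i\<in>{2..r}. complete_to G (B i) (C i)"
    proof
      fix i assume i: "i \<in> {2..r}"
      then have i': "i \<in> {1..r}" by auto
      show "complete_to G (B i) (C i)"
        by (rule complete_toI) (use comp[OF i] KBC(2)[OF i'] in \<open>auto simp: incomplete_def B_def C_def\<close>)
    qed
    show "\<forall>i\<in>{1..r}. \<forall>j\<in>{1..r}. i \<noteq> j \<longrightarrow> anticomplete_to G (B i \<union> C i) (B j \<union> C j)"
      using Kanti KBC(1) by (auto intro!: anticomplete_toI)
  qed
  then show ?thesis unfolding lantern_def using r3 by blast
qed

end

section \<open>Graphs with a 6-hole\<close>

text \<open>The hubs are \<open>a\<close> and \<open>d\<close>, joined by the three paths through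
  \<open>b1\<close>, \<open>c1\<close> and so on. The exclusion serves \<open>L6_L3\<close>, the one
  place where no \<open>P7\<close>, \<open>C4\<close> or \<open>C5\<close> settles the
  matter.\<close>

definition no_theta :: "('a \<Rightarrow> 'a \<Rightarrow> bool) \<Rightarrow> bool" where
  "no_theta N \<longleftrightarrow> (\<forall>a b1 b2 b3 c1 c2 c3 d. N a b1 \<longrightarrow> N a b2 \<longrightarrow> N a b3 \<longrightarrow> N b1 c1 \<longrightarrow> N b2 c2 \<longrightarrow> N b3 c3 \<longrightarrow> N c1 d \<longrightarrow> N c2 d \<longrightarrow> N c3 d \<longrightarrow>
    \<not> N a c1 \<longrightarrow> \<not> N a c2 \<longrightarrow> \<not> N a c3 \<longrightarrow> \<not> N a d \<longrightarrow> \<not> N b1 b2 \<longrightarrow> \<not> N b1 b3 \<longrightarrow> \<not> N b1 c2 \<longrightarrow>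
    \<not> N b1 c3 \<longrightarrow> \<not> N b1 d \<longrightarrow> \<not> N b2 b3 \<longrightarrow> \<not> N b2 c1 \<longrightarrow> \<not> N b2 c3 \<longrightarrow> \<not> N b2 d \<longrightarrow> \<not> N b3 c1 \<longrightarrow>
    \<not> N b3 c2 \<longrightarrow> \<not> N b3 d \<longrightarrow> \<not> N c1 c2 \<longrightarrow> \<not> N c1 c3 \<longrightarrow> \<not> N c2 c3 \<longrightarrow>  False)"

locale atom_no_theta = atom_no_C7 +
  assumes no_theta: "no_theta (nb G)"
begin

lemmas Theta = no_theta[unfolded no_theta_def, rule_format]

section \<open>Vertex types with respect to a 6-hole\<close>

definition hole6 :: "(6 \<Rightarrow> 'a) \<Rightarrow> bool" where
  "hole6 c \<longleftrightarrow> (\<forall>i j. nb G (c i) (c j) \<longleftrightarrow> j - i = 0 \<or> j - i = 1 \<or> j - i = 5)"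

definition T6 :: "(6 \<Rightarrow> 'a) \<Rightarrow> 6 \<Rightarrow> 'a set" where
  "T6 c i = {v \<in> verts G. \<forall>j. nb G v (c j) \<longleftrightarrow> j - i = 0 \<or> j - i = 1 \<or> j - i = 5}"

definition W6 :: "(6 \<Rightarrow> 'a) \<Rightarrow> 6 \<Rightarrow> 'a set" where
  "W6 c i = {v \<in> verts G. \<forall>j. nb G v (c j) \<longleftrightarrow> j - i = 0 \<or> j - i = 1}"

definition L6 :: "(6 \<Rightarrow> 'a) \<Rightarrow> 6 \<Rightarrow> 'a set" where
  "L6 c i = {v \<in> verts G. \<forall>j. nb G v (c j) \<longleftrightarrow> j - i = 0}"

definition U6 :: "(6 \<Rightarrow> 'a) \<Rightarrow> 'a set" where
  "U6 c = {v \<in> verts G. \<forall>j. nb G v (c j)}"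

definition Z6 :: "(6 \<Rightarrow> 'a) \<Rightarrow> 'a set" where
  "Z6 c = {v \<in> verts G. \<forall>j. \<not> nb G v (c j)}"

lemma hole6D: "hole6 c \<Longrightarrow> nb G (c i) (c j) \<longleftrightarrow> j - i = 0 \<or> j - i = 1 \<or> j - i = 5"
  by (simp add: hole6_def)

lemma T6D:
  assumes "v \<in> T6 c i"
  shows "nb G v (c j) \<longleftrightarrow> j - i = 0 \<or> j - i = 1 \<or> j - i = 5"
    and "nb G (c j) v \<longleftrightarrow> j - i = 0 \<or> j - i = 1 \<or> j - i = 5"
  using assms nb_commute[of G v "c j"] by (simp_all add: T6_def)

lemma W6D:
  assumes "v \<in> W6 c i"
  shows "nb G v (c j) \<longleftrightarrow> j - i = 0 \<or> j - i = 1" and "nb G (c j) v \<longleftrightarrow> j - i = 0 \<or> j - i = 1"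
  using assms nb_commute[of G v "c j"] by (simp_all add: W6_def)

lemma L6D:
  assumes "v \<in> L6 c i"
  shows "nb G v (c j) \<longleftrightarrow> j - i = 0" and "nb G (c j) v \<longleftrightarrow> j - i = 0"
  using assms nb_commute[of G v "c j"] by (simp_all add: L6_def)

lemma U6D:
  assumes "v \<in> U6 c"
  shows "nb G v (c j)" and "nb G (c j) v"
  using assms nb_commute[of G v "c j"] by (simp_all add: U6_def)

lemma Z6D:
  assumes "v \<in> Z6 c"
  shows "\<not> nb G v (c j)" and "\<not> nb G (c j) v"
  using assms nb_commute[of G v "c j"] by (simp_all add: Z6_def)

lemma hole6_verts: "hole6 c \<Longrightarrow> c i \<in> verts G"
proof -
  assume h: "hole6 c"
  have "nb G (c i) (c (i + 1))" "nb G (c (i + 1)) (c (i + 2))" "\<not> nb G (c i) (c (i + 2))"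
    using hole6D[OF h] by simp_all
  then show ?thesis using nb_verts[OF simple] by metis
qed

lemma hole6_T: "hole6 c \<Longrightarrow> c i \<in> T6 c i"
  using hole6_verts[of c i] hole6D[of c i] unfolding T6_def by simp

lemma hole6_rotate: "hole6 c \<Longrightarrow> hole6 (\<lambda>j. c (k + j))"
  unfolding hole6_def by simp

lemma shift_all_6: "(\<forall>j. P (c (k + j)) (j - i)) \<longleftrightarrow> (\<forall>j. P (c j) (j - (k + i)))" for P :: "'a \<Rightarrow> 6 \<Rightarrow> bool"
  by (metis (no_types, opaque_lifting) add_diff_cancel_left diff_add_cancel add.commute)

lemma T6_rotate: "T6 (\<lambda>j. c (k + j)) i = T6 c (k + i)"
  using shift_all_6[of "\<lambda>x d. nb G v x \<longleftrightarrow> d = 0 \<or> d = 1 \<or> d = 5" for v] by (simp add: T6_def)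

lemma W6_rotate: "W6 (\<lambda>j. c (k + j)) i = W6 c (k + i)"
  using shift_all_6[of "\<lambda>x d. nb G v x \<longleftrightarrow> d = 0 \<or> d = 1" for v] by (simp add: W6_def)

lemma L6_rotate: "L6 (\<lambda>j. c (k + j)) i = L6 c (k + i)"
  using shift_all_6[of "\<lambda>x d. nb G v x \<longleftrightarrow> d = 0" for v] by (simp add: L6_def)

lemma U6_rotate: "U6 (\<lambda>j. c (k + j)) = U6 c"
  unfolding U6_def by (metis (no_types, opaque_lifting) add_diff_cancel_left' diff_add_cancel add.commute)

lemma Z6_rotate: "Z6 (\<lambda>j. c (k + j)) = Z6 c"
  unfolding Z6_def by (metis (no_types, opaque_lifting) add_diff_cancel_left' diff_add_cancel add.commute)

text \<open>As for the 7-hole, gaps have length at least three, and six positions admit only one. No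
  \<open>P7\<close> is available against short intervals here, so one, two or three consecutive
  neighbours all remain possible.\<close>

lemma hole6_cover:
  assumes h: "hole6 c" and v: "v \<in> verts G"
  shows "v \<in> U6 c \<or> v \<in> Z6 c \<or> (\<exists>i. v \<in> T6 c i) \<or> (\<exists>i. v \<in> W6 c i) \<or> (\<exists>i. v \<in> L6 c i)"
proof -
  define p where "p i = nb G v (c i)" for i
  note [simp] = hole6D[OF h] p_def[symmetric] nb_commute[of G "c j" v for j]
  have a: "p i \<Longrightarrow> p (i + 2) \<Longrightarrow> p (i + 1)" for i
    by (rule ccontr, rule C4[of v "c i" "c (i + 1)" "c (i + 2)"]) simp_all
  have b: "p i \<Longrightarrow> p (i + 3) \<Longrightarrow> p (i + 1) \<or> p (i + 2)" for i
    by (rule ccontr, rule C5[of v "c i" "c (i + 1)" "c (i + 2)" "c (i + 3)"]) simp_all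
  have all: "(\<forall>i. p i \<longrightarrow> p (i + 2) \<longrightarrow> p (i + 1)) \<and> (\<forall>i. p i \<longrightarrow> p (i + 3) \<longrightarrow> p (i + 1) \<or> p (i + 2))"
    using a b by blast
  have ex: "(\<exists>i::6. Q i) \<longleftrightarrow> Q 0 \<or> Q 1 \<or> Q 2 \<or> Q 3 \<or> Q 4 \<or> Q 5" for Q
    using all_6[of "\<lambda>i. \<not> Q i"] by blast
  from all show ?thesis
    unfolding U6_def Z6_def T6_def W6_def L6_def mem_Collect_eq p_def[symmetric] ex all_6
    by (simp add: v mod_6) argo
qed

lemma T6_clique:
  assumes h: "hole6 c" and t': "t \<in> T6 c 0" and s': "s \<in> T6 c 0"
  shows "nb G t s"
  by (rule nbI, rule C4[of t "c 1" s "c 5"]) (simp_all add: hole6D[OF h] T6D[OF t'] T6D[OF s'])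

lemma T6_T2:
  assumes h: "hole6 c" and t': "t \<in> T6 c 0" and s': "s \<in> T6 c 2"
  shows "\<not> nb G t s"
  by (rule not_nbI, rule C5[of t s "c 3" "c 4" "c 5"]) (simp_all add: hole6D[OF h] T6D[OF t'] T6D[OF s'])

lemma T6_T3:
  assumes h: "hole6 c" and t': "t \<in> T6 c 0" and s': "s \<in> T6 c 3"
  shows "\<not> nb G t s"
  by (rule not_nbI, rule C4[of t s "c 2" "c 1"]) (simp_all add: hole6D[OF h] T6D[OF t'] T6D[OF s'])

lemma U6_clique:
  assumes h: "hole6 c" and u': "u \<in> U6 c" and v': "v \<in> U6 c"
  shows "nb G u v"
  by (rule nbI, rule C4[of u "c 0" v "c 2"]) (simp_all add: hole6D[OF h] U6D[OF u'] U6D[OF v'])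

lemma U6_T:
  assumes h: "hole6 c" and u': "u \<in> U6 c" and t': "t \<in> T6 c 0"
  shows "nb G u t"
  by (rule nbI, rule C4[of u "c 1" t "c 5"]) (simp_all add: hole6D[OF h] U6D[OF u'] T6D[OF t'])

lemma L6_L1:
  assumes h: "hole6 c" and l': "l \<in> L6 c 0" and m': "m \<in> L6 c 1"
  shows "\<not> nb G l m"
  by (rule not_nbI, rule C4[of l m "c 1" "c 0"]) (simp_all add: hole6D[OF h] L6D[OF l'] L6D[OF m'])

lemma L6_L2:
  assumes h: "hole6 c" and l': "l \<in> L6 c 0" and m': "m \<in> L6 c 2"
  shows "False"
proof -
  note [simp] = hole6D[OF h] L6D[OF l'] L6D[OF m']
  have *: "\<not> nb G l m" by (rule not_nbI, rule C5[of l m "c 2" "c 1" "c 0"]) simp_all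
  note [simp] = * *[THEN not_nb_sym]
  show False by (rule P7[of l "c 0" "c 5" "c 4" "c 3" "c 2" m]) simp_all
qed

text \<open>If adjacent, \<open>l\<close> and \<open>m\<close> form the third path of a theta with
  hubs \<open>c 0\<close> and \<open>c 3\<close>; the other two paths are the arcs of the
  hole.\<close>

lemma L6_L3:
  assumes h: "hole6 c" and l': "l \<in> L6 c 0" and m': "m \<in> L6 c 3"
  shows "\<not> nb G l m"
proof
  assume n: "nb G l m"
  note [simp] = hole6D[OF h] L6D[OF l'] L6D[OF m'] n n[THEN nb_sym]
  show False by (rule Theta[of "c 0" l "c 1" "c 5" m "c 2" "c 4" "c 3"]) simp_all
qed

lemma L6_Z:
  assumes h: "hole6 c" and l': "l \<in> L6 c 0" and z': "z \<in> Z6 c"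
  shows "\<not> nb G l z"
  by (rule not_nbI, rule P7[of z l "c 0" "c 1" "c 2" "c 3" "c 4"]) (simp_all add: hole6D[OF h] L6D[OF l'] Z6D[OF z'])

lemma W6_Z:
  assumes h: "hole6 c" and w': "w \<in> W6 c 0" and z': "z \<in> Z6 c"
  shows "\<not> nb G w z"
  by (rule not_nbI, rule P7[of z w "c 0" "c 5" "c 4" "c 3" "c 2"]) (simp_all add: hole6D[OF h] W6D[OF w'] Z6D[OF z'])

lemma L6_W0:
  assumes h: "hole6 c" and l': "l \<in> L6 c 0" and w': "w \<in> W6 c 0"
  shows "\<not> nb G l w"
  by (rule not_nbI, rule P7[of l w "c 1" "c 2" "c 3" "c 4" "c 5"]) (simp_all add: hole6D[OF h] L6D[OF l'] W6D[OF w'])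

lemma L6_W1:
  assumes h: "hole6 c" and l': "l \<in> L6 c 0" and w': "w \<in> W6 c 1"
  shows "\<not> nb G l w"
  by (rule not_nbI, rule C4[of l w "c 1" "c 0"]) (simp_all add: hole6D[OF h] L6D[OF l'] W6D[OF w'])

lemma L6_W2:
  assumes h: "hole6 c" and l': "l \<in> L6 c 0" and w': "w \<in> W6 c 2"
  shows "\<not> nb G l w"
  by (rule not_nbI, rule C5[of l w "c 2" "c 1" "c 0"]) (simp_all add: hole6D[OF h] L6D[OF l'] W6D[OF w'])

lemma L6_W3:
  assumes h: "hole6 c" and l': "l \<in> L6 c 0" and w': "w \<in> W6 c 3"
  shows "\<not> nb G l w"
  by (rule not_nbI, rule C5[of l w "c 4" "c 5" "c 0"]) (simp_all add: hole6D[OF h] L6D[OF l'] W6D[OF w'])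

lemma L6_W4:
  assumes h: "hole6 c" and l': "l \<in> L6 c 0" and w': "w \<in> W6 c 4"
  shows "\<not> nb G l w"
  by (rule not_nbI, rule C4[of l w "c 5" "c 0"]) (simp_all add: hole6D[OF h] L6D[OF l'] W6D[OF w'])

lemma L6_W5:
  assumes h: "hole6 c" and l': "l \<in> L6 c 0" and w': "w \<in> W6 c 5"
  shows "\<not> nb G l w"
  by (rule not_nbI, rule P7[of l w "c 5" "c 4" "c 3" "c 2" "c 1"]) (simp_all add: hole6D[OF h] L6D[OF l'] W6D[OF w'])

lemma L6_T2:
  assumes h: "hole6 c" and l': "l \<in> L6 c 0" and t': "t \<in> T6 c 2"
  shows "\<not> nb G l t"
  by (rule not_nbI, rule C4[of l t "c 1" "c 0"]) (simp_all add: hole6D[OF h] L6D[OF l'] T6D[OF t'])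

lemma L6_T3:
  assumes h: "hole6 c" and l': "l \<in> L6 c 0" and t': "t \<in> T6 c 3"
  shows "\<not> nb G l t"
  by (rule not_nbI, rule C5[of l t "c 2" "c 1" "c 0"]) (simp_all add: hole6D[OF h] L6D[OF l'] T6D[OF t'])

lemma L6_T4:
  assumes h: "hole6 c" and l': "l \<in> L6 c 0" and t': "t \<in> T6 c 4"
  shows "\<not> nb G l t"
  by (rule not_nbI, rule C4[of l t "c 5" "c 0"]) (simp_all add: hole6D[OF h] L6D[OF l'] T6D[OF t'])

lemma W6_W1:
  assumes h: "hole6 c" and w': "w \<in> W6 c 0" and v': "v \<in> W6 c 1"
  shows "False"
proof -
  note [simp] = hole6D[OF h] W6D[OF w'] W6D[OF v']
  have *: "\<not> nb G w v" by (rule not_nbI, rule C7[of w v "c 2" "c 3" "c 4" "c 5" "c 0"]) simp_all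
  note [simp] = * *[THEN not_nb_sym]
  show False by (rule P7[of w "c 0" "c 5" "c 4" "c 3" "c 2" v]) simp_all
qed

lemma W6_W2:
  assumes h: "hole6 c" and w': "w \<in> W6 c 0" and v': "v \<in> W6 c 2"
  shows "\<not> nb G w v"
  by (rule not_nbI, rule C4[of w v "c 2" "c 1"]) (simp_all add: hole6D[OF h] W6D[OF w'] W6D[OF v'])

lemma W6_W3:
  assumes h: "hole6 c" and w': "w \<in> W6 c 0" and v': "v \<in> W6 c 3"
  shows "\<not> nb G w v"
  by (rule not_nbI, rule C5[of w v "c 3" "c 2" "c 1"]) (simp_all add: hole6D[OF h] W6D[OF w'] W6D[OF v'])

lemma W6_T3:
  assumes h: "hole6 c" and w': "w \<in> W6 c 0" and t': "t \<in> T6 c 3"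
  shows "\<not> nb G w t"
  by (rule not_nbI, rule C4[of w t "c 2" "c 1"]) (simp_all add: hole6D[OF h] W6D[OF w'] T6D[OF t'])

lemma W6_T4:
  assumes h: "hole6 c" and w': "w \<in> W6 c 0" and t': "t \<in> T6 c 4"
  shows "\<not> nb G w t"
  by (rule not_nbI, rule C4[of w t "c 5" "c 0"]) (simp_all add: hole6D[OF h] W6D[OF w'] T6D[OF t'])

lemma Z6_T2_common:
  assumes h: "hole6 c" and z': "z \<in> Z6 c" and t': "t \<in> T6 c 0" and s': "s \<in> T6 c 2" and 1: "nb G z t" "nb G z s"
  shows "False"
proof -
  note [simp] = hole6D[OF h] Z6D[OF z'] T6D[OF t'] T6D[OF s'] 1 1[THEN nb_sym]
  have *: "\<not> nb G t s" by (rule not_nbI, rule C5[of t s "c 3" "c 4" "c 5"]) simp_all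
  note [simp] = * *[THEN not_nb_sym]
  show False by (rule C4[of z t "c 1" s]) simp_all
qed

lemma Z6_T2_step:
  assumes h: "hole6 c" and x': "x \<in> Z6 c" and y': "y \<in> Z6 c" and t': "t \<in> T6 c 0" and s': "s \<in> T6 c 2" and 1: "nb G x y"
    "nb G x t" and 2: "\<not> nb G y t" "\<not> nb G x s"
  shows "False"
proof -
  note [simp] = hole6D[OF h] Z6D[OF x'] Z6D[OF y'] T6D[OF t'] T6D[OF s'] 1 1[THEN nb_sym] 2 2[THEN not_nb_sym]
  show False by (rule P7[of y x t "c 1" "c 2" "c 3" "c 4"]) simp_all
qed

lemma Z6_T3_common:
  assumes h: "hole6 c" and z': "z \<in> Z6 c" and t': "t \<in> T6 c 0" and s': "s \<in> T6 c 3" and 1: "nb G z t" "nb G z s"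
  shows "False"
proof -
  note [simp] = hole6D[OF h] Z6D[OF z'] T6D[OF t'] T6D[OF s'] 1 1[THEN nb_sym]
  have *: "\<not> nb G t s" by (rule not_nbI, rule C4[of t s "c 2" "c 1"]) simp_all
  note [simp] = * *[THEN not_nb_sym]
  show False by (rule C5[of z t "c 1" "c 2" s]) simp_all
qed

lemma Z6_T3_step:
  assumes h: "hole6 c" and x': "x \<in> Z6 c" and y': "y \<in> Z6 c" and t': "t \<in> T6 c 0" and s': "s \<in> T6 c 3" and 1: "nb G x y"
    "nb G x t" and 2: "\<not> nb G y t" "\<not> nb G x s"
  shows "False"
proof -
  note [simp] = hole6D[OF h] Z6D[OF x'] Z6D[OF y'] T6D[OF t'] T6D[OF s'] 1 1[THEN nb_sym] 2 2[THEN not_nb_sym]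
  show False by (rule P7[of y x t "c 1" "c 2" "c 3" "c 4"]) simp_all
qed

lemma Z6_T1:
  assumes h: "hole6 c" and z': "z \<in> Z6 c" and t': "t \<in> T6 c 0" and s': "s \<in> T6 c 1" and 1: "\<not> nb G t s" and 2: "nb G z s"
  shows "False"
proof -
  note [simp] = hole6D[OF h] Z6D[OF z'] T6D[OF t'] T6D[OF s'] 1 1[THEN not_nb_sym] 2 2[THEN nb_sym]
  have *: "\<not> nb G z t" by (rule not_nbI, rule C4[of z t "c 0" s]) simp_all
  note [simp] = * *[THEN not_nb_sym]
  show False by (rule P7[of z s "c 1" t "c 5" "c 4" "c 3"]) simp_all
qed

lemma W6_T01:
  assumes h: "hole6 c" and w': "w \<in> W6 c 0" and t': "t \<in> T6 c 0" and s': "s \<in> T6 c 1" and 1: "\<not> nb G t s" and 2: "nb G w s"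
  shows "False"
proof -
  note [simp] = hole6D[OF h] W6D[OF w'] T6D[OF t'] T6D[OF s'] 1 1[THEN not_nb_sym] 2 2[THEN nb_sym]
  have *: "\<not> nb G w t" by (rule not_nbI, rule C7[of w t "c 5" "c 4" "c 3" "c 2" s]) simp_all
  note [simp] = * *[THEN not_nb_sym]
  show False by (rule P7[of w s "c 2" "c 3" "c 4" "c 5" t]) simp_all
qed

lemma L6_T01:
  assumes h: "hole6 c" and l': "l \<in> L6 c 0" and t': "t \<in> T6 c 0" and s': "s \<in> T6 c 1" and 1: "\<not> nb G t s" and 2: "nb G l s"
  shows "False"
proof -
  note [simp] = hole6D[OF h] L6D[OF l'] T6D[OF t'] T6D[OF s'] 1 1[THEN not_nb_sym] 2 2[THEN nb_sym]
  have *: "\<not> nb G l t" by (rule not_nbI, rule C4[of l t "c 1" s]) simp_all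
  note [simp] = * *[THEN not_nb_sym]
  show False by (rule P7[of l s "c 1" t "c 5" "c 4" "c 3"]) simp_all
qed

lemma L6_T05:
  assumes h: "hole6 c" and l': "l \<in> L6 c 0" and t': "t \<in> T6 c 0" and s': "s \<in> T6 c 5" and 1: "\<not> nb G t s" and 2: "nb G l s"
  shows "False"
proof -
  note [simp] = hole6D[OF h] L6D[OF l'] T6D[OF t'] T6D[OF s'] 1 1[THEN not_nb_sym] 2 2[THEN nb_sym]
  have *: "\<not> nb G l t" by (rule not_nbI, rule C4[of l t "c 5" s]) simp_all
  note [simp] = * *[THEN not_nb_sym]
  show False by (rule P7[of l s "c 4" "c 3" "c 2" "c 1" t]) simp_all
qed

lemma L6_T15_step:
  assumes h: "hole6 c" and x': "x \<in> L6 c 0" and y': "y \<in> L6 c 0" and t': "t \<in> T6 c 1" and s': "s \<in> T6 c 5" and 1: "nb G x y"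
    "nb G x t" and 2: "\<not> nb G y t" "\<not> nb G x s"
  shows "False"
proof -
  note [simp] = hole6D[OF h] L6D[OF x'] L6D[OF y'] T6D[OF t'] T6D[OF s'] 1 1[THEN nb_sym] 2 2[THEN not_nb_sym]
  show False by (rule P7[of y x t "c 2" "c 3" "c 4" "c 5"]) simp_all
qed

text \<open>The four \<open>W6_swap\<close> lemmas prepare an exchange: if \<open>w\<close> sees a
  vertex \<open>r\<close> of type \<open>T6 c 2\<close>, then \<open>r\<close> relates to the
  neighbouring types as \<open>c 2\<close> does. After \<open>r\<close> replaces \<open>c 2\<close>,
  all three-types survive and \<open>w\<close> becomes one; likewise at \<open>c 5\<close>.\<close>

lemma W6_swap2_T1:
  assumes h: "hole6 c" and w': "w \<in> W6 c 0" and r': "r \<in> T6 c 2" and s': "s \<in> T6 c 1" and 1: "nb G w r"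
  shows "nb G r s"
proof (rule ccontr)
  assume n: "\<not> nb G r s"
  note [simp] = hole6D[OF h] W6D[OF w'] T6D[OF r'] T6D[OF s'] 1 1[THEN nb_sym] n n[THEN not_nb_sym]
  have *: "\<not> nb G w s" by (rule not_nbI, rule C4[of w r "c 2" s]) simp_all
  note [simp] = * *[THEN not_nb_sym]
  show False by (rule C5[of w r "c 2" s "c 0"]) simp_all
qed

lemma W6_swap2_T3:
  assumes h: "hole6 c" and w': "w \<in> W6 c 0" and r': "r \<in> T6 c 2" and s': "s \<in> T6 c 3" and 1: "nb G w r"
  shows "nb G r s"
proof (rule ccontr)
  assume n: "\<not> nb G r s"
  note [simp] = hole6D[OF h] W6D[OF w'] T6D[OF r'] T6D[OF s'] 1 1[THEN nb_sym] n n[THEN not_nb_sym]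
  have *: "\<not> nb G w s" by (rule not_nbI, rule C4[of w r "c 2" s]) simp_all
  note [simp] = * *[THEN not_nb_sym]
  show False by (rule C7[of w r "c 2" s "c 4" "c 5" "c 0"]) simp_all
qed

lemma W6_swap5_T0:
  assumes h: "hole6 c" and w': "w \<in> W6 c 0" and r': "r \<in> T6 c 5" and s': "s \<in> T6 c 0" and 1: "nb G w r"
  shows "nb G r s"
proof (rule ccontr)
  assume n: "\<not> nb G r s"
  note [simp] = hole6D[OF h] W6D[OF w'] T6D[OF r'] T6D[OF s'] 1 1[THEN nb_sym] n n[THEN not_nb_sym]
  have *: "\<not> nb G w s" by (rule not_nbI, rule C4[of w r "c 5" s]) simp_all
  note [simp] = * *[THEN not_nb_sym]
  show False by (rule C5[of w r "c 5" s "c 1"]) simp_all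
qed

lemma W6_swap5_T4:
  assumes h: "hole6 c" and w': "w \<in> W6 c 0" and r': "r \<in> T6 c 5" and s': "s \<in> T6 c 4" and 1: "nb G w r"
  shows "nb G r s"
proof (rule ccontr)
  assume n: "\<not> nb G r s"
  note [simp] = hole6D[OF h] W6D[OF w'] T6D[OF r'] T6D[OF s'] 1 1[THEN nb_sym] n n[THEN not_nb_sym]
  have *: "\<not> nb G w s" by (rule not_nbI, rule C4[of w r "c 4" s]) simp_all
  note [simp] = * *[THEN not_nb_sym]
  show False by (rule C7[of w r "c 5" s "c 3" "c 2" "c 1"]) simp_all
qed

text \<open>For a vertex \<open>l\<close> with the single hole neighbour \<open>c 0\<close>, two
  exchanges are needed at once, \<open>t\<close> for \<open>c 1\<close> and \<open>s\<close> for
  \<open>c 5\<close>. The four lemmas of this group ensure that no three-type is lost.\<close>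

lemma L6_swap_T2:
  assumes h: "hole6 c" and l': "l \<in> L6 c 0" and t': "t \<in> T6 c 1" and s': "s \<in> T6 c 5" and x': "x \<in> T6 c 2" and 1: "nb G l t"
    "nb G l s"
  shows "nb G x t"
proof (rule ccontr)
  assume n: "\<not> nb G x t"
  note [simp] = hole6D[OF h] L6D[OF l'] T6D[OF t'] T6D[OF s'] T6D[OF x'] 1 1[THEN nb_sym] n n[THEN not_nb_sym]
  have *: "\<not> nb G l x" by (rule not_nbI, rule C4[of l t "c 1" x]) simp_all
  note [simp] = * *[THEN not_nb_sym]
  show False by (rule P7[of l t "c 1" x "c 3" "c 4" "c 5"]) simp_all
qed

lemma L6_swap_T4:
  assumes h: "hole6 c" and l': "l \<in> L6 c 0" and t': "t \<in> T6 c 1" and s': "s \<in> T6 c 5" and x': "x \<in> T6 c 4" and 1: "nb G l t"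
    "nb G l s"
  shows "nb G x s"
proof (rule ccontr)
  assume n: "\<not> nb G x s"
  note [simp] = hole6D[OF h] L6D[OF l'] T6D[OF t'] T6D[OF s'] T6D[OF x'] 1 1[THEN nb_sym] n n[THEN not_nb_sym]
  have *: "\<not> nb G l x" by (rule not_nbI, rule C4[of l s "c 4" x]) simp_all
  note [simp] = * *[THEN not_nb_sym]
  show False by (rule P7[of l s "c 5" x "c 3" "c 2" "c 1"]) simp_all
qed

lemma L6_swap_T0_1:
  assumes h: "hole6 c" and l': "l \<in> L6 c 0" and t': "t \<in> T6 c 1" and s': "s \<in> T6 c 5" and x': "x \<in> T6 c 0" and 1: "nb G l t"
    "nb G l s"
  shows "nb G x t"
proof (rule ccontr)
  assume n: "\<not> nb G x t"
  note [simp] = hole6D[OF h] L6D[OF l'] T6D[OF t'] T6D[OF s'] T6D[OF x'] 1 1[THEN nb_sym] n n[THEN not_nb_sym]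
  have *: "\<not> nb G l x" by (rule not_nbI, rule C4[of l t "c 1" x]) simp_all
  note [simp] = * *[THEN not_nb_sym]
  show False by (rule P7[of l t "c 1" x "c 5" "c 4" "c 3"]) simp_all
qed

lemma L6_swap_T0_5:
  assumes h: "hole6 c" and l': "l \<in> L6 c 0" and t': "t \<in> T6 c 1" and s': "s \<in> T6 c 5" and x': "x \<in> T6 c 0" and 1: "nb G l t"
    "nb G l s"
  shows "nb G x s"
proof (rule ccontr)
  assume n: "\<not> nb G x s"
  note [simp] = hole6D[OF h] L6D[OF l'] T6D[OF t'] T6D[OF s'] T6D[OF x'] 1 1[THEN nb_sym] n n[THEN not_nb_sym]
  have *: "\<not> nb G l x" by (rule not_nbI, rule C4[of l s "c 5" x]) simp_all
  note [simp] = * *[THEN not_nb_sym]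
  show False by (rule P7[of l s "c 4" "c 3" "c 2" "c 1" x]) simp_all
qed

text \<open>Two missing edges on opposite sides of the hole leave \<open>t\<close>,
  \<open>c 0\<close>, \<open>s\<close>, \<open>c 2\<close>, \<open>p\<close>, \<open>c 4\<close>,
  \<open>q\<close> as an induced path.\<close>

lemma T6_opposite:
  assumes h: "hole6 c" and t': "t \<in> T6 c 0" and s': "s \<in> T6 c 1" and p': "p \<in> T6 c 3" and q': "q \<in> T6 c 4" and 1:
    "\<not> nb G t s" "\<not> nb G p q"
  shows "False"
proof -
  note [simp] = hole6D[OF h] T6D[OF t'] T6D[OF s'] T6D[OF p'] T6D[OF q'] 1 1[THEN not_nb_sym]
  have *: "\<not> nb G t p" by (rule not_nbI, rule C4[of t p "c 2" "c 1"]) simp_all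
  note [simp] = * *[THEN not_nb_sym]
  have *: "\<not> nb G t q" by (rule not_nbI, rule C5[of t q "c 3" "c 2" "c 1"]) simp_all
  note [simp] = * *[THEN not_nb_sym]
  have *: "\<not> nb G s p" by (rule not_nbI, rule C5[of s p "c 4" "c 5" "c 0"]) simp_all
  note [simp] = * *[THEN not_nb_sym]
  have *: "\<not> nb G s q" by (rule not_nbI, rule C4[of s q "c 3" "c 2"]) simp_all
  note [simp] = * *[THEN not_nb_sym]
  show False by (rule P7[of t "c 0" s "c 2" p "c 4" q]) simp_all
qed

text \<open>Two consecutive gaps, possibly at different middle vertices, are turned into a stable
  triple \<open>t\<close>, \<open>s\<close>, \<open>r\<close> with one middle vertex;
  \<open>t\<close> and \<open>r\<close> are nonadjacent anyway by \<open>T6_T2\<close>.\<close>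

lemma T6_consecutive:
  assumes h: "hole6 c" and t': "t \<in> T6 c 0" and s': "s \<in> T6 c 1" and v': "v \<in> T6 c 1" and r': "r \<in> T6 c 2" and 1:
    "\<not> nb G t s" "\<not> nb G v r"
  shows "\<not> nb G s r"
proof
  assume n: "nb G s r"
  note [simp] = hole6D[OF h] T6D[OF t'] T6D[OF s'] T6D[OF v'] T6D[OF r'] 1 1[THEN not_nb_sym] n n[THEN nb_sym]
  have *: "\<not> nb G t r" by (rule not_nbI, rule C4[of t r s "c 0"]) simp_all
  note [simp] = * *[THEN not_nb_sym]
  have *: "nb G s v" by (rule nbI, rule C4[of s "c 0" v "c 2"]) simp_all
  note [simp] = * *[THEN nb_sym]
  have *: "\<not> nb G t v" by (rule not_nbI, rule C7[of t v s r "c 3" "c 4" "c 5"]) simp_all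
  note [simp] = * *[THEN not_nb_sym]
  show False by (rule P7[of t "c 5" "c 4" "c 3" r s v]) simp_all
qed

section \<open>Three-types next to a stable triple \<open>d1\<close>, \<open>d2\<close>,
  \<open>d3\<close>\<close>

lemma Q6_T2_a:
  assumes h: "hole6 c" and d1': "d1 \<in> T6 c 1" and d2': "d2 \<in> T6 c 2" and d3': "d3 \<in> T6 c 3" and v': "v \<in> T6 c 2" and 1:
    "\<not> nb G d1 d2" "\<not> nb G d2 d3" and 2: "nb G v d1"
  shows "nb G v d3"
proof (rule ccontr)
  assume n: "\<not> nb G v d3"
  note [simp] = hole6D[OF h] T6D[OF d1'] T6D[OF d2'] T6D[OF d3'] T6D[OF v'] 1 1[THEN not_nb_sym] 2 2[THEN nb_sym] n n[THEN not_nb_sym]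
  have *: "\<not> nb G d1 d3" by (rule not_nbI, rule C4[of d1 d3 "c 3" v]) simp_all
  note [simp] = * *[THEN not_nb_sym]
  have *: "\<not> nb G d2 v" by (rule not_nbI, rule P7[of d2 v d1 "c 0" "c 5" "c 4" d3]) simp_all
  note [simp] = * *[THEN not_nb_sym]
  show False by (rule C4[of d2 "c 1" v "c 3"]) simp_all
qed

lemma Q6_T2_b:
  assumes h: "hole6 c" and d1': "d1 \<in> T6 c 1" and d2': "d2 \<in> T6 c 2" and d3': "d3 \<in> T6 c 3" and v': "v \<in> T6 c 2" and 1:
    "\<not> nb G d1 d2" "\<not> nb G d2 d3" and 2: "nb G v d3"
  shows "nb G v d1"
proof (rule ccontr)
  assume n: "\<not> nb G v d1"
  note [simp] = hole6D[OF h] T6D[OF d1'] T6D[OF d2'] T6D[OF d3'] T6D[OF v'] 1 1[THEN not_nb_sym] 2 2[THEN nb_sym] n n[THEN not_nb_sym]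
  have *: "\<not> nb G d1 d3" by (rule not_nbI, rule C4[of d1 d3 v "c 1"]) simp_all
  note [simp] = * *[THEN not_nb_sym]
  have *: "\<not> nb G d2 v" by (rule not_nbI, rule P7[of d1 "c 0" "c 5" "c 4" d3 v d2]) simp_all
  note [simp] = * *[THEN not_nb_sym]
  show False by (rule C4[of d2 "c 1" v "c 3"]) simp_all
qed

text \<open>Used in contrapositive form: a vertex of \<open>T6 c 1\<close> with a nonneighbour in
  \<open>T6 c 2\<close> must miss \<open>d2\<close>. The triple thus detects which vertices belong
  to the mutually anticomplete parts of a crown. The suffix \<open>m\<close> marks mirror images
  about index 2.\<close>

lemma Q6_E1:
  assumes h: "hole6 c" and d1': "d1 \<in> T6 c 1" and d2': "d2 \<in> T6 c 2" and d3': "d3 \<in> T6 c 3" and v': "v \<in> T6 c 1" and x':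
    "x \<in> T6 c 2" and 1: "\<not> nb G d1 d2" "\<not> nb G d2 d3" and 2: "nb G v d2"
  shows "nb G v x"
proof (rule ccontr)
  assume n: "\<not> nb G v x"
  note [simp] = hole6D[OF h] T6D[OF d1'] T6D[OF d2'] T6D[OF d3'] T6D[OF v'] T6D[OF x'] 1 1[THEN not_nb_sym] 2 2[THEN nb_sym] n n[THEN not_nb_sym]
  have *: "\<not> nb G d1 d3" by (rule not_nbI, rule C5[of d1 d3 "c 3" d2 "c 1"]) simp_all
  note [simp] = * *[THEN not_nb_sym]
  have *: "nb G d1 v" by (rule nbI, rule C4[of d1 "c 0" v "c 2"]) simp_all
  note [simp] = * *[THEN nb_sym]
  have *: "nb G d2 x" by (rule nbI, rule C4[of d2 "c 1" x "c 3"]) simp_all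
  note [simp] = * *[THEN nb_sym]
  have *: "\<not> nb G d1 x" by (rule not_nbI, rule C4[of d1 v d2 x]) simp_all
  note [simp] = * *[THEN not_nb_sym]
  have *: "\<not> nb G d3 v" by (rule not_nbI, rule C4[of d2 v d3 "c 3"]) simp_all
  note [simp] = * *[THEN not_nb_sym]
  have *: "\<not> nb G d3 x" by (rule not_nbI, rule P7[of d1 v d2 x d3 "c 4" "c 5"]) simp_all
  note [simp] = * *[THEN not_nb_sym]
  show False by (rule P7[of d3 "c 4" "c 5" "c 0" v d2 x]) simp_all
qed

lemma Q6_E1m:
  assumes h: "hole6 c" and d1': "d1 \<in> T6 c 1" and d2': "d2 \<in> T6 c 2" and d3': "d3 \<in> T6 c 3" and v': "v \<in> T6 c 3" and x':
    "x \<in> T6 c 2" and 1: "\<not> nb G d1 d2" "\<not> nb G d2 d3" and 2: "nb G v d2"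
  shows "nb G v x"
proof (rule ccontr)
  assume n: "\<not> nb G v x"
  note [simp] = hole6D[OF h] T6D[OF d1'] T6D[OF d2'] T6D[OF d3'] T6D[OF v'] T6D[OF x'] 1 1[THEN not_nb_sym] 2 2[THEN nb_sym] n n[THEN not_nb_sym]
  have *: "\<not> nb G d1 v" by (rule not_nbI, rule C4[of d1 v d2 "c 1"]) simp_all
  note [simp] = * *[THEN not_nb_sym]
  have *: "nb G d2 x" by (rule nbI, rule C4[of d2 "c 1" x "c 3"]) simp_all
  note [simp] = * *[THEN nb_sym]
  have *: "\<not> nb G d1 x" by (rule not_nbI, rule C7[of d1 x d2 v "c 4" "c 5" "c 0"]) simp_all
  note [simp] = * *[THEN not_nb_sym]
  show False by (rule P7[of d1 "c 0" "c 5" "c 4" v d2 x]) simp_all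
qed

lemma Q6_E2a:
  assumes h: "hole6 c" and d1': "d1 \<in> T6 c 1" and d2': "d2 \<in> T6 c 2" and d3': "d3 \<in> T6 c 3" and v': "v \<in> T6 c 1" and x':
    "x \<in> T6 c 2" and 1: "\<not> nb G d1 d2" "\<not> nb G d2 d3" "\<not> nb G v d2" and 2: "nb G x v"
  shows "nb G x d1"
proof (rule ccontr)
  assume n: "\<not> nb G x d1"
  note [simp] = hole6D[OF h] T6D[OF d1'] T6D[OF d2'] T6D[OF d3'] T6D[OF v'] T6D[OF x'] 1 1[THEN not_nb_sym] 2 2[THEN nb_sym] n n[THEN not_nb_sym]
  have *: "\<not> nb G d1 d3" by (rule not_nbI, rule C5[of d1 d3 "c 3" d2 "c 1"]) simp_all
  note [simp] = * *[THEN not_nb_sym]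
  have *: "nb G d2 x" by (rule nbI, rule C4[of d2 "c 1" x "c 3"]) simp_all
  note [simp] = * *[THEN nb_sym]
  have *: "\<not> nb G d3 v" by (rule not_nbI, rule C5[of d2 "c 1" v d3 "c 3"]) simp_all
  note [simp] = * *[THEN not_nb_sym]
  have *: "\<not> nb G d3 x" by (rule not_nbI, rule P7[of d1 "c 0" "c 5" "c 4" d3 x d2]) simp_all
  note [simp] = * *[THEN not_nb_sym]
  show False by (rule P7[of d2 x v "c 0" "c 5" "c 4" d3]) simp_all
qed

lemma Q6_E2b:
  assumes h: "hole6 c" and d1': "d1 \<in> T6 c 1" and d2': "d2 \<in> T6 c 2" and d3': "d3 \<in> T6 c 3" and v': "v \<in> T6 c 1" and x':
    "x \<in> T6 c 2" and 1: "\<not> nb G d1 d2" "\<not> nb G d2 d3" "\<not> nb G v d2" and 2: "nb G x d1"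
  shows "nb G x v"
proof (rule ccontr)
  assume n: "\<not> nb G x v"
  note [simp] = hole6D[OF h] T6D[OF d1'] T6D[OF d2'] T6D[OF d3'] T6D[OF v'] T6D[OF x'] 1 1[THEN not_nb_sym] 2 2[THEN nb_sym] n n[THEN not_nb_sym]
  have *: "\<not> nb G d1 d3" by (rule not_nbI, rule C5[of d1 d3 "c 3" d2 "c 1"]) simp_all
  note [simp] = * *[THEN not_nb_sym]
  have *: "nb G d2 x" by (rule nbI, rule C4[of d2 "c 1" x "c 3"]) simp_all
  note [simp] = * *[THEN nb_sym]
  have *: "\<not> nb G d3 v" by (rule not_nbI, rule C5[of d2 "c 1" v d3 "c 3"]) simp_all
  note [simp] = * *[THEN not_nb_sym]
  have *: "\<not> nb G d3 x" by (rule not_nbI, rule P7[of d2 x d3 "c 4" "c 5" "c 0" v]) simp_all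
  note [simp] = * *[THEN not_nb_sym]
  show False by (rule P7[of d2 x d1 "c 0" "c 5" "c 4" d3]) simp_all
qed

lemma Q6_E2am:
  assumes h: "hole6 c" and d1': "d1 \<in> T6 c 1" and d2': "d2 \<in> T6 c 2" and d3': "d3 \<in> T6 c 3" and v': "v \<in> T6 c 3" and x':
    "x \<in> T6 c 2" and 1: "\<not> nb G d1 d2" "\<not> nb G d2 d3" "\<not> nb G v d2" and 2: "nb G x v"
  shows "nb G x d3"
proof (rule ccontr)
  assume n: "\<not> nb G x d3"
  note [simp] = hole6D[OF h] T6D[OF d1'] T6D[OF d2'] T6D[OF d3'] T6D[OF v'] T6D[OF x'] 1 1[THEN not_nb_sym] 2 2[THEN nb_sym] n n[THEN not_nb_sym]
  have *: "\<not> nb G d1 d3" by (rule not_nbI, rule C5[of d1 d3 "c 3" d2 "c 1"]) simp_all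
  note [simp] = * *[THEN not_nb_sym]
  have *: "\<not> nb G d1 v" by (rule not_nbI, rule C5[of d1 v "c 3" d2 "c 1"]) simp_all
  note [simp] = * *[THEN not_nb_sym]
  have *: "nb G d2 x" by (rule nbI, rule C4[of d2 "c 1" x "c 3"]) simp_all
  note [simp] = * *[THEN nb_sym]
  have *: "\<not> nb G d1 x" by (rule not_nbI, rule P7[of d2 x d1 "c 0" "c 5" "c 4" d3]) simp_all
  note [simp] = * *[THEN not_nb_sym]
  show False by (rule P7[of d1 "c 0" "c 5" "c 4" v x d2]) simp_all
qed

lemma Q6_E2bm:
  assumes h: "hole6 c" and d1': "d1 \<in> T6 c 1" and d2': "d2 \<in> T6 c 2" and d3': "d3 \<in> T6 c 3" and v': "v \<in> T6 c 3" and x':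
    "x \<in> T6 c 2" and 1: "\<not> nb G d1 d2" "\<not> nb G d2 d3" "\<not> nb G v d2" and 2: "nb G x d3"
  shows "nb G x v"
proof (rule ccontr)
  assume n: "\<not> nb G x v"
  note [simp] = hole6D[OF h] T6D[OF d1'] T6D[OF d2'] T6D[OF d3'] T6D[OF v'] T6D[OF x'] 1 1[THEN not_nb_sym] 2 2[THEN nb_sym] n n[THEN not_nb_sym]
  have *: "\<not> nb G d1 d3" by (rule not_nbI, rule C5[of d1 d3 "c 3" d2 "c 1"]) simp_all
  note [simp] = * *[THEN not_nb_sym]
  have *: "\<not> nb G d1 v" by (rule not_nbI, rule C5[of d1 v "c 3" d2 "c 1"]) simp_all
  note [simp] = * *[THEN not_nb_sym]
  have *: "nb G d2 x" by (rule nbI, rule C4[of d2 "c 1" x "c 3"]) simp_all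
  note [simp] = * *[THEN nb_sym]
  have *: "\<not> nb G d1 x" by (rule not_nbI, rule P7[of d2 x d1 "c 0" "c 5" "c 4" v]) simp_all
  note [simp] = * *[THEN not_nb_sym]
  show False by (rule P7[of d1 "c 0" "c 5" "c 4" d3 x d2]) simp_all
qed

lemma Q6_E3:
  assumes h: "hole6 c" and d1': "d1 \<in> T6 c 1" and d2': "d2 \<in> T6 c 2" and d3': "d3 \<in> T6 c 3" and t': "t \<in> T6 c 0" and s':
    "s \<in> T6 c 1" and 1: "\<not> nb G d1 d2" "\<not> nb G d2 d3" "\<not> nb G t s"
  shows "\<not> nb G s d2"
proof
  assume n: "nb G s d2"
  note [simp] = hole6D[OF h] T6D[OF d1'] T6D[OF d2'] T6D[OF d3'] T6D[OF t'] T6D[OF s'] 1 1[THEN not_nb_sym] n n[THEN nb_sym]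
  have *: "nb G d1 s" by (rule nbI, rule C4[of d1 "c 0" s "c 2"]) simp_all
  note [simp] = * *[THEN nb_sym]
  have *: "\<not> nb G d2 t" by (rule not_nbI, rule C4[of d2 t "c 0" s]) simp_all
  note [simp] = * *[THEN not_nb_sym]
  have *: "\<not> nb G d1 t" by (rule not_nbI, rule C7[of d1 t "c 5" "c 4" "c 3" d2 s]) simp_all
  note [simp] = * *[THEN not_nb_sym]
  show False by (rule P7[of d1 s d2 "c 3" "c 4" "c 5" t]) simp_all
qed

lemma Q6_E4:
  assumes h: "hole6 c" and d1': "d1 \<in> T6 c 1" and d2': "d2 \<in> T6 c 2" and d3': "d3 \<in> T6 c 3" and t': "t \<in> T6 c 0" and s':
    "s \<in> T6 c 1" and v': "v \<in> T6 c 1" and 1: "\<not> nb G d1 d2" "\<not> nb G d2 d3" "\<not> nb G t s" "\<not> nb G v d2"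
  shows "\<not> nb G t v"
proof
  assume n: "nb G t v"
  note [simp] = hole6D[OF h] T6D[OF d1'] T6D[OF d2'] T6D[OF d3'] T6D[OF t'] T6D[OF s'] T6D[OF v'] 1 1[THEN not_nb_sym] n n[THEN nb_sym]
  have *: "nb G d1 s" by (rule nbI, rule C4[of d1 "c 0" s "c 2"]) simp_all
  note [simp] = * *[THEN nb_sym]
  have *: "nb G d1 v" by (rule nbI, rule C4[of d1 "c 0" v "c 2"]) simp_all
  note [simp] = * *[THEN nb_sym]
  have *: "\<not> nb G d2 t" by (rule not_nbI, rule C4[of d2 t v "c 2"]) simp_all
  note [simp] = * *[THEN not_nb_sym]
  have *: "nb G d1 t" by (rule nbI, rule P7[of d1 v t "c 5" "c 4" "c 3" d2]) simp_all
  note [simp] = * *[THEN nb_sym]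
  have *: "\<not> nb G d2 s" by (rule not_nbI, rule C7[of d1 t "c 5" "c 4" "c 3" d2 s]) simp_all
  note [simp] = * *[THEN not_nb_sym]
  show False by (rule P7[of d2 "c 3" "c 4" "c 5" t d1 s]) simp_all
qed

lemmas rotate_6 = T6_rotate W6_rotate L6_rotate U6_rotate Z6_rotate add_0_right

lemmas T6_clique' = T6_clique[OF hole6_rotate, unfolded rotate_6]
lemmas T6_T2' = T6_T2[OF hole6_rotate, unfolded rotate_6]
lemmas T6_T3' = T6_T3[OF hole6_rotate, unfolded rotate_6]
lemmas W6_W2' = W6_W2[OF hole6_rotate, unfolded rotate_6]
lemmas U6_T' = U6_T[OF hole6_rotate, unfolded rotate_6]
lemmas L6_L1' = L6_L1[OF hole6_rotate, unfolded rotate_6]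
lemmas L6_L2' = L6_L2[OF hole6_rotate, unfolded rotate_6]
lemmas L6_L3' = L6_L3[OF hole6_rotate, unfolded rotate_6]
lemmas L6_Z' = L6_Z[OF hole6_rotate, unfolded rotate_6]
lemmas W6_Z' = W6_Z[OF hole6_rotate, unfolded rotate_6]
lemmas Z6_T2_common' = Z6_T2_common[OF hole6_rotate, unfolded rotate_6]
lemmas Z6_T2_step' = Z6_T2_step[OF hole6_rotate, unfolded rotate_6]
lemmas Z6_T3_common' = Z6_T3_common[OF hole6_rotate, unfolded rotate_6]
lemmas Z6_T3_step' = Z6_T3_step[OF hole6_rotate, unfolded rotate_6]
lemmas Z6_T1' = Z6_T1[OF hole6_rotate, unfolded rotate_6]
lemmas T6_opposite' = T6_opposite[OF hole6_rotate, unfolded rotate_6]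
lemmas T6_consecutive' = T6_consecutive[OF hole6_rotate, unfolded rotate_6]

text \<open>A component of \<open>Z6\<close> attaches only to \<open>U6\<close> and to three-types.
  Nonadjacent attachments at offset 2 or 3 are refuted by propagation through the component, those
  at offset 1 or 5 directly by \<open>Z6_T1\<close>.\<close>

lemma Z6_empty:
  assumes h: "hole6 c"
  shows "Z6 c = {}"
proof (rule ccontr)
  assume "Z6 c \<noteq> {}"
  then obtain z where z: "z \<in> Z6 c" by blast
  obtain K where K: "z \<in> K" "K \<subseteq> Z6 c" "\<And>x y. x \<in> K \<Longrightarrow> y \<in> Z6 c \<Longrightarrow> nb G x y \<Longrightarrow> y \<in> K"
    "\<And>S s. \<lbrakk>S \<subseteq> K; s \<in> S; \<And>x y. x \<in> S \<Longrightarrow> y \<in> K \<Longrightarrow> nb G x y \<Longrightarrow> y \<in> S\<rbrakk> \<Longrightarrow> S = K"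
    using nb_component[OF z, of G thesis] by blast
  have KV: "K \<subseteq> verts G" "K \<noteq> {}" using K(1,2) by (auto simp: Z6_def)
  have c0: "c 0 \<notin> K" "\<forall>k\<in>K. \<not> nb G (c 0) k"
    using K(2) Z6D(2)[of _ c 0] nb_refl[of G "c 0"] by blast+
  obtain x y k l where xy: "x \<in> verts G" "x \<notin> K" "y \<in> verts G" "y \<notin> K" "\<not> nb G x y" "k \<in> K" "nb G x k" "l \<in> K" "nb G y l"
    using no_clique_cutset_obtain[OF atom_graph_axioms KV hole6_verts[OF h] c0] by blast
  have UT: "w \<in> U6 c \<or> (\<exists>i. w \<in> T6 c i)" if w: "w \<in> verts G" "w \<notin> K" "k \<in> K" "nb G w k" for w k
  proof -
    have kw: "nb G k w" "k \<in> Z6 c" using w(3) K(2) nb_sym[OF w(4)] by blast+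
    then have "w \<notin> Z6 c" using K(3) w by blast
    moreover have "w \<notin> W6 c i" for i using W6_Z'[OF h, of w i k] kw w by blast
    moreover have "w \<notin> L6 c i" for i using L6_Z'[OF h, of w i k] kw w by blast
    ultimately show ?thesis using hole6_cover[OF h] w by blast
  qed
  have conn: False if "k \<in> K" "nb G k t" "l \<in> K" "nb G l s"
     and com: "\<And>k. k \<in> K \<Longrightarrow> nb G k t \<Longrightarrow> nb G k s \<Longrightarrow> False"
     and step: "\<And>x y. x \<in> K \<Longrightarrow> y \<in> K \<Longrightarrow> nb G x y \<Longrightarrow> nb G x t \<Longrightarrow> \<not> nb G y t \<Longrightarrow> \<not> nb G x s \<Longrightarrow> False" for t s k l
  proof -
    have "{k \<in> K. nb G k t} = K"
      by (rule K(4)[of _ k]) (use that in auto)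
    then show False using com[of l] that(3,4) by blast
  qed
  have TT: "nb G t s" if ts: "t \<in> T6 c i" "s \<in> T6 c j" and kl: "k \<in> K" "nb G k t" "l \<in> K" "nb G l s" for t s i j k l
  proof (rule ccontr)
    assume n: "\<not> nb G t s"
    have n': "\<not> nb G s t" using n by (rule not_nb_sym)
    have Z: "x \<in> Z6 c" if "x \<in> K" for x using K(2) that by blast
    have 2: False if "t \<in> T6 c i" "s \<in> T6 c (i + 2)" "k \<in> K" "nb G k t" "l \<in> K" "nb G l s" for i t s k l
      by (rule conn[OF that(3-6)])
        (use Z6_T2_common'[OF h Z that(1,2)] Z6_T2_step'[OF h Z Z that(1,2)] in blast)+
    have 3: False if "t \<in> T6 c i" "s \<in> T6 c (i + 3)" "k \<in> K" "nb G k t" "l \<in> K" "nb G l s" for i t s k l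
      by (rule conn[OF that(3-6)])
        (use Z6_T3_common'[OF h Z that(1,2)] Z6_T3_step'[OF h Z Z that(1,2)] in blast)+
    have "\<forall>d. s \<in> T6 c (i + d) \<longrightarrow> False"
      unfolding all_6
    proof (intro conjI impI)
      assume "s \<in> T6 c (i + 0)" then show False using T6_clique'[OF h ts(1)] n by simp
    next
      assume "s \<in> T6 c (i + 1)" then show False using Z6_T1'[OF h Z[OF kl(3)] ts(1)] n kl by blast
    next
      assume "s \<in> T6 c (i + 2)" then show False using 2 ts kl by blast
    next
      assume "s \<in> T6 c (i + 3)" then show False using 3 ts kl by blast
    next
      assume "s \<in> T6 c (i + 4)" then show False using 2[of s "i + 4" t] ts kl by (simp add: arith_6)
    next
      assume "s \<in> T6 c (i + 5)" then show False using Z6_T1'[OF h Z[OF kl(1)], of s "i + 5" t] ts n' kl by (simp add: arith_6)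
    qed
    from this[rule_format, of "j - i"] ts show False by simp
  qed
  show False
    using UT[OF xy(1,2,6,7)] UT[OF xy(3,4,8,9)] xy(5) not_nb_sym[OF xy(5)] U6_clique[OF h, of x y] U6_T'[OF h, of x y] U6_T'[OF h, of y x]
      TT[of x _ y _ k l] xy(6,8) nb_sym[OF xy(7)] nb_sym[OF xy(9)] by blast
qed

section \<open>Enlarging the set of three-types by exchanging hole vertices\<close>

definition TT6 :: "(6 \<Rightarrow> 'a) \<Rightarrow> 'a set" where "TT6 c = (\<Union>i. T6 c i)"

lemma TT6_rotate: "TT6 (\<lambda>j. c (k + j)) = TT6 c"
proof -
  have "(\<Union>i. T6 c (k + i)) = (\<Union>i. T6 c i)" by (metis (no_types) surj_plus UNIV_I image_image)
  then show ?thesis unfolding TT6_def T6_rotate .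
qed

text \<open>A vertex of \<open>T6 c m\<close> has the same neighbours on the hole as
  \<open>c m\<close> itself and can take its place.\<close>

lemma hole6_upd:
  assumes h: "hole6 c" and r: "r \<in> T6 c m"
  shows "hole6 (c(m := r))"
  unfolding hole6_def using hole6D[OF h] T6D[OF r] by (auto simp: algebra_simps)

lemma T6_upd:
  assumes v: "v \<in> T6 c j" and r: "nb G v r \<longleftrightarrow> m - j = 0 \<or> m - j = 1 \<or> m - j = 5"
  shows "v \<in> T6 (c(m := r)) j"
  using v r unfolding T6_def by auto

lemmas W6_W1' = W6_W1[OF hole6_rotate, unfolded rotate_6]
lemmas L6_W' = L6_W0[OF hole6_rotate, unfolded rotate_6] L6_W1[OF hole6_rotate, unfolded rotate_6]
  L6_W2[OF hole6_rotate, unfolded rotate_6] L6_W3[OF hole6_rotate, unfolded rotate_6]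
  L6_W4[OF hole6_rotate, unfolded rotate_6] L6_W5[OF hole6_rotate, unfolded rotate_6]

lemma L6_W:
  assumes h: "hole6 c" and l: "l \<in> L6 c i" and w: "w \<in> W6 c j"
  shows "\<not> nb G l w"
proof -
  have "\<forall>d. w \<in> W6 c (i + d) \<longrightarrow> \<not> nb G l w"
    unfolding all_6 using L6_W'[OF h l] by simp
  from this[rule_format, of "j - i"] w show ?thesis by simp
qed

lemma L6_L:
  assumes h: "hole6 c" and l: "l \<in> L6 c i" and m: "m \<in> L6 c j" and lm: "nb G l m"
  shows "i = j"
proof -
  have "\<forall>d. m \<in> L6 c (i + d) \<longrightarrow> d = 0"
    unfolding all_6
  proof (intro conjI impI)
    show "(1::6) = 0" if "m \<in> L6 c (i + 1)" using L6_L1'[OF h l that] lm by blast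
    show "(2::6) = 0" if "m \<in> L6 c (i + 2)" using L6_L2'[OF h l that] by blast
    show "(3::6) = 0" if "m \<in> L6 c (i + 3)" using L6_L3'[OF h l that] lm by blast
    show "(4::6) = 0" if "m \<in> L6 c (i + 4)" using L6_L2'[OF h that, of l] l by (simp add: arith_6)
    show "(5::6) = 0" if "m \<in> L6 c (i + 5)" using L6_L1'[OF h that, of l] l nb_sym[OF lm] by (simp add: arith_6)
  qed simp
  from this[rule_format, of "j - i"] m show ?thesis by simp
qed

text \<open>Without such a pair, \<open>W6 c 0\<close> would attach only to \<open>U6\<close>,
  \<open>T6 c 0\<close> and \<open>T6 c 1\<close>. A nonadjacent pair there would have one vertex in
  each of the two three-types, which \<open>W6_T01\<close> excludes, so the attachments would be a
  clique-cutset.\<close>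

lemma W6_attached:
  assumes h: "hole6 c" and w: "w \<in> W6 c 0"
  shows "\<exists>v\<in>W6 c 0. \<exists>r\<in>T6 c 2 \<union> T6 c 5. nb G v r"
proof (rule ccontr)
  assume no: "\<not> (\<exists>v\<in>W6 c 0. \<exists>r\<in>T6 c 2 \<union> T6 c 5. nb G v r)"
  have KV: "W6 c 0 \<subseteq> verts G" "W6 c 0 \<noteq> {}" using w by (auto simp: W6_def)
  have c0: "c 3 \<notin> W6 c 0" "\<forall>k\<in>W6 c 0. \<not> nb G (c 3) k"
    using W6D(1)[of "c 3" c 0 3] W6D(2)[of _ c 0 3] by auto
  obtain x y k l where xy: "x \<in> verts G" "x \<notin> W6 c 0" "y \<in> verts G" "y \<notin> W6 c 0" "\<not> nb G x y"
      "k \<in> W6 c 0" "nb G x k" "l \<in> W6 c 0" "nb G y l"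
    using no_clique_cutset_obtain[OF atom_graph_axioms KV hole6_verts[OF h] c0] by blast
  have UT: "x \<in> U6 c \<or> x \<in> T6 c 0 \<or> x \<in> T6 c 1"
    if x: "x \<in> verts G" "x \<notin> W6 c 0" "k \<in> W6 c 0" "nb G x k" for x k
  proof -
    have kx: "nb G k x" using nb_sym[OF x(4)] .
    have "\<forall>i. x \<notin> W6 c i"
      unfolding all_6
    proof (intro conjI)
      show "x \<notin> W6 c 0" by fact
      show "x \<notin> W6 c 1" using W6_W1[OF h x(3), of x] by blast
      show "x \<notin> W6 c 2" using W6_W2[OF h x(3), of x] kx by blast
      show "x \<notin> W6 c 3" using W6_W3[OF h x(3), of x] kx by blast
      show "x \<notin> W6 c 4" using W6_W2'[OF h, of x 4 k] x by (auto simp: mod_6)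
      show "x \<notin> W6 c 5" using W6_W1'[OF h, of x 5 k] x by (auto simp: mod_6)
    qed
    moreover have "x \<notin> L6 c i" for i using L6_W[OF h _ x(3)] x(4) by blast
    moreover have "\<forall>i. x \<in> T6 c i \<longrightarrow> i = 0 \<or> i = 1"
      unfolding all_6 using no x(3) kx W6_T3[OF h x(3), of x] W6_T4[OF h x(3), of x] by auto
    ultimately show ?thesis using hole6_cover[OF h x(1)] Z6_empty[OF h] by blast
  qed
  have "(x \<in> T6 c 0 \<and> y \<in> T6 c 1) \<or> (x \<in> T6 c 1 \<and> y \<in> T6 c 0)"
    using UT[OF xy(1,2,6,7)] UT[OF xy(3,4,8,9)] xy(5) not_nb_sym[OF xy(5)] U6_clique[OF h, of x y] U6_T'[OF h, of x y] U6_T'[OF h, of y x]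
      T6_clique'[OF h, of x _ y] by blast
  then show False
    using W6_T01[OF h xy(6), of y x] W6_T01[OF h xy(8), of x y] xy(5) not_nb_sym[OF xy(5)] nb_sym[OF xy(7)] nb_sym[OF xy(9)]
    by blast
qed

text \<open>Exchanging \<open>c 2\<close> or \<open>c 5\<close> for the neighbour \<open>r\<close>
  of \<open>v\<close> gives \<open>v\<close> a third consecutive neighbour. No three-type is lost,
  and \<open>v\<close> was none before.\<close>

lemma TT6_increase_W_0:
  assumes h: "hole6 c" and w: "w \<in> W6 c 0"
  shows "\<exists>d. hole6 d \<and> TT6 c \<subset> TT6 d"
proof -
  obtain v r where v: "v \<in> W6 c 0" and r: "r \<in> T6 c 2 \<or> r \<in> T6 c 5" and vr: "nb G v r"
    using W6_attached[OF h w] by blast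
  have nT: "v \<notin> TT6 c"
  proof
    assume "v \<in> TT6 c"
    then obtain i where "v \<in> T6 c i" by (auto simp: TT6_def)
    then have "\<forall>j. (j = 0 \<or> j = 1) \<longleftrightarrow> (j - i = 0 \<or> j - i = 1 \<or> j - i = 5)"
      using W6D(1)[OF v] T6D(1)[of v c i] by simp
    moreover have "\<forall>i. \<not> (\<forall>j. (j = 0 \<or> j = 1) \<longleftrightarrow> (j - i = 0 \<or> j - i = 1 \<or> j - i = (5::6)))"
      unfolding all_6 by simp
    ultimately show False by blast
  qed
  have vV: "v \<in> verts G" using v by (simp add: W6_def)
  from r show ?thesis
  proof
    assume r: "r \<in> T6 c 2"
    have A: "nb G s r \<longleftrightarrow> 2 - j = 0 \<or> 2 - j = 1 \<or> 2 - j = 5" if s: "s \<in> T6 c j" for s j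
    proof -
      have "\<forall>j. s \<in> T6 c j \<longrightarrow> (nb G s r \<longleftrightarrow> 2 - j = 0 \<or> 2 - j = 1 \<or> 2 - j = 5)"
        unfolding all_6 using T6_T2'[OF h, of s 0 r] T6_T2'[OF h, of r 2 s] T6_T3'[OF h, of r 2 s] r
          T6_clique'[OF h r, of s] W6_swap2_T1[OF h v r _ vr, of s] W6_swap2_T3[OF h v r _ vr, of s]
        by (auto simp: mod_6 nb_commute[of G s r])
      then show ?thesis using s by blast
    qed
    have "s \<in> T6 (c(2 := r)) j" if "s \<in> T6 c j" for s j by (rule T6_upd[OF that A[OF that]])
    then have "TT6 c \<subseteq> TT6 (c(2 := r))" unfolding TT6_def by blast
    moreover have "v \<in> T6 (c(2 := r)) 1"
      using W6D(1)[OF v] vr vV unfolding T6_def all_6 by simp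
    ultimately show ?thesis using hole6_upd[OF h r] nT unfolding TT6_def by blast
  next
    assume r: "r \<in> T6 c 5"
    have A: "nb G s r \<longleftrightarrow> 5 - j = 0 \<or> 5 - j = 1 \<or> 5 - j = 5" if s: "s \<in> T6 c j" for s j
    proof -
      have "\<forall>j. s \<in> T6 c j \<longrightarrow> (nb G s r \<longleftrightarrow> 5 - j = 0 \<or> 5 - j = 1 \<or> 5 - j = 5)"
        unfolding all_6 using T6_T2'[OF h, of s 3 r] T6_T2'[OF h, of r 5 s] T6_T3'[OF h, of r 5 s] r
          T6_clique'[OF h r, of s] W6_swap5_T0[OF h v r _ vr, of s] W6_swap5_T4[OF h v r _ vr, of s]
        by (auto simp: mod_6 nb_commute[of G s r])
      then show ?thesis using s by blast
    qed
    have "s \<in> T6 (c(5 := r)) j" if "s \<in> T6 c j" for s j by (rule T6_upd[OF that A[OF that]])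
    then have "TT6 c \<subseteq> TT6 (c(5 := r))" unfolding TT6_def by blast
    moreover have "v \<in> T6 (c(5 := r)) 0"
      using W6D(1)[OF v] vr vV unfolding T6_def all_6 by simp
    ultimately show ?thesis using hole6_upd[OF h r] nT unfolding TT6_def by blast
  qed
qed

text \<open>A component of \<open>L6 c 0\<close> attaches to \<open>U6\<close> and to three-types at
  0, 1 and 5. A nonadjacent pair of attachments must come from types 1 and 5, and if no single
  vertex saw both members, adjacency to the first would spread over the component up to the
  second.\<close>

lemma L6_attached:
  assumes h: "hole6 c" and l: "l \<in> L6 c 0"
  shows "\<exists>l\<in>L6 c 0. \<exists>t\<in>T6 c 1. \<exists>s\<in>T6 c 5. nb G l t \<and> nb G l s"
proof (rule ccontr)
  assume no: "\<not> (\<exists>l\<in>L6 c 0. \<exists>t\<in>T6 c 1. \<exists>s\<in>T6 c 5. nb G l t \<and> nb G l s)"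
  obtain K where K: "l \<in> K" "K \<subseteq> L6 c 0" "\<And>x y. x \<in> K \<Longrightarrow> y \<in> L6 c 0 \<Longrightarrow> nb G x y \<Longrightarrow> y \<in> K"
    "\<And>S s. \<lbrakk>S \<subseteq> K; s \<in> S; \<And>x y. x \<in> S \<Longrightarrow> y \<in> K \<Longrightarrow> nb G x y \<Longrightarrow> y \<in> S\<rbrakk> \<Longrightarrow> S = K"
    using nb_component[OF l, of G thesis] by blast
  have KV: "K \<subseteq> verts G" "K \<noteq> {}" using K(1,2) by (auto simp: L6_def)
  have c0: "c 3 \<notin> K" "\<forall>k\<in>K. \<not> nb G (c 3) k"
    using K(2) L6D(1)[of "c 3" c 0 3] L6D(2)[of _ c 0 3] by auto
  obtain x y k m where xy: "x \<in> verts G" "x \<notin> K" "y \<in> verts G" "y \<notin> K" "\<not> nb G x y" "k \<in> K" "nb G x k" "m \<in> K" "nb G y m"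
    using no_clique_cutset_obtain[OF atom_graph_axioms KV hole6_verts[OF h] c0] by blast
  have UT: "w \<in> U6 c \<or> w \<in> T6 c 0 \<or> w \<in> T6 c 1 \<or> w \<in> T6 c 5"
    if w: "w \<in> verts G" "w \<notin> K" "k \<in> K" "nb G w k" for w k
  proof -
    have kL: "k \<in> L6 c 0" using w K(2) by blast
    have kw: "nb G k w" using nb_sym[OF w(4)] .
    have "w \<notin> W6 c i" for i using L6_W[OF h kL] kw by blast
    moreover have "w \<notin> L6 c i" for i using L6_L[OF h kL _ kw, of i] K(3)[OF w(3) _ kw] w(2) by blast
    moreover have "\<forall>i. w \<in> T6 c i \<longrightarrow> i = 0 \<or> i = 1 \<or> i = 5"
      unfolding all_6 using kw L6_T2[OF h kL, of w] L6_T3[OF h kL, of w] L6_T4[OF h kL, of w] by auto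
    ultimately show ?thesis using hole6_cover[OF h w(1)] Z6_empty[OF h] by blast
  qed
  have step: False if ts: "t \<in> T6 c 1" "s \<in> T6 c 5" and kl: "k \<in> K" "nb G k t" "m \<in> K" "nb G m s" for t s k m
  proof -
    have com: "\<not> (nb G k t \<and> nb G k s)" if "k \<in> K" for k using no that ts K(2) by blast
    have "{k \<in> K. nb G k t} = K"
    proof (rule K(4)[of _ k])
      show "{k \<in> K. nb G k t} \<subseteq> K" "k \<in> {k \<in> K. nb G k t}" using kl by auto
      fix x y assume xy: "x \<in> {k \<in> K. nb G k t}" "y \<in> K" "nb G x y"
      then have L: "x \<in> L6 c 0" "y \<in> L6 c 0" using K(2) by auto
      show "y \<in> {k \<in> K. nb G k t}" using L6_T15_step[OF h L ts xy(3)] com[of x] xy by blast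
    qed
    then show False using com[of m] kl by blast
  qed
  have 01: "nb G t s" if "t \<in> T6 c 0" "s \<in> T6 c 1" "m \<in> K" "nb G m s" for t s m
    using L6_T01[OF h _ that(1,2) _ that(4)] that(3) K(2) by blast
  have 05: "nb G t s" if "t \<in> T6 c 0" "s \<in> T6 c 5" "m \<in> K" "nb G m s" for t s m
    using L6_T05[OF h _ that(1,2) _ that(4)] that(3) K(2) by blast
  have all: "nb G x y" if "x \<in> U6 c \<or> x \<in> T6 c 0 \<or> x \<in> T6 c 1 \<or> x \<in> T6 c 5"
    "y \<in> U6 c \<or> y \<in> T6 c 0 \<or> y \<in> T6 c 1 \<or> y \<in> T6 c 5" "k \<in> K" "nb G k x" "m \<in> K" "nb G m y" for x y k m
  proof -
    have "nb G x y" if "x \<in> U6 c" "y \<in> U6 c \<or> y \<in> T6 c 0 \<or> y \<in> T6 c 1 \<or> y \<in> T6 c 5" for x y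
      using that U6_clique[OF h that(1), of y] U6_T'[OF h that(1), of y] by blast
    note U = this[of x y] this[of y x, THEN nb_sym]
    have "nb G x y" if "x \<in> T6 c i" "y \<in> T6 c i" for i using T6_clique'[OF h that] .
    then show ?thesis using that U 01[of x y m] 01[of y x k, THEN nb_sym] 05[of x y m] 05[of y x k, THEN nb_sym]
        step[of x y k m] step[of y x m k] by blast
  qed
  show False
    using all[OF UT[OF xy(1,2,6,7)] UT[OF xy(3,4,8,9)] xy(6) nb_sym[OF xy(7)] xy(8) nb_sym[OF xy(9)]] xy(5) by blast
qed

lemma TT6_increase_L_0:
  assumes h: "hole6 c" and l: "l \<in> L6 c 0"
  shows "\<exists>d. hole6 d \<and> TT6 c \<subset> TT6 d"
proof -
  obtain v t s where v: "v \<in> L6 c 0" and t: "t \<in> T6 c 1" and s: "s \<in> T6 c 5" and vt: "nb G v t" and vs: "nb G v s"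
    using L6_attached[OF h l] by blast
  have nT: "v \<notin> TT6 c"
  proof
    assume "v \<in> TT6 c"
    then obtain i where "v \<in> T6 c i" by (auto simp: TT6_def)
    then have "\<forall>j. j = 0 \<longleftrightarrow> (j - i = 0 \<or> j - i = 1 \<or> j - i = 5)"
      using L6D(1)[OF v] T6D(1)[of v c i] by simp
    moreover have "\<forall>i. \<not> (\<forall>j. j = 0 \<longleftrightarrow> (j - i = 0 \<or> j - i = 1 \<or> j - i = (5::6)))"
      unfolding all_6 by simp
    ultimately show False by blast
  qed
  have vV: "v \<in> verts G" using v by (simp add: L6_def)
  have ts: "\<not> nb G t s" "\<not> nb G s t" using T6_T2'[OF h s, of t] t by (auto simp: mod_6 dest: nb_sym)
  have A: "nb G x t \<longleftrightarrow> 1 - j = 0 \<or> 1 - j = 1 \<or> 1 - j = 5" if x: "x \<in> T6 c j" for x j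
  proof -
    have "\<forall>j. x \<in> T6 c j \<longrightarrow> (nb G x t \<longleftrightarrow> 1 - j = 0 \<or> 1 - j = 1 \<or> 1 - j = 5)"
      unfolding all_6 using T6_T2'[OF h, of x 5 t] T6_T2'[OF h, of t 1 x] T6_T3'[OF h, of t 1 x] t
        T6_clique'[OF h t, of x] L6_swap_T0_1[OF h v t s _ vt vs, of x] L6_swap_T2[OF h v t s _ vt vs, of x]
      by (auto simp: mod_6 nb_commute[of G x t])
    then show ?thesis using x by blast
  qed
  have B: "nb G x s \<longleftrightarrow> 5 - j = 0 \<or> 5 - j = 1 \<or> 5 - j = 5" if x: "x \<in> T6 c j" for x j
  proof -
    have "\<forall>j. x \<in> T6 c j \<longrightarrow> (nb G x s \<longleftrightarrow> 5 - j = 0 \<or> 5 - j = 1 \<or> 5 - j = 5)"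
      unfolding all_6 using T6_T2'[OF h, of x 3 s] T6_T2'[OF h, of s 5 x] T6_T3'[OF h, of s 5 x] s
        T6_clique'[OF h s, of x] L6_swap_T0_5[OF h v t s _ vt vs, of x] L6_swap_T4[OF h v t s _ vt vs, of x]
      by (auto simp: mod_6 nb_commute[of G x s])
    then show ?thesis using x by blast
  qed
  define d where "d = c(1 := t, 5 := s)"
  have s': "s \<in> T6 (c(1 := t)) 5" using T6_upd[OF s] A[OF s] by blast
  have hd: "hole6 d" unfolding d_def by (rule hole6_upd[OF hole6_upd[OF h t] s'])
  have "x \<in> T6 d j" if "x \<in> T6 c j" for x j
    unfolding d_def by (rule T6_upd[OF T6_upd[OF that A[OF that]] B[OF that]])
  then have "TT6 c \<subseteq> TT6 d" unfolding TT6_def by blast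
  moreover have "v \<in> T6 d 0"
    using L6D(1)[OF v] vt vs vV unfolding T6_def all_6 d_def by simp
  ultimately show ?thesis using hd nT unfolding TT6_def by blast
qed

text \<open>\<open>TT6\<close> does not change under rotation, so maximality also holds for rotated
  holes and the index-0 exchange lemmas empty \<open>W6\<close> and \<open>L6\<close> at every
  index. What remains besides three-types would be universal.\<close>

lemma maximal_hole6:
  assumes "hole6 c"
  obtains d where "hole6 d" "verts G = TT6 d"
proof -
  have fin: "finite (verts G)" using simple by (simp add: simple_graph_def)
  have TV: "TT6 c \<subseteq> verts G" for c by (auto simp: TT6_def T6_def)
  have "\<forall>y. hole6 y \<longrightarrow> card (TT6 y) \<le> card (verts G)" using TV fin card_mono by blast
  then obtain d where d: "hole6 d" "\<And>e. hole6 e \<Longrightarrow> card (TT6 e) \<le> card (TT6 d)"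
    using ex_has_greatest_nat[of hole6 c "\<lambda>c. card (TT6 c)" "card (verts G) + 1"] assms by (metis le_imp_less_Suc Suc_eq_plus1)
  have max: "\<not> (\<exists>e. hole6 e \<and> TT6 d \<subset> TT6 e)"
    using d(2) psubset_card_mono finite_subset[OF TV fin] by (metis leD)
  have rot: "\<not> (\<exists>e. hole6 e \<and> TT6 (\<lambda>j. d (k + j)) \<subset> TT6 e)" for k using max unfolding TT6_rotate .
  have W: "W6 d i = {}" for i
    using TT6_increase_W_0[OF hole6_rotate[OF d(1), of i]] rot[of i] unfolding rotate_6 by blast
  have L: "L6 d i = {}" for i
    using TT6_increase_L_0[OF hole6_rotate[OF d(1), of i]] rot[of i] unfolding rotate_6 by blast
  have cov: "v \<in> U6 d \<or> v \<in> TT6 d" if "v \<in> verts G" for v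
    using hole6_cover[OF d(1) that] by (auto simp: TT6_def W L Z6_empty[OF d(1)])
  have "u \<notin> U6 d" for u
  proof
    assume u: "u \<in> U6 d"
    then have "u \<in> verts G" by (simp add: U6_def)
    then obtain v where v: "v \<in> verts G" "\<not> nb G u v" using no_universal by blast
    then show False using cov[OF v(1)] U6_clique[OF d(1) u, of v] U6_T'[OF d(1) u, of v] unfolding TT6_def by blast
  qed
  then have "verts G = TT6 d" using cov TV by blast
  then show thesis using that d(1) by blast
qed

lemma T6_T6_disjoint: "i \<noteq> j \<Longrightarrow> T6 c i \<inter> T6 c j = {}"
proof (rule ccontr)
  assume ij: "i \<noteq> j" "T6 c i \<inter> T6 c j \<noteq> {}"
  then obtain v where v: "v \<in> T6 c i" "v \<in> T6 c j" by blast
  define d where "d = j - i"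
  have "\<forall>k. (k - i = 0 \<or> k - i = 1 \<or> k - i = 5) \<longleftrightarrow> (k - j = 0 \<or> k - j = 1 \<or> k - j = 5)"
    using T6D(1)[OF v(1)] T6D(1)[OF v(2)] by blast
  then have *: "(k - i = 0 \<or> k - i = 1 \<or> k - i = 5) \<longleftrightarrow> ((k - i) - d = 0 \<or> (k - i) - d = 1 \<or> (k - i) - d = 5)" for k
    by (simp add: d_def algebra_simps)
  have "\<forall>m. (m = 0 \<or> m = 1 \<or> m = 5) \<longleftrightarrow> (m - d = 0 \<or> m - d = 1 \<or> m - d = 5)"
    using *[of "m + i" for m] by simp
  moreover have "\<forall>d. (\<forall>m. (m = 0 \<or> m = 1 \<or> m = 5) \<longleftrightarrow> (m - d = 0 \<or> m - d = 1 \<or> m - d = (5::6))) \<longrightarrow> d = 0"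
    unfolding all_6 by simp
  ultimately have "d = 0" by blast
  then show False using ij by (simp add: d_def)
qed

lemma T6_far:
  assumes h: "hole6 c" and x: "x \<in> T6 c i" and y: "y \<in> T6 c (i + d)" and d: "d = 2 \<or> d = 3 \<or> d = 4"
  shows "\<not> nb G x y"
proof -
  from d consider "d = 2" | "d = 3" | "d = 4" by blast
  then show ?thesis
  proof cases
    case 1 then show ?thesis using T6_T2'[OF h x] y by blast
  next
    case 2 then show ?thesis using T6_T3'[OF h x] y by blast
  next
    case 3
    then have "x \<in> T6 c (i + d + 2)" using x by (simp add: arith_6)
    from T6_T2'[OF h y this] show ?thesis by (rule not_nb_sym)
  qed
qed

section \<open>Recognizing wreaths and crowns\<close>

lemma wreath6I:
  assumes h: "hole6 c" and V: "verts G = TT6 c"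
    and full: "\<And>i t s. i = 0 \<or> i = 2 \<or> i = 4 \<Longrightarrow> t \<in> T6 c i \<Longrightarrow> s \<in> T6 c (i + 1) \<Longrightarrow> nb G t s"
  shows "wreath6 G"
proof -
  define X where "X = T6 c"
  have XV: "X i \<subseteq> verts G" for i using V by (auto simp: X_def TT6_def)
  have fin: "finite (X i)" for i using XV simple finite_subset unfolding simple_graph_def by metis
  have cX: "c i \<in> X i" for i using hole6_T[OF h] by (simp add: X_def)
  have nbX: "nb G x w \<Longrightarrow> w \<in> X (i - 1) \<union> X i \<union> X (i + 1)" if x: "x \<in> X i" for x w i
  proof -
    assume xw: "nb G x w"
    have "w \<in> verts G" using nb_verts[OF simple xw] x XV by blast
    then obtain j where j: "w \<in> T6 c j" using V by (auto simp: TT6_def)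
    have "\<forall>d. w \<in> T6 c (i + d) \<longrightarrow> d = 0 \<or> d = 1 \<or> d = 5"
      unfolding all_6 using T6_far[OF h, of x i w 2] T6_far[OF h, of x i w 3] T6_far[OF h, of x i w 4] x xw by (auto simp: X_def)
    from this[rule_format, of "j - i"] j have "j - i = 0 \<or> j - i = 1 \<or> j - i = 5" by simp
    then have "j = i \<or> j = i + 1 \<or> j = i - 1" by (auto simp: diff_eq_eq arith_6 add.commute)
    then show ?thesis using j by (auto simp: X_def)
  qed
  \<comment> \<open>Each class is complete to one of its two neighbouring classes. Closed
    neighbourhoods therefore differ only within the other one, a clique, and incomparable ones would
    give a \<open>C4\<close>.\<close>
  have side: "(\<forall>x\<in>X i. \<forall>y\<in>X (i + 1). nb G x y) \<or> (\<forall>x\<in>X i. \<forall>y\<in>X (i - 1). nb G x y)" for i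
  proof -
    have "i = 0 \<or> i = 1 \<or> i = 2 \<or> i = 3 \<or> i = 4 \<or> i = 5" using UNIV_6 by blast
    then have "(i = 0 \<or> i = 2 \<or> i = 4) \<or> (i - 1 = 0 \<or> i - 1 = 2 \<or> i - 1 = 4)" by auto
    then show ?thesis
    proof
      assume "i = 0 \<or> i = 2 \<or> i = 4"
      from full[OF this] show ?thesis by (auto simp: X_def)
    next
      assume "i - 1 = 0 \<or> i - 1 = 2 \<or> i - 1 = 4"
      from full[OF this] have "nb G y x" if "x \<in> X i" "y \<in> X (i - 1)" for x y using that by (simp add: X_def)
      then show ?thesis by (blast intro: nb_sym)
    qed
  qed
  have "\<exists>xs. ordering_of (X i) xs \<and> nested (closed_nbhd G) xs" for i
  proof -
    have "closed_nbhd G x \<subseteq> closed_nbhd G y \<or> closed_nbhd G y \<subseteq> closed_nbhd G x" if xy: "x \<in> X i" "y \<in> X i" for x y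
    proof (rule ccontr)
      assume "\<not> ?thesis"
      then obtain w w' where w: "nb G x w" "\<not> nb G y w" "nb G y w'" "\<not> nb G x w'"
        unfolding closed_nbhd_nb by blast
      have Xi: "nb G u v" if "u \<in> X i" "v \<in> X i" for u v i using T6_clique'[OF h] that by (simp add: X_def)
      have "w \<notin> X i" "w' \<notin> X i" using w Xi xy by blast+
      then have "(w \<in> X (i + 1) \<and> w' \<in> X (i + 1)) \<or> (w \<in> X (i - 1) \<and> w' \<in> X (i - 1))"
        using nbX[OF xy(1) w(1)] nbX[OF xy(2) w(3)] side[of i] xy w by blast
      then have "nb G w w'" using Xi by blast
      then show False
        using C4[of x w w' y] w Xi[OF xy] nb_sym[of G y w'] nb_sym[of G x y] not_nb_sym[of G y w] by blast
    qed
    then show ?thesis using chain_ordering[of "X i" "closed_nbhd G"] fin finite_nbhd[OF simple]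
      by (metis closed_nbhd_nb)
  qed
  then obtain us where us: "\<And>i. ordering_of (X i) (us i)" "\<And>i. nested (closed_nbhd G) (us i)" by metis
  have ne: "us i \<noteq> []" and sus: "set (us i) = X i" for i using us(1)[of i] cX[of i] by (auto simp: ordering_of_def)
  have hd: "closed_nbhd G (hd (us i)) = X (i - 1) \<union> X i \<union> X (i + 1)" for i
  proof
    have "hd (us i) \<in> X i" using ne sus hd_in_set by blast
    then show "closed_nbhd G (hd (us i)) \<subseteq> X (i - 1) \<union> X i \<union> X (i + 1)" using nbX unfolding closed_nbhd_nb by blast
    have "nb G (c i) w" if "w \<in> X (i - 1) \<union> X i \<union> X (i + 1)" for w
      using that T6D(2)[of w c "i - 1" i] T6D(2)[of w c i i] T6D(2)[of w c "i + 1" i] unfolding X_def by (auto simp: arith_6)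
    then have "X (i - 1) \<union> X i \<union> X (i + 1) \<subseteq> closed_nbhd G (c i)" unfolding closed_nbhd_nb by blast
    also have "\<dots> \<subseteq> closed_nbhd G (hd (us i))" using nested_hd[OF us(2)] sus cX by blast
    finally show "X (i - 1) \<union> X i \<union> X (i + 1) \<subseteq> closed_nbhd G (hd (us i))" .
  qed
  have last: "X i \<subseteq> closed_nbhd G (last (us i))" for i
    using T6_clique'[OF h, of "last (us i)" i] last_in_set[OF ne[of i]] sus unfolding closed_nbhd_nb X_def by blast
  have disj: "i \<noteq> j \<Longrightarrow> X i \<inter> X j = {}" for i j using T6_T6_disjoint unfolding X_def .
  have part: "partition_into (verts G) (map X [0, 1, 2, 3, 4, 5])"
    unfolding partition_into_def V TT6_def UNIV_6 using disj by (simp add: disjnt_def X_def)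
  have "complete_to G (X i) (X (i + 1))" if "i = 0 \<or> i = 2 \<or> i = 4" for i
    by (rule complete_toI) (use disj[of i "i + 1"] full[OF that] in \<open>auto simp: X_def\<close>)
  from this[of 0] this[of 2] this[of 4]
  have "complete_to G (X 0) (X 1)" "complete_to G (X 2) (X 3)" "complete_to G (X 4) (X 5)" by simp_all
  then show ?thesis unfolding wreath6_def
    using part us hd last cX by (intro exI[of _ X] exI[of _ us]) blast
qed

text \<open>A three-type with a nonneighbour in an adjacent class goes to \<open>D\<close>, all
  others go to \<open>C\<close>. The stable triple shows that the parts \<open>D\<close> are
  nonempty at 1, 2, 3 and controls all nonadjacencies between them.\<close>

lemma crown6I:
  assumes h: "hole6 c" and V: "verts G = TT6 c"
    and d: "d1 \<in> T6 c 1" "d2 \<in> T6 c 2" "d3 \<in> T6 c 3" "\<not> nb G d1 d2" "\<not> nb G d2 d3"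
    and full: "\<And>t s. t \<in> T6 c 3 \<Longrightarrow> s \<in> T6 c 4 \<Longrightarrow> nb G t s"
  shows "crown6 G"
proof -
  define D where "D i = {v \<in> T6 c i. \<exists>x\<in>T6 c (i - 1) \<union> T6 c (i + 1). \<not> nb G v x}" for i
  define C where "C i = T6 c i - D i" for i
  \<comment> \<open>By \<open>T6_opposite\<close> the gaps at \<open>d1\<close>, \<open>d2\<close>
    and at \<open>d2\<close>, \<open>d3\<close> make the opposite pairs of classes complete. With
    the hypothesis on classes 3 and 4 this empties \<open>D 4\<close> and \<open>D 5\<close>, so the
    distinguished index is 0.\<close>
  have full45: "nb G t s" if "t \<in> T6 c 4" "s \<in> T6 c 5" for t s
    using T6_opposite'[OF h d(1), of d2 t s] d that by auto
  have full50: "nb G t s" if "t \<in> T6 c 5" "s \<in> T6 c 0" for t s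
    using T6_opposite'[OF h d(2), of d3 t s] d that by (auto simp: mod_6)
  note S = nb_sym[of G]
  have D4: "D 4 = {}" using full[THEN nb_sym] full45 by (auto simp: D_def)
  have D5: "D 5 = {}"
  proof -
    have e: "(5::6) - 1 = 4" "(5::6) + 1 = 0" by simp_all
    show ?thesis unfolding D_def e using full45[THEN nb_sym] full50 by blast
  qed
  have n: "\<not> nb G d2 d1" "\<not> nb G d3 d2" by (rule not_nb_sym, fact)+
  have D1: "\<not> nb G v d2" if vD: "v \<in> D 1" for v
  proof -
    have v: "v \<in> T6 c 1" using vD by (simp add: D_def)
    obtain x where x: "x \<in> T6 c 0 \<or> x \<in> T6 c 2" "\<not> nb G v x" using vD by (auto simp: D_def)
    show ?thesis
      using x Q6_E1[OF h d(1-3) v, of x] Q6_E3[OF h d(1-3) _ v, of x] d(4,5) not_nb_sym[OF x(2)] by blast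
  qed
  have D3: "\<not> nb G v d2" if vD: "v \<in> D 3" for v
  proof -
    have v: "v \<in> T6 c 3" using vD by (simp add: D_def)
    obtain x where x: "x \<in> T6 c 2" "\<not> nb G v x" using vD full by (auto simp: D_def)
    show ?thesis using Q6_E1m[OF h d(1-3) v x(1)] x d(4,5) by blast
  qed
  have D2: "\<not> nb G v d1 \<and> \<not> nb G v d3" if vD: "v \<in> D 2" for v
  proof -
    have v: "v \<in> T6 c 2" using vD by (simp add: D_def)
    have iff: "nb G v d1 \<longleftrightarrow> nb G v d3"
      using Q6_T2_a[OF h d(1-3) v] Q6_T2_b[OF h d(1-3) v] d(4,5) by blast
    obtain x where x: "x \<in> T6 c 1 \<or> x \<in> T6 c 3" "\<not> nb G v x" using vD by (auto simp: D_def)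
    have x': "\<not> nb G x v" using not_nb_sym[OF x(2)] .
    from x(1) show ?thesis
    proof
      assume X: "x \<in> T6 c 1"
      have "\<not> nb G x d2" using Q6_E1[OF h d(1-3) X v] d(4,5) x' by blast
      then have "\<not> nb G v d1" using Q6_E2b[OF h d(1-3) X v] d(4,5) x by blast
      then show ?thesis using iff by blast
    next
      assume X: "x \<in> T6 c 3"
      have "\<not> nb G x d2" using Q6_E1m[OF h d(1-3) X v] d(4,5) x' by blast
      then have "\<not> nb G v d3" using Q6_E2bm[OF h d(1-3) X v] d(4,5) x by blast
      then show ?thesis using iff by blast
    qed
  qed
  have DT: "D i \<subseteq> T6 c i" for i by (auto simp: D_def)
  have D01: "\<not> nb G x y" if xy: "x \<in> D 0" "y \<in> D 1" for x y
  proof -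
    obtain s where s: "s \<in> T6 c 1" "\<not> nb G x s" using xy(1) full50[THEN nb_sym] by (auto simp: D_def mod_6)
    show ?thesis using Q6_E4[OF h d(1-3) _ s(1), of x y] xy DT D1[OF xy(2)] d(4,5) s by blast
  qed
  have D12: "\<not> nb G x y" if "x \<in> D 1" "y \<in> D 2" for x y
    using Q6_E2a[OF h d(1-3), of x y] D1[OF that(1)] D2[OF that(2)] d(4,5) nb_sym[of G x y] that DT by blast
  have D23: "\<not> nb G x y" if "x \<in> D 2" "y \<in> D 3" for x y
    using Q6_E2am[OF h d(1-3), of y x] D3[OF that(2)] D2[OF that(1)] d(4,5) that DT by blast
  have "\<forall>i. \<forall>x\<in>D i. \<forall>y\<in>D (i + 1). \<not> nb G x y"
    unfolding all_6 using D01 D12 D23 D4 D5 by (auto simp: mod_6)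
  then have DD1: "\<not> nb G x y" if "x \<in> D i" "y \<in> D (i + 1)" for x y i using that by blast
  have DD: "\<not> nb G x y" if ij: "i \<noteq> j" "x \<in> D i" "y \<in> D j" for x y i j
  proof -
    have x: "x \<in> T6 c i" using ij(2) DT by blast
    have "\<forall>e. y \<in> D (i + e) \<longrightarrow> e \<noteq> 0 \<longrightarrow> \<not> nb G x y"
      unfolding all_6
    proof (intro conjI impI)
      show "\<not> nb G x y" if "y \<in> D (i + 1)" using DD1 ij that by blast
      show "\<not> nb G x y" if "y \<in> D (i + 2)" using T6_far[OF h x, of y 2] that DT by blast
      show "\<not> nb G x y" if "y \<in> D (i + 3)" using T6_far[OF h x, of y 3] that DT by blast
      show "\<not> nb G x y" if "y \<in> D (i + 4)" using T6_far[OF h x, of y 4] that DT by blast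
      show "\<not> nb G x y" if "y \<in> D (i + 5)" using DD1[of y "i + 5" x] that ij(2) nb_sym[of G x y] by (auto simp: arith_6)
    qed simp_all
    from this[rule_format, of "j - i"] ij show ?thesis by simp
  qed
  have disj: "i \<noteq> j \<Longrightarrow> T6 c i \<inter> T6 c j = {}" for i j by (rule T6_T6_disjoint)
  have dC: "i \<noteq> j \<Longrightarrow> C i \<inter> C j = {}" for i j using disj[of i j] by (auto simp: C_def)
  have dD: "i \<noteq> j \<Longrightarrow> D i \<inter> D j = {}" for i j using disj[of i j] DT by blast
  have dCD: "C i \<inter> D j = {}" for i j using disj[of i j] DT by (cases "i = j") (auto simp: C_def)
  have CT: "C i \<subseteq> T6 c i" "C i \<union> D i = T6 c i" for i using DT by (auto simp: C_def)
  have TV: "T6 c i \<subseteq> verts G" for i by (auto simp: T6_def)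
  have Cfull: "nb G x y" if "x \<in> C i" "y \<in> T6 c (i - 1) \<or> y \<in> T6 c (i + 1)" for x y i
    using that by (auto simp: C_def D_def)
  have cC: "c i \<in> C i" for i
  proof -
    have "nb G (c i) y" if "y \<in> T6 c (i - 1) \<union> T6 c (i + 1)" for y
      using that T6D(2)[of y c "i - 1" i] T6D(2)[of y c "i + 1" i] by (auto simp: arith_6)
    then show ?thesis using hole6_T[OF h] by (auto simp: C_def D_def)
  qed
  have part: "partition_into (verts G) (map C [0, 1, 2, 3, 4, 5] @ map D [0, 1, 2, 3, 4, 5])"
  proof -
    have "sorted_wrt disjnt (map C [0, 1, 2, 3, 4, 5] @ map D [0, 1, 2, 3, 4, 5])"
      by (simp add: disjnt_def dC dD dCD)
    moreover have "(\<Union>i. C i) \<union> (\<Union>i. D i) = TT6 c" unfolding TT6_def CT(2)[symmetric] by (rule UN_Un_distrib[symmetric])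
    then have "\<Union> (set (map C [0, 1, 2, 3, 4, 5] @ map D [0, 1, 2, 3, 4, 5])) = verts G"
      unfolding V UNIV_6 by (simp add: Un_ac)
    ultimately show ?thesis unfolding partition_into_def by blast
  qed
  have far: "\<not> nb G x y" if "x \<in> T6 c i" "y \<in> C (i + 2) \<union> C (i + 3) \<union> C (i + 4)" for x y i
    using T6_far[OF h that(1), of y] that(2) CT(1) by blast
  show ?thesis unfolding crown6_def
    apply (rule exI[of _ C], rule exI[of _ D], rule exI[of _ 0])
  proof (intro conjI)
    show "partition_into (verts G) (map C [0, 1, 2, 3, 4, 5] @ map D [0, 1, 2, 3, 4, 5])" by (rule part)
    show "\<forall>i. clique G (C i) \<and> clique G (D i)"
      unfolding clique_nb using CT(1) DT TV T6_clique'[OF h] by blast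
    show "\<forall>i. C i \<noteq> {}" using cC by blast
    show "D (0 - 2) = {}" "D (0 - 1) = {}" using D4 D5 by (simp_all add: mod_6)
    have "d1 \<in> D 1" "d2 \<in> D 2" "d3 \<in> D 3" using d n by (auto simp: D_def)
    then show "D (0 + 1) \<noteq> {}" "D (0 + 2) \<noteq> {}" "D (0 + 3) \<noteq> {}" by auto
    show "\<forall>i. complete_to G (C i) (C (i - 1) \<union> C (i + 1)) \<and> anticomplete_to G (C i) (C (i + 2) \<union> C (i + 3) \<union> C (i + 4))"
    proof (intro allI conjI)
      fix i
      show "complete_to G (C i) (C (i - 1) \<union> C (i + 1))"
      proof (rule complete_toI)
        show "C i \<inter> (C (i - 1) \<union> C (i + 1)) = {}" using dC[of i "i - 1"] dC[of i "i + 1"] by (simp add: Int_Un_distrib)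
        show "nb G x y" if "x \<in> C i" "y \<in> C (i - 1) \<union> C (i + 1)" for x y
          using Cfull[OF that(1)] that(2) CT(1)[of "i - 1"] CT(1)[of "i + 1"] by blast
      qed
      show "anticomplete_to G (C i) (C (i + 2) \<union> C (i + 3) \<union> C (i + 4))"
        by (rule anticomplete_toI) (use far CT(1) in blast)
    qed
    show "\<forall>i. complete_to G (D i) (C (i - 1) \<union> C i \<union> C (i + 1)) \<and> anticomplete_to G (D i) (C (i + 2) \<union> C (i + 3) \<union> C (i + 4))"
    proof (intro allI conjI)
      fix i
      show "complete_to G (D i) (C (i - 1) \<union> C i \<union> C (i + 1))"
      proof (rule complete_toI)
        show "D i \<inter> (C (i - 1) \<union> C i \<union> C (i + 1)) = {}" using dCD by blast
        fix x y assume "x \<in> D i" "y \<in> C (i - 1) \<union> C i \<union> C (i + 1)"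
        then have x: "x \<in> T6 c i" and y: "y \<in> C (i - 1) \<or> y \<in> T6 c i \<or> y \<in> C (i + 1)" using DT CT(1) by blast+
        then show "nb G x y"
          using T6_clique'[OF h x, of y] Cfull[of y "i - 1" x, THEN nb_sym] Cfull[of y "i + 1" x, THEN nb_sym] by auto
      qed
      show "anticomplete_to G (D i) (C (i + 2) \<union> C (i + 3) \<union> C (i + 4))"
        by (rule anticomplete_toI) (use far DT in blast)
    qed
    show "\<forall>i j. i \<noteq> j \<longrightarrow> anticomplete_to G (D i) (D j)"
      by (intro allI impI anticomplete_toI) (rule DD)
  qed
qed

lemma hole6_reflect: "hole6 c \<Longrightarrow> hole6 (\<lambda>j. c (k - j))"
proof -
  assume h: "hole6 c"
  have "\<forall>d :: 6. (d = 0 \<or> d = 1 \<or> d = 5) \<longleftrightarrow> (- d = 0 \<or> - d = 1 \<or> - d = 5)" unfolding all_6 by simp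
  from this[rule_format, of "j - i" for i j] show ?thesis
    unfolding hole6_def using hole6D[OF h] by (simp add: algebra_simps)
qed

lemma T6_reflect: "T6 (\<lambda>j. c (k - j)) i = T6 c (k - i)"
proof -
  have n: "\<forall>d :: 6. (d = 0 \<or> d = 1 \<or> d = 5) \<longleftrightarrow> (- d = 0 \<or> - d = 1 \<or> - d = 5)" unfolding all_6 by simp
  have "(\<forall>j. nb G v (c (k - j)) \<longleftrightarrow> j - i = 0 \<or> j - i = 1 \<or> j - i = 5) \<longleftrightarrow>
      (\<forall>j. nb G v (c j) \<longleftrightarrow> j - (k - i) = 0 \<or> j - (k - i) = 1 \<or> j - (k - i) = 5)" (is "?L \<longleftrightarrow> ?R") for v
  proof
    assume L: ?L
    show ?R
    proof
      fix j
      show "nb G v (c j) \<longleftrightarrow> j - (k - i) = 0 \<or> j - (k - i) = 1 \<or> j - (k - i) = 5"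
        using L[rule_format, of "k - j"] n[rule_format, of "j - (k - i)"] by (simp add: algebra_simps)
    qed
  next
    assume R: ?R
    show ?L
    proof
      fix j
      show "nb G v (c (k - j)) \<longleftrightarrow> j - i = 0 \<or> j - i = 1 \<or> j - i = 5"
        using R[rule_format, of "k - j"] n[rule_format, of "j - i"] by (simp add: algebra_simps)
    qed
  qed
  then show ?thesis by (simp add: T6_def)
qed

lemma TT6_reflect: "TT6 (\<lambda>j. c (k - j)) = TT6 c"
proof -
  have "(\<Union>i. T6 c (k - i)) = (\<Union>i. T6 c i)"
  proof
    show "(\<Union>i. T6 c i) \<subseteq> (\<Union>i. T6 c (k - i))"
    proof
      fix x assume "x \<in> (\<Union>i. T6 c i)"
      then obtain i where "x \<in> T6 c (k - (k - i))" by auto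
      then show "x \<in> (\<Union>i. T6 c (k - i))" by blast
    qed
  qed blast
  then show ?thesis unfolding TT6_def T6_reflect .
qed

theorem hole6_structure:
  assumes "hole6 c"
  shows "wreath6 G \<or> crown6 G"
proof -
  obtain c where h: "hole6 c" and V: "verts G = TT6 c" using maximal_hole6[OF assms] by blast
  show ?thesis
  proof (cases "\<exists>i t s r. t \<in> T6 c i \<and> s \<in> T6 c (i + 1) \<and> r \<in> T6 c (i + 2) \<and> \<not> nb G t s \<and> \<not> nb G s r")
    case True
    then obtain i t s r where tsr: "t \<in> T6 c i" "s \<in> T6 c (i + 1)" "r \<in> T6 c (i + 2)" "\<not> nb G t s" "\<not> nb G s r" by blast
    \<comment> \<open>The shift by \<open>i - 1\<close> places the triple at indices 1, 2, 3, as
      \<open>crown6I\<close> expects.\<close>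
    define d where "d = (\<lambda>j. c (i - 1 + j))"
    have hd: "hole6 d" unfolding d_def by (rule hole6_rotate[OF h])
    have Vd: "verts G = TT6 d" unfolding d_def TT6_rotate by (rule V)
    have T: "t \<in> T6 d 1" "s \<in> T6 d 2" "r \<in> T6 d 3" unfolding d_def T6_rotate using tsr by (simp_all add: arith_6)
    show ?thesis
    proof (cases "\<forall>x\<in>T6 d 3. \<forall>y\<in>T6 d 4. nb G x y")
      case True
      then show ?thesis using crown6I[OF hd Vd T tsr(4,5)] by blast
    next
      case False
      \<comment> \<open>The reflection \<open>j\<close> to \<open>4 - j\<close> exchanges 1 with 3
        and fixes 2. A gap between classes 3 and 4 forces classes 0 and 1 to be complete to each
        other, which is the required hypothesis after reflection.\<close>
      define e where "e = (\<lambda>j. d (4 - j))"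
      have he: "hole6 e" unfolding e_def by (rule hole6_reflect[OF hd])
      have Ve: "verts G = TT6 e" unfolding e_def TT6_reflect by (rule Vd)
      have Te: "r \<in> T6 e 1" "s \<in> T6 e 2" "t \<in> T6 e 3" unfolding e_def T6_reflect using T by simp_all
      have "nb G x y" if "x \<in> T6 e 3" "y \<in> T6 e 4" for x y
      proof -
        have "x \<in> T6 d 1" "y \<in> T6 d 0" using that unfolding e_def T6_reflect by simp_all
        then show ?thesis using T6_opposite[OF hd, of y x] False nb_sym[of G y x] by blast
      qed
      then show ?thesis using crown6I[OF he Ve Te not_nb_sym[OF tsr(5)] not_nb_sym[OF tsr(4)]] by blast
    qed
  next
    case False
    \<comment> \<open>\<open>p\<close> marks gaps between consecutive classes. A gap excludes gaps
      at distances 1 and 3, so all gaps have the same parity, and the pairs of the other parity are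
      complete as in a wreath.\<close>
    define p where "p i \<longleftrightarrow> (\<exists>t\<in>T6 c i. \<exists>s\<in>T6 c (i + 1). \<not> nb G t s)" for i
    have 1: "\<not> p (i + 1)" if "p i" for i
    proof
      assume "p (i + 1)"
      then obtain v r where vr: "v \<in> T6 c (i + 1)" "r \<in> T6 c (i + 2)" "\<not> nb G v r" by (auto simp: p_def arith_6)
      obtain t s where ts: "t \<in> T6 c i" "s \<in> T6 c (i + 1)" "\<not> nb G t s" using \<open>p i\<close> by (auto simp: p_def)
      show False using T6_consecutive'[OF h ts(1,2) vr(1,2) ts(3) vr(3)] False ts vr by blast
    qed
    have 3: "\<not> p (i + 3)" if "p i" for i
    proof
      assume "p (i + 3)"
      then obtain v r where vr: "v \<in> T6 c (i + 3)" "r \<in> T6 c (i + 4)" "\<not> nb G v r" by (auto simp: p_def arith_6)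
      obtain t s where ts: "t \<in> T6 c i" "s \<in> T6 c (i + 1)" "\<not> nb G t s" using \<open>p i\<close> by (auto simp: p_def)
      show False using T6_opposite'[OF h ts(1,2) vr(1,2) ts(3) vr(3)] .
    qed
    obtain k where k: "\<not> p k" "\<not> p (k + 2)" "\<not> p (k + 4)"
    proof -
      have "(\<not> p 0 \<and> \<not> p 2 \<and> \<not> p 4) \<or> (\<not> p 1 \<and> \<not> p 3 \<and> \<not> p 5)"
      proof -
        have "p 0 \<longrightarrow> \<not> p 1" "p 1 \<longrightarrow> \<not> p 2" "p 2 \<longrightarrow> \<not> p 3" "p 3 \<longrightarrow> \<not> p 4" "p 4 \<longrightarrow> \<not> p 5" "p 5 \<longrightarrow> \<not> p 0"
          using 1[of 0] 1[of 1] 1[of 2] 1[of 3] 1[of 4] 1[of 5] by (simp_all add: mod_6)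
        moreover have "p 0 \<longrightarrow> \<not> p 3" "p 1 \<longrightarrow> \<not> p 4" "p 2 \<longrightarrow> \<not> p 5"
          using 3[of 0] 3[of 1] 3[of 2] by (simp_all add: mod_6)
        ultimately show ?thesis by argo
      qed
      then show thesis using that[of 0] that[of 1] by auto
    qed
    have "wreath6 G"
    proof (rule wreath6I[OF hole6_rotate[OF h, of k]])
      show "verts G = TT6 (\<lambda>j. c (k + j))" unfolding TT6_rotate by (rule V)
      fix i t s assume "i = 0 \<or> i = 2 \<or> i = (4::6)" "t \<in> T6 (\<lambda>j. c (k + j)) i" "s \<in> T6 (\<lambda>j. c (k + j)) (i + 1)"
      then show "nb G t s" using k unfolding T6_rotate p_def by (auto simp: arith_6)
    qed
    then show ?thesis ..
  qed
qed

end

section \<open>Existence of a long hole\<close>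

definition hex :: "'a \<Rightarrow> 'a \<Rightarrow> 'a \<Rightarrow> 'a \<Rightarrow> 'a \<Rightarrow> 'a \<Rightarrow> 6 \<Rightarrow> 'a" where
  "hex a b c d e f i = (if i = 0 then a else if i = 1 then b else if i = 2 then c else if i = 3 then d else if i = 4 then e else f)"

definition hep :: "'a \<Rightarrow> 'a \<Rightarrow> 'a \<Rightarrow> 'a \<Rightarrow> 'a \<Rightarrow> 'a \<Rightarrow> 'a \<Rightarrow> 7 \<Rightarrow> 'a" where
  "hep a b c d e f g i = (if i = 0 then a else if i = 1 then b else if i = 2 then c else if i = 3 then d else if i = 4 then e else if i = 5 then f else g)"

definition tri :: "'a \<Rightarrow> 'a \<Rightarrow> 'a \<Rightarrow> 3 \<Rightarrow> 'a" where
  "tri a b c i = (if i = 0 then a else if i = 1 then b else c)"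

context free_graph
begin

lemma hole6_hex:
  assumes "nb G a b" "nb G b c" "nb G c d" "nb G d e" "nb G e f" "nb G f a"
    "\<not> nb G a c" "\<not> nb G a d" "\<not> nb G a e" "\<not> nb G b d" "\<not> nb G b e" "\<not> nb G b f" "\<not> nb G c e" "\<not> nb G c f" "\<not> nb G d f"
  shows "\<forall>i j. nb G (hex a b c d e f i) (hex a b c d e f j) \<longleftrightarrow> j - i = 0 \<or> j - i = 1 \<or> j - i = 5"
  unfolding all_6 hex_def by (simp add: assms assms(1-6)[THEN nb_sym] assms(7-)[THEN not_nb_sym])

lemma hole7_hep:
  assumes "nb G a b" "nb G b c" "nb G c d" "nb G d e" "nb G e f" "nb G f g" "nb G g a"
    "\<not> nb G a c" "\<not> nb G a d" "\<not> nb G a e" "\<not> nb G a f" "\<not> nb G b d" "\<not> nb G b e" "\<not> nb G b f" "\<not> nb G b g"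
    "\<not> nb G c e" "\<not> nb G c f" "\<not> nb G c g" "\<not> nb G d f" "\<not> nb G d g" "\<not> nb G e g"
  shows "hole7 (hep a b c d e f g)"
  unfolding hole7_def all_7 hep_def by (simp add: assms assms(1-7)[THEN nb_sym] assms(8-)[THEN not_nb_sym])

end

context atom_graph
begin

text \<open>A shortest route from \<open>x\<close> to \<open>y\<close> through the component closes
  to a hole with \<open>a\<close>. Too short a route gives \<open>C4\<close> or \<open>C5\<close>,
  and a fifth layer gives a \<open>P7\<close> starting at \<open>a\<close>, so the hole has length 6
  or 7.\<close>

lemma long_hole_exists:
  assumes ne: "verts G \<noteq> {}"
  shows "(\<exists>c :: 6 \<Rightarrow> 'a. \<forall>i j. nb G (c i) (c j) \<longleftrightarrow> j - i = 0 \<or> j - i = 1 \<or> j - i = 5) \<or> (\<exists>c. hole7 c)"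
proof -
  obtain a where a: "a \<in> verts G" using ne by blast
  obtain b where b: "b \<in> verts G" "\<not> nb G a b" using no_universal[OF a] by blast
  define Z where "Z = {v \<in> verts G. \<not> nb G a v}"
  have bZ: "b \<in> Z" using b by (simp add: Z_def)
  obtain K where K: "b \<in> K" "K \<subseteq> Z" "\<And>x y. x \<in> K \<Longrightarrow> y \<in> Z \<Longrightarrow> nb G x y \<Longrightarrow> y \<in> K"
    "\<And>S s. \<lbrakk>S \<subseteq> K; s \<in> S; \<And>x y. x \<in> S \<Longrightarrow> y \<in> K \<Longrightarrow> nb G x y \<Longrightarrow> y \<in> S\<rbrakk> \<Longrightarrow> S = K"
    using nb_component[OF bZ, of G thesis] by blast
  have KV: "K \<subseteq> verts G" "K \<noteq> {}" using K(1,2) by (auto simp: Z_def)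
  have aK: "a \<notin> K" "\<forall>k\<in>K. \<not> nb G a k" using K(2) by (auto simp: Z_def)
  obtain x y k l where xy: "x \<in> verts G" "x \<notin> K" "y \<in> verts G" "y \<notin> K" "\<not> nb G x y" "k \<in> K" "nb G x k" "l \<in> K" "nb G y l"
    using no_clique_cutset_obtain[OF atom_graph_axioms KV a aK] by blast
  have "x \<notin> Z" "y \<notin> Z" using K(3)[OF xy(6) _ nb_sym[OF xy(7)]] K(3)[OF xy(8) _ nb_sym[OF xy(9)]] xy(2,4) by blast+
  then have ax: "nb G a x" "nb G a y" using xy(1,3) by (auto simp: Z_def)
  \<comment> \<open>\<open>R1\<close> to \<open>R4\<close> are the layers of \<open>K\<close> at
    distance 1 to 4 from \<open>x\<close>.\<close>
  define R1 where "R1 = {u \<in> K. nb G x u}"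
  define R2 where "R2 = {u \<in> K - R1. \<exists>w\<in>R1. nb G w u}"
  define R3 where "R3 = {u \<in> K - R1 - R2. \<exists>w\<in>R2. nb G w u}"
  define R4 where "R4 = {u \<in> K - R1 - R2 - R3. \<exists>w\<in>R3. nb G w u}"
  have d1: "\<not> nb G x u" if "u \<in> K - R1" for u using that by (auto simp: R1_def)
  have d2: "\<not> nb G w u" if "w \<in> R1" "u \<in> K - R1 - R2" for u w using that by (auto simp: R2_def)
  have d3: "\<not> nb G w u" if "w \<in> R2" "u \<in> K - R1 - R2 - R3" for u w using that by (auto simp: R3_def)
  have d4: "\<not> nb G w u" if "w \<in> R3" "u \<in> K - R1 - R2 - R3 - R4" for u w using that by (auto simp: R4_def)
  have na: "\<not> nb G a u" "\<not> nb G u a" if "u \<in> K" for u proof -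
    show "\<not> nb G a u" using aK that by blast
    then show "\<not> nb G u a" by (rule not_nb_sym)
  qed
  have s1: "u \<in> K" "nb G x u" if "u \<in> R1" for u using that by (auto simp: R1_def)
  have s2: "u \<in> K" "u \<notin> R1" if "u \<in> R2" for u using that by (auto simp: R2_def)
  have s3: "u \<in> K" "u \<notin> R1" "u \<notin> R2" if "u \<in> R3" for u using that by (auto simp: R3_def)
  have s4: "u \<in> K" "u \<notin> R1" "u \<notin> R2" "u \<notin> R3" if "u \<in> R4" for u using that by (auto simp: R4_def)
  have p2: "\<exists>w\<in>R1. nb G w u" if "u \<in> R2" for u using that by (auto simp: R2_def)
  have p3: "\<exists>w\<in>R2. nb G w u" if "u \<in> R3" for u using that by (auto simp: R3_def)
  have p4: "\<exists>w\<in>R3. nb G w u" if "u \<in> R4" for u using that by (auto simp: R4_def)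
  note [simp] = ax xy(5) ax(2)[THEN nb_sym]
  have y1: "\<not> nb G u y" if u: "u \<in> R1" for u
    by (rule notI, rule C4[of a x u y]) (use s1[OF u] na[of u] in simp_all)
  have y2: "\<not> nb G u y" if u: "u \<in> R2" for u
  proof
    assume uy: "nb G u y"
    obtain w where w: "w \<in> R1" "nb G w u" using p2[OF u] by blast
    show False
      by (rule C5[of a x w u y]) (use s1[OF w(1)] s2[OF u] d1[of u] na y1[OF w(1)] w uy in simp_all)
  qed
  have "(\<exists>u\<in>R3. nb G u y) \<or> (\<exists>u\<in>R4. nb G u y)"
  proof (rule ccontr)
    assume n: "\<not> ?thesis"
    have cl: "\<exists>u\<in>R1 \<union> R2 \<union> R3 \<union> R4. \<exists>v\<in>K. v \<notin> R1 \<union> R2 \<union> R3 \<union> R4 \<and> nb G u v"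
    proof (rule ccontr)
      assume c: "\<not> ?thesis"
      have kR: "k \<in> R1" using xy(6,7) by (simp add: R1_def)
      have "R1 \<union> R2 \<union> R3 \<union> R4 = K"
      proof (rule K(4)[of _ k])
        show "R1 \<union> R2 \<union> R3 \<union> R4 \<subseteq> K" using s1 s2 s3 s4 by blast
        show "k \<in> R1 \<union> R2 \<union> R3 \<union> R4" using kR by blast
        show "v \<in> R1 \<union> R2 \<union> R3 \<union> R4" if "u \<in> R1 \<union> R2 \<union> R3 \<union> R4" "v \<in> K" "nb G u v" for u v using c that by blast
      qed
      then have "l \<in> R1 \<union> R2 \<union> R3 \<union> R4" using xy(8) by blast
      then show False using n y1[of l] y2[of l] nb_sym[OF xy(9)] by blast
    qed
    \<comment> \<open>If \<open>y\<close> sees neither the third nor the fourth layer, its neighbour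
      \<open>l\<close> in \<open>K\<close> lies beyond them; hence some edge leaves the four layers,
      and it starts in \<open>R4\<close>.\<close>
    then obtain u v where uv: "u \<in> R1 \<union> R2 \<union> R3 \<union> R4" "v \<in> K - R1 - R2 - R3 - R4" "nb G u v" by blast
    have "u \<notin> R1" "u \<notin> R2" "u \<notin> R3" using d2[of u v] d3[of u v] d4[of u v] uv by blast+
    then have u: "u \<in> R4" using uv by blast
    obtain t where t: "t \<in> R3" "nb G t u" using p4[OF u] by blast
    obtain s where s: "s \<in> R2" "nb G s t" using p3[OF t(1)] by blast
    obtain r where r: "r \<in> R1" "nb G r s" using p2[OF s(1)] by blast
    show False
      by (rule P7[of a x r s t u v])
        (use uv s1[OF r(1)] s2[OF s(1)] s3[OF t(1)] s4[OF u] r s t in \<open>simp_all add: na d1 d2 d3 d4\<close>)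
  qed
  then show ?thesis
  proof (elim disjE bexE)
    fix t assume t: "t \<in> R3" "nb G t y"
    obtain s where s: "s \<in> R2" "nb G s t" using p3[OF t(1)] by blast
    obtain r where r: "r \<in> R1" "nb G r s" using p2[OF s(1)] by blast
    note [simp] = s1[OF r(1)] s2[OF s(1)] s3[OF t(1)] r s t na d1 d2 d3 y1[OF r(1)] y2[OF s(1)]
    have "\<forall>i j. nb G (hex a x r s t y i) (hex a x r s t y j) \<longleftrightarrow> j - i = 0 \<or> j - i = 1 \<or> j - i = 5"
      by (rule hole6_hex) simp_all
    then show ?thesis by blast
  next
    fix u assume u: "u \<in> R4" "nb G u y"
    obtain t where t: "t \<in> R3" "nb G t u" using p4[OF u(1)] by blast
    obtain s where s: "s \<in> R2" "nb G s t" using p3[OF t(1)] by blast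
    obtain r where r: "r \<in> R1" "nb G r s" using p2[OF s(1)] by blast
    note [simp] = s1[OF r(1)] s2[OF s(1)] s3[OF t(1)] s4[OF u(1)] r s t u na d1 d2 d3 d4 y1[OF r(1)] y2[OF s(1)]
    show ?thesis
    \<comment> \<open>If \<open>y\<close> already sees the predecessor \<open>t\<close>, the route
      is one vertex shorter and closes to a 6-hole.\<close>
    proof (cases "nb G t y")
      case True
      note [simp] = True
      have "\<forall>i j. nb G (hex a x r s t y i) (hex a x r s t y j) \<longleftrightarrow> j - i = 0 \<or> j - i = 1 \<or> j - i = 5"
        by (rule hole6_hex) simp_all
      then show ?thesis by blast
    next
      case False
      note [simp] = False
      have "hole7 (hep a x r s t u y)"
        by (rule hole7_hep) simp_all
      then show ?thesis by blast
    qed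
  qed
qed

theorem atom_structure:
  assumes "verts G \<noteq> {}"
  shows "bracelet7 G \<or> thickened_emerald G \<or> lantern G \<or> wreath6 G \<or> crown6 G"
proof (cases "\<exists>c. hole7 c")
  case True
  then show ?thesis using hole7_structure by blast
next
  case no7: False
  have "no_C7 (nb G)"
    unfolding no_C7_def
  proof (intro allI impI)
    fix a b c d e f g
    assume "nb G a b" "nb G b c" "nb G c d" "nb G d e" "nb G e f" "nb G f g" "nb G g a"
      "\<not> nb G a c" "\<not> nb G a d" "\<not> nb G a e" "\<not> nb G a f" "\<not> nb G b d" "\<not> nb G b e" "\<not> nb G b f" "\<not> nb G b g"
      "\<not> nb G c e" "\<not> nb G c f" "\<not> nb G c g" "\<not> nb G d f" "\<not> nb G d g" "\<not> nb G e g"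
    then have "hole7 (hep a b c d e f g)" by (rule hole7_hep)
    then show False using no7 by blast
  qed
  then interpret c: atom_no_C7 G by unfold_locales
  obtain c where c: "\<forall>i j. nb G (c i) (c j) \<longleftrightarrow> j - i = 0 \<or> j - i = 1 \<or> j - i = (5::6)"
    using long_hole_exists[OF assms] no7 by blast
  show ?thesis
  proof (cases "no_theta (nb G)")
    case True
    then interpret t: atom_no_theta G by unfold_locales
    have "t.hole6 c" unfolding t.hole6_def by (rule c)
    then show ?thesis using t.hole6_structure by blast
  next
    case False
    then obtain a b1 b2 b3 c1 c2 c3 d where T:
      "nb G a b1" "nb G a b2" "nb G a b3" "nb G b1 c1" "nb G b2 c2" "nb G b3 c3" "nb G c1 d" "nb G c2 d" "nb G c3 d"
      "\<not> nb G a c1" "\<not> nb G a c2" "\<not> nb G a c3" "\<not> nb G a d" "\<not> nb G b1 b2" "\<not> nb G b1 b3" "\<not> nb G b1 c2"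
      "\<not> nb G b1 c3" "\<not> nb G b1 d" "\<not> nb G b2 b3" "\<not> nb G b2 c1" "\<not> nb G b2 c3" "\<not> nb G b2 d" "\<not> nb G b3 c1"
      "\<not> nb G b3 c2" "\<not> nb G b3 d" "\<not> nb G c1 c2" "\<not> nb G c1 c3" "\<not> nb G c2 c3"
      unfolding no_theta_def by blast
    note T' = T T(1-9)[THEN nb_sym] T(10-)[THEN not_nb_sym]
    have B: "\<forall>i j. nb G (tri b1 b2 b3 i) (tri b1 b2 b3 j) \<longleftrightarrow> i = j"
      "\<forall>i j. nb G (tri c1 c2 c3 i) (tri c1 c2 c3 j) \<longleftrightarrow> i = j"
      "\<forall>i j. nb G (tri b1 b2 b3 i) (tri c1 c2 c3 j) \<longleftrightarrow> i = j"
      "\<forall>i. nb G a (tri b1 b2 b3 i)" "\<forall>i. nb G d (tri c1 c2 c3 i)"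
      "\<forall>i. \<not> nb G a (tri c1 c2 c3 i)" "\<forall>i. \<not> nb G d (tri b1 b2 b3 i)"
      unfolding all_3 tri_def by (simp_all add: T')
    interpret l: theta_graph G a d "tri b1 b2 b3" "tri c1 c2 c3"
      by unfold_locales (use B T' in blast)+
    show ?thesis using l.lantern by blast
  qed
qed

end

text \<open>Every vertex of an induced \<open>P7\<close> has a nonneighbour on it, and a vertex
  outside \<open>H\<close> has no nonneighbour at all, so the path lies inside \<open>H\<close>. The
  lemmas for \<open>C4\<close> and \<open>C5\<close> rest on the same remark.\<close>

lemma no_P7_verts:
  assumes "no_P7 (nb H)" "verts H \<subseteq> verts G" "simple_graph G"
    and eq: "\<And>x y. x \<in> verts H \<Longrightarrow> y \<in> verts H \<Longrightarrow> nb H x y \<longleftrightarrow> nb G x y"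
    and out: "\<And>x y. x \<in> verts G - verts H \<Longrightarrow> y \<in> verts G \<Longrightarrow> nb G x y"
  shows "no_P7 (nb G)"
  unfolding no_P7_def
proof (intro allI impI)
  fix a b c d e f g
  assume A: "nb G a b" "nb G b c" "nb G c d" "nb G d e" "nb G e f" "nb G f g"
    and B: "\<not> nb G a c" "\<not> nb G a d" "\<not> nb G a e" "\<not> nb G a f" "\<not> nb G a g" "\<not> nb G b d" "\<not> nb G b e" "\<not> nb G b f"
     "\<not> nb G b g" "\<not> nb G c e" "\<not> nb G c f" "\<not> nb G c g" "\<not> nb G d f" "\<not> nb G d g" "\<not> nb G e g"
  have "a \<noteq> b" "b \<noteq> c" "c \<noteq> d" "d \<noteq> e" "e \<noteq> f" "f \<noteq> g" using A B by auto
  then have V: "a \<in> verts G" "b \<in> verts G" "c \<in> verts G" "d \<in> verts G" "e \<in> verts G" "f \<in> verts G" "g \<in> verts G"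
    using nb_verts[OF assms(3)] A by blast+
  have "a \<in> verts H" "b \<in> verts H" "c \<in> verts H" "d \<in> verts H" "e \<in> verts H" "f \<in> verts H" "g \<in> verts H"
    using out[of a c] out[of b d] out[of c e] out[of d f] out[of e g] out[of f a] out[of g a] V B
      not_nb_sym[OF B(4)] not_nb_sym[OF B(5)] by blast+
  then show False
    using assms(1)[unfolded no_P7_def, rule_format, of a b c d e f g] A B eq by simp
qed

lemma no_C4_verts:
  assumes "no_C4 (nb H)" "verts H \<subseteq> verts G" "simple_graph G"
    and eq: "\<And>x y. x \<in> verts H \<Longrightarrow> y \<in> verts H \<Longrightarrow> nb H x y \<longleftrightarrow> nb G x y"
    and out: "\<And>x y. x \<in> verts G - verts H \<Longrightarrow> y \<in> verts G \<Longrightarrow> nb G x y"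
  shows "no_C4 (nb G)"
  unfolding no_C4_def
proof (intro allI impI)
  fix a b c d
  assume A: "nb G a b" "nb G b c" "nb G c d" "nb G d a" and B: "\<not> nb G a c" "\<not> nb G b d"
  have "a \<noteq> b" "b \<noteq> c" "c \<noteq> d" using A B nb_sym[of G d a] by auto
  then have V: "a \<in> verts G" "b \<in> verts G" "c \<in> verts G" "d \<in> verts G"
    using nb_verts[OF assms(3)] A by blast+
  have "a \<in> verts H" "b \<in> verts H" "c \<in> verts H" "d \<in> verts H"
    using out[of a c] out[of b d] out[of c a] out[of d b] V B not_nb_sym[OF B(1)] not_nb_sym[OF B(2)] by blast+
  then show False
    using assms(1)[unfolded no_C4_def, rule_format, of a b c d] A B eq by simp
qed

lemma no_C5_verts:
  assumes "no_C5 (nb H)" "verts H \<subseteq> verts G" "simple_graph G"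
    and eq: "\<And>x y. x \<in> verts H \<Longrightarrow> y \<in> verts H \<Longrightarrow> nb H x y \<longleftrightarrow> nb G x y"
    and out: "\<And>x y. x \<in> verts G - verts H \<Longrightarrow> y \<in> verts G \<Longrightarrow> nb G x y"
  shows "no_C5 (nb G)"
  unfolding no_C5_def
proof (intro allI impI)
  fix a b c d e
  assume A: "nb G a b" "nb G b c" "nb G c d" "nb G d e" "nb G e a"
    and B: "\<not> nb G a c" "\<not> nb G a d" "\<not> nb G b d" "\<not> nb G b e" "\<not> nb G c e"
  have "a \<noteq> b" "b \<noteq> c" "c \<noteq> d" "d \<noteq> e" using A B by auto
  then have V: "a \<in> verts G" "b \<in> verts G" "c \<in> verts G" "d \<in> verts G" "e \<in> verts G"
    using nb_verts[OF assms(3)] A by blast+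
  have "a \<in> verts H" "b \<in> verts H" "c \<in> verts H" "d \<in> verts H" "e \<in> verts H"
    using out[of a c] out[of b d] out[of c e] out[of d a] out[of e b] V B not_nb_sym[OF B(2)] not_nb_sym[OF B(4)] by blast+
  then show False
    using assms(1)[unfolded no_C5_def, rule_format, of a b c d e] A B eq by simp
qed

lemma free_induce:
  assumes "free_graph G" "X \<subseteq> verts G" "X \<noteq> {}"
  shows "free_graph (induce G X)"
proof -
  interpret free_graph G by fact
  have s: "simple_graph (induce G X)" using simple_induce[OF simple assms(2,3)] .
  have up: "nb G x y" if "nb (induce G X) x y" for x y using that by (auto simp: nb_def adj_induce)
  have X: "x \<in> X" "y \<in> X" if "nb (induce G X) x y" "x \<noteq> y" for x y
    using nb_verts[OF s that] by simp_all
  show ?thesis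
  proof
    show "simple_graph (induce G X)" by (rule s)
    show "no_P7 (nb (induce G X))"
      unfolding no_P7_def
    proof (intro allI impI)
      fix a b c d e f g
      assume A: "nb (induce G X) a b" "nb (induce G X) b c" "nb (induce G X) c d" "nb (induce G X) d e" "nb (induce G X) e f" "nb (induce G X) f g"
        and B: "\<not> nb (induce G X) a c" "\<not> nb (induce G X) a d" "\<not> nb (induce G X) a e" "\<not> nb (induce G X) a f" "\<not> nb (induce G X) a g"
          "\<not> nb (induce G X) b d" "\<not> nb (induce G X) b e" "\<not> nb (induce G X) b f" "\<not> nb (induce G X) b g" "\<not> nb (induce G X) c e"
          "\<not> nb (induce G X) c f" "\<not> nb (induce G X) c g" "\<not> nb (induce G X) d f" "\<not> nb (induce G X) d g" "\<not> nb (induce G X) e g"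
      have "a \<noteq> b" "b \<noteq> c" "c \<noteq> d" "d \<noteq> e" "e \<noteq> f" "f \<noteq> g" using A B by auto
      then have V: "a \<in> X" "b \<in> X" "c \<in> X" "d \<in> X" "e \<in> X" "f \<in> X" "g \<in> X" using X A by blast+
      show False using P7[of a b c d e f g] A B V by (simp add: nb_induce)
    qed
    show "no_C4 (nb (induce G X))"
      unfolding no_C4_def
    proof (intro allI impI)
      fix a b c d
      assume A: "nb (induce G X) a b" "nb (induce G X) b c" "nb (induce G X) c d" "nb (induce G X) d a"
        and B: "\<not> nb (induce G X) a c" "\<not> nb (induce G X) b d"
      have "a \<noteq> b" "b \<noteq> c" "c \<noteq> d" using A B nb_sym[of "induce G X" d a] by auto
      then have V: "a \<in> X" "b \<in> X" "c \<in> X" "d \<in> X" using X A by blast+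
      show False using C4[of a b c d] A B V by (simp add: nb_induce)
    qed
    show "no_C5 (nb (induce G X))"
      unfolding no_C5_def
    proof (intro allI impI)
      fix a b c d e
      assume A: "nb (induce G X) a b" "nb (induce G X) b c" "nb (induce G X) c d" "nb (induce G X) d e" "nb (induce G X) e a"
        and B: "\<not> nb (induce G X) a c" "\<not> nb (induce G X) a d" "\<not> nb (induce G X) b d" "\<not> nb (induce G X) b e" "\<not> nb (induce G X) c e"
      have "a \<noteq> b" "b \<noteq> c" "c \<noteq> d" "d \<noteq> e" using A B by auto
      then have V: "a \<in> X" "b \<in> X" "c \<in> X" "d \<in> X" "e \<in> X" using X A by blast+
      show False using C5[of a b c d e] A B V by (simp add: nb_induce)
    qed
  qed
qed

lemma closed_rtrancl:
  assumes "(x, y) \<in> r\<^sup>*" "x \<in> S" "\<And>u v. u \<in> S \<Longrightarrow> (u, v) \<in> r \<Longrightarrow> v \<in> S"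
  shows "y \<in> S"
  using assms(1,2) by induction (use assms(3) in blast)+

text \<open>Let \<open>C\<close> be the set of attachments of \<open>K\<close>. Outside
  \<open>C\<close> no edge leaves \<open>K\<close>, so \<open>v\<close> cannot be reached from
  \<open>K\<close>; if \<open>C\<close> were a clique, it would be a clique-cutset.\<close>

lemma attachment_not_clique:
  assumes G: "simple_graph G" and nc: "\<not> (\<exists>C. clique_cutset G C)"
    and K: "K \<subseteq> verts G" "K \<noteq> {}" and v: "v \<in> verts G" "v \<notin> K" "\<forall>k\<in>K. \<not> nb G v k"
  shows "\<exists>x\<in>verts G - K. \<exists>y\<in>verts G - K. \<not> nb G x y \<and> (\<exists>k\<in>K. nb G x k) \<and> (\<exists>k\<in>K. nb G y k)"
proof (rule ccontr)
  assume no: "\<not> ?thesis"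
  define C where "C = {x \<in> verts G - K. \<exists>k\<in>K. nb G x k}"
  have "clique G C" using no unfolding clique_nb C_def by blast
  moreover have vC: "v \<notin> C" using v by (auto simp: C_def)
  moreover have "C \<subseteq> verts G" by (auto simp: C_def)
  moreover have "\<not> connected_graph (induce G (verts G - C))"
  proof
    assume c: "connected_graph (induce G (verts G - C))"
    obtain k where k: "k \<in> K" using K by blast
    then have "k \<in> verts G - C" using K by (auto simp: C_def)
    then have "(k, v) \<in> {(x, y). adj (induce G (verts G - C)) x y}\<^sup>*"
      using c v(1) vC unfolding connected_graph_def by simp
    then have "v \<in> K"
    proof (rule closed_rtrancl[OF _ k])
      fix x y assume x: "x \<in> K" and "(x, y) \<in> {(x, y). adj (induce G (verts G - C)) x y}"
      then have "adj G x y" "y \<in> verts G - C" by (auto simp: adj_induce)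
      then have "nb G y x" "y \<in> verts G" "y \<notin> C" by (auto simp: nb_def adj_commute)
      then show "y \<in> K" using x unfolding C_def by blast
    qed
    then show False using v by blast
  qed
  ultimately show False using nc v(1) unfolding clique_cutset_def by blast
qed

lemma verts_complement [simp]: "verts (graph_complement G) = verts G"
  by (simp add: graph_complement_def)

lemma adj_complement: "adj (graph_complement G) x y \<longleftrightarrow> x \<in> verts G \<and> y \<in> verts G \<and> \<not> nb G x y"
proof -
  have "adj (graph_complement G) x y \<longleftrightarrow>
      {x, y} \<in> {{u, v} |u v. u \<in> verts G \<and> v \<in> verts G \<and> u \<noteq> v \<and> \<not> adj G u v}"
    by (simp add: adj_def graph_complement_def)
  also have "\<dots> \<longleftrightarrow> x \<in> verts G \<and> y \<in> verts G \<and> \<not> nb G x y"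
    unfolding nb_def by (auto simp: doubleton_eq_iff adj_commute)
  finally show ?thesis .
qed

lemma complement_induce:
  assumes "X \<subseteq> verts G"
  shows "graph_complement (induce G X) = induce (graph_complement G) X"
proof -
  have "{{u, v} |u v. u \<in> X \<and> v \<in> X \<and> u \<noteq> v \<and> \<not> adj (induce G X) u v} =
    {e \<in> {{u, v} |u v. u \<in> verts G \<and> v \<in> verts G \<and> u \<noteq> v \<and> \<not> adj G u v}. e \<subseteq> X}" (is "?L = ?R")
  proof
    show "?L \<subseteq> ?R" using assms by (auto simp: adj_induce)
    show "?R \<subseteq> ?L" by (auto simp: adj_induce)
  qed
  then show ?thesis by (simp add: graph_complement_def induce_def)
qed

section \<open>Anticomponents\<close>

definition reach :: "'a graph \<Rightarrow> 'a \<Rightarrow> 'a set" where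
  "reach A v = {u. (v, u) \<in> {(x, y). adj A x y}\<^sup>*}"

lemma reach_self: "v \<in> reach A v" by (simp add: reach_def)

lemma reach_step: "x \<in> reach A v \<Longrightarrow> adj A x y \<Longrightarrow> y \<in> reach A v"
  unfolding reach_def by (auto intro: rtrancl_into_rtrancl)

lemma reach_connected: "connected_graph (induce A (reach A v))"
proof -
  have 1: "(v, u) \<in> {(x, y). adj (induce A (reach A v)) x y}\<^sup>*" if "u \<in> reach A v" for u
  proof -
    have "(v, u) \<in> {(x, y). adj A x y}\<^sup>*" using that by (simp add: reach_def)
    then show ?thesis
    proof induction
      case (step y z)
      then have "y \<in> reach A v" "adj A y z" by (simp_all add: reach_def)
      then have "(y, z) \<in> {(x, y). adj (induce A (reach A v)) x y}" using reach_step[of y A v z] by (simp add: adj_induce)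
      then show ?case using step.IH by (rule rtrancl_into_rtrancl[rotated])
    qed simp
  qed
  have "sym {(x, y). adj (induce A (reach A v)) x y}" by (auto simp: sym_def adj_commute)
  then have "sym ({(x, y). adj (induce A (reach A v)) x y}\<^sup>*)" by (rule sym_rtrancl)
  then have "(u, w) \<in> {(x, y). adj (induce A (reach A v)) x y}\<^sup>*" if "u \<in> reach A v" "w \<in> reach A v" for u w
    using 1[OF that(1)] 1[OF that(2)] by (meson rtrancl_trans symD)
  then show ?thesis unfolding connected_graph_def using reach_self[of v A] by auto
qed

text \<open>Reachability sets are connected and contain every connected set that they meet, so they
  are the maximal connected sets. The hypothesis that edges end in vertices keeps them inside
  \<open>verts A\<close>.\<close>

lemma component_iff:
  assumes "\<And>x y. adj A x y \<Longrightarrow> y \<in> verts A"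
  shows "component H A \<longleftrightarrow> (\<exists>v\<in>verts A. H = induce A (reach A v))"
proof
  assume H: "component H A"
  then have ind: "induced_subgraph H A" and c: "connected_graph H"
    and max: "\<forall>K. induced_subgraph K A \<and> connected_graph K \<and> verts H \<subseteq> verts K \<longrightarrow> K = H"
    unfolding component_def by simp_all
  from ind obtain X where X: "X \<subseteq> verts A" "X \<noteq> {}" "H = induce A X"
    unfolding induced_subgraph_def by (elim exE conjE)
  obtain v where v: "v \<in> X" using X by blast
  have "reach A v \<subseteq> verts A"
  proof
    fix u assume "u \<in> reach A v"
    then have "(v, u) \<in> {(x, y). adj A x y}\<^sup>*" by (simp add: reach_def)
    then show "u \<in> verts A" by (rule closed_rtrancl) (use v X assms in auto)
  qed
  then have "induced_subgraph (induce A (reach A v)) A"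
    unfolding induced_subgraph_def using reach_self[of v A] by (intro exI[of _ "reach A v"]) auto
  moreover have "verts H \<subseteq> verts (induce A (reach A v))"
  proof
    fix u assume "u \<in> verts H"
    then have "(v, u) \<in> {(x, y). adj H x y}\<^sup>*" using c v X(3) unfolding connected_graph_def by simp
    moreover have "{(x, y). adj H x y} \<subseteq> {(x, y). adj A x y}" using X(3) by (auto simp: adj_induce)
    ultimately show "u \<in> verts (induce A (reach A v))" using rtrancl_mono by (auto simp: reach_def)
  qed
  ultimately show "\<exists>v\<in>verts A. H = induce A (reach A v)"
    using max[rule_format, of "induce A (reach A v)"] reach_connected[of A v] v X by (intro bexI[of _ v]) auto
next
  assume "\<exists>v\<in>verts A. H = induce A (reach A v)"
  then obtain v where v: "v \<in> verts A" "H = induce A (reach A v)" by blast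
  have sub: "reach A v \<subseteq> verts A"
  proof
    fix u assume "u \<in> reach A v"
    then have "(v, u) \<in> {(x, y). adj A x y}\<^sup>*" by (simp add: reach_def)
    then show "u \<in> verts A" by (rule closed_rtrancl) (use v assms in auto)
  qed
  show "component H A" unfolding component_def
  proof (intro conjI allI impI)
    show "induced_subgraph H A" unfolding induced_subgraph_def
      using v sub reach_self[of v A] by (intro exI[of _ "reach A v"]) auto
    show "connected_graph H" using v reach_connected by simp
    fix K assume K: "induced_subgraph K A \<and> connected_graph K \<and> verts H \<subseteq> verts K"
    then obtain Y where Y: "K = induce A Y" unfolding induced_subgraph_def by (elim exE conjE)
    have "Y \<subseteq> reach A v"
    proof
      fix u assume "u \<in> Y"
      moreover have "v \<in> Y" using K v Y reach_self[of v A] by auto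
      ultimately have "(v, u) \<in> {(x, y). adj K x y}\<^sup>*" using K Y unfolding connected_graph_def by simp
      moreover have "{(x, y). adj K x y} \<subseteq> {(x, y). adj A x y}" using Y by (auto simp: adj_induce)
      ultimately show "u \<in> reach A v" using rtrancl_mono by (auto simp: reach_def)
    qed
    moreover have "reach A v \<subseteq> Y" using K v Y by simp
    ultimately show "K = H" using Y v by auto
  qed
qed

definition anticomp :: "'a graph \<Rightarrow> 'a \<Rightarrow> 'a set" where
  "anticomp G v = reach (graph_complement G) v"

lemma anticomp_verts:
  assumes "v \<in> verts G"
  shows "anticomp G v \<subseteq> verts G"
proof
  fix u assume "u \<in> anticomp G v"
  then have "(v, u) \<in> {(x, y). adj (graph_complement G) x y}\<^sup>*" by (simp add: anticomp_def reach_def)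
  then show "u \<in> verts G" by (rule closed_rtrancl) (use assms in \<open>auto simp: adj_complement\<close>)
qed

lemma anticomp_step: "x \<in> anticomp G v \<Longrightarrow> x \<in> verts G \<Longrightarrow> y \<in> verts G \<Longrightarrow> \<not> nb G x y \<Longrightarrow> y \<in> anticomp G v"
  unfolding anticomp_def by (rule reach_step) (auto simp: adj_complement)

lemma anticomponent_iff: "anticomponent H G \<longleftrightarrow> (\<exists>v\<in>verts G. H = induce G (anticomp G v))"
proof -
  have vA: "\<And>x y. adj (graph_complement G) x y \<Longrightarrow> y \<in> verts (graph_complement G)" by (simp add: adj_complement)
  show ?thesis
  proof
    assume "anticomponent H G"
    then obtain X where X: "X \<subseteq> verts G" "H = induce G X" and c: "component (graph_complement H) (graph_complement G)"
      unfolding anticomponent_def induced_subgraph_def by (elim exE conjE)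
    obtain v where v: "v \<in> verts G" "graph_complement H = induce (graph_complement G) (anticomp G v)"
      using c component_iff[OF vA] unfolding anticomp_def by auto
    have "verts (graph_complement H) = anticomp G v" using v by simp
    then have "X = anticomp G v" using X by simp
    then show "\<exists>v\<in>verts G. H = induce G (anticomp G v)" using X v by blast
  next
    assume "\<exists>v\<in>verts G. H = induce G (anticomp G v)"
    then obtain v where v: "v \<in> verts G" "H = induce G (anticomp G v)" by blast
    have "v \<in> anticomp G v" by (simp add: anticomp_def reach_self)
    then have "induced_subgraph H G" unfolding induced_subgraph_def
      by (intro exI[of _ "anticomp G v"]) (use v anticomp_verts[OF v(1)] in auto)
    moreover have "graph_complement H = induce (graph_complement G) (reach (graph_complement G) v)"
      using v complement_induce[OF anticomp_verts[OF v(1)]] by (simp add: anticomp_def)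
    then have "component (graph_complement H) (graph_complement G)" using component_iff[OF vA] v by auto
    ultimately show "anticomponent H G" unfolding anticomponent_def by blast
  qed
qed

text \<open>The anticomponent of \<open>v\<close> is larger than \<open>{v}\<close> as soon as
  \<open>v\<close> has one nonneighbour, so trivial anticomponents come from universal
  vertices.\<close>

lemma nontrivial_anticomponent_iff:
  assumes s: "simple_graph G"
  shows "nontrivial_anticomponent H G \<longleftrightarrow>
    (\<exists>v\<in>verts G. H = induce G (anticomp G v) \<and> (\<exists>u\<in>verts G. \<not> nb G v u))"
proof -
  have fin: "finite (verts G)" using s by (simp add: simple_graph_def)
  have "card (anticomp G v) \<ge> 2 \<longleftrightarrow> (\<exists>u\<in>verts G. \<not> nb G v u)" if v: "v \<in> verts G" for v
  proof
    assume c: "card (anticomp G v) \<ge> 2"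
    show "\<exists>u\<in>verts G. \<not> nb G v u"
    proof (rule ccontr)
      assume n: "\<not> ?thesis"
      have "anticomp G v \<subseteq> {v}"
      proof
        fix u assume "u \<in> anticomp G v"
        then have "(v, u) \<in> {(x, y). adj (graph_complement G) x y}\<^sup>*" by (simp add: anticomp_def reach_def)
        then show "u \<in> {v}" by (rule closed_rtrancl) (use n in \<open>auto simp: adj_complement\<close>)
      qed
      then have "card (anticomp G v) \<le> card {v}" by (intro card_mono) auto
      then show False using c by simp
    qed
  next
    assume "\<exists>u\<in>verts G. \<not> nb G v u"
    then obtain u where u: "u \<in> verts G" "\<not> nb G v u" by blast
    have "v \<in> anticomp G v" by (simp add: anticomp_def reach_self)
    then have "{v, u} \<subseteq> anticomp G v" using anticomp_step[of v G v u] v u by blast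
    moreover have "v \<noteq> u" using u by auto
    moreover have "finite (anticomp G v)" using fin anticomp_verts[OF v] finite_subset by blast
    ultimately show "card (anticomp G v) \<ge> 2" by (metis card_2_iff card_mono)
  qed
  then show ?thesis unfolding nontrivial_anticomponent_def anticomponent_iff by auto
qed

theorem forward:
  assumes s: "simple_graph G" and f: "graph_free {path_graph 7, cycle_graph 4, cycle_graph 5} G"
    and nc: "\<not> (\<exists>C. clique_cutset G C)" and ncomp: "\<not> complete_graph G"
  shows "(\<exists>!H. nontrivial_anticomponent H G) \<and>
    (\<forall>H. nontrivial_anticomponent H G \<longrightarrow> bracelet7 H \<or> thickened_emerald H \<or> lantern H \<or> wreath6 H \<or> crown6 H)"
proof -
  interpret free_graph G using s f graph_free_iff[OF s] by unfold_locales auto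
  define X where "X = {v \<in> verts G. \<exists>u\<in>verts G. \<not> nb G v u}"
  have XV: "X \<subseteq> verts G" by (auto simp: X_def)
  have Xne: "X \<noteq> {}" using ncomp unfolding complete_graph_def clique_nb X_def by blast
  have XI: "x \<in> X \<and> y \<in> X" if "x \<in> verts G" "y \<in> verts G" "\<not> nb G x y" for x y
    using that not_nb_sym[OF that(3)] by (auto simp: X_def)
  have ac: "anticomp G v = X" if v: "v \<in> X" for v
  proof
    obtain v' where v': "v' \<in> verts G" "\<not> nb G v v'" using v by (auto simp: X_def)
    have vV: "v \<in> verts G" using v XV by blast
    have vA: "v \<in> anticomp G v" by (simp add: anticomp_def reach_self)
    show "anticomp G v \<subseteq> X"
    proof
      fix u assume "u \<in> anticomp G v"
      then have "(v, u) \<in> {(x, y). adj (graph_complement G) x y}\<^sup>*" by (simp add: anticomp_def reach_def)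
      then show "u \<in> X" by (rule closed_rtrancl) (use v XI in \<open>auto simp: adj_complement\<close>)
    qed
    show "X \<subseteq> anticomp G v"
    proof
      fix u assume u: "u \<in> X"
      then obtain u' where u': "u' \<in> verts G" "\<not> nb G u u'" by (auto simp: X_def)
      have uV: "u \<in> verts G" using u XV by blast
      show "u \<in> anticomp G v"
      \<comment> \<open>Different anticomponents are complete to each other, so a nonadjacent pair
        from each of two nontrivial ones would form a \<open>C4\<close>.\<close>
      proof (rule ccontr)
        assume n: "u \<notin> anticomp G v"
        have v'A: "v' \<in> anticomp G v" using anticomp_step[OF vA vV v'] .
        have n': "u' \<notin> anticomp G v" using anticomp_step[of u' G v u] n u'(1) uV not_nb_sym[OF u'(2)] by blast
        have N: "nb G x y" if "x \<in> anticomp G v" "x \<in> verts G" "y \<notin> anticomp G v" "y \<in> verts G" for x y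
          using anticomp_step[of x G v y] that by blast
        show False
          using C4[of v u v' u'] N[OF vA vV n uV] N[OF v'A v'(1) n uV, THEN nb_sym] N[OF v'A v'(1) n' u'(1)] N[OF vA vV n' u'(1), THEN nb_sym]
            v'(2) u'(2) by blast
      qed
    qed
  qed
  have na: "nontrivial_anticomponent H G \<longleftrightarrow> H = induce G X" for H
  proof -
    have "nontrivial_anticomponent H G \<longleftrightarrow> (\<exists>v\<in>X. H = induce G (anticomp G v))"
      unfolding nontrivial_anticomponent_iff[OF s] X_def by auto
    then show ?thesis using ac Xne by auto
  qed
  interpret H: free_graph "induce G X" using free_induce[OF free_graph_axioms XV Xne] .
  interpret H: atom_graph "induce G X"
  proof
    fix K v
    assume K: "K \<subseteq> verts (induce G X)" "K \<noteq> {}" "v \<in> verts (induce G X)" "v \<notin> K" "\<forall>k\<in>K. \<not> nb (induce G X) v k"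
    then have K': "K \<subseteq> X" "v \<in> X" by simp_all
    then have "K \<subseteq> verts G" "v \<in> verts G" "\<forall>k\<in>K. \<not> nb G v k" using XV K(5) nb_induce[of v X _ G] by auto
    from attachment_not_clique[OF s nc this(1) K(2) this(2) K(4) this(3)]
    obtain x y k l where xy: "x \<in> verts G - K" "y \<in> verts G - K" "\<not> nb G x y" "k \<in> K" "nb G x k" "l \<in> K" "nb G y l"
      by (elim bexE conjE)
    \<comment> \<open>Nonadjacent attachments found in \<open>G\<close> are not universal, so they
      lie in \<open>X\<close>: the cutset condition passes from \<open>G\<close> to the
      anticomponent.\<close>
    have "x \<in> X" "y \<in> X" using XI[of x y] xy by auto
    then show "\<exists>x\<in>verts (induce G X) - K. \<exists>y\<in>verts (induce G X) - K.
        \<not> nb (induce G X) x y \<and> (\<exists>k\<in>K. nb (induce G X) x k) \<and> (\<exists>k\<in>K. nb (induce G X) y k)"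
    proof (intro bexI conjI)
      have KX: "k \<in> X" "l \<in> X" using xy K'(1) by auto
      show "\<not> nb (induce G X) x y" using xy(3) \<open>x \<in> X\<close> \<open>y \<in> X\<close> by (simp add: nb_induce)
      show "nb (induce G X) x k" using xy(5) \<open>x \<in> X\<close> KX by (simp add: nb_induce)
      show "nb (induce G X) y l" using xy(7) \<open>y \<in> X\<close> KX by (simp add: nb_induce)
    qed (use xy \<open>x \<in> X\<close> \<open>y \<in> X\<close> in auto)
  next
    fix u assume u: "u \<in> verts (induce G X)"
    then obtain v where "v \<in> verts G" "\<not> nb G u v" by (auto simp: X_def)
    then have "v \<in> X" using XI[of u v] u XV by auto
    then show "\<exists>v\<in>verts (induce G X). \<not> nb (induce G X) u v" using u \<open>\<not> nb G u v\<close> by (auto simp: nb_induce)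
  qed
  have "bracelet7 (induce G X) \<or> thickened_emerald (induce G X) \<or> lantern (induce G X) \<or> wreath6 (induce G X) \<or> crown6 (induce G X)"
    using H.atom_structure Xne by simp
  then show ?thesis unfolding na by auto
qed

text \<open>The formulation does not ask that anything remains after the removal, nor that
  \<open>C\<close> lies in \<open>verts H\<close>; it can thus be applied directly to the trace of a
  clique of a larger graph.\<close>

definition clique_robust :: "'a graph \<Rightarrow> bool" where
  "clique_robust H \<longleftrightarrow> (\<forall>C. (\<forall>x\<in>C. \<forall>y\<in>C. nb H x y) \<longrightarrow>
     (\<forall>x\<in>verts H - C. \<forall>y\<in>verts H - C. (x, y) \<in> {(u, v). u \<in> verts H - C \<and> v \<in> verts H - C \<and> nb H u v}\<^sup>*))"

text \<open>Uniqueness of the nontrivial anticomponent makes all vertices outside it universal. Such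
  vertices lie in no forbidden subgraph, and one of them that survives the removal of a clique joins
  everything that is left.\<close>

theorem backward:
  assumes s: "simple_graph G" and u: "\<exists>!H. nontrivial_anticomponent H G"
    and H: "nontrivial_anticomponent H G" "free_graph H" "clique_robust H"
  shows "graph_free {path_graph 7, cycle_graph 4, cycle_graph 5} G \<and> \<not> (\<exists>C. clique_cutset G C)"
proof -
  obtain w where w: "w \<in> verts G" "H = induce G (anticomp G w)" using H(1) nontrivial_anticomponent_iff[OF s] by blast
  define Y where "Y = anticomp G w"
  have YV: "Y \<subseteq> verts G" using anticomp_verts w by (simp add: Y_def)
  have HY: "verts H = Y" and nbH: "\<And>x y. x \<in> Y \<Longrightarrow> y \<in> Y \<Longrightarrow> nb H x y \<longleftrightarrow> nb G x y"
    using w by (simp_all add: Y_def nb_induce)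
  have out: "nb G x y" if x: "x \<in> verts G - Y" and y: "y \<in> verts G" for x y
  proof (rule ccontr)
    assume "\<not> nb G x y"
    then have "nontrivial_anticomponent (induce G (anticomp G x)) G"
      using nontrivial_anticomponent_iff[OF s] x y by blast
    then have "induce G (anticomp G x) = H" using u H(1) by blast
    then have "verts (induce G (anticomp G x)) = Y" using HY by simp
    then have "x \<in> Y" by (simp add: anticomp_def) (metis reach_self)
    then show False using x by blast
  qed
  have HV: "verts H \<subseteq> verts G" using HY YV by simp
  have eq: "\<And>x y. x \<in> verts H \<Longrightarrow> y \<in> verts H \<Longrightarrow> nb H x y \<longleftrightarrow> nb G x y" using nbH HY by simp
  have out': "\<And>x y. x \<in> verts G - verts H \<Longrightarrow> y \<in> verts G \<Longrightarrow> nb G x y" using out HY by simp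
  interpret free_graph H by fact
  have "graph_free {path_graph 7, cycle_graph 4, cycle_graph 5} G"
    unfolding graph_free_iff[OF s]
    using no_P7_verts[OF no_P7 HV s eq out'] no_C4_verts[OF no_C4 HV s eq out'] no_C5_verts[OF no_C5 HV s eq out'] by blast
  moreover have "\<not> clique_cutset G C" for C
  proof
    assume "clique_cutset G C"
    then have C: "clique G C" "C \<subset> verts G" "\<not> connected_graph (induce G (verts G - C))"
      unfolding clique_cutset_def by blast+
    define D where "D = verts G - C"
    have "D \<noteq> {}" using C(2) by (auto simp: D_def)
    have "(x, y) \<in> {(x, y). adj (induce G D) x y}\<^sup>*" if "x \<in> D" "y \<in> D" for x y
    proof (cases "D \<subseteq> Y")
      case True
      have DY: "D = Y - C \<inter> Y" using True YV by (auto simp: D_def)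
      have "\<forall>x\<in>C \<inter> Y. \<forall>y\<in>C \<inter> Y. nb H x y" using C(1) nbH unfolding clique_nb by auto
      then have "(x, y) \<in> {(u, v). u \<in> D \<and> v \<in> D \<and> nb H u v}\<^sup>*"
        \<comment> \<open>No vertex outside the anticomponent has survived here, so the connections
          must come from \<open>H\<close> itself, applied to the part of the clique inside
          it.\<close>
        using H(3)[unfolded clique_robust_def, rule_format, of "C \<inter> Y" x y] that unfolding HY DY by blast
      then show ?thesis
      proof induction
        case (step a b)
        then have "a \<in> D" "b \<in> D" "nb G a b" using True nbH by auto
        then have "a = b \<or> adj (induce G D) a b" by (auto simp: nb_def adj_induce)
        then show ?case using step.IH by (auto intro: rtrancl_into_rtrancl)
      qed simp
    next
      \<comment> \<open>A surviving universal vertex \<open>z\<close> links any two remaining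
        vertices.\<close>
      case False
      then obtain z where z: "z \<in> D" "z \<in> verts G - Y" by (auto simp: D_def)
      have "nb G z x" "nb G z y" using out[OF z(2)] that by (auto simp: D_def)
      then have "nb G x z" "nb G z y" using nb_sym[of G z x] by blast+
      then have "x = z \<or> adj (induce G D) x z" "z = y \<or> adj (induce G D) z y"
        using that z by (auto simp: nb_def adj_induce)
      then show ?thesis by (auto intro: r_into_rtrancl rtrancl_trans)
    qed
    then have "connected_graph (induce G D)" using \<open>D \<noteq> {}\<close> unfolding connected_graph_def by simp
    then show False using C(3) by (simp add: D_def)
  qed
  ultimately show ?thesis by blast
qed

lemma complete_graph_free:
  assumes s: "simple_graph G" and c: "complete_graph G"
  shows "graph_free {path_graph 7, cycle_graph 4, cycle_graph 5} G \<and> \<not> (\<exists>C. clique_cutset G C)"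
proof -
  have a: "nb G x y" if "x \<in> verts G" "y \<in> verts G" for x y using c that unfolding complete_graph_def clique_nb by blast
  have t: "nb G x z" if "nb G x y" "nb G y z" for x y z
    using a[of x z] nb_verts[OF s that(1)] nb_verts[OF s that(2)] that by (cases "x = y"; cases "y = z") auto
  have "no_P7 (nb G)" "no_C4 (nb G)" "no_C5 (nb G)" unfolding no_P7_def no_C4_def no_C5_def using t by blast+
  moreover have "connected_graph (induce G (verts G - C))" if "C \<subset> verts G" for C
    unfolding connected_graph_def
  proof (intro conjI ballI)
    show "verts (induce G (verts G - C)) \<noteq> {}" using that by auto
    fix u v assume uv: "u \<in> verts (induce G (verts G - C))" "v \<in> verts (induce G (verts G - C))"
    then have "u = v \<or> adj (induce G (verts G - C)) u v" using a[of u v] by (auto simp: nb_def adj_induce)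
    then show "(u, v) \<in> {(x, y). adj (induce G (verts G - C)) x y}\<^sup>*" by (auto intro: r_into_rtrancl)
  qed
  then have "\<not> (\<exists>C. clique_cutset G C)" unfolding clique_cutset_def by blast
  ultimately show ?thesis unfolding graph_free_iff[OF s] by blast
qed

section \<open>The converse\<close>

text \<open>Each \<open>i\<close> occurs in its own list, so this relation is reflexive like
  \<open>nb\<close>; concrete lists allow the check by evaluation.\<close>

definition adjl :: "nat list list \<Rightarrow> nat \<Rightarrow> nat \<Rightarrow> bool" where
  "adjl L i j \<longleftrightarrow> i < length L \<and> j \<in> set (L ! i)"

text \<open>The quantifiers are interleaved with the nonadjacency conditions so that evaluation stops early.\<close>

definition model_check :: "nat list list \<Rightarrow> bool" where
  "model_check L \<longleftrightarrow> (\<forall>a\<in>set [0..<length L]. \<forall>b\<in>set (L ! a). b < length L \<and> a \<in> set (L ! b) \<and>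
     (\<forall>c\<in>set (L ! b). c \<in> set (L ! a) \<or> (\<forall>d\<in>set (L ! c). d \<in> set (L ! b) \<or> d \<notin> set (L ! a) \<and>
       (\<forall>e\<in>set (L ! d). e \<in> set (L ! b) \<or> e \<in> set (L ! c) \<or> e \<notin> set (L ! a) \<and>
         (\<forall>f\<in>set (L ! e). f \<in> set (L ! a) \<or> f \<in> set (L ! b) \<or> f \<in> set (L ! c) \<or> f \<in> set (L ! d) \<or>
           (\<forall>g\<in>set (L ! f). g \<in> set (L ! a) \<or> g \<in> set (L ! b) \<or> g \<in> set (L ! c) \<or> g \<in> set (L ! d) \<or> g \<in> set (L ! e)))))))"

text \<open>The check grows induced paths vertex by vertex. Closing up after four or five vertices
  is what \<open>d \<notin> set (L ! a)\<close> and \<open>e \<notin> set (L ! a)\<close> exclude,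
  and no induced path may reach a seventh vertex. \<open>P4\<close> and \<open>P5\<close> state what
  remains after four and five vertices.\<close>

lemma model_check_free:
  assumes L: "model_check L"
  shows "no_P7 (adjl L)" "no_C4 (adjl L)" "no_C5 (adjl L)"
proof -
  have M: "b < length L \<and> a \<in> set (L ! b) \<and>
     (\<forall>c\<in>set (L ! b). c \<in> set (L ! a) \<or> (\<forall>d\<in>set (L ! c). d \<in> set (L ! b) \<or> d \<notin> set (L ! a) \<and>
       (\<forall>e\<in>set (L ! d). e \<in> set (L ! b) \<or> e \<in> set (L ! c) \<or> e \<notin> set (L ! a) \<and>
         (\<forall>f\<in>set (L ! e). f \<in> set (L ! a) \<or> f \<in> set (L ! b) \<or> f \<in> set (L ! c) \<or> f \<in> set (L ! d) \<or>
           (\<forall>g\<in>set (L ! f). g \<in> set (L ! a) \<or> g \<in> set (L ! b) \<or> g \<in> set (L ! c) \<or> g \<in> set (L ! d) \<or> g \<in> set (L ! e))))))"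
    if "a < length L" "b \<in> set (L ! a)" for a b
    using L[unfolded model_check_def, rule_format, of a b] that by simp
  have sym: "adjl L i j \<Longrightarrow> adjl L j i" for i j using M[of i j] by (simp add: adjl_def)
  have lt: "adjl L i j \<Longrightarrow> i < length L \<and> j < length L" for i j using M[of i j] by (simp add: adjl_def)
  have eq: "j \<in> set (L ! i) \<longleftrightarrow> adjl L i j" if "i < length L" for i j using that by (simp add: adjl_def)
  have P4: "\<not> adjl L a d \<and>
       (\<forall>e\<in>set (L ! d). e \<in> set (L ! b) \<or> e \<in> set (L ! c) \<or> e \<notin> set (L ! a) \<and>
         (\<forall>f\<in>set (L ! e). f \<in> set (L ! a) \<or> f \<in> set (L ! b) \<or> f \<in> set (L ! c) \<or> f \<in> set (L ! d) \<or>
           (\<forall>g\<in>set (L ! f). g \<in> set (L ! a) \<or> g \<in> set (L ! b) \<or> g \<in> set (L ! c) \<or> g \<in> set (L ! d) \<or> g \<in> set (L ! e))))"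
    if "adjl L a b" "adjl L b c" "adjl L c d" "\<not> adjl L a c" "\<not> adjl L b d" for a b c d
  proof -
    have l: "a < length L" "b < length L" "c < length L" "d < length L" using lt that by blast+
    have B: "b \<in> set (L ! a)" "c \<in> set (L ! b)" "d \<in> set (L ! c)" "c \<notin> set (L ! a)" "d \<notin> set (L ! b)"
      using that l by (simp_all add: adjl_def)
    from M[OF l(1) B(1)] B(2,4) have "\<forall>d\<in>set (L ! c). d \<in> set (L ! b) \<or> d \<notin> set (L ! a) \<and>
       (\<forall>e\<in>set (L ! d). e \<in> set (L ! b) \<or> e \<in> set (L ! c) \<or> e \<notin> set (L ! a) \<and>
         (\<forall>f\<in>set (L ! e). f \<in> set (L ! a) \<or> f \<in> set (L ! b) \<or> f \<in> set (L ! c) \<or> f \<in> set (L ! d) \<or>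
           (\<forall>g\<in>set (L ! f). g \<in> set (L ! a) \<or> g \<in> set (L ! b) \<or> g \<in> set (L ! c) \<or> g \<in> set (L ! d) \<or> g \<in> set (L ! e))))"
      by (elim conjE) (drule (1) bspec, simp)
    from bspec[OF this B(3)] B(5) show ?thesis by (simp add: adjl_def)
  qed
  have P5: "\<not> adjl L a e \<and>
         (\<forall>f\<in>set (L ! e). f \<in> set (L ! a) \<or> f \<in> set (L ! b) \<or> f \<in> set (L ! c) \<or> f \<in> set (L ! d) \<or>
           (\<forall>g\<in>set (L ! f). g \<in> set (L ! a) \<or> g \<in> set (L ! b) \<or> g \<in> set (L ! c) \<or> g \<in> set (L ! d) \<or> g \<in> set (L ! e)))"
    if abcd: "adjl L a b" "adjl L b c" "adjl L c d" "\<not> adjl L a c" "\<not> adjl L b d" and "adjl L d e" "\<not> adjl L b e" "\<not> adjl L c e"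
    for a b c d e
  proof -
    have l: "a < length L" "b < length L" "c < length L" "d < length L" "e < length L" using lt that by blast+
    have B: "e \<in> set (L ! d)" "e \<notin> set (L ! b)" "e \<notin> set (L ! c)" using that l by (simp_all add: adjl_def)
    from bspec[OF conjunct2[OF P4[OF abcd]] B(1)] B(2,3) show ?thesis by (simp add: adjl_def)
  qed
  show "no_P7 (adjl L)" unfolding no_P7_def
  proof (intro allI impI)
    fix a b c d e f g
    assume 1: "adjl L a b" "adjl L b c" "adjl L c d" and 2: "adjl L d e" and 3: "adjl L e f" "adjl L f g"
      and n: "\<not> adjl L a c" "\<not> adjl L a d" "\<not> adjl L a e" "\<not> adjl L a f" "\<not> adjl L a g" "\<not> adjl L b d" "\<not> adjl L b e" "\<not> adjl L b f"
       "\<not> adjl L b g" "\<not> adjl L c e" "\<not> adjl L c f" "\<not> adjl L c g" "\<not> adjl L d f" "\<not> adjl L d g" "\<not> adjl L e g"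
    have l: "a < length L" "b < length L" "c < length L" "d < length L" "e < length L" "f < length L"
      using lt 1 2 3 by blast+
    have B: "f \<in> set (L ! e)" "g \<in> set (L ! f)" using 3 by (simp_all add: adjl_def)
    have N: "f \<notin> set (L ! a)" "f \<notin> set (L ! b)" "f \<notin> set (L ! c)" "f \<notin> set (L ! d)"
      "g \<notin> set (L ! a)" "g \<notin> set (L ! b)" "g \<notin> set (L ! c)" "g \<notin> set (L ! d)" "g \<notin> set (L ! e)"
      using n l by (simp_all add: adjl_def)
    show False
      using bspec[OF conjunct2[OF P5[OF 1 n(1,6) 2 n(7,10)]] B(1)] B(2) N by blast
  qed
  show "no_C4 (adjl L)" unfolding no_C4_def
  proof (intro allI impI)
    fix a b c d
    assume "adjl L a b" "adjl L b c" "adjl L c d" "adjl L d a" "\<not> adjl L a c" "\<not> adjl L b d"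
    then show False using P4[of a b c d] sym[of d a] by blast
  qed
  show "no_C5 (adjl L)" unfolding no_C5_def
  proof (intro allI impI)
    fix a b c d e
    assume "adjl L a b" "adjl L b c" "adjl L c d" "adjl L d e" "adjl L e a" "\<not> adjl L a c" "\<not> adjl L a d"
      "\<not> adjl L b d" "\<not> adjl L b e" "\<not> adjl L c e"
    then show False using P5[of a b c d e] sym[of e a] by blast
  qed
qed

text \<open>Closed adjacency lists of the quotient of a thickened emerald by its parts, numbered in the order
  \<open>C, Zm, Zp, A (k + 1), Rs, Rm, A (k + 3), A (k - 3), Ls, Lp, A (k - 1)\<close>.\<close>

definition emerald_model :: "nat list list" where
  "emerald_model = [[0,4,6,7,8],[1,2,3,10,9],[2,1,3,10,5],[3,1,2,4,5],[4,0,3,5,6],[5,2,3,4,6],[6,0,4,5,7],[7,0,6,8,9],[8,0,7,9,10],[9,1,7,8,10],[10,1,2,8,9]]"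

text \<open>The parts are \<open>C k, \<dots>, C (k + 5), D k, \<dots>, D (k + 3)\<close>.\<close>

definition crown_model :: "nat list list" where
  "crown_model = [[0,1,5,6,7],[1,0,2,6,7,8],[2,1,3,7,8,9],[3,2,4,8,9],[4,3,5,9],[5,4,0,6],[6,5,0,1],[7,0,1,2],[8,1,2,3],[9,2,3,4]]"

lemma emerald_model_check: "model_check emerald_model"
  by code_simp

lemma crown_model_check: "model_check crown_model"
  by code_simp

text \<open>Consecutive members of a pattern are distinct and \<open>nb\<close>-related and hence
  vertices, so only patterns inside \<open>verts H\<close> have to be refuted.\<close>

lemma free_graphI:
  assumes "simple_graph H"
    and "\<And>a b c d e f g. \<lbrakk>a \<in> verts H; b \<in> verts H; c \<in> verts H; d \<in> verts H; e \<in> verts H; f \<in> verts H; g \<in> verts H;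
      nb H a b; nb H b c; nb H c d; nb H d e; nb H e f; nb H f g;
      \<not> nb H a c; \<not> nb H a d; \<not> nb H a e; \<not> nb H a f; \<not> nb H a g; \<not> nb H b d; \<not> nb H b e; \<not> nb H b f;
      \<not> nb H b g; \<not> nb H c e; \<not> nb H c f; \<not> nb H c g; \<not> nb H d f; \<not> nb H d g; \<not> nb H e g\<rbrakk> \<Longrightarrow> False"
    and "\<And>a b c d. \<lbrakk>a \<in> verts H; b \<in> verts H; c \<in> verts H; d \<in> verts H;
      nb H a b; nb H b c; nb H c d; nb H d a; \<not> nb H a c; \<not> nb H b d\<rbrakk> \<Longrightarrow> False"
    and "\<And>a b c d e. \<lbrakk>a \<in> verts H; b \<in> verts H; c \<in> verts H; d \<in> verts H; e \<in> verts H;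
      nb H a b; nb H b c; nb H c d; nb H d e; nb H e a;
      \<not> nb H a c; \<not> nb H a d; \<not> nb H b d; \<not> nb H b e; \<not> nb H c e\<rbrakk> \<Longrightarrow> False"
  shows "free_graph H"
proof
  note V = nb_verts[OF assms(1)]
  show "simple_graph H" by fact
  show "no_P7 (nb H)" unfolding no_P7_def
  proof (intro allI impI)
    fix a b c d e f g
    assume A: "nb H a b" "nb H b c" "nb H c d" "nb H d e" "nb H e f" "nb H f g"
      and B: "\<not> nb H a c" "\<not> nb H a d" "\<not> nb H a e" "\<not> nb H a f" "\<not> nb H a g" "\<not> nb H b d" "\<not> nb H b e" "\<not> nb H b f"
       "\<not> nb H b g" "\<not> nb H c e" "\<not> nb H c f" "\<not> nb H c g" "\<not> nb H d f" "\<not> nb H d g" "\<not> nb H e g"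
    have "a \<noteq> b" "b \<noteq> c" "c \<noteq> d" "d \<noteq> e" "e \<noteq> f" "f \<noteq> g" using A B by auto
    then have "a \<in> verts H" "b \<in> verts H" "c \<in> verts H" "d \<in> verts H" "e \<in> verts H" "f \<in> verts H" "g \<in> verts H"
      using V A by blast+
    from assms(2)[OF this A B] show False .
  qed
  show "no_C4 (nb H)" unfolding no_C4_def
  proof (intro allI impI)
    fix a b c d
    assume A: "nb H a b" "nb H b c" "nb H c d" "nb H d a" and B: "\<not> nb H a c" "\<not> nb H b d"
    have "a \<noteq> b" "b \<noteq> c" "c \<noteq> d" using A B nb_sym[of H d a] by auto
    then have "a \<in> verts H" "b \<in> verts H" "c \<in> verts H" "d \<in> verts H" using V A by blast+
    from assms(3)[OF this A B] show False .
  qed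
  show "no_C5 (nb H)" unfolding no_C5_def
  proof (intro allI impI)
    fix a b c d e
    assume A: "nb H a b" "nb H b c" "nb H c d" "nb H d e" "nb H e a"
      and B: "\<not> nb H a c" "\<not> nb H a d" "\<not> nb H b d" "\<not> nb H b e" "\<not> nb H c e"
    have "a \<noteq> b" "b \<noteq> c" "c \<noteq> d" "d \<noteq> e" using A B by auto
    then have "a \<in> verts H" "b \<in> verts H" "c \<in> verts H" "d \<in> verts H" "e \<in> verts H" using V A by blast+
    from assms(4)[OF this A B] show False .
  qed
qed

text \<open>Sending each vertex to its part preserves and reflects the reflexive adjacency. Since
  the forbidden patterns are expressed by that relation alone, without distinctness conditions, a
  pattern in \<open>H\<close> appears as a pattern in the quotient.\<close>

lemma blowup_free:
  fixes B :: "nat \<Rightarrow> 'a set"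
  assumes s: "simple_graph H" and L: "model_check L" and cov: "verts H = (\<Union>i<length L. B i)"
    and adj: "\<And>i j x y. i < length L \<Longrightarrow> j < length L \<Longrightarrow> x \<in> B i \<Longrightarrow> y \<in> B j \<Longrightarrow> nb H x y \<longleftrightarrow> j \<in> set (L ! i)"
  shows "free_graph H"
proof -
  define cl where "cl v = (SOME i. i < length L \<and> v \<in> B i)" for v
  have cl: "cl v < length L \<and> v \<in> B (cl v)" if "v \<in> verts H" for v
  proof -
    have "\<exists>i. i < length L \<and> v \<in> B i" using that cov by blast
    then show ?thesis unfolding cl_def by (rule someI_ex)
  qed
  have N: "nb H x y \<longleftrightarrow> adjl L (cl x) (cl y)" if "x \<in> verts H" "y \<in> verts H" for x y
    using adj[of "cl x" "cl y" x y] cl[OF that(1)] cl[OF that(2)] by (simp add: adjl_def)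
  show ?thesis
  proof (rule free_graphI[OF s], goal_cases)
    case (1 a b c d e f g)
    then show False
      using model_check_free(1)[OF L, unfolded no_P7_def, rule_format, of "cl a" "cl b" "cl c" "cl d" "cl e" "cl f" "cl g"]
      by (simp add: N)
  next
    case (2 a b c d)
    then show False
      using model_check_free(2)[OF L, unfolded no_C4_def, rule_format, of "cl a" "cl b" "cl c" "cl d"] by (simp add: N)
  next
    case (3 a b c d e)
    then show False
      using model_check_free(3)[OF L, unfolded no_C5_def, rule_format, of "cl a" "cl b" "cl c" "cl d" "cl e"] by (simp add: N)
  qed
qed

text \<open>The relation is symmetric, so it suffices to reach one common vertex \<open>z\<close>
  from everywhere.\<close>

lemma robust_hub:
  assumes "\<And>C. (\<And>x y. x \<in> C \<Longrightarrow> y \<in> C \<Longrightarrow> nb H x y) \<Longrightarrow>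
    \<exists>z. \<forall>x\<in>verts H - C. (x, z) \<in> {(u, v). u \<in> verts H - C \<and> v \<in> verts H - C \<and> nb H u v}\<^sup>*"
  shows "clique_robust H"
  unfolding clique_robust_def
proof (intro allI impI ballI)
  fix C x y
  assume C: "\<forall>x\<in>C. \<forall>y\<in>C. nb H x y" and xy: "x \<in> verts H - C" "y \<in> verts H - C"
  let ?R = "{(u, v). u \<in> verts H - C \<and> v \<in> verts H - C \<and> nb H u v}"
  obtain z where z: "\<forall>x\<in>verts H - C. (x, z) \<in> ?R\<^sup>*" using assms[of C] C by blast
  have "sym ?R" by (auto simp: sym_def nb_commute)
  then have "sym (?R\<^sup>*)" by (rule sym_rtrancl)
  then show "(x, y) \<in> ?R\<^sup>*" using z xy by (meson rtrancl_trans symD)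
qed

text \<open>A clique meets an induced cycle in at most two consecutive vertices, so what remains of the cycle is connected.\<close>

lemma robust_ring_7:
  fixes c :: "7 \<Rightarrow> 'a"
  assumes c: "\<And>i j. nb H (c i) (c j) \<longleftrightarrow> j - i = 0 \<or> j - i = 1 \<or> j - i = 6" and cV: "\<And>i. c i \<in> verts H"
    and att: "\<And>v. v \<in> verts H \<Longrightarrow> \<exists>i j. nb H v (c i) \<and> nb H v (c j) \<and> \<not> nb H (c i) (c j)"
  shows "clique_robust H"
proof (rule robust_hub)
  fix C assume C: "\<And>x y. x \<in> C \<Longrightarrow> y \<in> C \<Longrightarrow> nb H x y"
  define R where "R = {(u, v). u \<in> verts H - C \<and> v \<in> verts H - C \<and> nb H u v}"
  \<comment> \<open>If the clique meets the hole, \<open>m\<close> is the index of a common vertex,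
    and otherwise arbitrary. In both cases the hole vertices at distance two or more from
    \<open>c m\<close> survive.\<close>
  obtain m where m: "c m \<in> C \<or> (\<forall>i. c i \<notin> C)" by blast
  have far: "c (m + 2) \<notin> C \<and> c (m + 3) \<notin> C \<and> c (m + 4) \<notin> C \<and> c (m + 5) \<notin> C"
    using m C[of "c m" "c (m + 2)"] C[of "c m" "c (m + 3)"] C[of "c m" "c (m + 4)"] C[of "c m" "c (m + 5)"] by (auto simp: c)
  have st: "(c i, c (i + 1)) \<in> R" "(c (i + 1), c i) \<in> R" if "c i \<notin> C" "c (i + 1) \<notin> C" for i
    using that cV by (auto simp: c R_def)
  have r: "(c i, c (m + 3)) \<in> R\<^sup>*" if "c i \<notin> C" for i
  proof -
    have 2: "(c (m + 2), c (m + 3)) \<in> R\<^sup>*" using st(1)[of "m + 2"] far by (simp add: arith_7 r_into_rtrancl)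
    have 4: "(c (m + 4), c (m + 3)) \<in> R\<^sup>*" using st(2)[of "m + 3"] far by (simp add: arith_7 r_into_rtrancl)
    have 5: "(c (m + 5), c (m + 3)) \<in> R\<^sup>*"
      using st(2)[of "m + 4"] far 4 by (simp add: arith_7 converse_rtrancl_into_rtrancl)
    have 6: "(c (m + 6), c (m + 3)) \<in> R\<^sup>*" if "c (m + 6) \<notin> C"
      using st(2)[of "m + 5"] far 5 that by (simp add: arith_7 converse_rtrancl_into_rtrancl)
    have 1: "(c (m + 1), c (m + 3)) \<in> R\<^sup>*" if "c (m + 1) \<notin> C"
      using st(1)[of "m + 1"] far 2 that by (simp add: arith_7 converse_rtrancl_into_rtrancl)
    have 0: "(c m, c (m + 3)) \<in> R\<^sup>*" if "c m \<notin> C"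
    proof -
      \<comment> \<open>If \<open>c m\<close> survives, the choice of \<open>m\<close> means that
        the clique misses the hole entirely.\<close>
      have "c (m + 1) \<notin> C" using m that by blast
      then show ?thesis using st(1)[of m] 1 that by (simp add: converse_rtrancl_into_rtrancl)
    qed
    have "\<forall>d. c (m + d) \<notin> C \<longrightarrow> (c (m + d), c (m + 3)) \<in> R\<^sup>*"
      unfolding all_7 using 0 1 2 4 5 6 by simp
    from this[rule_format, of "i - m"] show ?thesis using that by simp
  qed
  have "(x, c (m + 3)) \<in> R\<^sup>*" if x: "x \<in> verts H - C" for x
  proof -
    obtain i j where ij: "nb H x (c i)" "nb H x (c j)" "\<not> nb H (c i) (c j)" using att x by blast
    then obtain k where k: "nb H x (c k)" "c k \<notin> C" using C[of "c i" "c j"] by blast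
    then have "(x, c k) \<in> R" using x cV by (simp add: R_def)
    then show ?thesis using r[OF k(2)] by (rule converse_rtrancl_into_rtrancl)
  qed
  then show "\<exists>z. \<forall>x\<in>verts H - C. (x, z) \<in> {(u, v). u \<in> verts H - C \<and> v \<in> verts H - C \<and> nb H u v}\<^sup>*"
    unfolding R_def by blast
qed

lemma robust_ring_6:
  fixes c :: "6 \<Rightarrow> 'a"
  assumes c: "\<And>i j. nb H (c i) (c j) \<longleftrightarrow> j - i = 0 \<or> j - i = 1 \<or> j - i = 5" and cV: "\<And>i. c i \<in> verts H"
    and att: "\<And>v. v \<in> verts H \<Longrightarrow> \<exists>i j. nb H v (c i) \<and> nb H v (c j) \<and> \<not> nb H (c i) (c j)"
  shows "clique_robust H"
proof (rule robust_hub)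
  fix C assume C: "\<And>x y. x \<in> C \<Longrightarrow> y \<in> C \<Longrightarrow> nb H x y"
  define R where "R = {(u, v). u \<in> verts H - C \<and> v \<in> verts H - C \<and> nb H u v}"
  obtain m where m: "c m \<in> C \<or> (\<forall>i. c i \<notin> C)" by blast
  have far: "c (m + 2) \<notin> C \<and> c (m + 3) \<notin> C \<and> c (m + 4) \<notin> C"
    using m C[of "c m" "c (m + 2)"] C[of "c m" "c (m + 3)"] C[of "c m" "c (m + 4)"] by (auto simp: c)
  have st: "(c i, c (i + 1)) \<in> R" "(c (i + 1), c i) \<in> R" if "c i \<notin> C" "c (i + 1) \<notin> C" for i
    using that cV by (auto simp: c R_def)
  have r: "(c i, c (m + 3)) \<in> R\<^sup>*" if "c i \<notin> C" for i
  proof -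
    have 2: "(c (m + 2), c (m + 3)) \<in> R\<^sup>*" using st(1)[of "m + 2"] far by (simp add: arith_6 r_into_rtrancl)
    have 4: "(c (m + 4), c (m + 3)) \<in> R\<^sup>*" using st(2)[of "m + 3"] far by (simp add: arith_6 r_into_rtrancl)
    have 5: "(c (m + 5), c (m + 3)) \<in> R\<^sup>*" if "c (m + 5) \<notin> C"
      using st(2)[of "m + 4"] far 4 that by (simp add: arith_6 converse_rtrancl_into_rtrancl)
    have 1: "(c (m + 1), c (m + 3)) \<in> R\<^sup>*" if "c (m + 1) \<notin> C"
      using st(1)[of "m + 1"] far 2 that by (simp add: arith_6 converse_rtrancl_into_rtrancl)
    have 0: "(c m, c (m + 3)) \<in> R\<^sup>*" if "c m \<notin> C"
    proof -
      have "c (m + 1) \<notin> C" using m that by blast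
      then show ?thesis using st(1)[of m] 1 that by (simp add: converse_rtrancl_into_rtrancl)
    qed
    have "\<forall>d. c (m + d) \<notin> C \<longrightarrow> (c (m + d), c (m + 3)) \<in> R\<^sup>*"
      unfolding all_6 using 0 1 2 4 5 by simp
    from this[rule_format, of "i - m"] show ?thesis using that by simp
  qed
  have "(x, c (m + 3)) \<in> R\<^sup>*" if x: "x \<in> verts H - C" for x
  proof -
    obtain i j where ij: "nb H x (c i)" "nb H x (c j)" "\<not> nb H (c i) (c j)" using att x by blast
    then obtain k where k: "nb H x (c k)" "c k \<notin> C" using C[of "c i" "c j"] by blast
    then have "(x, c k) \<in> R" using x cV by (simp add: R_def)
    then show ?thesis using r[OF k(2)] by (rule converse_rtrancl_into_rtrancl)
  qed
  then show "\<exists>z. \<forall>x\<in>verts H - C. (x, z) \<in> {(u, v). u \<in> verts H - C \<and> v \<in> verts H - C \<and> nb H u v}\<^sup>*"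
    unfolding R_def by blast
qed

section \<open>Lanterns\<close>

locale lantern_parts =
  fixes H :: "'a graph" and A D :: "'a set" and B C :: "nat \<Rightarrow> 'a set" and I :: "nat set"
  assumes simple: "simple_graph H"
    and cov: "verts H = A \<union> D \<union> (\<Union>i\<in>I. B i) \<union> (\<Union>i\<in>I. C i)"
    and ne: "A \<noteq> {}" "D \<noteq> {}" and two: "\<And>j. \<exists>i\<in>I. i \<noteq> j"
    and neB: "\<And>i. i \<in> I \<Longrightarrow> B i \<noteq> {} \<and> C i \<noteq> {}"
    and AA: "\<And>x y. x \<in> A \<Longrightarrow> y \<in> A \<Longrightarrow> nb H x y" and DD: "\<And>x y. x \<in> D \<Longrightarrow> y \<in> D \<Longrightarrow> nb H x y"
    and AD: "\<And>x y. x \<in> A \<Longrightarrow> y \<in> D \<Longrightarrow> \<not> nb H x y"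
    and AB: "\<And>x y i. x \<in> A \<Longrightarrow> i \<in> I \<Longrightarrow> y \<in> B i \<Longrightarrow> nb H x y" and AC: "\<And>x y i. x \<in> A \<Longrightarrow> i \<in> I \<Longrightarrow> y \<in> C i \<Longrightarrow> \<not> nb H x y"
    and DC: "\<And>x y i. x \<in> D \<Longrightarrow> i \<in> I \<Longrightarrow> y \<in> C i \<Longrightarrow> nb H x y" and DB: "\<And>x y i. x \<in> D \<Longrightarrow> i \<in> I \<Longrightarrow> y \<in> B i \<Longrightarrow> \<not> nb H x y"
    and BB: "\<And>x y i j. i \<in> I \<Longrightarrow> j \<in> I \<Longrightarrow> x \<in> B i \<Longrightarrow> y \<in> B j \<Longrightarrow> nb H x y \<longleftrightarrow> i = j"
    and CC: "\<And>x y i j. i \<in> I \<Longrightarrow> j \<in> I \<Longrightarrow> x \<in> C i \<Longrightarrow> y \<in> C j \<Longrightarrow> nb H x y \<longleftrightarrow> i = j"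
    and BC: "\<And>x y i j. i \<in> I \<Longrightarrow> j \<in> I \<Longrightarrow> x \<in> B i \<Longrightarrow> y \<in> C j \<Longrightarrow> nb H x y \<Longrightarrow> i = j"
    and inc: "\<And>x y i. i \<in> I \<Longrightarrow> x \<in> B i \<Longrightarrow> y \<in> C i \<Longrightarrow> \<not> nb H x y \<Longrightarrow> i = 1"
    and nest: "\<And>x y u v i. i \<in> I \<Longrightarrow> x \<in> B i \<Longrightarrow> y \<in> B i \<Longrightarrow> u \<in> C i \<Longrightarrow> v \<in> C i \<Longrightarrow> nb H x u \<Longrightarrow> nb H y v \<Longrightarrow> nb H x v \<or> nb H y u"
    and Bn: "\<And>x i. i \<in> I \<Longrightarrow> x \<in> B i \<Longrightarrow> \<exists>y\<in>C i. nb H x y" and Cn: "\<And>y i. i \<in> I \<Longrightarrow> y \<in> C i \<Longrightarrow> \<exists>x\<in>B i. nb H x y"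
begin

text \<open>Exchanging the hubs together with the two sides is a symmetry of these hypotheses. Facts
  about \<open>A\<close> are proved once and reused for \<open>D\<close>.\<close>

lemma reflect: "lantern_parts H D A C B I"
proof
  show "simple_graph H" by (rule simple)
  show "verts H = D \<union> A \<union> (\<Union>i\<in>I. C i) \<union> (\<Union>i\<in>I. B i)" unfolding cov by (simp add: Un_ac)
  show "i = j" if "i \<in> I" "j \<in> I" "x \<in> C i" "y \<in> B j" "nb H x y" for x y i j
    using BC[OF that(2,1,4,3)] nb_sym[OF that(5)] by simp
  show "i = 1" if "i \<in> I" "x \<in> C i" "y \<in> B i" "\<not> nb H x y" for x y i
    using inc[OF that(1,3,2)] not_nb_sym[OF that(4)] by blast
  show "nb H x v \<or> nb H y u" if "i \<in> I" "x \<in> C i" "y \<in> C i" "u \<in> B i" "v \<in> B i" "nb H x u" "nb H y v" for x y u v i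
    using nest[OF that(1,4,5,2,3) nb_sym[OF that(6)] nb_sym[OF that(7)]] nb_sym[of H u y] nb_sym[of H v x] by blast
  show "\<exists>y\<in>B i. nb H x y" if "i \<in> I" "x \<in> C i" for x i using Cn[OF that] nb_commute[of H x] by blast
  show "\<exists>x\<in>C i. nb H x y" if "i \<in> I" "y \<in> B i" for y i using Bn[OF that] nb_commute[of H y] by blast
  show "\<not> nb H x y" if "x \<in> D" "y \<in> A" for x y using AD[OF that(2,1)] by (rule not_nb_sym)
  show "D \<noteq> {}" "A \<noteq> {}" by (rule ne)+
  show "\<exists>i\<in>I. i \<noteq> j" for j by (rule two)
  show "C i \<noteq> {} \<and> B i \<noteq> {}" if "i \<in> I" for i using neB[OF that] by simp
  show "nb H x y" if "x \<in> D" "y \<in> D" for x y by (rule DD[OF that])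
  show "nb H x y" if "x \<in> A" "y \<in> A" for x y by (rule AA[OF that])
  show "nb H x y" if "x \<in> D" "i \<in> I" "y \<in> C i" for x y i by (rule DC[OF that])
  show "\<not> nb H x y" if "x \<in> D" "i \<in> I" "y \<in> B i" for x y i by (rule DB[OF that])
  show "nb H x y" if "x \<in> A" "i \<in> I" "y \<in> B i" for x y i by (rule AB[OF that])
  show "\<not> nb H x y" if "x \<in> A" "i \<in> I" "y \<in> C i" for x y i by (rule AC[OF that])
  show "nb H x y \<longleftrightarrow> i = j" if "i \<in> I" "j \<in> I" "x \<in> C i" "y \<in> C j" for x y i j by (rule CC[OF that])
  show "nb H x y \<longleftrightarrow> i = j" if "i \<in> I" "j \<in> I" "x \<in> B i" "y \<in> B j" for x y i j by (rule BB[OF that])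
qed

lemma vert_cases:
  assumes "v \<in> verts H"
  shows "v \<in> A \<or> v \<in> D \<or> (\<exists>i\<in>I. v \<in> B i) \<or> (\<exists>i\<in>I. v \<in> C i)"
  using assms unfolding cov by simp

lemma notA:
  assumes "a \<in> A" "v \<in> verts H" "\<not> nb H a v"
  shows "v \<in> D \<or> (\<exists>i\<in>I. v \<in> C i)"
  using vert_cases[OF assms(2)] AA[OF assms(1)] AB[OF assms(1)] assms(3) by blast

lemma nbrA:
  assumes "a \<in> A" "v \<in> verts H" "nb H a v"
  shows "v \<in> A \<or> (\<exists>i\<in>I. v \<in> B i)"
  using vert_cases[OF assms(2)] AD[OF assms(1)] AC[OF assms(1)] assms(3) by blast

text \<open>Nonneighbours of \<open>a\<close> lie in \<open>D\<close> or in some \<open>C i\<close>,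
  and \<open>D\<close> is complete to all of these. A nonneighbour of \<open>a\<close> that misses
  another one can therefore not be in \<open>D\<close>.\<close>

lemma notA_C:
  assumes a: "a \<in> A" and v: "v \<in> verts H" "\<not> nb H a v" and w: "w \<in> verts H" "\<not> nb H a w" "\<not> nb H v w"
  shows "\<exists>i\<in>I. v \<in> C i"
  using notA[OF a v] notA[OF a w(1,2)] w(3) DD DC by blast

text \<open>All three path vertices are pushed into the sets \<open>C i\<close> by
  \<open>notA_C\<close>. These are cliques anticomplete to each other, so they contain no induced
  path on three vertices.\<close>

lemma P3_A:
  assumes a: "a \<in> A" and V: "u \<in> verts H" "v \<in> verts H" "w \<in> verts H" "t \<in> verts H"
    and N: "\<not> nb H a u" "\<not> nb H a v" "\<not> nb H a w" "\<not> nb H a t" and P: "nb H u v" "nb H v w" "\<not> nb H u w" "\<not> nb H v t"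
  shows False
proof -
  have "\<not> nb H w u" using P(3) by (rule not_nb_sym)
  from notA_C[OF a V(1) N(1) V(3) N(3) P(3)] notA_C[OF a V(3) N(3) V(1) N(1) this] notA_C[OF a V(2) N(2) V(4) N(4) P(4)]
  obtain i j k where "i \<in> I" "u \<in> C i" "j \<in> I" "v \<in> C j" "k \<in> I" "w \<in> C k" by metis
  then show False using CC[of i j u v] CC[of j k v w] CC[of i k u w] P by simp
qed

text \<open>A vertex of the path other than the middle one has an induced path on three vertices
  among its nonneighbours there, which \<open>P3_A\<close> excludes. The middle one sees too little
  for this and needs the bound on incomplete legs; the remaining positions follow by
  reversal.\<close>

lemma P7_no_A:
  assumes V: "a \<in> verts H" "b \<in> verts H" "c \<in> verts H" "d \<in> verts H" "e \<in> verts H" "f \<in> verts H" "g \<in> verts H"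
    and P: "nb H a b" "nb H b c" "nb H c d" "nb H d e" "nb H e f" "nb H f g"
    and N: "\<not> nb H a c" "\<not> nb H a d" "\<not> nb H a e" "\<not> nb H a f" "\<not> nb H a g" "\<not> nb H b d" "\<not> nb H b e" "\<not> nb H b f"
      "\<not> nb H b g" "\<not> nb H c e" "\<not> nb H c f" "\<not> nb H c g" "\<not> nb H d f" "\<not> nb H d g" "\<not> nb H e g"
  shows "a \<notin> A \<and> b \<notin> A \<and> c \<notin> A \<and> d \<notin> A"
proof (intro conjI notI)
  assume "a \<in> A" then show False using P3_A[of a c d e f] V P N by blast
next
  assume "b \<in> A" then show False using P3_A[of b d e f g] V P N by blast
next
  assume c: "c \<in> A"
  have n: "\<not> nb H c a" "\<not> nb H f a" by (rule not_nb_sym, fact)+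
  show False using P3_A[OF c V(5,6,7,1)] P N n by blast
next
  \<comment> \<open>With the middle vertex in \<open>A\<close>, the two ends of the path run into
    different legs and each of these legs misses an edge; but only leg 1 may be incomplete.\<close>
  assume d: "d \<in> A"
  have n: "\<not> nb H d a" "\<not> nb H d b" "\<not> nb H f a" "\<not> nb H g a" "\<not> nb H f b" by (rule not_nb_sym, fact)+
  obtain i where i: "i \<in> I" "a \<in> C i" using notA_C[OF d V(1) n(1) V(6) _ N(4)] N by blast
  obtain j where j: "j \<in> I" "b \<in> C j" using notA_C[OF d V(2) n(2) V(6) _ N(8)] N by blast
  obtain k where k: "k \<in> I" "f \<in> C k" using notA_C[OF d V(6) N(13) V(1) n(1,3)] by blast
  obtain l where l: "l \<in> I" "g \<in> C l" using notA_C[OF d V(7) N(14) V(1) n(1,4)] by blast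
  have ij: "i = j" using CC[OF i(1) j(1) i(2) j(2)] P by blast
  have kl: "k = l" using CC[OF k(1) l(1) k(2) l(2)] P by blast
  have ik: "i \<noteq> k" using CC[OF i(1) k(1) i(2) k(2)] N by blast
  have ce: "nb H d c" "nb H d e" using P nb_sym[OF P(3)] by blast+
  have "c \<notin> A" using AC[OF _ j, of c] nb_sym[OF P(2)] by blast
  then obtain m where m: "m \<in> I" "c \<in> B m" using nbrA[OF d V(3) ce(1)] by blast
  have "e \<notin> A" using AC[OF _ k, of e] P(5) by blast
  then obtain q where q: "q \<in> I" "e \<in> B q" using nbrA[OF d V(5) ce(2)] by blast
  have "m = j" using BC[OF m(1) j(1) m(2) j(2) nb_sym[OF P(2)]] .
  moreover have "q = k" using BC[OF q(1) k(1) q(2) k(2) P(5)] .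
  moreover have "\<not> nb H c a" by (rule not_nb_sym, fact)
  ultimately have "m = 1" "q = 1" using inc[of m c a] inc[of q e g] i j k l m q ij kl N by blast+
  then show False using ik ij \<open>m = j\<close> \<open>q = k\<close> by simp
qed

lemma C4_no_A:
  assumes V: "a \<in> verts H" "b \<in> verts H" "c \<in> verts H" "d \<in> verts H"
    and P: "nb H a b" "nb H b c" "nb H c d" "nb H d a" and N: "\<not> nb H a c" "\<not> nb H b d"
  shows "a \<notin> A"
proof
  assume a: "a \<in> A"
  have ad: "nb H a d" using P(4) by (rule nb_sym)
  have N': "\<not> nb H d b" using N(2) by (rule not_nb_sym)
  obtain i j where ij: "i \<in> I" "b \<in> B i" "j \<in> I" "d \<in> B j"
    using nbrA[OF a V(2) P(1)] nbrA[OF a V(4) ad] N(2) N' AA AB by blast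
  have "c \<in> D \<or> (\<exists>k\<in>I. c \<in> C k)" using notA[OF a V(3) N(1)] .
  moreover have "c \<notin> D" using DB[OF _ ij(1,2), of c] nb_sym[OF P(2)] by blast
  ultimately obtain k where k: "k \<in> I" "c \<in> C k" by blast
  have "i = k" "j = k" using BC[OF ij(1) k(1) ij(2) k(2) P(2)] BC[OF ij(3) k(1) ij(4) k(2) nb_sym[OF P(3)]] .
  then show False using BB[OF ij(1,3,2,4)] N(2) by blast
qed

lemma C5_no_A:
  assumes V: "a \<in> verts H" "b \<in> verts H" "c \<in> verts H" "d \<in> verts H" "e \<in> verts H"
    and P: "nb H a b" "nb H b c" "nb H c d" "nb H d e" "nb H e a"
    and N: "\<not> nb H a c" "\<not> nb H a d" "\<not> nb H b d" "\<not> nb H b e" "\<not> nb H c e"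
  shows "a \<notin> A"
proof
  assume a: "a \<in> A"
  have ae: "nb H a e" using P(5) by (rule nb_sym)
  have N': "\<not> nb H e b" using N(4) by (rule not_nb_sym)
  obtain i j where ij: "i \<in> I" "b \<in> B i" "j \<in> I" "e \<in> B j"
    using nbrA[OF a V(2) P(1)] nbrA[OF a V(5) ae] N(4) N' AA AB by blast
  have "c \<notin> D" "d \<notin> D" using DB[OF _ ij(1,2), of c] nb_sym[OF P(2)] DB[OF _ ij(3,4), of d] P(4) by blast+
  then obtain k l where kl: "k \<in> I" "c \<in> C k" "l \<in> I" "d \<in> C l"
    using notA[OF a V(3) N(1)] notA[OF a V(4) N(2)] by blast
  have "i = k" "j = l" "k = l" using BC[OF ij(1) kl(1) ij(2) kl(2) P(2)] BC[OF ij(3) kl(3) ij(4) kl(4) nb_sym[OF P(4)]]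
    CC[OF kl(1,3,2,4)] P(3) by blast+
  then show False using BB[OF ij(1,3,2,4)] N(4) by blast
qed

lemma P7_no_A_all:
  assumes V: "a \<in> verts H" "b \<in> verts H" "c \<in> verts H" "d \<in> verts H" "e \<in> verts H" "f \<in> verts H" "g \<in> verts H"
    and P: "nb H a b" "nb H b c" "nb H c d" "nb H d e" "nb H e f" "nb H f g"
    and N: "\<not> nb H a c" "\<not> nb H a d" "\<not> nb H a e" "\<not> nb H a f" "\<not> nb H a g" "\<not> nb H b d" "\<not> nb H b e" "\<not> nb H b f"
      "\<not> nb H b g" "\<not> nb H c e" "\<not> nb H c f" "\<not> nb H c g" "\<not> nb H d f" "\<not> nb H d g" "\<not> nb H e g"
  shows "a \<notin> A \<and> b \<notin> A \<and> c \<notin> A \<and> d \<notin> A \<and> e \<notin> A"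
proof -
  have 1: "nb H g f" "nb H f e" "nb H e d" "nb H d c" "nb H c b" "nb H b a" by (rule nb_sym, fact)+
  have 2: "\<not> nb H g e" "\<not> nb H g d" "\<not> nb H g c" "\<not> nb H g b" "\<not> nb H g a" "\<not> nb H f d" "\<not> nb H f c" "\<not> nb H f b"
      "\<not> nb H f a" "\<not> nb H e c" "\<not> nb H e b" "\<not> nb H e a" "\<not> nb H d b" "\<not> nb H d a" "\<not> nb H c a"
    by (rule not_nb_sym, fact)+
  show ?thesis using P7_no_A[OF V P N] P7_no_A[OF V(7,6,5,4,3,2,1) 1 2] by blast
qed

lemma rest:
  assumes "v \<in> verts H" "v \<notin> A" "v \<notin> D"
  shows "\<exists>i. i \<in> I \<and> (v \<in> B i \<or> v \<in> C i)"
  using vert_cases[OF assms(1)] assms(2,3) by blast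

lemma same_comp:
  assumes "i \<in> I" "j \<in> I" "v \<in> B i \<or> v \<in> C i" "w \<in> B j \<or> w \<in> C j" "nb H v w"
  shows "i = j"
  using assms BB[OF assms(1,2), of v w] CC[OF assms(1,2), of v w] BC[OF assms(1,2), of v w] BC[OF assms(2,1), of w v] nb_sym[OF assms(5)]
  by blast

text \<open>Once the relevant vertices avoid both hubs, they all lie in one leg, which is the union
  of two cliques. That leaves no room for three pairwise nonadjacent vertices or for an induced
  \<open>C5\<close>, and nestedness excludes \<open>C4\<close>.\<close>

lemma free: "free_graph H"
proof (rule free_graphI[OF simple])
  interpret r: lantern_parts H D A C B I by (rule reflect)
  fix a b c d e
  show False if V: "a \<in> verts H" "b \<in> verts H" "c \<in> verts H" "d \<in> verts H" "e \<in> verts H" "f \<in> verts H" "g \<in> verts H"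
    and P: "nb H a b" "nb H b c" "nb H c d" "nb H d e" "nb H e f" "nb H f g"
    and N: "\<not> nb H a c" "\<not> nb H a d" "\<not> nb H a e" "\<not> nb H a f" "\<not> nb H a g" "\<not> nb H b d" "\<not> nb H b e" "\<not> nb H b f"
      "\<not> nb H b g" "\<not> nb H c e" "\<not> nb H c f" "\<not> nb H c g" "\<not> nb H d f" "\<not> nb H d g" "\<not> nb H e g" for f g
  proof -
    have "a \<notin> A" "a \<notin> D" using P7_no_A_all[OF V P N] r.P7_no_A_all[OF V P N] by simp_all
    from rest[OF V(1) this] obtain i where i: "i \<in> I" "a \<in> B i \<or> a \<in> C i" by blast
    have "b \<notin> A" "b \<notin> D" using P7_no_A_all[OF V P N] r.P7_no_A_all[OF V P N] by simp_all
    from rest[OF V(2) this] obtain j where j: "j \<in> I" "b \<in> B j \<or> b \<in> C j" by blast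
    have "c \<notin> A" "c \<notin> D" using P7_no_A_all[OF V P N] r.P7_no_A_all[OF V P N] by simp_all
    from rest[OF V(3) this] obtain k where k: "k \<in> I" "c \<in> B k \<or> c \<in> C k" by blast
    have "d \<notin> A" "d \<notin> D" using P7_no_A_all[OF V P N] r.P7_no_A_all[OF V P N] by simp_all
    from rest[OF V(4) this] obtain l where l: "l \<in> I" "d \<in> B l \<or> d \<in> C l" by blast
    have "e \<notin> A" "e \<notin> D" using P7_no_A_all[OF V P N] r.P7_no_A_all[OF V P N] by simp_all
    from rest[OF V(5) this] obtain m where m: "m \<in> I" "e \<in> B m \<or> e \<in> C m" by blast
    note ijk = i j k l m
    have "i = j" "j = k" "k = l" "l = m"
      using same_comp[OF ijk(1,3,2,4) P(1)] same_comp[OF ijk(3,5,4,6) P(2)] same_comp[OF ijk(5,7,6,8) P(3)] same_comp[OF ijk(7,9,8,10) P(4)] .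
    then have m: "a \<in> B i \<or> a \<in> C i" "c \<in> B i \<or> c \<in> C i" "e \<in> B i \<or> e \<in> C i" using ijk by auto
    \<comment> \<open>The vertices \<open>a\<close>, \<open>c\<close>, \<open>e\<close> are pairwise
      nonadjacent but lie in two cliques.\<close>
    show False using m BB[OF i(1) i(1), of a c] CC[OF i(1) i(1), of a c] BB[OF i(1) i(1), of a e] CC[OF i(1) i(1), of a e] BB[OF i(1) i(1), of c e] CC[OF i(1) i(1), of c e]
      N(1,3,10) by argo
  qed
  show False if V: "a \<in> verts H" "b \<in> verts H" "c \<in> verts H" "d \<in> verts H"
    and P: "nb H a b" "nb H b c" "nb H c d" "nb H d a" and N: "\<not> nb H a c" "\<not> nb H b d"
  proof -
    have N': "\<not> nb H c a" "\<not> nb H d b" by (rule not_nb_sym, fact)+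
    note all = C4_no_A[OF V P N] C4_no_A[OF V(2,3,4,1) P(2,3,4,1) N(2) N'(1)] C4_no_A[OF V(3,4,1,2) P(3,4,1,2) N'] C4_no_A[OF V(4,1,2,3) P(4,1,2,3) N'(2) N(1)]
      r.C4_no_A[OF V P N] r.C4_no_A[OF V(2,3,4,1) P(2,3,4,1) N(2) N'(1)] r.C4_no_A[OF V(3,4,1,2) P(3,4,1,2) N'] r.C4_no_A[OF V(4,1,2,3) P(4,1,2,3) N'(2) N(1)]
    have "a \<notin> A" "a \<notin> D" using all by simp_all
    from rest[OF V(1) this] obtain i where i: "i \<in> I" "a \<in> B i \<or> a \<in> C i" by blast
    have "b \<notin> A" "b \<notin> D" using all by simp_all
    from rest[OF V(2) this] obtain j where j: "j \<in> I" "b \<in> B j \<or> b \<in> C j" by blast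
    have "c \<notin> A" "c \<notin> D" using all by simp_all
    from rest[OF V(3) this] obtain k where k: "k \<in> I" "c \<in> B k \<or> c \<in> C k" by blast
    have "d \<notin> A" "d \<notin> D" using all by simp_all
    from rest[OF V(4) this] obtain l where l: "l \<in> I" "d \<in> B l \<or> d \<in> C l" by blast
    note ijk = i j k l
    have eq: "i = j" "j = k" "k = l"
      using same_comp[OF ijk(1,3,2,4) P(1)] same_comp[OF ijk(3,5,4,6) P(2)] same_comp[OF ijk(5,7,6,8) P(3)] .
    have m: "a \<in> B i \<or> a \<in> C i" "b \<in> B i \<or> b \<in> C i" "c \<in> B i \<or> c \<in> C i" "d \<in> B i \<or> d \<in> C i" using ijk eq by auto
    have "(a \<in> B i \<and> c \<in> C i) \<or> (a \<in> C i \<and> c \<in> B i)" "(b \<in> B i \<and> d \<in> C i) \<or> (b \<in> C i \<and> d \<in> B i)"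
      using m BB[OF i(1) i(1), of a c] CC[OF i(1) i(1), of a c] BB[OF i(1) i(1), of b d] CC[OF i(1) i(1), of b d] N by blast+
    then consider "a \<in> B i" "c \<in> C i" "b \<in> B i" "d \<in> C i" | "a \<in> B i" "c \<in> C i" "b \<in> C i" "d \<in> B i"
      | "a \<in> C i" "c \<in> B i" "b \<in> B i" "d \<in> C i" | "a \<in> C i" "c \<in> B i" "b \<in> C i" "d \<in> B i" by blast
    then show False
    proof cases
      case 1 then show False using nest[OF i(1), of a b d c] nb_sym[OF P(4)] P N by blast
    next
      case 2 then show False using nest[OF i(1), of a d b c] P(1) nb_sym[OF P(3)] N N' by blast
    next
      case 3 then show False using nest[OF i(1), of b c a d] nb_sym[OF P(1)] P(3) N N' by blast
    next
      case 4 then show False using nest[OF i(1), of c d b a] nb_sym[OF P(2)] P(4) N' by blast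
    qed
  qed
  show False if V: "a \<in> verts H" "b \<in> verts H" "c \<in> verts H" "d \<in> verts H" "e \<in> verts H"
    and P: "nb H a b" "nb H b c" "nb H c d" "nb H d e" "nb H e a"
    and N: "\<not> nb H a c" "\<not> nb H a d" "\<not> nb H b d" "\<not> nb H b e" "\<not> nb H c e"
  proof -
    have N': "\<not> nb H c a" "\<not> nb H d a" "\<not> nb H d b" "\<not> nb H e b" "\<not> nb H e c" by (rule not_nb_sym, fact)+
    note all = C5_no_A[OF V P N] C5_no_A[OF V(2,3,4,5,1) P(2,3,4,5,1) N(3,4,5) N'(1,2)]
      C5_no_A[OF V(3,4,5,1,2) P(3,4,5,1,2) N(5) N'(1,2,3,4)] C5_no_A[OF V(4,5,1,2,3) P(4,5,1,2,3) N'(2,3,4,5) N(1)]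
      C5_no_A[OF V(5,1,2,3,4) P(5,1,2,3,4) N'(4,5) N(1,2,3)]
    note all' = r.C5_no_A[OF V P N] r.C5_no_A[OF V(2,3,4,5,1) P(2,3,4,5,1) N(3,4,5) N'(1,2)]
      r.C5_no_A[OF V(3,4,5,1,2) P(3,4,5,1,2) N(5) N'(1,2,3,4)] r.C5_no_A[OF V(4,5,1,2,3) P(4,5,1,2,3) N'(2,3,4,5) N(1)]
      r.C5_no_A[OF V(5,1,2,3,4) P(5,1,2,3,4) N'(4,5) N(1,2,3)]
    have "a \<notin> A" "a \<notin> D" using all all' by simp_all
    from rest[OF V(1) this] obtain i where i: "i \<in> I" "a \<in> B i \<or> a \<in> C i" by blast
    have "b \<notin> A" "b \<notin> D" using all all' by simp_all
    from rest[OF V(2) this] obtain j where j: "j \<in> I" "b \<in> B j \<or> b \<in> C j" by blast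
    have "c \<notin> A" "c \<notin> D" using all all' by simp_all
    from rest[OF V(3) this] obtain k where k: "k \<in> I" "c \<in> B k \<or> c \<in> C k" by blast
    have "d \<notin> A" "d \<notin> D" using all all' by simp_all
    from rest[OF V(4) this] obtain l where l: "l \<in> I" "d \<in> B l \<or> d \<in> C l" by blast
    have "e \<notin> A" "e \<notin> D" using all all' by simp_all
    from rest[OF V(5) this] obtain m where m: "m \<in> I" "e \<in> B m \<or> e \<in> C m" by blast
    note ijk = i j k l m
    have eq: "i = j" "j = k" "k = l" "l = m"
      using same_comp[OF ijk(1,3,2,4) P(1)] same_comp[OF ijk(3,5,4,6) P(2)] same_comp[OF ijk(5,7,6,8) P(3)] same_comp[OF ijk(7,9,8,10) P(4)] .
    have m: "a \<in> B i \<or> a \<in> C i" "b \<in> B i \<or> b \<in> C i" "c \<in> B i \<or> c \<in> C i" "d \<in> B i \<or> d \<in> C i" "e \<in> B i \<or> e \<in> C i" using ijk eq by auto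
    have n: "\<not> (u \<in> B i \<and> w \<in> B i)" "\<not> (u \<in> C i \<and> w \<in> C i)" if "\<not> nb H u w" for u w
      using BB[OF i(1) i(1), of u w] CC[OF i(1) i(1), of u w] that by blast+
    show False using m n[OF N(1)] n[OF N(2)] n[OF N(3)] n[OF N(4)] n[OF N(5)] by argo
  qed
qed

text \<open>A clique that meets \<open>A\<close> misses \<open>D\<close> and every
  \<open>C i\<close>, so all survivors reach a fixed vertex of \<open>D\<close>, those in
  \<open>B i\<close> through a neighbour in \<open>C i\<close>.\<close>

lemma robust_case:
  assumes K: "\<And>x y. x \<in> K \<Longrightarrow> y \<in> K \<Longrightarrow> nb H x y" and "K \<inter> A \<noteq> {}"
  shows "\<exists>z. \<forall>x\<in>verts H - K. (x, z) \<in> {(u, v). u \<in> verts H - K \<and> v \<in> verts H - K \<and> nb H u v}\<^sup>*"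
proof -
  define R where "R = {(u, v). u \<in> verts H - K \<and> v \<in> verts H - K \<and> nb H u v}"
  obtain a where a: "a \<in> A" "a \<in> K" using assms(2) by blast
  obtain d where d: "d \<in> D" using ne by blast
  have DK: "x \<notin> K" if "x \<in> D" for x using K[OF a(2)] AD[OF a(1) that] by blast
  have CK: "x \<notin> K" if "i \<in> I" "x \<in> C i" for x i using K[OF a(2)] AC[OF a(1) that] by blast
  have DV: "D \<subseteq> verts H" and AV: "A \<subseteq> verts H" and CV: "\<And>i. i \<in> I \<Longrightarrow> C i \<subseteq> verts H" and BV: "\<And>i. i \<in> I \<Longrightarrow> B i \<subseteq> verts H"
    using cov by blast+
  have rD: "(x, d) \<in> R\<^sup>*" if "x \<in> D" for x
    using that DK[OF that] DK[OF d] d DV DD[OF that d] unfolding R_def by (intro r_into_rtrancl) blast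
  have rC: "(x, d) \<in> R\<^sup>*" if "i \<in> I" "x \<in> C i" for x i
    using that CK[OF that] DK[OF d] d DV CV DC[OF d that, THEN nb_sym] unfolding R_def by (intro r_into_rtrancl) blast
  have rB: "(x, d) \<in> R\<^sup>*" if x: "i \<in> I" "x \<in> B i" "x \<notin> K" for x i
  proof -
    obtain y where y: "y \<in> C i" "nb H x y" using Bn[OF x(1,2)] by blast
    then have "(x, y) \<in> R" using x CK[OF x(1) y(1)] BV CV unfolding R_def by blast
    then show ?thesis using rC[OF x(1) y(1)] by (rule converse_rtrancl_into_rtrancl)
  qed
  have rA: "(x, d) \<in> R\<^sup>*" if x: "x \<in> A" "x \<notin> K" for x
  proof -
    \<comment> \<open>A clique meets \<open>B i\<close> for at most one \<open>i\<close>, so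
      survivors in \<open>A\<close> can descend along another leg.\<close>
    obtain i where i: "i \<in> I" "B i \<inter> K = {}"
    proof (cases "\<exists>j\<in>I. B j \<inter> K \<noteq> {}")
      case True
      then obtain j y where j: "j \<in> I" "y \<in> B j" "y \<in> K" by blast
      obtain i where i: "i \<in> I" "i \<noteq> j" using two by blast
      have "B i \<inter> K = {}" using BB[OF i(1) j(1) _ j(2)] K[OF _ j(3)] i(2) by blast
      then show thesis using that i by blast
    next
      case False
      then show thesis using that two by blast
    qed
    obtain y where y: "y \<in> B i" using neB[OF i(1)] by blast
    then have "(x, y) \<in> R" using x i AB[OF x(1) i(1) y] AV BV unfolding R_def by blast
    moreover have "(y, d) \<in> R\<^sup>*" using rB[OF i(1) y] i y by blast
    ultimately show ?thesis by (rule converse_rtrancl_into_rtrancl)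
  qed
  have "(x, d) \<in> R\<^sup>*" if "x \<in> verts H - K" for x using that rA rB rC rD cov by blast
  then show ?thesis unfolding R_def by blast
qed

text \<open>A clique that avoids both hubs meets at most one leg; an untouched leg then connects the
  side of \<open>A\<close> with the side of \<open>D\<close>.\<close>

lemma robust: "clique_robust H"
proof (rule robust_hub)
  interpret r: lantern_parts H D A C B I by (rule reflect)
  fix K assume K: "\<And>x y. x \<in> K \<Longrightarrow> y \<in> K \<Longrightarrow> nb H x y"
  consider "K \<inter> A \<noteq> {}" | "K \<inter> D \<noteq> {}" | "K \<inter> A = {}" "K \<inter> D = {}" by blast
  then show "\<exists>z. \<forall>x\<in>verts H - K. (x, z) \<in> {(u, v). u \<in> verts H - K \<and> v \<in> verts H - K \<and> nb H u v}\<^sup>*"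
  proof cases
    case 1 then show ?thesis using robust_case[OF K] by blast
  next
    case 2 then show ?thesis using r.robust_case[OF K] by blast
  next
    case 3
    define R where "R = {(u, v). u \<in> verts H - K \<and> v \<in> verts H - K \<and> nb H u v}"
    have DV: "D \<subseteq> verts H" and AV: "A \<subseteq> verts H" and CV: "\<And>i. i \<in> I \<Longrightarrow> C i \<subseteq> verts H" and BV: "\<And>i. i \<in> I \<Longrightarrow> B i \<subseteq> verts H"
      using cov by blast+
    obtain i where i: "i \<in> I" "B i \<inter> K = {}" "C i \<inter> K = {}"
    proof (cases "\<exists>j\<in>I. (B j \<union> C j) \<inter> K \<noteq> {}")
      case True
      then obtain j y where j: "j \<in> I" "y \<in> B j \<or> y \<in> C j" "y \<in> K" by blast
      obtain i where i: "i \<in> I" "i \<noteq> j" using two by blast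
      have "x \<notin> K" if "x \<in> B i \<or> x \<in> C i" for x using same_comp[OF i(1) j(1) that j(2)] K[OF _ j(3)] i(2) by blast
      then show thesis using that[of i] i(1) by blast
    next
      case False
      then show thesis using that two by blast
    qed
    obtain c b where cb: "c \<in> C i" "b \<in> B i" "nb H b c" using neB[OF i(1)] Cn[OF i(1)] by blast
    obtain a where a: "a \<in> A" using ne by blast
    obtain d where d: "d \<in> D" using ne by blast
    have rA: "(x, a) \<in> R\<^sup>*" if "x \<in> A" for x
      using that 3 a AV AA[OF that a] unfolding R_def by (intro r_into_rtrancl) blast
    have rB: "(x, a) \<in> R\<^sup>*" if "j \<in> I" "x \<in> B j" "x \<notin> K" for x j
      using that 3 a AV BV AB[OF a that(1,2), THEN nb_sym] unfolding R_def by (intro r_into_rtrancl) blast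
    have "(c, b) \<in> R" using cb i BV CV nb_sym[OF cb(3)] unfolding R_def by blast
    then have rc: "(c, a) \<in> R\<^sup>*" using rB[OF i(1) cb(2)] i cb by (blast intro: converse_rtrancl_into_rtrancl)
    have rD: "(x, a) \<in> R\<^sup>*" if "x \<in> D" for x
    proof -
      have "(x, c) \<in> R" using that 3 cb i DV CV DC[OF that i(1) cb(1)] unfolding R_def by blast
      then show ?thesis using rc by (rule converse_rtrancl_into_rtrancl)
    qed
    have rC: "(x, a) \<in> R\<^sup>*" if "j \<in> I" "x \<in> C j" "x \<notin> K" for x j
    proof -
      have "(x, d) \<in> R" using that 3 d DV CV DC[OF d that(1,2), THEN nb_sym] unfolding R_def by blast
      then show ?thesis using rD[OF d] by (rule converse_rtrancl_into_rtrancl)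
    qed
    have "(x, a) \<in> R\<^sup>*" if "x \<in> verts H - K" for x using that rA rB rC rD cov by blast
    then show ?thesis unfolding R_def by blast
  qed
qed

end

lemma nested_total: "nested f xs \<Longrightarrow> x \<in> set xs \<Longrightarrow> y \<in> set xs \<Longrightarrow> f x \<subseteq> f y \<or> f y \<subseteq> f x"
  unfolding nested_def by (induction xs) auto

lemma sorted_wrt_disjnt_map:
  assumes "sorted_wrt disjnt (map B [m..<n])" "i \<in> {m..<n}" "j \<in> {m..<n}" "i \<noteq> j"
  shows "B i \<inter> B j = {}"
proof -
  have *: "B i \<inter> B j = {}" if "i < j" "m \<le> i" "j < n" for i j
    using sorted_wrt_nth_less[OF assms(1), of "i - m" "j - m"] that by (simp add: disjnt_def less_diff_conv)
  show ?thesis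
  proof (cases "i < j")
    case True then show ?thesis using * assms by simp
  next
    case False then show ?thesis using *[of j i] assms by (auto simp: Int_commute)
  qed
qed

text \<open>Orderings are translated into comparability of neighbourhoods, and the first element of
  each ordering, which sees all of the opposite side of leg 1, supplies the neighbours required by
  \<open>Bn\<close> and \<open>Cn\<close>.\<close>

lemma lantern_partsI:
  assumes s: "simple_graph H" and "lantern H"
  obtains A D B C I where "lantern_parts H A D B C I"
proof -
  obtain r where "r_lantern r H" using assms(2) unfolding lantern_def by blast
  then obtain A B C D where r: "r \<ge> 3" and
    part: "partition_into (verts H) (A # map B [1..<r + 1] @ map C [1..<r + 1] @ [D])" and
    A: "A \<noteq> {}" "clique H A" and D: "D \<noteq> {}" "clique H D" and
    BC: "\<forall>i \<in> {1..r}. B i \<noteq> {} \<and> clique H (B i) \<and> C i \<noteq> {} \<and> clique H (C i)" and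
    AD: "anticomplete_to H A D" and
    AB: "complete_to H A (\<Union>i \<in> {1..r}. B i)" and AC: "anticomplete_to H A (\<Union>i \<in> {1..r}. C i)" and
    DC: "complete_to H D (\<Union>i \<in> {1..r}. C i)" and DB: "anticomplete_to H D (\<Union>i \<in> {1..r}. B i)" and
    bs: "\<exists>bs. ordering_of (B 1) bs \<and> nested (\<lambda>b. closed_nbhd H b \<inter> C 1) bs \<and> closed_nbhd H (hd bs) \<inter> C 1 = C 1" and
    cs: "\<exists>cs. ordering_of (C 1) cs \<and> nested (\<lambda>c. closed_nbhd H c \<inter> B 1) cs \<and> closed_nbhd H (hd cs) \<inter> B 1 = B 1" and
    comp: "\<forall>i \<in> {2..r}. complete_to H (B i) (C i)" and
    anti: "\<forall>i \<in> {1..r}. \<forall>j \<in> {1..r}. i \<noteq> j \<longrightarrow> anticomplete_to H (B i \<union> C i) (B j \<union> C j)"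
    unfolding r_lantern_def by metis
  have dj: "sorted_wrt disjnt (A # map B [1..<r + 1] @ map C [1..<r + 1] @ [D])"
    and un: "\<Union> (set (A # map B [1..<r + 1] @ map C [1..<r + 1] @ [D])) = verts H"
    using part unfolding partition_into_def by blast+
  have iv: "{1..<r + 1} = {1..r}" by auto
  have djA: "A \<inter> D = {}" "\<And>i. i \<in> {1..r} \<Longrightarrow> A \<inter> B i = {} \<and> A \<inter> C i = {}"
    and djD: "\<And>i. i \<in> {1..r} \<Longrightarrow> D \<inter> B i = {} \<and> D \<inter> C i = {}"
    and djBC: "\<And>i j. i \<in> {1..r} \<Longrightarrow> j \<in> {1..r} \<Longrightarrow> B i \<inter> C j = {}"
    using dj by (auto simp: sorted_wrt_append disjnt_def iv simp del: upt_Suc; blast)+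
  have "sorted_wrt disjnt (map B [1..<r + 1])" "sorted_wrt disjnt (map C [1..<r + 1])"
    using dj by (simp_all add: sorted_wrt_append del: upt_Suc)
  note djB = sorted_wrt_disjnt_map[OF this(1), unfolded iv] and djC = sorted_wrt_disjnt_map[OF this(2), unfolded iv]
  have nest: "nb H x v \<or> nb H y u" if "x \<in> B i" "y \<in> B i" "u \<in> C i" "v \<in> C i" "nb H x u" "nb H y v" "i = 1" for x y u v i
  proof -
    obtain bs where "set bs = B 1" "nested (\<lambda>b. closed_nbhd H b \<inter> C 1) bs"
      using bs unfolding ordering_of_def by blast
    then show ?thesis using nested_total[of "\<lambda>b. closed_nbhd H b \<inter> C 1" bs x y] that unfolding closed_nbhd_nb by blast
  qed
  have full: "nb H x y" if "i \<in> {1..r}" "i \<noteq> 1" "x \<in> B i" "y \<in> C i" for x y i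
  proof -
    have "i \<in> {2..r}" using that(1,2) by auto
    then show ?thesis using comp that(3,4) unfolding complete_to_def nb_def by blast
  qed
  have "lantern_parts H A D B C {1..r}"
  proof
    show "simple_graph H" by fact
    show "verts H = A \<union> D \<union> \<Union> (B ` {1..r}) \<union> \<Union> (C ` {1..r})"
      unfolding un[symmetric] by (simp add: atLeastLessThanSuc_atLeastAtMost Un_ac del: upt_Suc)
    show "A \<noteq> {}" "D \<noteq> {}" by fact+
    show "\<exists>i\<in>{1..r}. i \<noteq> j" for j
    proof (cases "j = 1")
      case True then show ?thesis using r by (intro bexI[of _ 2]) auto
    next
      case False then show ?thesis using r by (intro bexI[of _ 1]) auto
    qed
    show "B i \<noteq> {} \<and> C i \<noteq> {}" if "i \<in> {1..r}" for i using BC that by blast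
    show "nb H x y" if "x \<in> A" "y \<in> A" for x y using A that unfolding clique_nb by blast
    show "nb H x y" if "x \<in> D" "y \<in> D" for x y using D that unfolding clique_nb by blast
    show "\<not> nb H x y" if "x \<in> A" "y \<in> D" for x y
      by (rule anticomplete_to_nbD[OF AD that]) (use djA(1) that in blast)
    show "nb H x y" if "x \<in> A" "i \<in> {1..r}" "y \<in> B i" for x y i
      using AB that unfolding complete_to_def nb_def by blast
    show "nb H x y" if "x \<in> D" "i \<in> {1..r}" "y \<in> C i" for x y i
      using DC that unfolding complete_to_def nb_def by blast
    show "\<not> nb H x y" if "x \<in> A" "i \<in> {1..r}" "y \<in> C i" for x y i
      by (rule anticomplete_to_nbD[OF AC that(1)]) (use djA(2)[OF that(2)] that in blast)+
    show "\<not> nb H x y" if "x \<in> D" "i \<in> {1..r}" "y \<in> B i" for x y i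
      by (rule anticomplete_to_nbD[OF DB that(1)]) (use djD[OF that(2)] that in blast)+
    have an: "\<not> nb H x y" if "i \<in> {1..r}" "j \<in> {1..r}" "i \<noteq> j" "x \<in> B i \<union> C i" "y \<in> B j \<union> C j" for x y i j
    proof (rule anticomplete_to_nbD)
      show "anticomplete_to H (B i \<union> C i) (B j \<union> C j)" using anti that(1-3) by blast
      show "x \<noteq> y" using djB[OF that(1-3)] djC[OF that(1-3)] djBC[OF that(1,2)] djBC[OF that(2,1)] that(4,5) by blast
    qed fact+
    show "nb H x y \<longleftrightarrow> i = j" if "i \<in> {1..r}" "j \<in> {1..r}" "x \<in> B i" "y \<in> B j" for x y i j
      using an[of i j x y] BC that unfolding clique_nb by blast
    show "nb H x y \<longleftrightarrow> i = j" if "i \<in> {1..r}" "j \<in> {1..r}" "x \<in> C i" "y \<in> C j" for x y i j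
      using an[of i j x y] BC that unfolding clique_nb by blast
    show "i = j" if "i \<in> {1..r}" "j \<in> {1..r}" "x \<in> B i" "y \<in> C j" "nb H x y" for x y i j
      using an[of i j x y] that by blast
    show "i = 1" if "i \<in> {1..r}" "x \<in> B i" "y \<in> C i" "\<not> nb H x y" for x y i
      using full[of i x y] that by blast
    show "nb H x v \<or> nb H y u" if "i \<in> {1..r}" "x \<in> B i" "y \<in> B i" "u \<in> C i" "v \<in> C i" "nb H x u" "nb H y v" for x y u v i
      using nest[OF that(2-7)] full[OF that(1) _ that(2,5)] by blast
    show "\<exists>y\<in>C i. nb H x y" if "i \<in> {1..r}" "x \<in> B i" for x i
    proof (cases "i = 1")
      case True
      obtain cs where cs: "ordering_of (C 1) cs" "closed_nbhd H (hd cs) \<inter> B 1 = B 1" using cs by blast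
      have "C 1 \<noteq> {}" using BC that(1) True by simp
      then have "hd cs \<in> C 1" using cs(1) unfolding ordering_of_def by (cases cs) auto
      moreover have "nb H x (hd cs)" using cs(2) that(2) True nb_commute[of H x "hd cs"] unfolding closed_nbhd_nb by blast
      ultimately show ?thesis using True by blast
    next
      case False then show ?thesis using full[OF that(1) False that(2)] BC that(1) by blast
    qed
    show "\<exists>x\<in>B i. nb H x y" if "i \<in> {1..r}" "y \<in> C i" for y i
    proof (cases "i = 1")
      case True
      obtain bs where bs: "ordering_of (B 1) bs" "closed_nbhd H (hd bs) \<inter> C 1 = C 1" using bs by blast
      have "B 1 \<noteq> {}" using BC that(1) True by simp
      then have "hd bs \<in> B 1" using bs(1) unfolding ordering_of_def by (cases bs) auto
      moreover have "nb H (hd bs) y" using bs(2) that(2) True unfolding closed_nbhd_nb by blast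
      ultimately show ?thesis using True by blast
    next
      case False then show ?thesis using full[OF that(1) False _ that(2)] BC that(1) by blast
    qed
  qed
  then show thesis by (rule that)
qed

lemma lantern_class:
  assumes "simple_graph H" "lantern H"
  shows "free_graph H \<and> clique_robust H"
  using lantern_partsI[OF assms] lantern_parts.free lantern_parts.robust by metis

section \<open>Crowns and thickened emeralds as blow-ups\<close>

lemma crown6_class:
  assumes s: "simple_graph H" and "crown6 H"
  shows "free_graph H \<and> clique_robust H"
proof -
  obtain C D :: "6 \<Rightarrow> 'a set" and k :: 6 where
    part: "partition_into (verts H) (map C [0, 1, 2, 3, 4, 5] @ map D [0, 1, 2, 3, 4, 5])" and
    cl: "\<forall>i. clique H (C i) \<and> clique H (D i)" and ne: "\<forall>i. C i \<noteq> {}" and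
    De: "D (k - 2) = {}" "D (k - 1) = {}" and
    CC: "\<forall>i. complete_to H (C i) (C (i - 1) \<union> C (i + 1)) \<and> anticomplete_to H (C i) (C (i + 2) \<union> C (i + 3) \<union> C (i + 4))" and
    DC: "\<forall>i. complete_to H (D i) (C (i - 1) \<union> C i \<union> C (i + 1)) \<and> anticomplete_to H (D i) (C (i + 2) \<union> C (i + 3) \<union> C (i + 4))" and
    DD: "\<forall>i j. i \<noteq> j \<longrightarrow> anticomplete_to H (D i) (D j)"
    using assms(2) unfolding crown6_def by metis
  have djC: "i \<noteq> j \<Longrightarrow> C i \<inter> C j = {}" and djD: "i \<noteq> j \<Longrightarrow> D i \<inter> D j = {}" and djCD: "C i \<inter> D j = {}" for i j
  proof -
    have "\<forall>i j. (i \<noteq> j \<longrightarrow> C i \<inter> C j = {}) \<and> (i \<noteq> j \<longrightarrow> D i \<inter> D j = {}) \<and> C i \<inter> D j = {}"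
      using part unfolding partition_into_def all_6 by (simp add: disjnt_def Int_commute)
    then show "i \<noteq> j \<Longrightarrow> C i \<inter> C j = {}" "i \<noteq> j \<Longrightarrow> D i \<inter> D j = {}" "C i \<inter> D j = {}" by blast+
  qed
  have un: "verts H = (\<Union>i. C i) \<union> (\<Union>i. D i)"
    using part unfolding partition_into_def UNIV_6 by (simp add: Un_ac)
  have nCC: "nb H x y \<longleftrightarrow> j - i = 0 \<or> j - i = 1 \<or> j - i = 5" if "x \<in> C i" "y \<in> C j" for x y i j
  proof -
    have "\<forall>d. y \<in> C (i + d) \<longrightarrow> (nb H x y \<longleftrightarrow> d = 0 \<or> d = 1 \<or> d = 5)"
      unfolding all_6
      using that(1) cl[rule_format, of i] CC[rule_format, of i] djC[of i "i + 2"] djC[of i "i + 3"] djC[of i "i + 4"]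
      by (auto simp: clique_nb complete_to_def anticomplete_to_def nb_def arith_6)
    from this[rule_format, of "j - i"] show ?thesis using that by simp
  qed
  have nDC: "nb H x y \<longleftrightarrow> j - i = 0 \<or> j - i = 1 \<or> j - i = 5" if "x \<in> D i" "y \<in> C j" for x y i j
  proof -
    have "\<forall>d. y \<in> C (i + d) \<longrightarrow> (nb H x y \<longleftrightarrow> d = 0 \<or> d = 1 \<or> d = 5)"
      unfolding all_6
      using that(1) DC[rule_format, of i] djCD[of "i + 2" i] djCD[of "i + 3" i] djCD[of "i + 4" i]
      by (auto simp: complete_to_def anticomplete_to_def nb_def arith_6)
    from this[rule_format, of "j - i"] show ?thesis using that by simp
  qed
  have nDD: "nb H x y \<longleftrightarrow> i = j" if "x \<in> D i" "y \<in> D j" for x y i j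
  proof (cases "i = j")
    case True
    then show ?thesis using that cl unfolding clique_nb by simp
  next
    case False
    then have "anticomplete_to H (D i) (D j)" "x \<noteq> y" using DD djD that by blast+
    then show ?thesis using anticomplete_to_nbD that False by metis
  qed
  have nCD: "nb H x y \<longleftrightarrow> j - i = 0 \<or> j - i = 1 \<or> j - i = 5" if "x \<in> C i" "y \<in> D j" for x y i j
  proof -
    have "\<forall>d::6. (- d = 0 \<or> - d = 1 \<or> - d = 5) \<longleftrightarrow> d = 0 \<or> d = 1 \<or> d = 5" unfolding all_6 by simp
    from this[rule_format, of "i - j"] show ?thesis using nDC[OF that(2,1)] nb_commute[of H x y] by simp
  qed
  have cov: "(\<Union>i. C i) = C (k + 0) \<union> C (k + 1) \<union> C (k + 2) \<union> C (k + 3) \<union> C (k + 4) \<union> C (k + 5)"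
    "(\<Union>i. D i) = D (k + 0) \<union> D (k + 1) \<union> D (k + 2) \<union> D (k + 3)"
  proof -
    have *: "(\<Union>i. F i) = F (k + 0) \<union> F (k + 1) \<union> F (k + 2) \<union> F (k + 3) \<union> F (k + 4) \<union> F (k + 5)" for F :: "6 \<Rightarrow> 'a set"
    proof -
      have "\<forall>d. F (k + d) \<subseteq> F (k + 0) \<union> F (k + 1) \<union> F (k + 2) \<union> F (k + 3) \<union> F (k + 4) \<union> F (k + 5)"
        unfolding all_6 by auto
      from this[rule_format, of "i - k" for i] show ?thesis by auto
    qed
    show "(\<Union>i. C i) = C (k + 0) \<union> C (k + 1) \<union> C (k + 2) \<union> C (k + 3) \<union> C (k + 4) \<union> C (k + 5)" by (rule *)
    show "(\<Union>i. D i) = D (k + 0) \<union> D (k + 1) \<union> D (k + 2) \<union> D (k + 3)" unfolding *[of D] using De by (simp add: arith_6)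
  qed
  define B where "B n = [C (k + 0), C (k + 1), C (k + 2), C (k + 3), C (k + 4), C (k + 5), D (k + 0), D (k + 1), D (k + 2), D (k + 3)] ! n" for n
  have len: "length crown_model = 10" by (simp add: crown_model_def)
  have lt10: "n < 10 \<Longrightarrow> n = 0 \<or> n = 1 \<or> n = 2 \<or> n = 3 \<or> n = 4 \<or> n = 5 \<or> n = 6 \<or> n = 7 \<or> n = 8 \<or> n = (9::nat)" for n by presburger
  have free: "free_graph H"
  proof (rule blowup_free[OF s crown_model_check])
    have "{..<10::nat} = {0,1,2,3,4,5,6,7,8,9}" by auto
    then show "verts H = (\<Union>i<length crown_model. B i)" unfolding un cov len by (simp add: B_def Un_ac)
    fix i j x y assume "i < length crown_model" "j < length crown_model" and xy: "x \<in> B i" "y \<in> B j"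
    then have i: "i < 10" and j: "j < 10" by (simp_all add: len)
    show "nb H x y \<longleftrightarrow> j \<in> set (crown_model ! i)"
      using lt10[OF i] lt10[OF j] xy
      by (elim disjE) (simp_all add: B_def nCC nDC nCD nDD crown_model_def)
  qed
  define c where "c i = (SOME x. x \<in> C i)" for i
  have c: "c i \<in> C i" for i using ne unfolding c_def by (metis some_in_eq)
  have "clique_robust H"
  proof (rule robust_ring_6)
    show "nb H (c i) (c j) \<longleftrightarrow> j - i = 0 \<or> j - i = 1 \<or> j - i = 5" for i j by (rule nCC[OF c c])
    show "c i \<in> verts H" for i using c un by blast
    fix v assume "v \<in> verts H"
    then obtain i where i: "v \<in> C i \<or> v \<in> D i" using un by blast
    then have "nb H v (c (i + 1))" "nb H v (c (i + 5))"
      using nCC[OF _ c, of v i] nDC[OF _ c, of v i] by auto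
    moreover have "\<not> nb H (c (i + 1)) (c (i + 5))" using nCC[OF c c] by simp
    ultimately show "\<exists>i j. nb H v (c i) \<and> nb H v (c j) \<and> \<not> nb H (c i) (c j)" by blast
  qed
  with free show ?thesis by blast
qed

lemma anticomplete_nb_iff:
  "anticomplete_to H X Y \<Longrightarrow> X \<inter> Y = {} \<Longrightarrow> x \<in> X \<Longrightarrow> y \<in> Y \<Longrightarrow> \<not> nb H x y \<and> \<not> nb H y x"
  unfolding anticomplete_to_def nb_def using adj_commute[of H x y] by auto

lemma complete_nb: "complete_to H X Y \<Longrightarrow> x \<in> X \<Longrightarrow> y \<in> Y \<Longrightarrow> nb H x y \<and> nb H y x"
  unfolding complete_to_def nb_def using adj_commute[of H x y] by auto

lemma thickened_emerald_class:
  assumes s: "simple_graph H" and "thickened_emerald H"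
  shows "free_graph H \<and> clique_robust H"
proof -
  obtain C :: "'a set" and A :: "7 \<Rightarrow> 'a set" and k Zm Zp Rs Rm Ls Lp where
    part: "partition_into (verts H) (C # map A [0, 1, 2, 3, 4, 5, 6])" and
    C: "C \<noteq> {}" "clique H C" and A: "\<forall>i. A i \<noteq> {} \<and> clique H (A i)" and
    AA: "\<forall>i. complete_to H (A i) (A (i - 1) \<union> A (i + 1)) \<and> anticomplete_to H (A i) (A (i - 3) \<union> A (i + 3))" and
    A2: "\<forall>i \<in> {k - 3, k - 1, k + 1, k + 3}. anticomplete_to H (A i) (A (i - 2) \<union> A (i + 2))" and
    dj: "sorted_wrt disjnt [Zm, Zp, Rs, Rm, Ls, Lp]" and
    ne: "\<forall>X \<in> {Zm, Zp, Rs, Rm, Ls, Lp}. X \<noteq> {} \<and> clique H X" and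
    parts: "A k = Zm \<union> Zp" "A (k + 2) = Rs \<union> Rm" "A (k - 2) = Ls \<union> Lp" and
    Z: "complete_to H Zm Lp" "anticomplete_to H Zm (Ls \<union> A (k + 2))"
       "complete_to H Zp Rm" "anticomplete_to H Zp (Rs \<union> A (k - 2))" and
    CX: "complete_to H C (Rs \<union> A (k + 3) \<union> A (k - 3) \<union> Ls)"
       "anticomplete_to H C (Lp \<union> A (k - 1) \<union> A k \<union> A (k + 1) \<union> Rm)"
    using assms(2) unfolding thickened_emerald_def by metis
  have djA: "i \<noteq> j \<Longrightarrow> A i \<inter> A j = {}" and djC: "C \<inter> A i = {}" for i j
  proof -
    have "\<forall>i j. (i \<noteq> j \<longrightarrow> A i \<inter> A j = {}) \<and> C \<inter> A i = {}"
      using part unfolding partition_into_def all_7 by (simp add: disjnt_def Int_commute)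
    then show "i \<noteq> j \<Longrightarrow> A i \<inter> A j = {}" "C \<inter> A i = {}" by blast+
  qed
  have un: "verts H = C \<union> (\<Union>i. A i)"
    using part unfolding partition_into_def UNIV_7 by (simp add: Un_ac)
  \<comment> \<open>Between classes the offset decides adjacency, except at distance two among the
    split classes at 0, 2 and 5. The side condition leaves out just those pairs, which
    \<open>sp\<close> treats part by part.\<close>
  have nA: "nb H x y \<longleftrightarrow> b - a = 0 \<or> b - a = 1 \<or> b - a = 6"
    if "x \<in> A (k + a)" "y \<in> A (k + b)"
      "b - a \<noteq> 2 \<and> b - a \<noteq> 5 \<or> a = 1 \<or> a = 3 \<or> a = 4 \<or> a = 6 \<or> b = 1 \<or> b = 3 \<or> b = 4 \<or> b = 6" for x y a b
  proof -
    define i where "i = k + a"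
    have S: "anticomplete_to H (A (k + a)) (A (k + a - 2) \<union> A (k + a + 2))" if "a = 1 \<or> a = 3 \<or> a = 4 \<or> a = 6" for a
      using A2 that by (auto simp: arith_7)
    have x: "x \<in> A i" using that(1) by (simp add: i_def)
    have f: "nb H x y" if "y \<in> A i" for y using A x that unfolding clique_nb by blast
    have g: "nb H x y" if "y \<in> A (i + 1) \<or> y \<in> A (i + 6)" for y
      using AA[rule_format, of i] x that by (auto simp: complete_to_def nb_def minus_7)
    have h: "\<not> nb H x y" if "y \<in> A (i + 3) \<or> y \<in> A (i + 4)" for y
      using AA[rule_format, of i] x that djA[of i "i + 3"] djA[of i "i + 4"] by (auto simp: anticomplete_to_def nb_def minus_7)
    have l: "\<not> nb H x y" if "y \<in> A (i + 2) \<or> y \<in> A (i + 5)" "a = 1 \<or> a = 3 \<or> a = 4 \<or> a = 6" for y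
      using S[OF that(2)] x that(1) djA[of i "i + 2"] djA[of i "i + 5"]
      by (auto simp: anticomplete_to_def nb_def minus_7 i_def)
    have m: "\<not> nb H x y" if "y \<in> A (k + b)" "k + b = i + 2 \<or> k + b = i + 5" "b = 1 \<or> b = 3 \<or> b = 4 \<or> b = 6"
    proof -
      have i: "i = k + b - 2 \<or> i = k + b + 2"
        using that(2)
      proof
        assume h: "k + b = i + 2" show ?thesis unfolding h by simp
      next
        assume h: "k + b = i + 5" show ?thesis unfolding h by (simp add: mod_7 add.assoc)
      qed
      then have "\<not> nb H y x"
        using anticomplete_nb_iff[OF S[OF that(3)] _ that(1)] x djA[of "k + b" "k + b - 2"] djA[of "k + b" "k + b + 2"] by auto
      then show ?thesis by (rule not_nb_sym)
    qed
    have "\<forall>d. y \<in> A (i + d) \<longrightarrow> (d \<noteq> 2 \<and> d \<noteq> 5 \<longrightarrow> (nb H x y \<longleftrightarrow> d = 0 \<or> d = 1 \<or> d = 6)) \<and>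
        (d = 2 \<or> d = 5 \<longrightarrow> a = 1 \<or> a = 3 \<or> a = 4 \<or> a = 6 \<longrightarrow> \<not> nb H x y)"
      unfolding all_7 using f[of y] g[of y] h[of y] l[of y] by auto
    moreover have "y \<in> A (i + (b - a))" using that(2) by (simp add: i_def)
    ultimately have *: "(b - a \<noteq> 2 \<and> b - a \<noteq> 5 \<longrightarrow> (nb H x y \<longleftrightarrow> b - a = 0 \<or> b - a = 1 \<or> b - a = 6)) \<and>
        (b - a = 2 \<or> b - a = 5 \<longrightarrow> a = 1 \<or> a = 3 \<or> a = 4 \<or> a = 6 \<longrightarrow> \<not> nb H x y)"
      by blast
    show ?thesis
    proof (cases "b - a = 2 \<or> b - a = 5")
      case True
      then have "k + b = i + 2 \<or> k + b = i + 5" by (auto simp: i_def diff_eq_eq)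
      then have "\<not> nb H x y" using m[OF that(2)] * True that(3) by blast
      then show ?thesis using True by auto
    next
      case False
      then show ?thesis using * by blast
    qed
  qed
  have k5: "k - 2 = k + 5" "k - 3 = k + 4" "k - 1 = k + 6" by (simp_all add: arith_7)
  note parts = parts[unfolded k5] and Z = Z[unfolded k5] and CX = CX[unfolded k5]
  have zz: "Zm \<subseteq> A (k + 0)" "Zp \<subseteq> A (k + 0)" "Rs \<subseteq> A (k + 2)" "Rm \<subseteq> A (k + 2)" "Ls \<subseteq> A (k + 5)" "Lp \<subseteq> A (k + 5)"
    using parts by auto
  have dZ: "Zm \<inter> Lp = {}" "Zm \<inter> (Ls \<union> A (k + 2)) = {}" "Zp \<inter> Rm = {}" "Zp \<inter> (Rs \<union> A (k + 5)) = {}"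
    using zz djA[of "k + 0" "k + 5"] djA[of "k + 0" "k + 2"] by auto
  have dC: "C \<inter> (Lp \<union> A (k + 6) \<union> A k \<union> A (k + 1) \<union> Rm) = {}" using zz djC by fast
  note sp1 = complete_nb[OF Z(1)] anticomplete_nb_iff[OF Z(2) dZ(2)] complete_nb[OF Z(3)] anticomplete_nb_iff[OF Z(4) dZ(4)]
    complete_nb[OF CX(1)] anticomplete_nb_iff[OF CX(2) dC]
  have sp: "x \<in> Zm \<Longrightarrow> y \<in> Lp \<Longrightarrow> nb H x y \<and> nb H y x" "x \<in> Zm \<Longrightarrow> y \<in> Ls \<Longrightarrow> \<not> nb H x y \<and> \<not> nb H y x"
    "x \<in> Zm \<Longrightarrow> y \<in> Rs \<Longrightarrow> \<not> nb H x y \<and> \<not> nb H y x" "x \<in> Zm \<Longrightarrow> y \<in> Rm \<Longrightarrow> \<not> nb H x y \<and> \<not> nb H y x"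
    "x \<in> Zp \<Longrightarrow> y \<in> Rm \<Longrightarrow> nb H x y \<and> nb H y x" "x \<in> Zp \<Longrightarrow> y \<in> Rs \<Longrightarrow> \<not> nb H x y \<and> \<not> nb H y x"
    "x \<in> Zp \<Longrightarrow> y \<in> Ls \<Longrightarrow> \<not> nb H x y \<and> \<not> nb H y x" "x \<in> Zp \<Longrightarrow> y \<in> Lp \<Longrightarrow> \<not> nb H x y \<and> \<not> nb H y x"
    "x \<in> C \<Longrightarrow> y \<in> Rs \<Longrightarrow> nb H x y \<and> nb H y x" "x \<in> C \<Longrightarrow> y \<in> A (k + 3) \<Longrightarrow> nb H x y \<and> nb H y x"
    "x \<in> C \<Longrightarrow> y \<in> A (k + 4) \<Longrightarrow> nb H x y \<and> nb H y x" "x \<in> C \<Longrightarrow> y \<in> Ls \<Longrightarrow> nb H x y \<and> nb H y x"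
    "x \<in> C \<Longrightarrow> y \<in> Lp \<Longrightarrow> \<not> nb H x y \<and> \<not> nb H y x" "x \<in> C \<Longrightarrow> y \<in> A (k + 6) \<Longrightarrow> \<not> nb H x y \<and> \<not> nb H y x"
    "x \<in> C \<Longrightarrow> y \<in> Zm \<Longrightarrow> \<not> nb H x y \<and> \<not> nb H y x" "x \<in> C \<Longrightarrow> y \<in> Zp \<Longrightarrow> \<not> nb H x y \<and> \<not> nb H y x"
    "x \<in> C \<Longrightarrow> y \<in> A (k + 1) \<Longrightarrow> \<not> nb H x y \<and> \<not> nb H y x" "x \<in> C \<Longrightarrow> y \<in> Rm \<Longrightarrow> \<not> nb H x y \<and> \<not> nb H y x" for x y
    using sp1[of x y] unfolding parts by simp_all
  have CC: "nb H x y" if "x \<in> C" "y \<in> C" for x y using C that unfolding clique_nb by blast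
  define B where "B n = [C, Zm, Zp, A (k + 1), Rs, Rm, A (k + 3), A (k + 4), Ls, Lp, A (k + 6)] ! n" for n
  \<comment> \<open>\<open>lv n\<close> is the offset of the class that contains part
    \<open>n\<close>. The entry for part 0, the clique \<open>C\<close>, is a dummy, guarded below
    by conditions that \<open>i\<close> and \<open>j\<close> are nonzero.\<close>
  define lv where "lv n = [0, 0, 0, 1, 2, 2, 3, 4, 5, 5, 6 :: 7] ! n" for n
  have len: "length emerald_model = 11" by (simp add: emerald_model_def)
  have lt11: "n < 11 \<Longrightarrow> n = 0 \<or> n = 1 \<or> n = 2 \<or> n = 3 \<or> n = 4 \<or> n = 5 \<or> n = 6 \<or> n = 7 \<or> n = 8 \<or> n = 9 \<or> n = (10::nat)" for n
    by presburger
  have BA: "n \<noteq> 0 \<Longrightarrow> B n \<subseteq> A (k + lv n)" if "n < 11" for n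
    using lt11[OF that] zz by (elim disjE) (simp_all add: B_def lv_def)
  have adj: "nb H x y \<longleftrightarrow> j \<in> set (emerald_model ! i)" if "i < length emerald_model" "j < length emerald_model" "x \<in> B i" "y \<in> B j" for i j x y
  proof -
    have i: "i < 11" and j: "j < 11" using that by (simp_all add: len)
    have n: "i \<noteq> 0 \<and> j \<noteq> 0 \<longrightarrow> lv j - lv i \<noteq> 2 \<and> lv j - lv i \<noteq> 5 \<or> lv i = 1 \<or> lv i = 3 \<or> lv i = 4 \<or> lv i = 6
        \<or> lv j = 1 \<or> lv j = 3 \<or> lv j = 4 \<or> lv j = 6 \<longrightarrow> (nb H x y \<longleftrightarrow> lv j - lv i = 0 \<or> lv j - lv i = 1 \<or> lv j - lv i = 6)"
      using nA[of x "lv i" y "lv j"] BA[OF i] BA[OF j] that(3,4) by blast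
    note xy = that(3,4)
    show ?thesis
      using lt11[OF i] lt11[OF j] xy n
      by (elim disjE) (simp_all add: B_def lv_def emerald_model_def CC sp)
  qed
  have cov: "verts H = (\<Union>i<length emerald_model. B i)"
  proof -
    have eq: "{..<11::nat} = {0,1,2,3,4,5,6,7,8,9,10}"
    proof (rule set_eqI)
      fix n :: nat
      show "n \<in> {..<11} \<longleftrightarrow> n \<in> {0,1,2,3,4,5,6,7,8,9,10}" using lt11[of n] by auto
    qed
    have "\<forall>d. A (k + d) \<subseteq> A (k + 0) \<union> A (k + 1) \<union> A (k + 2) \<union> A (k + 3) \<union> A (k + 4) \<union> A (k + 5) \<union> A (k + 6)"
      unfolding all_7 by auto
    from this[rule_format, of "i - k" for i]
    have "(\<Union>i. A i) = A (k + 0) \<union> A (k + 1) \<union> A (k + 2) \<union> A (k + 3) \<union> A (k + 4) \<union> A (k + 5) \<union> A (k + 6)" by auto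
    then show ?thesis unfolding un len eq by (simp add: B_def parts Un_ac)
  qed
  have free: "free_graph H" using blowup_free[OF s emerald_model_check cov adj] .
  \<comment> \<open>One part per class, namely \<open>Zm\<close>, \<open>Rm\<close> and
    \<open>Ls\<close> from the split ones: \<open>Zm\<close> is anticomplete to both
    \<open>Rm\<close> and \<open>Ls\<close>, so representatives form an induced 7-hole.\<close>
  define bl where "bl = hep 1 3 5 6 7 8 (10::nat)"
  define c where "c i = (SOME x. x \<in> B (bl i))" for i
  have bl: "\<forall>i. bl i < length emerald_model \<and> B (bl i) \<noteq> {}" unfolding all_7 using ne A by (simp add: bl_def hep_def len B_def)
  have c: "c i \<in> B (bl i)" for i using bl unfolding c_def by (metis some_in_eq)
  have nc: "nb H (c i) (c j) \<longleftrightarrow> bl j \<in> set (emerald_model ! bl i)" for i j using adj[OF _ _ c c] bl by blast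
  have "\<forall>i j. bl j \<in> set (emerald_model ! bl i) \<longleftrightarrow> j - i = 0 \<or> j - i = 1 \<or> j - i = 6"
    unfolding all_7 by (simp add: bl_def hep_def emerald_model_def)
  then have ring: "nb H (c i) (c j) \<longleftrightarrow> j - i = 0 \<or> j - i = 1 \<or> j - i = 6" for i j unfolding nc by blast
  have "clique_robust H"
  proof (rule robust_ring_7[OF ring])
    show "c i \<in> verts H" for i using c bl cov by blast
    fix v assume "v \<in> verts H"
    then obtain n where n: "n < length emerald_model" "v \<in> B n" using cov by blast
    have att: "\<exists>i j. nb H v (c i) \<and> nb H v (c j) \<and> \<not> nb H (c i) (c j)"
      if "bl i \<in> set (emerald_model ! n)" "bl j \<in> set (emerald_model ! n)" "j - i \<noteq> 0" "j - i \<noteq> 1" "j - i \<noteq> 6" for i j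
      using that adj[OF n(1) _ n(2) c] bl ring by blast
    have "n < 11" using n(1) len by simp
    from lt11[OF this] show "\<exists>i j. nb H v (c i) \<and> nb H v (c j) \<and> \<not> nb H (c i) (c j)"
      using att[of 3 5] att[of 1 6] att[of 0 2] att[of 1 3] att[of 2 4] att[of 4 6] att[of 0 5]
      by (elim disjE) (simp_all add: bl_def hep_def emerald_model_def)
  qed
  with free show ?thesis by blast
qed

section \<open>Wreaths\<close>

lemma nested_last: "nested f xs \<Longrightarrow> x \<in> set xs \<Longrightarrow> f (last xs) \<subseteq> f x"
  unfolding nested_def by (induction xs) (auto split: if_splits)

text \<open>The steps are 1 or -1, with 5 standing for -1. As consecutive ones do not cancel, the
  first three are equal, and the sum is 2 or 4 up to sign.\<close>

lemma cyc6_4: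
  "\<lbrakk>p = 1 \<or> p = 5; q = 1 \<or> q = 5; r = 1 \<or> r = 5; t = 1 \<or> t = 5; p + q \<noteq> 0; q + r \<noteq> 0\<rbrakk> \<Longrightarrow> p + q + r + t \<noteq> (0 :: 6)"
  by (elim disjE) (simp_all add: mod_6)

text \<open>An odd number of odd steps has an odd sum, and 6 is even.\<close>

lemma cyc6_5:
  "\<lbrakk>p = 1 \<or> p = 5; q = 1 \<or> q = 5; r = 1 \<or> r = 5; t = 1 \<or> t = 5; u = 1 \<or> u = 5\<rbrakk> \<Longrightarrow> p + q + r + t + u \<noteq> (0 :: 6)"
  by (elim disjE) (simp_all add: mod_6)

text \<open>Three cliques, each made of two consecutive classes, cover the graph and exclude the
  four alternate vertices of a \<open>P7\<close>. A \<open>C4\<close> or \<open>C5\<close> would be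
  a closed walk in the index ring with steps 1 and -1 that the counting lemmas forbid.\<close>

lemma wreath6_class:
  assumes s: "simple_graph H" and "wreath6 H"
  shows "free_graph H \<and> clique_robust H"
proof -
  obtain X :: "6 \<Rightarrow> 'a set" and us where
    part: "partition_into (verts H) (map X [0, 1, 2, 3, 4, 5])" and
    X: "\<forall>i. X i \<noteq> {} \<and> ordering_of (X i) (us i) \<and> X i \<subseteq> closed_nbhd H (last (us i)) \<and>
       nested (closed_nbhd H) (us i) \<and> closed_nbhd H (hd (us i)) = X (i - 1) \<union> X i \<union> X (i + 1)" and
    cp: "complete_to H (X 0) (X 1)" "complete_to H (X 2) (X 3)" "complete_to H (X 4) (X 5)"
    using assms(2) unfolding wreath6_def by metis
  have dj: "i \<noteq> j \<Longrightarrow> X i \<inter> X j = {}" for i j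
  proof -
    have "\<forall>i j. (i \<noteq> j \<longrightarrow> X i \<inter> X j = {})"
      using part unfolding partition_into_def all_6 by (simp add: disjnt_def Int_commute)
    then show "i \<noteq> j \<Longrightarrow> X i \<inter> X j = {}" by blast
  qed
  have un: "verts H = (\<Union>i. X i)"
    using part unfolding partition_into_def UNIV_6 by (simp add: Un_ac)
  have us: "set (us i) = X i" "nested (closed_nbhd H) (us i)" "us i \<noteq> []" for i
    using X[rule_format, of i] unfolding ordering_of_def by auto
  have hd: "hd (us i) \<in> X i" for i using us(1)[of i] hd_in_set[OF us(3)[of i]] by simp
  have XX: "nb H x y" if "x \<in> X i" "y \<in> X i" for x y i
  proof -
    have "closed_nbhd H (last (us i)) \<subseteq> closed_nbhd H x" by (rule nested_last[OF us(2)]) (simp add: us(1) that(1))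
    moreover have "y \<in> closed_nbhd H (last (us i))" using X that(2) by blast
    ultimately show ?thesis unfolding closed_nbhd_nb by blast
  qed
  have N: "nb H (hd (us i)) y \<longleftrightarrow> y \<in> X (i - 1) \<union> X i \<union> X (i + 1)" for i y
    using X[rule_format, of i] unfolding closed_nbhd_nb by blast
  have step: "j - i = 0 \<or> j - i = 1 \<or> j - i = 5" if "x \<in> X i" "y \<in> X j" "nb H x y" for x y i j
  proof -
    have "closed_nbhd H x \<subseteq> closed_nbhd H (hd (us i))" using nested_hd[OF us(2)] us(1) that(1) by blast
    then have "nb H (hd (us i)) y" using that(3) unfolding closed_nbhd_nb by blast
    then have "y \<in> X (i - 1) \<union> X i \<union> X (i + 1)" unfolding N .
    then have "j = i - 1 \<or> j = i \<or> j = i + 1" using dj that(2) by blast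
    then show ?thesis by (auto simp: arith_6)
  qed
  have comp: "\<not> (nb H x u \<and> \<not> nb H y u \<and> nb H y v \<and> \<not> nb H x v)" if "x \<in> X i" "y \<in> X i" for x y u v i
    using nested_total[OF us(2), of x i y] us(1) that unfolding closed_nbhd_nb by blast
  \<comment> \<open>An edge whose ends both have private neighbours cannot stay inside one class,
    where closed neighbourhoods are comparable. Every edge of an induced \<open>C4\<close> or
    \<open>C5\<close> is of this kind.\<close>
  have move: "j - i = 1 \<or> j - i = 5" if "x \<in> X i" "y \<in> X j" "nb H x y" "nb H x u" "\<not> nb H y u" "nb H y v" "\<not> nb H x v" for x y u v i j
    using step[OF that(1,2,3)] comp[of x i y u v] that by auto
  have P: "nb H x y" if "x \<in> X 0 \<union> X 1 \<and> y \<in> X 0 \<union> X 1 \<or> x \<in> X 2 \<union> X 3 \<and> y \<in> X 2 \<union> X 3 \<or> x \<in> X 4 \<union> X 5 \<and> y \<in> X 4 \<union> X 5" for x y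
    using that XX[of x _ y] complete_nb[OF cp(1), of x y] complete_nb[OF cp(1), of y x] complete_nb[OF cp(2), of x y] complete_nb[OF cp(2), of y x]
      complete_nb[OF cp(3), of x y] complete_nb[OF cp(3), of y x] by blast
  have V3: "x \<in> X 0 \<union> X 1 \<or> x \<in> X 2 \<union> X 3 \<or> x \<in> X 4 \<union> X 5" if "x \<in> verts H" for x
    using that unfolding un UNIV_6 by auto
  have free: "free_graph H"
  proof (rule free_graphI[OF s], goal_cases)
    case (1 a b c d e f g)
    note v = V3[OF 1(1)] V3[OF 1(3)] V3[OF 1(5)] V3[OF 1(7)]
    show False using v P[of a c] P[of a e] P[of a g] P[of c e] P[of c g] P[of e g] 1(14,16,18,23,25,28) by argo
  next
    case (2 a b c d)
    then obtain i j k l where idx: "a \<in> X i" "b \<in> X j" "c \<in> X k" "d \<in> X l" unfolding un by blast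
    note n = 2(9,10)[THEN not_nb_sym]
    note y = 2(5-8)[THEN nb_sym]
    have m: "j - i = 1 \<or> j - i = 5" "k - j = 1 \<or> k - j = 5" "l - k = 1 \<or> l - k = 5" "i - l = 1 \<or> i - l = 5"
      using move[OF idx(1,2) 2(5) y(4) not_nb_sym[OF n(2)] 2(6) 2(9)] move[OF idx(2,3) 2(6) y(1) n(1) 2(7) 2(10)]
        move[OF idx(3,4) 2(7) y(2) n(2) 2(8) n(1)] move[OF idx(4,1) 2(8) y(3) 2(9) 2(5) n(2)] by blast+
    have "k \<noteq> i" "l \<noteq> j" using XX idx 2(9,10) by blast+
    then show False using cyc6_4[OF m] by simp
  next
    case (3 a b c d e)
    then obtain i j k l m where idx: "a \<in> X i" "b \<in> X j" "c \<in> X k" "d \<in> X l" "e \<in> X m" unfolding un by blast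
    note y = 3(6-10)[THEN nb_sym] and n = 3(11-15)[THEN not_nb_sym]
    have m: "j - i = 1 \<or> j - i = 5" "k - j = 1 \<or> k - j = 5" "l - k = 1 \<or> l - k = 5" "m - l = 1 \<or> m - l = 5" "i - m = 1 \<or> i - m = 5"
      using move[OF idx(1,2) 3(6) y(5) 3(14) 3(7) 3(11)] move[OF idx(2,3) 3(7) y(1) n(1) 3(8) 3(13)]
        move[OF idx(3,4) 3(8) y(2) n(3) 3(9) 3(15)] move[OF idx(4,5) 3(9) y(3) n(5) 3(10) n(2)]
        move[OF idx(5,1) 3(10) y(4) 3(12) 3(6) n(4)] by blast+
    show False using cyc6_5[OF m] by simp
  qed
  have "clique_robust H"
  proof (rule robust_ring_6)
    show ring: "nb H (hd (us i)) (hd (us j)) \<longleftrightarrow> j - i = 0 \<or> j - i = 1 \<or> j - i = 5" for i j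
    proof
      assume "nb H (hd (us i)) (hd (us j))"
      then show "j - i = 0 \<or> j - i = 1 \<or> j - i = 5" by (rule step[OF hd hd])
    next
      assume "j - i = 0 \<or> j - i = 1 \<or> j - i = 5"
      then have "j = i \<or> j = i + 1 \<or> j = i - 1" by (auto simp: diff_eq_eq arith_6 add.commute)
      then show "nb H (hd (us i)) (hd (us j))" unfolding N using hd by blast
    qed
    show "hd (us i) \<in> verts H" for i using hd un by blast
    fix v assume "v \<in> verts H"
    then obtain i where i: "v \<in> X i" using un by blast
    have "nb H (hd (us (i + 1))) v" "nb H (hd (us (i - 1))) v" unfolding N using i by simp_all
    note this[THEN nb_sym]
    moreover have "\<not> nb H (hd (us (i + 1))) (hd (us (i - 1)))" unfolding ring by (simp add: arith_6)
    ultimately show "\<exists>i j. nb H v (hd (us i)) \<and> nb H v (hd (us j)) \<and> \<not> nb H (hd (us i)) (hd (us j))" by blast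
  qed
  with free show ?thesis by blast
qed

text \<open>The possible index differences along an induced path on three vertices of a bracelet, and the triples
  of differences that an induced path cannot have.\<close>

definition steps7 :: "7 \<Rightarrow> 7 \<Rightarrow> bool" where
  "steps7 s t \<longleftrightarrow> s = 0 \<and> t = 2 \<or> s = 2 \<and> t = 0 \<or> s = 1 \<and> t = 1 \<or> s = 1 \<and> t = 2 \<or> s = 2 \<and> t = 1 \<or>
     s = 0 \<and> t = 5 \<or> s = 5 \<and> t = 0 \<or> s = 6 \<and> t = 6 \<or> s = 6 \<and> t = 5 \<or> s = 5 \<and> t = 6"

definition turn7 :: "7 \<Rightarrow> 7 \<Rightarrow> 7 \<Rightarrow> bool" where
  "turn7 s t u \<longleftrightarrow> s = 2 \<and> t = 0 \<and> u = 5 \<or> s = 5 \<and> t = 0 \<and> u = 2 \<or> s = 2 \<and> t = 1 \<and> u = 2 \<or> s = 5 \<and> t = 6 \<and> u = 5"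

text \<open>Single steps of 3 and 4 are impossible, the total must not make the path ends adjacent,
  and two steps by 2 in the same direction would give the middle vertex distance-two neighbours on
  both sides. The ten listed pairs are what is left.\<close>

lemma steps7I:
  assumes "s = 0 \<or> s = 1 \<or> s = 2 \<or> s = 5 \<or> s = 6" "t = 0 \<or> t = 1 \<or> t = 2 \<or> t = 5 \<or> t = 6"
    "s + t \<noteq> 0" "s + t \<noteq> 1" "s + t \<noteq> 6" "\<not> (s = 2 \<and> t = 2)" "\<not> (s = 5 \<and> t = 5)"
  shows "steps7 s t"
  using assms(1,2) assms(3-) unfolding steps7_def by (elim disjE) (simp_all add: mod_7)

lemma steps7_simps:
  "steps7 0 t \<longleftrightarrow> t = 2 \<or> t = 5" "steps7 1 t \<longleftrightarrow> t = 1 \<or> t = 2" "steps7 2 t \<longleftrightarrow> t = 0 \<or> t = 1"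
  "steps7 5 t \<longleftrightarrow> t = 0 \<or> t = 6" "steps7 6 t \<longleftrightarrow> t = 5 \<or> t = 6"
  by (auto simp: steps7_def)

text \<open>A closed walk must return to its class, so its index differences add up to zero. Given
  one difference, \<open>steps7_simps\<close> leaves two choices for the next, and the enumeration
  with \<open>turn7\<close> finds no closed walk.\<close>

lemma cyc7_4:
  assumes "steps7 p q" "steps7 q r" "steps7 r s" "steps7 s p"
    "\<not> turn7 p q r" "\<not> turn7 q r s" "\<not> turn7 r s p" "\<not> turn7 s p q"
  shows "p + q + r + s \<noteq> 0"
  using assms(1)[unfolded steps7_def] assms(2-)
  apply (elim disjE conjE)
  apply (simp_all add: steps7_simps turn7_def)
  apply ((erule disjE; simp add: steps7_simps turn7_def)+)
  done

lemma cyc7_5: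
  assumes "steps7 p q" "steps7 q r" "steps7 r s" "steps7 s t" "steps7 t p"
    "\<not> turn7 p q r" "\<not> turn7 q r s" "\<not> turn7 r s t" "\<not> turn7 s t p" "\<not> turn7 t p q"
  shows "p + q + r + s + t \<noteq> 0"
  using assms(1)[unfolded steps7_def] assms(2-)
  apply (elim disjE conjE)
  apply (simp_all add: steps7_simps turn7_def)
  apply ((erule disjE; simp add: steps7_simps turn7_def)+)
  done

text \<open>The indices 0, \<open>p\<close>, \<open>q\<close>, \<open>r\<close> would be four
  pairwise nonadjacent vertices of a 7-cycle, whose stable sets have at most three elements.\<close>

lemma stable7:
  fixes p q r :: 7
  assumes "p \<noteq> 0 \<and> p \<noteq> 1 \<and> p \<noteq> 6" "q \<noteq> 0 \<and> q \<noteq> 1 \<and> q \<noteq> 6"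
    "r \<noteq> 0 \<and> r \<noteq> 1 \<and> r \<noteq> 6"
    "p - q \<noteq> 0 \<and> p - q \<noteq> 1 \<and> p - q \<noteq> 6" "p - r \<noteq> 0 \<and> p - r \<noteq> 1 \<and> p - r \<noteq> 6" "q - r \<noteq> 0 \<and> q - r \<noteq> 1 \<and> q - r \<noteq> 6"
  shows False
proof -
  have *: "\<forall>x::7. x \<noteq> 0 \<and> x \<noteq> 1 \<and> x \<noteq> 6 \<longrightarrow> x = 2 \<or> x = 3 \<or> x = 4 \<or> x = 5" unfolding all_7 by simp
  show False
    using *[rule_format, OF assms(1)] *[rule_format, OF assms(2)] *[rule_format, OF assms(3)] assms(4-)
    by (elim disjE) simp_all
qed

text \<open>Induced paths and cycles are followed through the class indices. Alternate vertices of a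
  \<open>P7\<close> contradict \<open>stable7\<close>, and an induced \<open>C4\<close> or
  \<open>C5\<close> would give a closed sequence of differences excluded by \<open>cyc7_4\<close> or
  \<open>cyc7_5\<close>.\<close>

lemma bracelet7_class:
  assumes s: "simple_graph H" and "bracelet7 H"
  shows "free_graph H \<and> clique_robust H"
proof -
  obtain A As Ap Am :: "7 \<Rightarrow> 'a set" and k :: 7 where
    part: "partition_into (verts H) (map A [0, 1, 2, 3, 4, 5, 6])" and
    A: "\<forall>i. A i \<noteq> {} \<and> clique H (A i) \<and> complete_to H (A i) (A (i - 1) \<union> A (i + 1)) \<and>
          anticomplete_to H (A i) (A (i - 3) \<union> A (i + 3))" and
    S: "\<forall>i. partition_into (A i) [As i, Ap i, Am i] \<and>
             anticomplete_to H (As i) (A (i - 2) \<union> A (i + 2)) \<and>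
             anticomplete_to H (Ap i) (A (i - 2)) \<and>
             (\<forall>v \<in> Ap i. \<exists>w \<in> A (i + 2). adj H v w) \<and>
             anticomplete_to H (Am i) (A (i + 2)) \<and>
             (\<forall>v \<in> Am i. \<exists>w \<in> A (i - 2). adj H v w) \<and>
             (Ap i \<noteq> {} \<longrightarrow> (\<exists>xs. ordering_of (Ap i) xs \<and> nested (closed_nbhd H) xs)) \<and>
             (Am i \<noteq> {} \<longrightarrow> (\<exists>xs. ordering_of (Am i) xs \<and> nested (closed_nbhd H) xs)) \<and>
             (As i \<noteq> {} \<or> \<not> complete_to H (Ap i) (A (i + 2)) \<or>
              \<not> complete_to H (Am i) (A (i - 2)))" and
    K: "A (k - 3) = As (k - 3)" "A (k + 3) = As (k + 3)"
        "A (k - 2) = As (k - 2) \<union> Ap (k - 2)" "A (k + 2) = As (k + 2) \<union> Am (k + 2)"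
        "A (k - 1) = As (k - 1) \<union> Ap (k - 1)" "A (k + 1) = As (k + 1) \<union> Am (k + 1)"
    using assms(2)[unfolded bracelet7_def bracelet7_pair_def] by (elim exE conjE) (rule that; assumption)
  have dj: "i \<noteq> j \<Longrightarrow> A i \<inter> A j = {}" for i j
  proof -
    have "\<forall>i j. (i \<noteq> j \<longrightarrow> A i \<inter> A j = {})"
      using part unfolding partition_into_def all_7 by (simp add: disjnt_def Int_commute)
    then show "i \<noteq> j \<Longrightarrow> A i \<inter> A j = {}" by blast
  qed
  have un: "verts H = (\<Union>i. A i)"
    using part unfolding partition_into_def UNIV_7 by (simp add: Un_ac)
  have pa: "A i = As i \<union> Ap i \<union> Am i" "As i \<inter> Ap i = {}" "As i \<inter> Am i = {}" "Ap i \<inter> Am i = {}" for i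
    using S[rule_format, of i] unfolding partition_into_def by (auto simp: disjnt_def)
  have d2: "A i \<inter> A (i + 2) = {}" "A i \<inter> A (i - 2) = {}" "A i \<inter> A (i - 3) = {}" "A i \<inter> A (i + 3) = {}" for i
    by (rule dj, simp)+
  have A0: "nb H x y" if "x \<in> A i" "y \<in> A i" for x y i using A that unfolding clique_nb by blast
  have A1: "nb H x y" if "x \<in> A i" "y \<in> A (i - 1) \<union> A (i + 1)" for x y i
    using complete_nb[of H "A i" "A (i - 1) \<union> A (i + 1)" x y] A[rule_format, of i] that by simp
  have a3: "anticomplete_to H (A i) (A (i - 3) \<union> A (i + 3))" "A i \<inter> (A (i - 3) \<union> A (i + 3)) = {}" for i
    using A[rule_format, of i] d2(3,4)[of i] by auto
  have A3: "\<not> nb H x y" if "x \<in> A i" "y \<in> A (i - 3) \<union> A (i + 3)" for x y i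
    using anticomplete_nb_iff[OF a3 that] by simp
  have as: "anticomplete_to H (As i) (A (i - 2) \<union> A (i + 2))" "As i \<inter> (A (i - 2) \<union> A (i + 2)) = {}" for i
    using S[rule_format, of i] d2(1,2)[of i] pa(1)[of i] by auto
  have ns: "\<not> nb H x y" if "x \<in> As i" "y \<in> A (i - 2) \<union> A (i + 2)" for x y i
    using anticomplete_nb_iff[OF as that] by simp
  have ap: "anticomplete_to H (Ap i) (A (i - 2))" "Ap i \<inter> A (i - 2) = {}" for i
    using S[rule_format, of i] d2(2)[of i] pa(1)[of i] by auto
  have np: "\<not> nb H x y" if "x \<in> Ap i" "y \<in> A (i - 2)" for x y i
    using anticomplete_nb_iff[OF ap that] by simp
  have am: "anticomplete_to H (Am i) (A (i + 2))" "Am i \<inter> A (i + 2) = {}" for i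
    using S[rule_format, of i] d2(1)[of i] pa(1)[of i] by auto
  have nm: "\<not> nb H x y" if "x \<in> Am i" "y \<in> A (i + 2)" for x y i
    using anticomplete_nb_iff[OF am that] by simp
  \<comment> \<open>An edge across distance two can join only a plus part to the minus part ahead of
    it, since all other parts are anticomplete in that direction.\<close>
  have ext: "nb H x y \<Longrightarrow> x \<in> Ap i \<and> y \<in> Am (i + 2)" if "x \<in> A i" "y \<in> A (i + 2)" for x y i
  proof -
    assume h: "nb H x y"
    have x: "x \<in> A (i + 2 - 2)" using that(1) by simp
    have h': "nb H y x" using h by (rule nb_sym)
    have "x \<notin> As i" "x \<notin> Am i" "y \<notin> As (i + 2)" "y \<notin> Ap (i + 2)"
      using ns[of x i y] nm[of x i y] ns[of y "i + 2" x] np[of y "i + 2" x] that(2) x h h' by blast+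
    then show "x \<in> Ap i \<and> y \<in> Am (i + 2)" using that pa(1) by blast
  qed
  have one: "\<not> (nb H x y \<and> nb H x z)" if "x \<in> A i" "y \<in> A (i + 2)" "z \<in> A (i - 2)" for x y z i
    using ext[OF that(1,2)] np[of x i z] that(3) by blast
  have noAp: "Ap (k + 1) = {}" "Ap (k + 2) = {}" "Ap (k + 3) = {}" "Ap (k + 4) = {}"
  proof -
    show "Ap (k + 1) = {}" using K(6) pa(1,2,4)[of "k + 1"] by blast
    show "Ap (k + 2) = {}" using K(4) pa(1,2,4)[of "k + 2"] by blast
    show "Ap (k + 3) = {}" using K(2) pa(1,2,4)[of "k + 3"] by blast
    show "Ap (k + 4) = {}" using K(1)[unfolded minus_7(3)] pa(1,2,4)[of "k + 4"] by blast
  qed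
  \<comment> \<open>The clauses for the distinguished index leave such edges only at
    \<open>k\<close>, \<open>k - 1\<close> and \<open>k - 2\<close>, written here as differences 0,
    6 and 5.\<close>
  have act: "i - k = 0 \<or> i - k = 5 \<or> i - k = 6" if "x \<in> A i" "y \<in> A (i + 2)" "nb H x y" for x y i
  proof -
    have x: "x \<in> Ap i" using ext that by blast
    have "\<forall>d. i = k + d \<longrightarrow> d = 0 \<or> d = 5 \<or> d = 6"
      unfolding all_7 using x noAp by auto
    from this[rule_format, of "i - k"] show ?thesis by simp
  qed
  have nest: "nb H x y' \<or> nb H x' y" if "x \<in> A i" "x' \<in> A i" "y \<in> A (i + 2)" "y' \<in> A (i + 2)" "nb H x y" "nb H x' y'" for x x' y y' i
  proof -
    have x: "x \<in> Ap i" "x' \<in> Ap i" using ext that by blast+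
    then obtain xs where "set xs = Ap i" "nested (closed_nbhd H) xs" using S unfolding ordering_of_def by blast
    then have "closed_nbhd H x \<subseteq> closed_nbhd H x' \<or> closed_nbhd H x' \<subseteq> closed_nbhd H x" using nested_total x by metis
    then show ?thesis using that unfolding closed_nbhd_nb by blast
  qed
  \<comment> \<open>The vertex from the last clause on the parts has a nonneighbour on both sides:
    on the side where it may have neighbours by incompleteness, on the other side
    automatically.\<close>
  have hollow: "\<exists>x\<in>A i. \<exists>y\<in>A (i + 2). \<exists>z\<in>A (i - 2). \<not> nb H x y \<and> \<not> nb H x z" for i
  proof -
    obtain y z where yz: "y \<in> A (i + 2)" "z \<in> A (i - 2)" using A by blast
    consider x where "x \<in> As i" | x y where "x \<in> Ap i" "y \<in> A (i + 2)" "\<not> adj H x y" | x z where "x \<in> Am i" "z \<in> A (i - 2)" "\<not> adj H x z"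
      using S[rule_format, of i] unfolding complete_to_def by blast
    then show ?thesis
    proof cases
      case (1 x)
      then show ?thesis using ns[of x i] pa(1)[of i] yz by blast
    next
      case (2 x y)
      moreover have "x \<in> A i" using 2(1) pa(1)[of i] by blast
      moreover then have "\<not> nb H x y" using 2(2,3) d2(1)[of i] unfolding nb_def by blast
      ultimately show ?thesis using np[of x i z] yz by blast
    next
      case (3 x z)
      moreover have "x \<in> A i" using 3(1) pa(1)[of i] by blast
      moreover then have "\<not> nb H x z" using 3(2,3) d2(2)[of i] unfolding nb_def by blast
      ultimately show ?thesis using nm[of x i y] yz by blast
    qed
  qed
  have far: "\<not> nb H x y" if "x \<in> A i" "y \<in> A j" "j - i = 3 \<or> j - i = 4" for x y i j
  proof -
    have "j = i + 3 \<or> j = i - 3" using that(3) by (auto simp: diff_eq_eq arith_7 add.commute)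
    then show ?thesis using A3[of x i y] that(1,2) by blast
  qed
  have near: "nb H x y" if "x \<in> A i" "y \<in> A j" "j - i = 0 \<or> j - i = 1 \<or> j - i = 6" for x y i j
  proof -
    have "j = i \<or> j = i + 1 \<or> j = i - 1" using that(3) by (auto simp: diff_eq_eq arith_7 add.commute)
    then show ?thesis using A0[of x i y] A1[of x i y] that(1,2) by blast
  qed
  have r7: "\<forall>d::7. d = 0 \<or> d = 1 \<or> d = 2 \<or> d = 3 \<or> d = 4 \<or> d = 5 \<or> d = 6" unfolding all_7 by simp
  have step: "j - i = 0 \<or> j - i = 1 \<or> j - i = 2 \<or> j - i = 5 \<or> j - i = 6" if "x \<in> A i" "y \<in> A j" "nb H x y" for x y i j
    using far[OF that(1,2)] that(3) r7[rule_format, of "j - i"] by argo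
  have two: "y \<in> A (i + 2)" if "y \<in> A j" "j - i = 2" for y i j
    using that by (simp add: diff_eq_eq add.commute)
  have five: "y \<in> A (i - 2)" "i - j = 2" if "y \<in> A j" "j - i = 5" for y i j
  proof -
    have j: "j = i + 5" using that(2) by (simp add: diff_eq_eq add.commute)
    show "y \<in> A (i - 2)" using that(1) unfolding j by (simp add: arith_7)
    show "i - j = 2" unfolding j by simp
  qed
  have pair: "steps7 (j - i) (l - j)" if "x \<in> A i" "y \<in> A j" "z \<in> A l" "nb H x y" "nb H y z" "\<not> nb H x z" for x y z i j l
  proof (rule steps7I)
    show "j - i = 0 \<or> j - i = 1 \<or> j - i = 2 \<or> j - i = 5 \<or> j - i = 6" by (rule step[OF that(1,2,4)])
    show "l - j = 0 \<or> l - j = 1 \<or> l - j = 2 \<or> l - j = 5 \<or> l - j = 6" by (rule step[OF that(2,3,5)])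
    have "l - i \<noteq> 0 \<and> l - i \<noteq> 1 \<and> l - i \<noteq> 6" using near[OF that(1,3)] that(6) by blast
    then show "j - i + (l - j) \<noteq> 0" "j - i + (l - j) \<noteq> 1" "j - i + (l - j) \<noteq> 6" by simp_all
    have yx: "nb H y x" using that(4) by (rule nb_sym)
    show "\<not> (j - i = 2 \<and> l - j = 2)"
    proof
      assume h: "j - i = 2 \<and> l - j = 2"
      then have "x \<in> A (j - 2)" "z \<in> A (j + 2)" using that(1) two[OF that(3)] by (auto simp: diff_eq_eq)
      then show False using one[OF that(2)] that(5) yx by blast
    qed
    show "\<not> (j - i = 5 \<and> l - j = 5)"
    proof
      assume h: "j - i = 5 \<and> l - j = 5"
      then have "x \<in> A (j + 2)" "z \<in> A (j - 2)" using two[OF that(1)] five(2)[OF that(2)] five(1)[OF that(3)] by auto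
      then show False using one[OF that(2)] that(5) yx by blast
    qed
  qed
  have flat: False if "w \<in> A i" "z \<in> A i" "x \<in> A (i + 2)" "y \<in> A (i + 2)" "nb H w x" "nb H z y" "\<not> nb H w y" "\<not> nb H z x" for w x y z i
    using nest[OF that(1,2,3,4,5,6)] that(7,8) by blast
  \<comment> \<open>Of the three active positions no two differ by 3; this refutes the turns that go
    2, 1, 2 in one direction.\<close>
  have act': "j - i \<noteq> 3" if "x \<in> A i" "y \<in> A (i + 2)" "nb H x y" "u \<in> A j" "v \<in> A (j + 2)" "nb H u v" for x y u v i j
  proof
    assume "j - i = 3"
    then have "j - k = i - k + 3" by (simp add: diff_eq_eq algebra_simps)
    then show False using act[OF that(1-3)] act[OF that(4-6)] by (auto simp: mod_7)
  qed
  have trip: "\<not> turn7 (j - i) (l - j) (m - l)"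
    if "w \<in> A i" "x \<in> A j" "y \<in> A l" "z \<in> A m" "nb H w x" "nb H x y" "nb H y z" "\<not> nb H w y" "\<not> nb H x z" for w x y z i j l m
  proof
    note sy = that(5)[THEN nb_sym] that(6)[THEN nb_sym] that(7)[THEN nb_sym] that(8)[THEN not_nb_sym] that(9)[THEN not_nb_sym]
    assume "turn7 (j - i) (l - j) (m - l)"
    then consider "j - i = 2" "l - j = 0" "m - l = 5" | "j - i = 5" "l - j = 0" "m - l = 2"
      | "j - i = 2" "l - j = 1" "m - l = 2" | "j - i = 5" "l - j = 6" "m - l = 5" unfolding turn7_def by blast
    then show False
    proof cases
      case 1
      then have e: "j = i + 2" "l = i + 2" "m = i"
        using five(2)[OF that(4) 1(3)] by (auto simp: diff_eq_eq add.commute)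
      show False by (rule flat[of w i z x y]) (use that sy e in simp_all)
    next
      case 2
      then have e: "i = j + 2" "l = j" "m = j + 2"
        using five(2)[OF that(2) 2(1)] by (auto simp: diff_eq_eq add.commute)
      show False by (rule flat[of x j y w z]) (use that sy e in simp_all)
    next
      case 3
      then have e: "j = i + 2" "m = l + 2" by (auto simp: diff_eq_eq add.commute)
      have "l - i = 3" using 3(2) e(1) by (simp add: diff_eq_eq)
      then show False using act'[of w i x y l z] that(1-7) e by simp
    next
      case 4
      then have "i - j = 2" "l - m = 2" using five(2)[OF that(2)] five(2)[OF that(4)] by blast+
      then have e: "i = j + 2" "l = j + 6" "l = m + 2" using 4(2) by (auto simp: diff_eq_eq add.commute)
      have "j = l + 1" unfolding e(2) by (simp add: mod_7 add.assoc)
      then have "j - m = 3" unfolding e(3) by simp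
      then show False using act'[of z m y x j w] that(1-4) sy e(1,3) by simp
    qed
  qed
  have free: "free_graph H"
  proof (rule free_graphI[OF s], goal_cases)
    case (1 a b c d e f g)
    obtain i j l m where idx: "a \<in> A i" "c \<in> A j" "e \<in> A l" "g \<in> A m" using 1(1,3,5,7) unfolding un by blast
    have n: "l - j \<noteq> 0 \<and> l - j \<noteq> 1 \<and> l - j \<noteq> 6" if "x \<in> A j" "y \<in> A l" "\<not> nb H x y" for x y j l
      using near[OF that(1,2)] that(3) by blast
    show False
      using stable7[of "m - i" "l - i" "j - i"] n[OF idx(1,2) 1(14)] n[OF idx(1,3) 1(16)] n[OF idx(1,4) 1(18)]
        n[OF idx(2,3) 1(23)] n[OF idx(2,4) 1(25)] n[OF idx(3,4) 1(28)] by simp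
  next
    case (2 a b c d)
    obtain i j l m where idx: "a \<in> A i" "b \<in> A j" "c \<in> A l" "d \<in> A m" using 2(1-4) unfolding un by blast
    note n = 2(9,10)[THEN not_nb_sym]
    have "j - i + (l - j) + (m - l) + (i - m) \<noteq> 0"
      by (rule cyc7_4[OF pair[OF idx(1,2,3) 2(5,6,9)] pair[OF idx(2,3,4) 2(6,7,10)] pair[OF idx(3,4,1) 2(7,8) n(1)] pair[OF idx(4,1,2) 2(8,5) n(2)]
        trip[OF idx 2(5,6,7,9,10)] trip[OF idx(2,3,4,1) 2(6,7,8,10) n(1)] trip[OF idx(3,4,1,2) 2(7,8,5) n] trip[OF idx(4,1,2,3) 2(8,5,6) n(2) 2(9)]])
    then show False by simp
  next
    case (3 a b c d e)
    obtain i j l m q where idx: "a \<in> A i" "b \<in> A j" "c \<in> A l" "d \<in> A m" "e \<in> A q" using 3(1-5) unfolding un by blast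
    note n = 3(11-15)[THEN not_nb_sym]
    have "j - i + (l - j) + (m - l) + (q - m) + (i - q) \<noteq> 0"
      by (rule cyc7_5[OF pair[OF idx(1,2,3) 3(6,7,11)] pair[OF idx(2,3,4) 3(7,8,13)] pair[OF idx(3,4,5) 3(8,9,15)]
        pair[OF idx(4,5,1) 3(9,10) n(2)] pair[OF idx(5,1,2) 3(10,6) n(4)]
        trip[OF idx(1,2,3,4) 3(6,7,8,11,13)] trip[OF idx(2,3,4,5) 3(7,8,9,13,15)] trip[OF idx(3,4,5,1) 3(8,9,10,15) n(2)]
        trip[OF idx(4,5,1,2) 3(9,10,6) n(2,4)] trip[OF idx(5,1,2,3) 3(10,6,7) n(4) 3(11)]])
    then show False by simp
  qed
  \<comment> \<open>Only three pairs of classes at distance two can carry edges: those at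
    \<open>k\<close> with \<open>k + 2\<close>, \<open>k - 2\<close> with \<open>k\<close>, and
    \<open>k - 1\<close> with \<open>k + 1\<close>. Two applications of \<open>hollow\<close> make
    these nonadjacent, and the remaining two vertices are arbitrary.\<close>
  obtain x0 x2 x5 where x0: "x0 \<in> A k" "x2 \<in> A (k + 2)" "x5 \<in> A (k - 2)" "\<not> nb H x0 x2" "\<not> nb H x0 x5" using hollow[of k] by blast
  obtain x6 x1 where x6: "x6 \<in> A (k - 1)" "x1 \<in> A (k - 1 + 2)" "\<not> nb H x6 x1" using hollow[of "k - 1"] by blast
  obtain x3 x4 where x3: "x3 \<in> A (k + 3)" "x4 \<in> A (k + 4)" using A by blast
  define c where "c i = hep x0 x1 x2 x3 x4 x5 x6 (i - k)" for i
  have cA: "c (k + d) \<in> A (k + d)" for d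
  proof -
    have "\<forall>d. c (k + d) \<in> A (k + d)" unfolding all_7 using x0 x6 x3 by (simp add: c_def hep_def arith_7)
    then show ?thesis by blast
  qed
  have cA: "c i \<in> A i" for i using cA[of "i - k"] by simp
  have c2: "\<not> nb H (c (k + d)) (c (k + d + 2))" for d
  proof -
    have "\<forall>d. \<not> nb H (c (k + d)) (c (k + d + 2))"
    proof (rule allI, rule notI)
      fix d assume h: "nb H (c (k + d)) (c (k + d + 2))"
      have "k + d - k = 0 \<or> k + d - k = 5 \<or> k + d - k = 6" by (rule act[OF cA cA h])
      then have "d = 0 \<or> d = 5 \<or> d = 6" by simp
      then show False
        using h x0(4) x0(5)[THEN not_nb_sym] x6(3) by (auto simp: c_def hep_def mod_7 add.assoc)
    qed
    then show ?thesis by blast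
  qed
  have c2: "\<not> nb H (c i) (c (i + 2))" for i using c2[of "i - k"] by (simp add: algebra_simps)
  have c5: "\<not> nb H (c i) (c j)" if "j - i = 2 \<or> j - i = 5" for i j
    using that
  proof
    assume "j - i = 2" then have "j = i + 2" by (simp add: diff_eq_eq add.commute)
    then show ?thesis using c2 by simp
  next
    assume h: "j - i = 5"
    have "i = j + 2" using five(2)[OF cA h] by (simp add: diff_eq_eq add.commute)
    then show ?thesis using c2[of j, THEN not_nb_sym] by simp
  qed
  have ring: "nb H (c i) (c j) \<longleftrightarrow> j - i = 0 \<or> j - i = 1 \<or> j - i = 6" for i j
    using near[OF cA cA, of j i] far[OF cA cA, of j i] c5[of j i] r7[rule_format, of "j - i"] by blast
  have "clique_robust H"
  proof (rule robust_ring_7[OF ring])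
    show "c i \<in> verts H" for i using cA un by blast
    fix v assume "v \<in> verts H"
    then obtain i where i: "v \<in> A i" using un by blast
    have "nb H v (c (i + 1))" "nb H v (c (i + 6))" by (rule near[OF i cA], simp)+
    moreover have "\<not> nb H (c (i + 1)) (c (i + 6))" unfolding ring by simp
    ultimately show "\<exists>i j. nb H v (c i) \<and> nb H v (c j) \<and> \<not> nb H (c i) (c j)" by blast
  qed
  with free show ?thesis by blast
qed

theorem theorem3p1:
  fixes G :: "'a graph"
  assumes "simple_graph G"
  shows "(graph_free {path_graph 7, cycle_graph 4, cycle_graph 5} G \<and>
          \<not> (\<exists>C. clique_cutset G C))
     \<longleftrightarrow>
         (complete_graph G \<or>
          (\<exists>!H. nontrivial_anticomponent H G) \<and>
          (\<forall>H. nontrivial_anticomponent H G \<longrightarrow>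
             bracelet7 H \<or> thickened_emerald H \<or> lantern H \<or> wreath6 H \<or> crown6 H))"
    (is "?L \<longleftrightarrow> _ \<or> ?R")
proof
  assume ?L
  then show "complete_graph G \<or> ?R" using forward[OF assms] by blast
next
  assume R: "complete_graph G \<or> ?R"
  show ?L
  proof (cases "complete_graph G")
    case True
    then show ?thesis by (rule complete_graph_free[OF assms])
  next
    case False
    then have ex: "\<exists>!H. nontrivial_anticomponent H G"
      and cls: "\<forall>H. nontrivial_anticomponent H G \<longrightarrow> bracelet7 H \<or> thickened_emerald H \<or> lantern H \<or> wreath6 H \<or> crown6 H"
      using R by blast+
    obtain H where H: "nontrivial_anticomponent H G" using ex by blast
    have s: "simple_graph H"
    proof -
      obtain X where "H = induce G X" "X \<subseteq> verts G" "X \<noteq> {}"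
        using H unfolding nontrivial_anticomponent_def anticomponent_def induced_subgraph_def by blast
      then show ?thesis using simple_induce[OF assms] by blast
    qed
    have "free_graph H \<and> clique_robust H"
      using cls[rule_format, OF H] bracelet7_class[OF s] thickened_emerald_class[OF s] lantern_class[OF s] wreath6_class[OF s]
        crown6_class[OF s] by blast
    then show ?thesis using backward[OF assms ex H] by blast
  qed
qed

end
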